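(* Assume the Riemann Hypothesis. There is an absolute constant $C>0$ such that for every integer $N \geq 2$, \[ \left|\sum_{n=1}^{N} R(n) - \frac{N^{2}}{2} + 2 \sum_{\rho} \frac{N^{\rho + 1}}{\rho (\rho + 1)}\right| \le C\, N \log^{3}N, \] where $R(n) = \sum_{h_1+h_2=n} \Lambda(h_1)\Lambda(h_2)$ (sum over positive integers $h_1,h_2$) and $\rho=1/2+i\gamma$ runs over the non-trivial zeros of the Riemann zeta function $\zeta(s)$, counted with multiplicity.
   Context: $\Lambda$ denotes the von Mangoldt function. The sum over $\rho$ converges absolutely. *)

theory Defs
  imports
    "HOL-Complex_Analysis.Complex_Analysis"
    "HOL-Number_Theory.Number_Theory"
begin

text \<open>
  The Riemann zeta function is the analytic continuation of its Dirichlet series to the complex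
  plane without 1. By the identity theorem there is at most one such function on that connected
  domain, and its existence is classical. The value 0 at the pole is a convention that makes
  the description determine a total function; it plays no role in the critical strip.
\<close>
definition zeta :: "complex \<Rightarrow> complex" where
  "zeta = (THE f. f holomorphic_on (- {1}) \<and>
                  (\<forall>s. Re s > 1 \<longrightarrow> (\<lambda>n. 1 / of_nat (Suc n) powr s) sums f s) \<and>
                  f 1 = 0)"

definition nontrivial_zeros :: "complex set" where
  "nontrivial_zeros = {\<rho>. zeta \<rho> = 0 \<and> 0 < Re \<rho> \<and> Re \<rho> < 1}"

definition riemann_hypothesis :: bool where
  "riemann_hypothesis \<longleftrightarrow> (\<forall>\<rho>\<in>nontrivial_zeros. Re \<rho> = 1 / 2)"

definition goldbach_R :: "nat \<Rightarrow> real" where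
  "goldbach_R n = (\<Sum>(h1, h2) | h1 > 0 \<and> h2 > 0 \<and> h1 + h2 = n. mangoldt h1 * mangoldt h2)"

text \<open>
  A zero is indexed once and weighted by its multiplicity, the order of vanishing of zeta there.
\<close>
definition zero_term :: "nat \<Rightarrow> complex \<Rightarrow> complex" where
  "zero_term N \<rho> = of_int (zorder zeta \<rho>) * (of_nat N powr (\<rho> + 1) / (\<rho> * (\<rho> + 1)))"

end

theory Submission
  imports Defs "HOL-Real_Asymp.Real_Asymp"
begin

text \<open>
  Write \<open>\<Delta>(n) = (\<Sum>k\<le>n. \<Lambda>(k) - 1)\<close>. Expanding \<open>\<Lambda> = 1 + (\<Lambda> - 1)\<close> in both factors, the sum of \<open>R(n)\<close> over
  \<open>n \<le> N\<close> is \<open>2 \<psi>\<^sub>1(N) - N\<^sup>2 / 2 + N / 2\<close> plus the sum \<open>E\<close> of \<open>(\<Lambda>(a) - 1) (\<Lambda>(b) - 1)\<close> over \<open>a + b \<le> N\<close>, where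
  \<open>\<psi>\<^sub>1(x) = (\<Sum>n\<le>x. \<Lambda>(n) (x - n))\<close>. The explicit formula for \<open>\<psi>\<^sub>1\<close> produces the sum over the zeros up to
  \<open>O(N)\<close>, so it remains to show \<open>E = O(N log\<^sup>3 N)\<close>.

  No circle method is used for this. The indicator of \<open>a + b \<le> N\<close> is decomposed dyadically into tent functions
  of width \<open>h = 2\<^sup>k\<close>; weighted by a tent, the double sum becomes a sum over \<open>x\<close> of
  \<open>(\<Delta>(x + h) - \<Delta>(x)) (\<Delta>(M - x + h) - \<Delta>(M - x))\<close>, and by Cauchy-Schwarz it is bounded by the mean square of
  \<open>\<Delta>(x + h) - \<Delta>(x)\<close>. Under the Riemann Hypothesis this mean square over \<open>X \<le> x < 2X\<close> is \<open>O(h X log\<^sup>2 X)\<close>: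
  apply the explicit formula to \<open>\<psi>\<^sub>1(x + 1) - \<psi>\<^sub>1(x)\<close>, a linear interpolation of \<open>\<psi>\<close>, expand the square, and
  use that unit intervals at height \<open>t\<close> contain \<open>O(log t)\<close> zeros. Each of the \<open>O(log N)\<close> scales thus
  contributes \<open>O(N log\<^sup>2 N)\<close>.
\<close>

section \<open>Analytic continuation of zeta\<close>

text \<open>The analytic input on zeta is modest: polynomial growth in right half-planes, a lower
  bound on the line Re s = 2 and non-vanishing for Re s >= 1. No functional equation enters, so
  zeros are counted in discs of fixed radius centred on Re s = 2, and the contour stops at Re s =
  -3/4. There the logarithmic derivative with its poles removed is still O(|t| powr (5/8)), hence
  integrable against 1 / (s (s + 1)). Working with \<open>psi1\<close> instead of psi makes the sum
  over zeros converge absolutely, since unit height intervals contain only O(log t) zeros; no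
  truncated formula is needed.

  A pointwise bound for \<Delta> sees no gain when the window h is much shorter than X; the mean
  square does. Splitting the zeros at height T = X / h balances the low zeros, which cost h^2 T
  log^2 T, against the high ones, which cost X^2 / T log^2 T. One of these logarithms counts zeros
  up to T, the other counts the zeros near a given one; the third logarithm of the theorem is the
  number of scales.\<close>

lemma holomorphic_suminf:
  fixes f :: "nat \<Rightarrow> complex \<Rightarrow> complex"
  assumes "open S" "\<And>n. f n holomorphic_on S"
    and M: "\<And>x. x \<in> S \<Longrightarrow> \<exists>d M. d > 0 \<and> cball x d \<subseteq> S \<and> summable M \<and> (\<forall>n. \<forall>y\<in>cball x d. norm (f n y) \<le> M n)"
  shows "(\<lambda>x. \<Sum>n. f n x) holomorphic_on S"
proof (rule holomorphic_uniform_sequence[OF assms(1)])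
  show "(\<lambda>x. \<Sum>i<n. f i x) holomorphic_on S" for n
    by (intro holomorphic_intros assms)
  fix x assume "x \<in> S"
  then obtain d M where d: "d > 0" "cball x d \<subseteq> S" "summable M" "\<And>n y. y\<in>cball x d \<Longrightarrow> norm (f n y) \<le> M n"
    using M by metis
  have "uniform_limit (cball x d) (\<lambda>n x. \<Sum>i<n. f i x) (\<lambda>x. \<Sum>i. f i x) sequentially"
    by (rule Weierstrass_m_test[OF d(4) d(3)])
  thus "\<exists>d>0. cball x d \<subseteq> S \<and> uniform_limit (cball x d) (\<lambda>n x. \<Sum>i<n. f i x) (\<lambda>x. \<Sum>i. f i x) sequentially"
    using d by blast
qed

text \<open>The remainder of the binomial expansion of \<open>x powr a\<close> over the unit step
  from \<open>n + 1\<close> to \<open>n + 2\<close>. With \<open>a = 1 - s\<close> it has size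
  \<open>n powr (- Re s - K)\<close>, so every further term of the expansion moves the convergence
  of the sum over \<open>n\<close> one unit to the left.\<close>

definition powr_taylor_rem :: "nat \<Rightarrow> nat \<Rightarrow> complex \<Rightarrow> complex" where
  "powr_taylor_rem K n a = of_nat (Suc (Suc n)) powr a
     - (\<Sum>i\<le>K. (a gchoose i) * of_nat (Suc n) powr (a - of_nat i))"

text \<open>Taylor's theorem on the segment between the two integers. The hypothesis makes the
  exponent of the last derivative nonpositive, so that derivative is largest at the left end; the
  factorial in the denominator is given away.\<close>

lemma norm_powr_taylor_rem_le:
  assumes "Re a \<le> real K + 1"
  shows "norm (powr_taylor_rem K n a) \<le> (norm a + real K) ^ Suc K * real (Suc n) powr (Re a - real K - 1)"
proof -
  define f where "f = (\<lambda>i x. (\<Prod>l<i. a - of_nat l) * x powr (a - of_nat i))"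
  let ?S = "closed_segment (of_nat (Suc n)) (of_nat (Suc (Suc n))) :: complex set"
  have S: "\<exists>r\<ge>real (Suc n). x = of_real r" if x: "x \<in> ?S" for x
  proof -
    from x obtain u where u: "0 \<le> u" "u \<le> 1" "x = (1-u) *\<^sub>R of_nat (Suc n) + u *\<^sub>R of_nat (Suc (Suc n))"
      by (auto simp: in_segment)
    hence "x = of_real (real (Suc n) + u)" by (simp add: algebra_simps scaleR_conv_of_real)
    with u show ?thesis by (intro exI[of _ "real (Suc n) + u"]) auto
  qed
  have "cmod (f 0 (of_nat (Suc (Suc n))) - (\<Sum>i\<le>K. f i (of_nat (Suc n)) * (of_nat (Suc (Suc n)) - of_nat (Suc n)) ^ i / (fact i)))
     \<le> ((norm a + real K) ^ Suc K * real (Suc n) powr (Re a - real K - 1)) * cmod(of_nat (Suc (Suc n)) - of_nat (Suc n))^(Suc K) / fact K"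
  proof (rule complex_Taylor[where S = ?S])
    show "convex ?S" "of_nat (Suc n) \<in> ?S" "of_nat (Suc (Suc n)) \<in> ?S" by auto
  next
    fix i x assume x: "x \<in> ?S"
    then obtain r where r: "r \<ge> real (Suc n)" "x = of_real r" using S by blast
    have nz: "x \<notin> \<real>\<^sub>\<le>\<^sub>0" using r by (auto simp: complex_nonpos_Reals_iff)
    show "(f i has_field_derivative f (Suc i) x) (at x within ?S)"
    proof -
      have "((\<lambda>x. x powr (a - of_nat i)) has_field_derivative (a - of_nat i) * x powr (a - of_nat i - 1)) (at x within ?S)"
        by (rule DERIV_subset[OF has_field_derivative_powr[OF nz]]) auto
      from DERIV_cmult[OF this, of "\<Prod>l<i. a - of_nat l"] show ?thesis
        unfolding f_def by (simp add: algebra_simps)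
    qed
  next
    fix x assume x: "x \<in> ?S"
    then obtain r where r: "r \<ge> real (Suc n)" "x = of_real r" using S by blast
    have r0: "r > 0" using r(1) by linarith
    have "norm (\<Prod>l<Suc K. a - of_nat l) \<le> (\<Prod>l<Suc K. norm a + real K)"
      unfolding prod_norm[symmetric]
    proof (rule prod_mono)
      fix l assume "l \<in> {..<Suc K}"
      have "norm (a - of_nat l) \<le> norm a + norm (of_nat l :: complex)" by (rule norm_triangle_ineq4)
      thus "0 \<le> norm (a - of_nat l) \<and> norm (a - of_nat l) \<le> norm a + real K" using \<open>l \<in> _\<close> by auto
    qed
    also have "\<dots> = (norm a + real K) ^ Suc K" by simp
    finally have 1: "norm (\<Prod>l<Suc K. a - of_nat l) \<le> (norm a + real K) ^ Suc K" .
    have "norm (x powr (a - of_nat (Suc K))) = r powr (Re a - real K - 1)"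
      using r0 r by (subst norm_powr_real_powr) (auto simp: algebra_simps)
    also have "\<dots> \<le> real (Suc n) powr (Re a - real K - 1)"
      using assms r r0 by (intro powr_mono2') auto
    finally have 2: "norm (x powr (a - of_nat (Suc K))) \<le> real (Suc n) powr (Re a - real K - 1)" .
    show "cmod (f (Suc K) x) \<le> (norm a + real K) ^ Suc K * real (Suc n) powr (Re a - real K - 1)"
      unfolding f_def norm_mult by (intro mult_mono 1 2) auto
  qed
  also have "f 0 (of_nat (Suc (Suc n))) - (\<Sum>i\<le>K. f i (of_nat (Suc n)) * (of_nat (Suc (Suc n)) - of_nat (Suc n)) ^ i / (fact i))
     = powr_taylor_rem K n a"
    unfolding f_def powr_taylor_rem_def
    by (simp add: gbinomial_prod_rev atLeast0LessThan)
  also have "(norm a + real K) ^ Suc K * real (Suc n) powr (Re a - real K - 1) * cmod(of_nat (Suc (Suc n)) - of_nat (Suc n))^(Suc K) / fact K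
     \<le> (norm a + real K) ^ Suc K * real (Suc n) powr (Re a - real K - 1)"
    using frac_le[of "(norm a + real K) ^ Suc K * real (Suc n) powr (Re a - real K - 1)"
                     "(norm a + real K) ^ Suc K * real (Suc n) powr (Re a - real K - 1)" 1 "fact K"]
    by (simp add: fact_ge_1)
  finally show ?thesis .
qed

definition powr_taylor_sum :: "nat \<Rightarrow> complex \<Rightarrow> complex" where
  "powr_taylor_sum K s = (\<Sum>n. powr_taylor_rem K n (1 - s))"

lemma summable_Suc_powr: "p < -1 \<Longrightarrow> summable (\<lambda>n. real (Suc n) powr p)"
  using summable_Suc_iff[of "\<lambda>n. real n powr p"] summable_real_powr_iff[of p] by simp

lemma holomorphic_powr_taylor_sum: "powr_taylor_sum K holomorphic_on {s. Re s > 1 - real K}"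
  unfolding powr_taylor_sum_def
proof (rule holomorphic_suminf)
  show "open {s. Re s > 1 - real K}" by (simp add: open_halfspace_Re_gt)
  show "(\<lambda>s. powr_taylor_rem K n (1 - s)) holomorphic_on {s. Re s > 1 - real K}" for n
    unfolding powr_taylor_rem_def gbinomial_prod_rev by (intro holomorphic_intros) auto
  fix x assume "x \<in> {s. Re s > 1 - real K}"
  define d where "d = (Re x - (1 - real K)) / 2"
  have d: "d > 0" using \<open>x \<in> _\<close> by (simp add: d_def)
  have Re: "Re y \<ge> 1 - real K + d" "norm y \<le> norm x + d" if "y \<in> cball x d" for y
  proof -
    have "norm (y - x) \<le> d" using that by (simp add: dist_norm norm_minus_commute)
    thus "norm y \<le> norm x + d" using norm_triangle_sub[of y x] by linarith
    have "Re x - Re y \<le> d" using complex_Re_le_cmod[of "x - y"] that by (simp add: dist_norm)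
    moreover have "Re x = 2 * d + 1 - real K" by (simp add: d_def field_simps)
    ultimately show "Re y \<ge> 1 - real K + d" by linarith
  qed
  define M where "M = (\<lambda>n. (1 + norm x + d + real K) ^ Suc K * real (Suc n) powr (-1-d))"
  have "summable M" unfolding M_def by (intro summable_mult summable_Suc_powr) (use d in auto)
  moreover have "norm (powr_taylor_rem K n (1 - y)) \<le> M n" if "y \<in> cball x d" for n y
  proof -
    have "norm (powr_taylor_rem K n (1 - y)) \<le> (norm (1 - y) + real K) ^ Suc K * real (Suc n) powr (Re (1-y) - real K - 1)"
      by (rule norm_powr_taylor_rem_le) (use Re(1)[OF that] d in auto)
    also have "\<dots> \<le> M n" unfolding M_def
    proof (intro mult_mono power_mono powr_mono)
      show "norm (1 - y) + real K \<le> 1 + norm x + d + real K"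
        using norm_triangle_ineq4[of 1 y] Re(2)[OF that] by simp
      show "Re (1 - y) - real K - 1 \<le> - 1 - d" using Re(1)[OF that] d by simp
    qed (use d in auto)
    finally show ?thesis .
  qed
  ultimately show "\<exists>d M. d > 0 \<and> cball x d \<subseteq> {s. Re s > 1 - real K} \<and> summable M \<and> (\<forall>n. \<forall>y\<in>cball x d. norm (powr_taylor_rem K n (1 - y)) \<le> M n)"
    using d Re(1) by (intro exI[of _ d] exI[of _ M]) force
qed

text \<open>On a disc of fixed radius at height t this bounds the logarithm of the modulus by O(log
  t), which is what the zero count and the estimate of the logarithmic derivative feed on.\<close>

definition poly_bounded :: "real \<Rightarrow> (complex \<Rightarrow> complex) \<Rightarrow> bool" where
  "poly_bounded \<sigma> f \<longleftrightarrow> (\<exists>C A. \<forall>s. Re s \<ge> \<sigma> \<longrightarrow> norm (f s) \<le> C * (1 + norm s) ^ A)"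

text \<open>The exponent stays free above \<open>A\<close> so that two bounds can be brought to a
  common exponent.\<close>

lemma poly_boundedE:
  assumes "poly_bounded \<sigma> f"
  obtains C A where "C \<ge> 0" "\<And>s B. Re s \<ge> \<sigma> \<Longrightarrow> B \<ge> A \<Longrightarrow> norm (f s) \<le> C * (1 + norm s) ^ B"
proof -
  obtain C A where CA: "\<And>s. Re s \<ge> \<sigma> \<Longrightarrow> norm (f s) \<le> C * (1 + norm s) ^ A"
    using assms unfolding poly_bounded_def by blast
  show ?thesis
  proof (rule that[of "\<bar>C\<bar>" A])
    fix s B assume "Re s \<ge> \<sigma>" "B \<ge> A"
    have "norm (f s) \<le> C * (1 + norm s) ^ A" by (rule CA) fact
    also have "\<dots> \<le> \<bar>C\<bar> * (1 + norm s) ^ B"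
      by (intro mult_mono power_increasing) (use \<open>B \<ge> A\<close> in auto)
    finally show "norm (f s) \<le> \<bar>C\<bar> * (1 + norm s) ^ B" .
  qed simp
qed

lemma poly_bounded_add [intro]:
  assumes "poly_bounded \<sigma> f" "poly_bounded \<sigma> g"
  shows "poly_bounded \<sigma> (\<lambda>s. f s + g s)"
proof -
  obtain C A where 1: "C \<ge> 0" "\<And>s B. Re s \<ge> \<sigma> \<Longrightarrow> B \<ge> A \<Longrightarrow> norm (f s) \<le> C * (1 + norm s) ^ B"
    using assms(1) by (rule poly_boundedE) blast
  obtain C' A' where 2: "C' \<ge> 0" "\<And>s B. Re s \<ge> \<sigma> \<Longrightarrow> B \<ge> A' \<Longrightarrow> norm (g s) \<le> C' * (1 + norm s) ^ B"
    using assms(2) by (rule poly_boundedE) blast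
  have "norm (f s + g s) \<le> (C + C') * (1 + norm s) ^ (max A A')" if "Re s \<ge> \<sigma>" for s
    using 1(2)[OF that, of "max A A'"] 2(2)[OF that, of "max A A'"] norm_triangle_ineq[of "f s" "g s"]
    by (simp add: algebra_simps)
  thus ?thesis unfolding poly_bounded_def by blast
qed

lemma poly_bounded_mult [intro]:
  assumes "poly_bounded \<sigma> f" "poly_bounded \<sigma> g"
  shows "poly_bounded \<sigma> (\<lambda>s. f s * g s)"
proof -
  obtain C A where 1: "C \<ge> 0" "\<And>s B. Re s \<ge> \<sigma> \<Longrightarrow> B \<ge> A \<Longrightarrow> norm (f s) \<le> C * (1 + norm s) ^ B"
    using assms(1) by (rule poly_boundedE) blast
  obtain C' A' where 2: "C' \<ge> 0" "\<And>s B. Re s \<ge> \<sigma> \<Longrightarrow> B \<ge> A' \<Longrightarrow> norm (g s) \<le> C' * (1 + norm s) ^ B"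
    using assms(2) by (rule poly_boundedE) blast
  have "norm (f s * g s) \<le> (C * C') * (1 + norm s) ^ (A + A')" if "Re s \<ge> \<sigma>" for s
    using mult_mono[OF 1(2)[OF that, of A] 2(2)[OF that, of A']] 1 2
    by (simp add: norm_mult power_add mult_ac)
  thus ?thesis unfolding poly_bounded_def by blast
qed

lemma poly_bounded_const [intro]: "poly_bounded \<sigma> (\<lambda>_. c)"
  unfolding poly_bounded_def by (rule exI[of _ "norm c"], rule exI[of _ 0]) auto

lemma poly_bounded_id [intro]: "poly_bounded \<sigma> (\<lambda>s. s)"
  unfolding poly_bounded_def by (rule exI[of _ 1], rule exI[of _ 1]) auto

lemma poly_bounded_diff [intro]:
  assumes "poly_bounded \<sigma> f" "poly_bounded \<sigma> g"
  shows "poly_bounded \<sigma> (\<lambda>s. f s - g s)"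
  using poly_bounded_add[OF assms(1) poly_bounded_mult[OF poly_bounded_const[of \<sigma> "-1"] assms(2)]] by simp

lemma poly_bounded_sum [intro]:
  "(\<And>i. i \<in> I \<Longrightarrow> poly_bounded \<sigma> (f i)) \<Longrightarrow> poly_bounded \<sigma> (\<lambda>s. \<Sum>i\<in>I. f i s)"
  by (induction I rule: infinite_finite_induct) auto

lemma poly_bounded_prod [intro]:
  "(\<And>i. i \<in> I \<Longrightarrow> poly_bounded \<sigma> (f i)) \<Longrightarrow> poly_bounded \<sigma> (\<lambda>s. \<Prod>i\<in>I. f i s)"
  by (induction I rule: infinite_finite_induct) auto

lemma poly_bounded_shift:
  assumes "poly_bounded \<sigma> f" "\<sigma> \<le> \<sigma>' + real k"
  shows "poly_bounded \<sigma>' (\<lambda>s. f (s + of_nat k))"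
proof -
  obtain C A where 1: "C \<ge> 0" "\<And>s B. Re s \<ge> \<sigma> \<Longrightarrow> B \<ge> A \<Longrightarrow> norm (f s) \<le> C * (1 + norm s) ^ B"
    using assms(1) by (rule poly_boundedE) blast
  have "norm (f (s + of_nat k)) \<le> C * (1 + real k) ^ A * (1 + norm s) ^ A" if "Re s \<ge> \<sigma>'" for s
  proof -
    have "norm (f (s + of_nat k)) \<le> C * (1 + norm (s + of_nat k)) ^ A"
      using 1(2)[of "s + of_nat k" A] that assms(2) by simp
    also have "\<dots> \<le> C * ((1 + real k) * (1 + norm s)) ^ A"
    proof (intro mult_left_mono power_mono)
      have "norm (s + of_nat k) \<le> norm s + real k" using norm_triangle_ineq[of s "of_nat k"] by simp
      also have "\<dots> \<le> norm s + real k + real k * norm s" by simp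
      finally show "1 + norm (s + of_nat k) \<le> (1 + real k) * (1 + norm s)" by (simp add: algebra_simps)
    qed (use 1 in auto)
    finally show ?thesis by (simp add: power_mult_distrib mult_ac)
  qed
  thus ?thesis unfolding poly_bounded_def by blast
qed

text \<open>A margin of one half to the right of the abscissa of convergence
  \<open>1 - real K\<close> gives the fixed summable majorant with exponent -3/2, uniformly on the
  closed half-plane.\<close>

lemma poly_bounded_powr_taylor_sum:
  assumes "\<sigma> \<ge> 3 / 2 - real K"
  shows "poly_bounded \<sigma> (powr_taylor_sum K)"
proof -
  define Z where "Z = (\<Sum>n. real (Suc n) powr (-3/2))"
  have sZ: "summable (\<lambda>n. real (Suc n) powr (-3/2))" by (rule summable_Suc_powr) simp
  have "norm (powr_taylor_sum K s) \<le> (1 + real K) ^ Suc K * Z * (1 + norm s) ^ Suc K" if s: "Re s \<ge> \<sigma>" for s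
  proof -
    have b: "norm (powr_taylor_rem K n (1 - s)) \<le> ((1 + real K) * (1 + norm s)) ^ Suc K * real (Suc n) powr (-3/2)" for n
    proof -
      have "norm (powr_taylor_rem K n (1 - s)) \<le> (norm (1 - s) + real K) ^ Suc K * real (Suc n) powr (Re (1-s) - real K - 1)"
        by (rule norm_powr_taylor_rem_le) (use s assms in auto)
      also have "\<dots> \<le> ((1 + real K) * (1 + norm s)) ^ Suc K * real (Suc n) powr (-3/2)"
      proof (intro mult_mono power_mono powr_mono)
        have "norm (1 - s) + real K \<le> 1 + norm s + real K"
          using norm_triangle_ineq4[of 1 s] by simp
        also have "\<dots> \<le> 1 + norm s + real K + real K * norm s" by simp
        finally show "norm (1 - s) + real K \<le> (1 + real K) * (1 + norm s)" by (simp add: algebra_simps)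
        show "Re (1 - s) - real K - 1 \<le> - 3/2" using s assms by simp
      qed auto
      finally show ?thesis .
    qed
    have "norm (powr_taylor_sum K s) \<le> (\<Sum>n. ((1 + real K) * (1 + norm s)) ^ Suc K * real (Suc n) powr (-3/2))"
      unfolding powr_taylor_sum_def
      by (rule norm_suminf_le[OF b]) (intro summable_mult sZ)
    also have "\<dots> = ((1 + real K) * (1 + norm s)) ^ Suc K * Z"
      unfolding Z_def by (rule suminf_mult[OF sZ])
    finally show ?thesis by (simp add: power_mult_distrib mult_ac)
  qed
  thus ?thesis unfolding poly_bounded_def by blast
qed

section \<open>The Dirichlet series of zeta and its continuation\<close>

definition zeta_series :: "complex \<Rightarrow> complex" where
  "zeta_series s = (\<Sum>n. 1 / of_nat (Suc n) powr s)"

lemma norm_zeta_summand: "norm (1 / of_nat (Suc n) powr s :: complex) = real (Suc n) powr (- Re s)"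
proof -
  have "of_nat (Suc n) = (of_real (real (Suc n)) :: complex)" by simp
  thus ?thesis
    by (subst norm_divide, subst \<open>of_nat (Suc n) = _\<close>, subst norm_powr_real_powr)
       (auto simp: powr_minus divide_simps)
qed

lemma zeta_series_sums:
  assumes "Re s > 1"
  shows "(\<lambda>n. 1 / of_nat (Suc n) powr s) sums zeta_series s"
proof -
  have "summable (\<lambda>n. norm (1 / of_nat (Suc n) powr s :: complex))"
    unfolding norm_zeta_summand by (rule summable_Suc_powr) (use assms in auto)
  thus ?thesis unfolding zeta_series_def by (rule summable_sums[OF summable_norm_cancel])
qed

text \<open>
  Summing the binomial expansion of \<open>(n + 1) powr (1 - s)\<close> at \<open>n\<close> over all \<open>n\<close> telescopes and expresses
  \<open>zeta s\<close> through its values at \<open>s + 1, s + 2, \<dots>\<close> and a series converging further to the left.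
\<close>
lemma zeta_series_recurrence:
  assumes s: "Re s > 1"
  shows "(s - 1) * zeta_series s = 1 + powr_taylor_sum (Suc m) s
           + (\<Sum>k=1..m. ((1 - s) gchoose Suc k) * zeta_series (s + of_nat k))"
proof -
  have "(\<lambda>n. of_nat (Suc (Suc n)) powr (1 - s) - of_nat (Suc n) powr (1 - s)) sums (0 - of_nat (Suc 0) powr (1 - s) :: complex)"
  proof (rule telescope_sums)
    have "(\<lambda>n. real (Suc n) powr (1 - Re s)) \<longlonglongrightarrow> 0"
      by (rule LIMSEQ_Suc, rule tendsto_neg_powr) (use s in \<open>auto simp: filterlim_real_sequentially\<close>)
    hence "(\<lambda>n. norm (of_nat (Suc n) powr (1 - s) :: complex)) \<longlonglongrightarrow> 0"
    proof (rule Lim_transform_eventually)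
      show "\<forall>\<^sub>F n in sequentially. real (Suc n) powr (1 - Re s) = norm (of_nat (Suc n) powr (1 - s) :: complex)"
      proof (rule always_eventually, rule allI)
        fix n
        have "of_nat (Suc n) = (of_real (real (Suc n)) :: complex)" by simp
        thus "real (Suc n) powr (1 - Re s) = norm (of_nat (Suc n) powr (1 - s) :: complex)"
          by (subst \<open>of_nat (Suc n) = _\<close>, subst norm_powr_real_powr) auto
      qed
    qed
    thus "(\<lambda>n. of_nat (Suc n) powr (1 - s) :: complex) \<longlonglongrightarrow> 0" by (rule tendsto_norm_zero_cancel)
  qed
  moreover have "(\<lambda>n. \<Sum>k\<le>m. ((1 - s) gchoose Suc k) * (1 / of_nat (Suc n) powr (s + of_nat k))) sums
      (\<Sum>k\<le>m. ((1 - s) gchoose Suc k) * zeta_series (s + of_nat k))"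
    using s by (intro sums_sum sums_mult zeta_series_sums) auto
  ultimately have "(\<lambda>n. (of_nat (Suc (Suc n)) powr (1 - s) - of_nat (Suc n) powr (1 - s))
       - (\<Sum>k\<le>m. ((1 - s) gchoose Suc k) * (1 / of_nat (Suc n) powr (s + of_nat k)))) sums
       ((0 - of_nat (Suc 0) powr (1 - s)) - (\<Sum>k\<le>m. ((1 - s) gchoose Suc k) * zeta_series (s + of_nat k)))"
    by (rule sums_diff)
  also have "(\<lambda>n. (of_nat (Suc (Suc n)) powr (1 - s) - of_nat (Suc n) powr (1 - s))
       - (\<Sum>k\<le>m. ((1 - s) gchoose Suc k) * (1 / of_nat (Suc n) powr (s + of_nat k)))) = (\<lambda>n. powr_taylor_rem (Suc m) n (1 - s))"
  proof
    fix n
    have e: "1 / of_nat (Suc n) powr (s + of_nat k) = (of_nat (Suc n) powr (1 - s - of_nat (Suc k)) :: complex)" for k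
      by (subst powr_minus_divide[symmetric]) (rule arg_cong[of _ _ "\<lambda>w. _ powr w"], simp)
    show "(of_nat (Suc (Suc n)) powr (1 - s) - of_nat (Suc n) powr (1 - s))
       - (\<Sum>k\<le>m. ((1 - s) gchoose Suc k) * (1 / of_nat (Suc n) powr (s + of_nat k))) = powr_taylor_rem (Suc m) n (1 - s)"
      unfolding powr_taylor_rem_def e by (subst sum.atMost_Suc_shift) (simp del: of_nat_Suc)
  qed
  finally have "powr_taylor_sum (Suc m) s = -1 - (\<Sum>k\<le>m. ((1 - s) gchoose Suc k) * zeta_series (s + of_nat k))"
    unfolding powr_taylor_sum_def by (simp add: sums_iff)
  \<comment> \<open>The term for \<open>k = 0\<close> is \<open>(1 - s) * zeta_series s\<close> and
    moves to the left-hand side.\<close>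
  also have "{..m} = insert 0 {1..m}" by auto
  finally show ?thesis by (simp add: algebra_simps)
qed

text \<open>The function continued is \<open>(s - 1) * zeta_series s\<close>. The coefficient
  \<open>(1 - s) gchoose Suc k\<close> contains the factor \<open>1 - s - k\<close>, which cancels
  the pole of zeta at \<open>s + k = 1\<close>; so the recurrence closes up in terms of
  \<open>g (s + k)\<close> alone. For \<open>m = 0\<close> the sum is empty and nothing about
  \<open>g\<close> is assumed.\<close>

lemma zeta_continuation_step:
  fixes m :: nat
  assumes "m = 0 \<or> (g holomorphic_on {s. Re s > 1 - real m} \<and> (\<forall>s. Re s > 1 \<longrightarrow> g s = (s - 1) * zeta_series s)
     \<and> poly_bounded (3/2 - real m) g)"
  shows "\<exists>g'. g' holomorphic_on {s. Re s > 1 - real (Suc m)} \<and> (\<forall>s. Re s > 1 \<longrightarrow> g' s = (s - 1) * zeta_series s)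
     \<and> poly_bounded (3/2 - real (Suc m)) g'"
proof -
  define g' where "g' = (\<lambda>s. 1 + powr_taylor_sum (Suc m) s - (\<Sum>k=1..m. (((1 - s) gchoose k) * (1 / of_nat (Suc k))) * g (s + of_nat k)))"
  have "g' holomorphic_on {s. Re s > 1 - real (Suc m)}"
  proof -
    have "(\<lambda>s. g (s + of_nat k)) holomorphic_on {s. Re s > 1 - real (Suc m)}" if "k \<in> {1..m}" for k
    proof -
      have "g \<circ> (\<lambda>s. s + of_nat k) holomorphic_on {s. Re s > 1 - real (Suc m)}"
        by (rule holomorphic_on_compose_gen[where t = "{s. Re s > 1 - real m}"])
           (use assms that in \<open>auto intro!: holomorphic_intros\<close>)
      thus ?thesis by (simp add: o_def)
    qed
    thus ?thesis unfolding g'_def gbinomial_prod_rev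
      by (intro holomorphic_intros holomorphic_powr_taylor_sum) auto
  qed
  moreover have "g' s = (s - 1) * zeta_series s" if s: "Re s > 1" for s
  proof -
    have "((1 - s) gchoose Suc k) * zeta_series (s + of_nat k) = - ((((1 - s) gchoose k) * (1 / of_nat (Suc k))) * g (s + of_nat k))"
      if "k \<in> {1..m}" for k
    proof -
      have "g (s + of_nat k) = (s + of_nat k - 1) * zeta_series (s + of_nat k)"
        using assms s that by auto
      moreover have "((1 - s) gchoose Suc k) = ((1 - s) gchoose k) * (1 - s - of_nat k) / of_nat (Suc k)"
        by (simp add: gbinomial_prod_rev field_simps)
      ultimately show ?thesis by (simp only: divide_inverse mult_1_left) (simp add: algebra_simps del: of_nat_Suc)
    qed
    hence "(\<Sum>k=1..m. ((1 - s) gchoose Suc k) * zeta_series (s + of_nat k)) =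
       - (\<Sum>k=1..m. (((1 - s) gchoose k) * (1 / of_nat (Suc k))) * g (s + of_nat k))"
      by (simp add: sum_negf[symmetric])
    thus ?thesis unfolding zeta_series_recurrence[OF s, of m] g'_def by simp
  qed
  moreover have "poly_bounded (3/2 - real (Suc m)) g'"
  proof -
    have "poly_bounded (3/2 - real (Suc m)) (\<lambda>s. g (s + of_nat k))" if "k \<in> {1..m}" for k
      by (rule poly_bounded_shift[of "3/2 - real m"]) (use assms that in auto)
    thus ?thesis unfolding g'_def gbinomial_prod_rev divide_inverse
      by (intro poly_bounded_add poly_bounded_diff poly_bounded_sum poly_bounded_mult poly_bounded_prod
           poly_bounded_const poly_bounded_id poly_bounded_powr_taylor_sum) auto
  qed
  ultimately show ?thesis by blast
qed

lemma zeta_continuation_halfplane: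
  "\<exists>g. g holomorphic_on {s. Re s > 1 - real (Suc m)} \<and> (\<forall>s. Re s > 1 \<longrightarrow> g s = (s - 1) * zeta_series s)
     \<and> poly_bounded (3/2 - real (Suc m)) g"
proof (induction m)
  case 0
  show ?case using zeta_continuation_step[of 0] by auto
next
  case (Suc m)
  then obtain g where "g holomorphic_on {s. Re s > 1 - real (Suc m)} \<and> (\<forall>s. Re s > 1 \<longrightarrow> g s = (s - 1) * zeta_series s)
     \<and> poly_bounded (3/2 - real (Suc m)) g" by blast
  thus ?case using zeta_continuation_step[of "Suc m" g] by blast
qed

lemma zeta_continuation_entire:
  obtains g where "g holomorphic_on UNIV" "\<And>s. Re s > 1 \<Longrightarrow> g s = (s - 1) * zeta_series s"
    "\<And>\<sigma>. poly_bounded \<sigma> g"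
proof -
  obtain G where G: "\<And>m. G m holomorphic_on {s. Re s > 1 - real (Suc m)}"
    "\<And>m s. Re s > 1 \<Longrightarrow> G m s = (s - 1) * zeta_series s" "\<And>m. poly_bounded (3/2 - real (Suc m)) (G m)"
    using zeta_continuation_halfplane by metis
  have agree: "G m s = G m' s" if "Re s > 1 - real (Suc m)" "m \<le> m'" for m m' s
  proof (rule analytic_continuation_open[where s = "{s. Re s > 1}" and s' = "{s. Re s > 1 - real (Suc m)}" and f = "G m" and g = "G m'"])
    show "{s. Re s > 1} \<noteq> {}" by (auto intro!: exI[of _ 2])
    show "connected {s. Re s > 1 - real (Suc m)}" by (intro convex_connected convex_halfspace_Re_gt)
    show "G m' holomorphic_on {s. Re s > 1 - real (Suc m)}"
      by (rule holomorphic_on_subset[OF G(1)]) (use that in auto)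
  qed (use G that in \<open>auto simp: open_halfspace_Re_gt\<close>)
  \<comment> \<open>The index depends on the point only so that its half-plane contains the point;
    by \<open>agree\<close> any larger index gives the same value.\<close>
  define g where "g = (\<lambda>s. G (nat \<lceil>1 - Re s\<rceil>) s)"
  have gG: "g s = G m s" if "Re s > 1 - real (Suc m)" for m s
  proof (cases "m \<le> nat \<lceil>1 - Re s\<rceil>")
    case True thus ?thesis unfolding g_def using agree[OF that True] by simp
  next
    case False
    have "Re s > 1 - real (Suc (nat \<lceil>1 - Re s\<rceil>))" by linarith
    show ?thesis unfolding g_def by (rule agree) (use False in linarith)+
  qed
  show ?thesis
  proof (rule that[of g])
    show "g holomorphic_on UNIV"
    proof (rule holomorphic_on_subset)
      show "g holomorphic_on (\<Union>m. {s. Re s > 1 - real (Suc m)})"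
      proof (rule holomorphic_on_UN_open)
        fix m :: nat
        show "g holomorphic_on {s. Re s > 1 - real (Suc m)}"
          using G(1)[of m] by (rule holomorphic_transform) (use gG in auto)
      qed (auto simp: open_halfspace_Re_gt)
      have "\<exists>m. Re s > 1 - real (Suc m)" for s
        using reals_Archimedean2[of "1 - Re s"] by (auto intro: less_trans) (smt (verit) of_nat_Suc)
      thus "UNIV \<subseteq> (\<Union>m. {s. Re s > 1 - real (Suc m)})" by auto
    qed
    show "g s = (s - 1) * zeta_series s" if "Re s > 1" for s
      using gG[of 0 s] G(2)[of s 0] that by simp
    fix \<sigma> :: real
    obtain m where m: "3/2 - real (Suc m) < \<sigma>"
      using reals_Archimedean2[of "1/2 - \<sigma>"] by (auto simp: algebra_simps)
    obtain C A where CA: "\<And>s. Re s \<ge> 3/2 - real (Suc m) \<Longrightarrow> norm (G m s) \<le> C * (1 + norm s) ^ A"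
      using G(3)[of m] unfolding poly_bounded_def by blast
    have "norm (g s) \<le> C * (1 + norm s) ^ A" if "Re s \<ge> \<sigma>" for s
      using CA[of s] gG[of m s] that m by auto
    thus "poly_bounded \<sigma> g" unfolding poly_bounded_def by blast
  qed
qed

text \<open>Multiplying by \<open>s - 1\<close> removes the only pole; the value at 1 is the
  residue. Away from 1 zeros and multiplicities are those of \<open>zeta\<close>.\<close>

definition zeta_entire :: "complex \<Rightarrow> complex" where
  "zeta_entire s = (if s = 1 then 1 else (s - 1) * zeta s)"

text \<open>The continuation satisfies the description that defines \<open>zeta\<close>, and the
  identity theorem makes it the only candidate. The values at 1 and 0 come from the recurrence with
  one correction term, valid for Re s > -1. The value at 0 matters because the explicit formula
  divides by the zeros.\<close>

lemma zeta_entire_facts: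
  shows holomorphic_zeta_entire: "zeta_entire holomorphic_on UNIV"
    and zeta_entire_eq: "Re s > 1 \<Longrightarrow> zeta_entire s = (s - 1) * zeta_series s"
    and poly_bounded_zeta_entire: "poly_bounded \<sigma> zeta_entire"
    and zeta_entire_0: "zeta_entire 0 = 1 / 2"
proof -
  obtain G where G: "G holomorphic_on UNIV" "\<And>s. Re s > 1 \<Longrightarrow> G s = (s - 1) * zeta_series s"
    "\<And>\<sigma>. poly_bounded \<sigma> G" using zeta_continuation_entire by blast
  \<comment> \<open>The recurrence for \<open>m = 1\<close>: the coefficient
    \<open>(1 - s) * (- s) / 2\<close> of \<open>zeta_series (s + 1)\<close> is rewritten through
    \<open>G (s + 1) = s * zeta_series (s + 1)\<close>.\<close>
  define R where "R = (\<lambda>s. 1 + powr_taylor_sum 2 s - (1 - s) * G (s + 1) / 2)"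
  have R: "G s = R s" if "Re s > -1" for s
  proof (rule analytic_continuation_open[where s = "{s. Re s > 1}" and s' = "{s. Re s > -1}" and f = G and g = R])
    show "{s. Re s > 1} \<noteq> {}" by (auto intro!: exI[of _ 2])
    show "connected {s. Re s > -1}" by (intro convex_connected convex_halfspace_Re_gt)
    have "(\<lambda>s. G (s + 1)) holomorphic_on UNIV"
    proof -
      have "(\<lambda>s::complex. s + 1) holomorphic_on UNIV" by (intro holomorphic_intros)
      from holomorphic_on_compose_gen[OF this G(1)] show ?thesis by (simp add: o_def)
    qed
    moreover have "powr_taylor_sum 2 holomorphic_on {s. Re s > -1}"
      using holomorphic_powr_taylor_sum[of 2] by simp
    ultimately show "R holomorphic_on {s. Re s > -1}" unfolding R_def
      by (intro holomorphic_intros) (auto intro: holomorphic_on_subset)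
    show "G z = R z" if "z \<in> {s. Re s > 1}" for z
    proof -
      have z: "Re z > 1" using that by simp
      have "((1 - z) gchoose 2) = (1 - z) * (- z) / 2"
        by (simp add: gbinomial_prod_rev numeral_2_eq_2)
      hence "(z - 1) * zeta_series z = 1 + powr_taylor_sum 2 z + (1 - z) * (- z) / 2 * zeta_series (z + 1)"
        using zeta_series_recurrence[OF z, of 1] by (simp add: numeral_2_eq_2)
      thus ?thesis using G(2)[OF z] G(2)[of "z + 1"] z by (simp add: R_def)
    qed
  qed (use G(1) that in \<open>auto simp: open_halfspace_Re_gt intro: holomorphic_on_subset\<close>)
  \<comment> \<open>For the exponents 0 and 1, that is at \<open>s = 1\<close> and
    \<open>s = 0\<close>, the binomial expansion is finite and exact.\<close>
  have "powr_taylor_rem 2 n 0 = 0" for n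
  proof -
    have "2 + of_nat n \<noteq> (0::complex)" "1 + of_nat n \<noteq> (0::complex)" by (auto simp: complex_eq_iff)
    thus ?thesis by (simp add: powr_taylor_rem_def numeral_2_eq_2 gbinomial_prod_rev)
  qed
  hence "powr_taylor_sum 2 1 = 0" by (simp add: powr_taylor_sum_def)
  hence G1: "G 1 = 1" using R[of 1] by (simp add: R_def)
  have "powr_taylor_rem 2 n 1 = 0" for n
  proof -
    have "2 + of_nat n \<noteq> (0::complex)" "1 + of_nat n \<noteq> (0::complex)" by (auto simp: complex_eq_iff)
    thus ?thesis by (simp add: powr_taylor_rem_def numeral_2_eq_2 gbinomial_prod_rev)
  qed
  hence "powr_taylor_sum 2 0 = 0" by (simp add: powr_taylor_sum_def)
  hence G0: "G 0 = 1 / 2" using R[of 0] G1 by (simp add: R_def)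
  define f0 where "f0 = (\<lambda>s. if s = 1 then 0 else G s / (s - 1))"
  have f0: "f0 holomorphic_on - {1}"
  proof -
    have "(\<lambda>s. G s / (s - 1)) holomorphic_on - {1}"
      by (intro holomorphic_intros holomorphic_on_subset[OF G(1)]) auto
    thus ?thesis by (rule holomorphic_transform) (auto simp: f0_def)
  qed
  have f0': "f0 s = zeta_series s" if "Re s > 1" for s
    using G(2)[OF that] that by (auto simp: f0_def)
  have "zeta = f0" unfolding zeta_def
  proof (rule the_equality, intro conjI allI impI)
    show "(\<lambda>n. 1 / of_nat (Suc n) powr s) sums f0 s" if "Re s > 1" for s
      using zeta_series_sums[OF that] f0'[OF that] by simp
    fix f assume f: "f holomorphic_on - {1} \<and> (\<forall>s. 1 < Re s \<longrightarrow> (\<lambda>n. 1 / of_nat (Suc n) powr s) sums f s) \<and> f 1 = 0"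
    show "f = f0"
    proof
      fix s show "f s = f0 s"
      proof (cases "s = 1")
        case True thus ?thesis using f by (simp add: f0_def)
      next
        case False
        show ?thesis
        proof (rule analytic_continuation_open[where s = "{s. Re s > 1}" and s' = "-{1}" and f = f and g = f0])
          show "{s. Re s > 1} \<noteq> {}" by (auto intro!: exI[of _ 2])
          show "connected (-{1::complex})" by (rule connected_punctured_universe) simp
          show "f z = f0 z" if "z \<in> {s. Re s > 1}" for z
          proof -
            have z: "Re z > 1" using that by simp
            hence "(\<lambda>n. 1 / of_nat (Suc n) powr z) sums f z" using f by blast
            with zeta_series_sums[OF z] f0'[OF z] show ?thesis using sums_unique2 by metis
          qed
        qed (use f f0 False in \<open>auto simp: open_halfspace_Re_gt\<close>)
      qed
    qed
  qed (use f0 in \<open>auto simp: f0_def\<close>)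
  hence eq: "zeta_entire = G"
    using G1 by (auto simp: zeta_entire_def f0_def fun_eq_iff)
  show "zeta_entire holomorphic_on UNIV" "Re s > 1 \<Longrightarrow> zeta_entire s = (s - 1) * zeta_series s"
     "poly_bounded \<sigma> zeta_entire" "zeta_entire 0 = 1 / 2" unfolding eq using G G0 by auto
qed

lemma zeta_entire_1 [simp]: "zeta_entire 1 = 1"
  by (simp add: zeta_entire_def)

lemma zeta_conv_zeta_entire: "s \<noteq> 1 \<Longrightarrow> zeta s = zeta_entire s / (s - 1)"
  by (simp add: zeta_entire_def)

section \<open>The logarithmic derivative of zeta\<close>

text \<open>Absolute convergence of the double series allows the pairs \<open>(d, m)\<close> to be
  regrouped by their product.\<close>

lemma dirichlet_product_has_sum:
  fixes a b :: "nat \<Rightarrow> complex"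
  assumes a: "(a has_sum A) {1..}" "(\<lambda>n. norm (a n)) summable_on {1..}"
    and b: "(b has_sum B) {1..}" "(\<lambda>n. norm (b n)) summable_on {1..}"
  shows "((\<lambda>n. \<Sum>d | d dvd n. a d * b (n div d)) has_sum (A * B)) {1..}"
proof -
  let ?P = "{1..} :: nat set"
  have "(\<lambda>x. norm (case x of (d,m) \<Rightarrow> a d * b m)) summable_on (?P \<times> ?P)"
  proof (rule iffD2[OF Infinite_Sum.abs_summable_on_Sigma_iff], intro conjI ballI)
    fix d assume "d \<in> ?P"
    show "(\<lambda>y. norm (case (d, y) of (d, m) \<Rightarrow> a d * b m)) summable_on ?P"
      using summable_on_cmult_right[OF b(2), of "norm (a d)"] by (simp add: norm_mult)
  next
    have "(\<lambda>x. norm (norm (a x) * (\<Sum>\<^sub>\<infinity>y\<in>?P. norm (b y)))) summable_on ?P"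
      using summable_on_cmult_left[OF a(2), of "\<bar>\<Sum>\<^sub>\<infinity>y\<in>?P. norm (b y)\<bar>"] by (simp add: abs_mult)
    thus "(\<lambda>x. norm (\<Sum>\<^sub>\<infinity>y\<in>?P. norm (case (x, y) of (d, m) \<Rightarrow> a d * b m))) summable_on ?P"
      by (simp add: norm_mult infsum_cmult_right')
  qed
  hence summ: "(\<lambda>(d,m). a d * b m) summable_on (?P \<times> ?P)" by (rule abs_summable_summable)
  have "((\<lambda>(d,m). a d * b m) has_sum (A * B)) (?P \<times> ?P)"
  proof (rule has_sum_SigmaI[OF _ _ summ])
    show "((\<lambda>m. case (d, m) of (d, m) \<Rightarrow> a d * b m) has_sum (a d * B)) ?P" for d
      using has_sum_cmult_right[OF b(1), of "a d"] by simp
    show "((\<lambda>d. a d * B) has_sum (A * B)) ?P" by (rule has_sum_cmult_left[OF a(1)])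
  qed
  also have "?this \<longleftrightarrow> ((\<lambda>(n,d). a d * b (n div d)) has_sum (A * B)) (Sigma ?P (\<lambda>n. {d. d dvd n}))"
    by (rule has_sum_reindex_bij_witness[where i = "\<lambda>(n,d). (d, n div d)" and j = "\<lambda>(d,m). (d * m, d)"])
       (auto simp: Suc_le_eq dest: dvd_imp_le intro!: Nat.gr0I elim!: dvdE)
  finally have *: "((\<lambda>(n,d). a d * b (n div d)) has_sum (A * B)) (Sigma ?P (\<lambda>n. {d. d dvd n}))" .
  show ?thesis
  proof (rule has_sum_SigmaD[OF *])
    fix n assume "n \<in> ?P"
    thus "((\<lambda>y. case (n, y) of (n, d) \<Rightarrow> a d * b (n div d)) has_sum (\<Sum>d | d dvd n. a d * b (n div d))) {d. d dvd n}"
      by (intro has_sum_finiteI) auto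
  qed
qed

definition mangoldt_series :: "complex \<Rightarrow> complex" where
  "mangoldt_series s = (\<Sum>n. mangoldt (Suc n) / of_nat (Suc n) powr s)"

lemma norm_mangoldt_summand:
  "norm (mangoldt (Suc n) / of_nat (Suc n) powr s :: complex) = mangoldt (Suc n) * real (Suc n) powr (- Re s)"
  using norm_zeta_summand[of n s] unfolding divide_inverse norm_mult norm_mangoldt by simp

lemma mangoldt_summand_le:
  assumes "\<sigma> \<ge> 1 + 2 * \<delta>" "\<delta> > 0"
  shows "mangoldt (Suc n) * real (Suc n) powr (- \<sigma>) \<le> real (Suc n) powr (-1-\<delta>) / \<delta>"
proof -
  have "mangoldt (Suc n) \<le> ln (real (Suc n))" by (rule mangoldt_le) simp
  also have "\<dots> \<le> real (Suc n) powr \<delta> / \<delta>" by (rule ln_powr_bound) (use assms in auto)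
  finally have "mangoldt (Suc n) * real (Suc n) powr (- \<sigma>) \<le> real (Suc n) powr \<delta> / \<delta> * real (Suc n) powr (- 1 - 2 * \<delta>)"
    by (intro mult_mono powr_mono) (use assms in auto)
  also have "\<dots> = real (Suc n) powr (-1-\<delta>) / \<delta>"
    by (simp add: powr_add[symmetric] algebra_simps)
  finally show ?thesis .
qed

lemma summable_mangoldt_norm:
  assumes "\<sigma> > 1"
  shows "summable (\<lambda>n. mangoldt (Suc n) * real (Suc n) powr (- \<sigma>))"
proof (rule summable_comparison_test')
  define \<delta> where "\<delta> = (\<sigma> - 1) / 2"
  have \<delta>: "\<sigma> \<ge> 1 + 2 * \<delta>" "\<delta> > 0" using assms by (auto simp: \<delta>_def field_simps)
  show "summable (\<lambda>n. real (Suc n) powr (-1-\<delta>) / \<delta>)"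
    by (intro summable_divide summable_Suc_powr) (use \<delta> in auto)
  show "norm (mangoldt (Suc n) * real (Suc n) powr (- \<sigma>)) \<le> real (Suc n) powr (-1-\<delta>) / \<delta>" if "n \<ge> 0" for n
    using mangoldt_summand_le[OF \<delta>, of n] by (simp add: mangoldt_nonneg)
qed

lemma mangoldt_series_sums:
  assumes "Re s > 1"
  shows "(\<lambda>n. mangoldt (Suc n) / of_nat (Suc n) powr s) sums mangoldt_series s"
proof -
  have "summable (\<lambda>n. norm (mangoldt (Suc n) / of_nat (Suc n) powr s :: complex))"
    unfolding norm_mangoldt_summand by (rule summable_mangoldt_norm) fact
  thus ?thesis unfolding mangoldt_series_def by (rule summable_sums[OF summable_norm_cancel])
qed

lemma Re_ge_of_cball:
  assumes "y \<in> cball x d" shows "Re y \<ge> Re x - d"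
  using complex_Re_le_cmod[of "x - y"] assms by (simp add: dist_norm)

lemma holomorphic_mangoldt_series: "mangoldt_series holomorphic_on {s. Re s > 1}"
  unfolding mangoldt_series_def
proof (rule holomorphic_suminf)
  show "open {s. Re s > 1}" by (simp add: open_halfspace_Re_gt)
  show "(\<lambda>s. mangoldt (Suc n) / of_nat (Suc n) powr s) holomorphic_on {s. Re s > 1}" for n
    by (intro holomorphic_intros) auto
  fix x assume x: "x \<in> {s. Re s > 1}"
  define d where "d = (Re x - 1) / 2"
  have d: "d > 0" "Re x - d > 1" using x by (auto simp: d_def field_simps)
  have "norm (mangoldt (Suc n) / of_nat (Suc n) powr y :: complex) \<le> mangoldt (Suc n) * real (Suc n) powr (- (Re x - d))"
    if "y \<in> cball x d" for n y
    unfolding norm_mangoldt_summand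
    by (intro mult_left_mono powr_mono) (use Re_ge_of_cball[OF that] in \<open>auto simp: mangoldt_nonneg\<close>)
  thus "\<exists>d M. d > 0 \<and> cball x d \<subseteq> {s. Re s > 1} \<and> summable M \<and> (\<forall>n. \<forall>y\<in>cball x d. norm (mangoldt (Suc n) / of_nat (Suc n) powr y :: complex) \<le> M n)"
    using d summable_mangoldt_norm[of "Re x - d"] Re_ge_of_cball[of _ x d]
    by (intro exI[of _ d] exI[of _ "\<lambda>n. mangoldt (Suc n) * real (Suc n) powr (- (Re x - d))"]) force
qed

lemma has_sum_atLeast_1_iff: "(f has_sum S) {1..} \<longleftrightarrow> ((\<lambda>n. f (Suc n)) has_sum S) UNIV"
  by (rule has_sum_reindex_bij_witness[where i = Suc and j = "\<lambda>n. n - 1"]) auto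

lemma has_sum_atLeast_1I:
  fixes f :: "nat \<Rightarrow> complex"
  assumes "(\<lambda>n. f (Suc n)) sums S" "summable (\<lambda>n. norm (f (Suc n)))"
  shows "(f has_sum S) {1..}" "(\<lambda>n. norm (f n)) summable_on {1..}"
proof -
  show "(f has_sum S) {1..}" unfolding has_sum_atLeast_1_iff
    by (rule norm_summable_imp_has_sum) (use assms in auto)
  have "((\<lambda>n. norm (f n)) has_sum (\<Sum>n. norm (f (Suc n)))) {1..}" unfolding has_sum_atLeast_1_iff
    by (rule sums_nonneg_imp_has_sum[OF summable_sums]) (use assms in auto)
  thus "(\<lambda>n. norm (f n)) summable_on {1..}" by (auto simp: summable_on_def)
qed

text \<open>Termwise differentiation gives the coefficients \<open>- ln n\<close>. Since
  \<open>ln n\<close> is the sum of \<open>mangoldt\<close> over the divisors of \<open>n\<close>,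
  the differentiated series is minus the Dirichlet product of the other two.\<close>

lemma zeta_series_has_derivative:
  assumes s: "Re s > 1"
  shows "(zeta_series has_field_derivative - mangoldt_series s * zeta_series s) (at s)"
proof -
  let ?f = "\<lambda>n s. 1 / of_nat (Suc n) powr s :: complex"
  let ?f' = "\<lambda>n s. - of_real (ln (real (Suc n))) / of_nat (Suc n) powr s :: complex"
  have "\<exists>g g'. \<forall>x\<in>{s. Re s > 1}. (\<lambda>n. ?f n x) sums g x \<and> (\<lambda>n. ?f' n x) sums g' x \<and> (g has_field_derivative g' x) (at x)"
  proof (rule series_and_derivative_comparison_complex)
    show "open {s. Re s > 1}" by (simp add: open_halfspace_Re_gt)
    show "(?f n has_field_derivative ?f' n x) (at x)" for n x
    proof -
      have e: "?f n = (\<lambda>x. exp (- x * of_real (ln (real (Suc n)))))"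
        by (auto simp: fun_eq_iff powr_def exp_minus divide_simps Ln_of_nat simp del: of_nat_Suc)
      have "?f' n x = exp (- x * of_real (ln (real (Suc n)))) * (- of_real (ln (real (Suc n))))"
        using fun_cong[OF e, of x] by (simp add: divide_inverse)
      thus ?thesis unfolding e by (auto intro!: derivative_eq_intros)
    qed
    fix x assume x: "x \<in> {s. Re s > 1}"
    define d where "d = (Re x - 1) / 2"
    have d: "d > 0" "Re x - d > 1" using x by (auto simp: d_def field_simps)
    let ?h = "\<lambda>n. complex_of_real (real (Suc n) powr (- (Re x - d)))"
    have "summable ?h" unfolding summable_complex_of_real
      by (rule summable_Suc_powr) (use d in auto)
    moreover have "norm (?f n y) \<le> norm (?h n)" if "y \<in> ball x d \<inter> {s. Re s > 1}" for n y
      unfolding norm_zeta_summand using Re_ge_of_cball[of y x d] that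
      by (auto intro!: powr_mono)
    ultimately show "\<exists>d h. 0 < d \<and> summable h \<and> range h \<subseteq> \<real>\<^sub>\<ge>\<^sub>0 \<and> (\<forall>\<^sub>F n in sequentially. \<forall>y\<in>ball x d \<inter> {s. Re s > 1}. norm (?f n y) \<le> cmod (h n))"
      using d by (intro exI[of _ d] exI[of _ ?h]) (auto intro!: always_eventually)
  qed
  then obtain g g' where g: "\<And>x. Re x > 1 \<Longrightarrow> (\<lambda>n. ?f n x) sums g x" "\<And>x. Re x > 1 \<Longrightarrow> (\<lambda>n. ?f' n x) sums g' x"
     "\<And>x. Re x > 1 \<Longrightarrow> (g has_field_derivative g' x) (at x)" by auto
  have eq: "g x = zeta_series x" if "Re x > 1" for x
    using g(1)[OF that] zeta_series_sums[OF that] by (rule sums_unique2)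
  have D: "(zeta_series has_field_derivative g' s) (at s)"
    by (rule has_field_derivative_transform_within_open[OF g(3)[OF s], of "{s. Re s > 1}"]) (use eq s in \<open>auto simp: open_halfspace_Re_gt\<close>)
  define a where "a = (\<lambda>n::nat. mangoldt n / of_nat n powr s :: complex)"
  define b where "b = (\<lambda>n::nat. 1 / of_nat n powr s :: complex)"
  have a: "(a has_sum mangoldt_series s) {1..}" "(\<lambda>n. norm (a n)) summable_on {1..}"
    using has_sum_atLeast_1I[of a "mangoldt_series s"] mangoldt_series_sums[OF s] summable_mangoldt_norm[OF s]
    unfolding a_def norm_mangoldt_summand by blast+
  have b: "(b has_sum zeta_series s) {1..}" "(\<lambda>n. norm (b n)) summable_on {1..}"
    using has_sum_atLeast_1I[of b "zeta_series s"] zeta_series_sums[OF s] summable_Suc_powr[of "- Re s"] s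
    unfolding b_def norm_zeta_summand by auto
  have "((\<lambda>n. \<Sum>d | d dvd n. a d * b (n div d)) has_sum (mangoldt_series s * zeta_series s)) {1..}"
    by (rule dirichlet_product_has_sum[OF a b])
  hence "(\<lambda>n. \<Sum>d | d dvd Suc n. a d * b (Suc n div d)) sums (mangoldt_series s * zeta_series s)"
    unfolding has_sum_atLeast_1_iff by (rule has_sum_imp_sums)
  also have "(\<lambda>n. \<Sum>d | d dvd Suc n. a d * b (Suc n div d)) = (\<lambda>n. - ?f' n s)"
  proof
    fix n
    have "a d * b (Suc n div d) = mangoldt d * (1 / of_nat (Suc n) powr s)" if "d dvd Suc n" for d
    proof -
      have "of_nat (Suc n) = of_nat d * (of_nat (Suc n div d) :: complex)"
        using that by (metis dvd_mult_div_cancel of_nat_mult)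
      hence "of_nat (Suc n) powr s = of_nat d powr s * (of_nat (Suc n div d) :: complex) powr s"
        by (simp add: powr_times_real)
      thus ?thesis by (simp add: a_def b_def)
    qed
    hence "(\<Sum>d | d dvd Suc n. a d * b (Suc n div d)) = (\<Sum>d | d dvd Suc n. mangoldt d) * (1 / of_nat (Suc n) powr s)"
      by (subst sum_distrib_right, intro sum.cong) auto
    also have "(\<Sum>d | d dvd Suc n. mangoldt d) = complex_of_real (ln (real (Suc n)))"
      by (rule mangoldt_sum) simp
    finally show "(\<Sum>d | d dvd Suc n. a d * b (Suc n div d)) = - ?f' n s" by simp
  qed
  finally have "?f' n s = ?f' n s" "(\<lambda>n. - ?f' n s) sums (mangoldt_series s * zeta_series s)" for n by auto
  moreover have "(\<lambda>n. - ?f' n s) sums (- g' s)" by (intro sums_minus g s)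
  ultimately have "- g' s = mangoldt_series s * zeta_series s" using sums_unique2 by blast
  hence "g' s = - mangoldt_series s * zeta_series s" by (metis minus_minus mult_minus_left)
  thus ?thesis using D by simp
qed

text \<open>Whatever \<open>t\<close> is, the terms after the first add up to at most
  \<open>pi^2 / 6 - 1 < 3 / 4\<close> in modulus. This is the reference value at the centres of the
  discs in which zeros are counted.\<close>

lemma norm_zeta_series_2_ge: "norm (zeta_series (2 + \<i> * of_real t)) \<ge> 1 / 4"
proof -
  let ?s = "2 + \<i> * of_real t"
  let ?f = "\<lambda>n. 1 / of_nat (Suc n) powr ?s :: complex"
  have "(\<lambda>n. ?f (Suc n)) sums (zeta_series ?s - ?f 0)"
    by (subst sums_Suc_iff) (use zeta_series_sums[of ?s] in simp)
  hence e: "zeta_series ?s - 1 = (\<Sum>n. ?f (Suc n))" by (simp add: sums_iff)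
  have sq: "(\<lambda>n. 1 / (real (Suc n) + 1)\<^sup>2) sums (pi\<^sup>2 / 6 - 1)"
    by (subst sums_Suc_iff) (use inverse_squares_sums in \<open>simp add: add_ac\<close>)
  have nf: "norm (?f (Suc n)) = 1 / (real (Suc n) + 1)\<^sup>2" for n
    unfolding norm_zeta_summand by (simp add: powr_minus divide_simps powr_numeral add_ac)
  have "norm (\<Sum>n. ?f (Suc n)) \<le> (\<Sum>n. 1 / (real (Suc n) + 1)\<^sup>2)"
    by (rule norm_suminf_le) (use sq nf in \<open>auto simp: sums_iff\<close>)
  also have "\<dots> = pi\<^sup>2 / 6 - 1" using sq by (simp add: sums_iff)
  also have "\<dots> \<le> 3.2\<^sup>2 / 6 - 1" using pi_approx by (intro diff_mono divide_right_mono power_mono) auto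
  also have "\<dots> \<le> 3 / 4" by (simp add: power2_eq_square)
  finally have "norm (zeta_series ?s - 1) \<le> 3 / 4" unfolding e .
  thus ?thesis using norm_triangle_ineq2[of 1 "1 - zeta_series ?s"] by (simp add: norm_minus_commute)
qed

lemma norm_zeta_entire_2_ge: "norm (zeta_entire (2 + \<i> * of_real t)) \<ge> 1 / 4"
proof -
  have "1 \<le> norm (1 + \<i> * of_real t)" using complex_Re_le_cmod[of "1 + \<i> * of_real t"] by simp
  hence "1 * (1/4) \<le> norm (1 + \<i> * of_real t) * norm (zeta_series (2 + \<i> * of_real t))"
    by (intro mult_mono norm_zeta_series_2_ge) auto
  also have "\<dots> = norm (zeta_entire (2 + \<i> * of_real t))"
    by (subst zeta_entire_eq) (simp_all flip: norm_mult)
  finally show ?thesis by simp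
qed

text \<open>The differential equation replaces the Euler product: with a primitive \<open>Q\<close>
  of \<open>mangoldt_series\<close>, the product \<open>zeta_series * exp Q\<close> has derivative
  0, so a single zero would force \<open>zeta_series 2 = 0\<close>.\<close>

lemma zeta_series_nonzero:
  assumes s: "Re s > 1" shows "zeta_series s \<noteq> 0"
proof
  assume z: "zeta_series s = 0"
  let ?S = "{s. Re s > 1}"
  have S: "convex ?S" "open ?S" by (auto simp: open_halfspace_Re_gt convex_halfspace_Re_gt)
  obtain Q where Q: "\<And>x. x \<in> ?S \<Longrightarrow> (Q has_field_derivative mangoldt_series x) (at x within ?S)"
    using holomorphic_convex_primitive'[OF S holomorphic_mangoldt_series] by blast
  have "((\<lambda>x. zeta_series x * exp (Q x)) has_field_derivative 0) (at x within ?S)" if "x \<in> ?S" for x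
  proof -
    have 1: "(zeta_series has_field_derivative - mangoldt_series x * zeta_series x) (at x within ?S)"
      by (rule DERIV_subset[OF zeta_series_has_derivative]) (use that in auto)
    have 2: "((\<lambda>x. exp (Q x)) has_field_derivative exp (Q x) * mangoldt_series x) (at x within ?S)"
      by (rule DERIV_chain2[OF DERIV_exp Q[OF that]])
    from DERIV_mult[OF 1 2] show ?thesis by (simp add: algebra_simps)
  qed
  from has_field_derivative_zero_constant[OF S(1) this]
  obtain c where "\<And>x. x \<in> ?S \<Longrightarrow> zeta_series x * exp (Q x) = c" by blast
  from this[of s] this[of 2] z s have "zeta_series 2 = 0" by auto
  thus False using norm_zeta_series_2_ge[of 0] by simp
qed

lemma logderiv_zeta_entire:
  assumes s: "Re s > 1"
  shows "zeta_entire s \<noteq> 0" "deriv zeta_entire s / zeta_entire s = 1 / (s - 1) - mangoldt_series s"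
proof -
  have s1: "s \<noteq> 1" using s by auto
  show nz: "zeta_entire s \<noteq> 0" using zeta_series_nonzero[OF s] zeta_entire_eq[OF s] s1 by simp
  have "((\<lambda>s. (s - 1) * zeta_series s) has_field_derivative zeta_series s + (- mangoldt_series s * zeta_series s) * (s - 1)) (at s)"
    by (auto intro!: derivative_eq_intros zeta_series_has_derivative s)
  hence "(zeta_entire has_field_derivative zeta_series s + (- mangoldt_series s * zeta_series s) * (s - 1)) (at s)"
    by (rule has_field_derivative_transform_within_open[of _ _ _ "{s. Re s > 1}"])
       (use s zeta_entire_eq in \<open>auto simp: open_halfspace_Re_gt\<close>)
  hence "deriv zeta_entire s = zeta_series s + (- mangoldt_series s * zeta_series s) * (s - 1)"
    by (rule DERIV_imp_deriv)
  thus "deriv zeta_entire s / zeta_entire s = 1 / (s - 1) - mangoldt_series s"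
    unfolding zeta_entire_eq[OF s] using s1 zeta_series_nonzero[OF s]
    by (simp add: divide_simps) (simp add: algebra_simps)
qed

text \<open>Comes from the local factorisation \<open>f w = g w * (w - a) ^ n\<close>. Points with
  \<open>f a \<noteq> 0\<close> are included, with order 0; thus the lemma also yields isolation of
  zeros around an arbitrary point.\<close>

lemma logderiv_near:
  assumes f: "f holomorphic_on UNIV" "\<exists>w. f w \<noteq> (0::complex)"
  obtains r g where "r > 0" "g holomorphic_on ball a r" "\<And>w. w \<in> ball a r \<Longrightarrow> g w \<noteq> 0"
    "\<And>w. w \<in> ball a r - {a} \<Longrightarrow> f w \<noteq> 0 \<and> deriv f w / f w = of_int (zorder f a) / (w - a) + deriv g w / g w"
proof -
  define n where "n = nat (zorder f a)"
  define g where "g = zor_poly f a"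
  have *: "(if f a = 0 then zorder f a > 0 else zorder f a = 0) \<and> (\<exists>r. r>0 \<and> cball a r \<subseteq> UNIV \<and> g holomorphic_on cball a r
    \<and> (\<forall>w\<in>cball a r. f w  = g w * (w-a) ^ n  \<and> g w \<noteq>0))"
    unfolding g_def n_def by (rule zorder_exist_zero) (use f in auto)
  then obtain r where r: "r > 0" "g holomorphic_on cball a r" "\<And>w. w \<in> cball a r \<Longrightarrow> f w = g w * (w-a) ^ n  \<and> g w \<noteq>0"
    by auto
  have zn: "zorder f a = int n" using * by (auto simp: n_def split: if_splits)
  show ?thesis
  proof (rule that[of r g])
    show "g holomorphic_on ball a r" by (rule holomorphic_on_subset[OF r(2)]) auto
    fix w assume w: "w \<in> ball a r - {a}"
    hence fw: "f w = g w * (w-a) ^ n" "g w \<noteq> 0" using r(3)[of w] by auto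
    have "(g has_field_derivative deriv g w) (at w)"
      by (rule holomorphic_derivI[OF \<open>g holomorphic_on ball a r\<close>]) (use w in auto)
    hence "((\<lambda>w. g w * (w-a) ^ n) has_field_derivative deriv g w * (w-a)^n + of_nat n * (w-a)^(n-1) * g w) (at w)"
      by (auto intro!: derivative_eq_intros)
    hence "(f has_field_derivative deriv g w * (w-a)^n + of_nat n * (w-a)^(n-1) * g w) (at w)"
      by (rule has_field_derivative_transform_within_open[of _ _ _ "ball a r"]) (use w r(3) in auto)
    hence d: "deriv f w = deriv g w * (w-a)^n + of_nat n * (w-a)^(n-1) * g w" by (rule DERIV_imp_deriv)
    show "f w \<noteq> 0 \<and> deriv f w / f w = of_int (zorder f a) / (w - a) + deriv g w / g w"
    proof
      show "f w \<noteq> 0" using fw w by auto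
      have "of_nat n * (w-a)^(n-1) * (w - a) = of_nat n * (w-a)^n" by (cases n) auto
      thus "deriv f w / f w = of_int (zorder f a) / (w - a) + deriv g w / g w"
        unfolding d fw(1) zn using fw(2) w by (cases n) (simp_all add: divide_simps, simp_all add: algebra_simps)
    qed
  qed (use r in auto)
qed

lemma logderiv_tendsto_zorder:
  assumes f: "f holomorphic_on UNIV" "\<exists>w. f w \<noteq> (0::complex)"
  shows "((\<lambda>z. (z - a) * (deriv f z / f z)) \<longlongrightarrow> of_int (zorder f a)) (at a)"
proof -
  obtain r g where r: "r > 0" "g holomorphic_on ball a r" "\<And>w. w \<in> ball a r \<Longrightarrow> g w \<noteq> 0"
    "\<And>w. w \<in> ball a r - {a} \<Longrightarrow> f w \<noteq> 0 \<and> deriv f w / f w = of_int (zorder f a) / (w - a) + deriv g w / g w"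
    using logderiv_near[OF f] by metis
  have "isCont (\<lambda>w. deriv g w / g w) a"
    using continuous_on_interior[OF holomorphic_on_imp_continuous_on[OF holomorphic_on_divide[OF holomorphic_deriv[OF r(2) open_ball] r(2) r(3)]], of a] r(1)
    by (simp add: interior_open)
  hence "((\<lambda>w. of_int (zorder f a) + (w - a) * (deriv g w / g w)) \<longlongrightarrow> of_int (zorder f a) + (a - a) * (deriv g a / g a)) (at a)"
    unfolding isCont_def by (intro tendsto_add tendsto_mult tendsto_diff tendsto_const tendsto_ident_at)
  hence "((\<lambda>w. of_int (zorder f a) + (w - a) * (deriv g w / g w)) \<longlongrightarrow> of_int (zorder f a)) (at a)" by simp
  thus ?thesis
  proof (rule Lim_transform_within_open[of _ _ _ UNIV "ball a r"])
    fix w assume w: "w \<in> ball a r" "w \<noteq> a"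
    thus "of_int (zorder f a) + (w - a) * (deriv g w / g w) = (w - a) * (deriv f w / f w)"
      using r(4)[of w] by (simp add: field_simps)
  qed (use r in auto)
qed

lemma zeta_entire_nontrivial: "\<exists>w. zeta_entire w \<noteq> 0"
  by (rule exI[of _ 1]) simp

lemma zeta_entire_analytic: "zeta_entire analytic_on {z}"
  using holomorphic_zeta_entire by (metis UNIV_I analytic_at open_UNIV)

lemma frequently_zeta_entire_nonzero: "frequently (\<lambda>w. zeta_entire w \<noteq> 0) (at z)"
proof (rule eventually_frequently)
  obtain b where "zeta_entire b \<noteq> 0" using zeta_entire_nontrivial by blast
  from non_zero_neighbour_alt[OF holomorphic_zeta_entire open_UNIV connected_UNIV UNIV_I UNIV_I this, of z]
  show "\<forall>\<^sub>F w in at z. zeta_entire w \<noteq> 0" by (rule eventually_mono) auto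
qed simp

lemma zorder_zeta_entire_nonneg: "zorder zeta_entire z \<ge> 0"
  by (rule zorder_ge_0[OF zeta_entire_analytic frequently_zeta_entire_nonzero])

lemma zorder_zeta_entire_pos_iff: "zorder zeta_entire z > 0 \<longleftrightarrow> zeta_entire z = 0"
  by (rule zorder_pos_iff'[OF zeta_entire_analytic frequently_zeta_entire_nonzero])

text \<open>
  The classical argument from \<open>3 + 4 cos \<theta> + cos 2\<theta> \<ge> 0\<close>.
\<close>
lemma zeta_entire_nonzero_line_1: "zeta_entire (1 + \<i> * of_real t) \<noteq> 0"
proof
  assume z: "zeta_entire (1 + \<i> * of_real t) = 0"
  hence t: "t \<noteq> 0" by auto
  define m where "m = (\<lambda>k::nat. real_of_int (zorder zeta_entire (1 + \<i> * of_real (real k * t))))"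
  define M where "M = (\<lambda>k::nat. \<lambda>\<sigma>::real. mangoldt_series (of_real \<sigma> + \<i> * of_real (real k * t)))"
  \<comment> \<open>\<open>m k\<close> is the order of \<open>zeta_entire\<close> at
    \<open>1 + i k t\<close>. As \<open>\<sigma>\<close> decreases to 1, the simple pole at 1
    contributes 1 when \<open>k = 0\<close>, and a zero of order \<open>m k\<close> contributes
    \<open>- m k\<close>.\<close>
  have lim: "((\<lambda>\<sigma>. (\<sigma> - 1) * Re (M k \<sigma>)) \<longlongrightarrow> (if k = 0 then 1 else 0) - m k) (at_right 1)" for k
  proof -
    let ?s = "\<lambda>\<sigma>::real. of_real \<sigma> + \<i> * complex_of_real (real k * t)"
    let ?a = "1 + \<i> * complex_of_real (real k * t)"
    have "filterlim ?s (at ?a) (at_right 1)"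
      unfolding filterlim_at
    proof
      show "(?s \<longlongrightarrow> ?a) (at_right 1)" by (auto intro!: tendsto_eq_intros)
      show "\<forall>\<^sub>F x in at_right 1. ?s x \<in> UNIV \<and> ?s x \<noteq> ?a"
        using eventually_at_right_less[of "1::real"] by eventually_elim (auto simp: complex_eq_iff)
    qed
    from filterlim_compose[OF logderiv_tendsto_zorder[OF holomorphic_zeta_entire zeta_entire_nontrivial, of ?a] this]
    have 1: "((\<lambda>\<sigma>. (of_real \<sigma> - 1) * (deriv zeta_entire (?s \<sigma>) / zeta_entire (?s \<sigma>))) \<longlongrightarrow> of_int (zorder zeta_entire ?a)) (at_right 1)"
      by simp
    have 2: "((\<lambda>\<sigma>::real. (of_real \<sigma> - 1) * (1 / (?s \<sigma> - 1))) \<longlongrightarrow> (if k = 0 then 1 else 0)) (at_right 1)"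
    proof (cases "k = 0")
      case True
      have "((\<lambda>\<sigma>::real. 1) \<longlongrightarrow> (1::complex)) (at_right 1)" by simp
      hence "((\<lambda>\<sigma>::real. (of_real \<sigma> - 1) * (1 / (of_real \<sigma> - 1))) \<longlongrightarrow> (1::complex)) (at_right 1)"
        by (rule Lim_transform_eventually)
           (use eventually_at_right_less[of "1::real"] in eventually_elim, auto simp: complex_eq_iff)
      thus ?thesis using True by simp
    next
      case False
      thus ?thesis using t by (auto intro!: tendsto_eq_intros simp: complex_eq_iff)
    qed
    have "((\<lambda>\<sigma>. (of_real \<sigma> - 1) * (1 / (?s \<sigma> - 1)) - (of_real \<sigma> - 1) * (deriv zeta_entire (?s \<sigma>) / zeta_entire (?s \<sigma>)))
      \<longlongrightarrow> (if k = 0 then 1 else 0) - of_int (zorder zeta_entire ?a)) (at_right 1)"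
      by (intro tendsto_diff 1 2)
    hence "((\<lambda>\<sigma>. of_real (\<sigma> - 1) * M k \<sigma>) \<longlongrightarrow> (if k = 0 then 1 else 0) - of_int (zorder zeta_entire ?a)) (at_right 1)"
    proof (rule Lim_transform_eventually)
      show "\<forall>\<^sub>F \<sigma> in at_right 1. (of_real \<sigma> - 1) * (1 / (?s \<sigma> - 1)) - (of_real \<sigma> - 1) * (deriv zeta_entire (?s \<sigma>) / zeta_entire (?s \<sigma>)) = of_real (\<sigma> - 1) * M k \<sigma>"
        using eventually_at_right_less[of "1::real"]
      proof eventually_elim
        case (elim \<sigma>)
        have "M k \<sigma> = 1 / (?s \<sigma> - 1) - deriv zeta_entire (?s \<sigma>) / zeta_entire (?s \<sigma>)"
          using logderiv_zeta_entire(2)[of "?s \<sigma>"] elim by (simp add: M_def)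
        thus ?case by (simp add: right_diff_distrib)
      qed
    qed
    from tendsto_Re[OF this] show ?thesis
      by (simp add: m_def if_distrib[of Re] cong: if_cong)
  qed
  have "((\<lambda>\<sigma>. 3 * ((\<sigma> - 1) * Re (M 0 \<sigma>)) + 4 * ((\<sigma> - 1) * Re (M 1 \<sigma>)) + (\<sigma> - 1) * Re (M 2 \<sigma>))
     \<longlongrightarrow> 3 * ((if (0::nat) = 0 then 1 else 0) - m 0) + 4 * ((if (1::nat) = 0 then 1 else 0) - m 1) + ((if (2::nat) = 0 then 1 else 0) - m 2)) (at_right 1)"
    by (intro tendsto_add tendsto_mult_left lim)
  moreover have "\<forall>\<^sub>F \<sigma> in at_right 1. 0 \<le> 3 * ((\<sigma> - 1) * Re (M 0 \<sigma>)) + 4 * ((\<sigma> - 1) * Re (M 1 \<sigma>)) + (\<sigma> - 1) * Re (M 2 \<sigma>)"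
    using eventually_at_right_less[of "1::real"]
  proof eventually_elim
    case (elim \<sigma>)
    have sums: "(\<lambda>n. mangoldt (Suc n) * real (Suc n) powr (-\<sigma>) * cos (real k * (t * ln (Suc n)))) sums Re (M k \<sigma>)" for k
    proof -
      have "Re (mangoldt (Suc n) / of_nat (Suc n) powr (of_real \<sigma> + \<i> * of_real (real k * t))) =
         mangoldt (Suc n) * real (Suc n) powr (-\<sigma>) * cos (real k * (t * ln (Suc n)))" for n
      proof -
        have "1 / of_nat (Suc n) powr (of_real \<sigma> + \<i> * of_real (real k * t)) = exp (of_real (-\<sigma> * ln (Suc n)) + \<i> * complex_of_real (- real k * t * ln (Suc n)))"
          by (simp add: powr_def Ln_of_nat exp_minus[symmetric] divide_inverse algebra_simps del: of_nat_Suc)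
        also have "Re \<dots> = real (Suc n) powr (-\<sigma>) * cos (real k * (t * ln (Suc n)))"
          by (simp add: Re_exp powr_def mult_ac)
        finally have "Re (1 / of_nat (Suc n) powr (of_real \<sigma> + \<i> * of_real (real k * t))) = real (Suc n) powr (-\<sigma>) * cos (real k * (t * ln (Suc n)))" .
        moreover have "Re (mangoldt (Suc n) * z) = mangoldt (Suc n) * Re z" for z :: complex by simp
        ultimately show ?thesis by (metis mult.assoc mult.right_neutral times_divide_eq_right)
      qed
      with sums_Re[OF mangoldt_series_sums[of "of_real \<sigma> + \<i> * of_real (real k * t)"]] elim
      show ?thesis by (simp add: M_def)
    qed
    have S: "(\<lambda>n. 3 * (mangoldt (Suc n) * real (Suc n) powr (-\<sigma>) * cos (real 0 * (t * ln (Suc n))))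
             + 4 * (mangoldt (Suc n) * real (Suc n) powr (-\<sigma>) * cos (real 1 * (t * ln (Suc n))))
             + mangoldt (Suc n) * real (Suc n) powr (-\<sigma>) * cos (real 2 * (t * ln (Suc n)))) sums
        (3 * Re (M 0 \<sigma>) + 4 * Re (M 1 \<sigma>) + Re (M 2 \<sigma>))"
      by (intro sums_add sums_mult sums)
    have P: "0 \<le> 3 * (mangoldt (Suc n) * real (Suc n) powr (-\<sigma>) * cos (real 0 * (t * ln (Suc n))))
             + 4 * (mangoldt (Suc n) * real (Suc n) powr (-\<sigma>) * cos (real 1 * (t * ln (Suc n))))
             + mangoldt (Suc n) * real (Suc n) powr (-\<sigma>) * cos (real 2 * (t * ln (Suc n)))" for n
    proof -
      define c where "c = cos (t * ln (Suc n))"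
      have "0 \<le> mangoldt (Suc n) * real (Suc n) powr (-\<sigma>) * (2 * (1 + c)\<^sup>2)"
        by (intro mult_nonneg_nonneg mangoldt_nonneg) auto
      also have "cos (2 * (t * ln (Suc n))) = 2 * c\<^sup>2 - 1" unfolding c_def by (rule cos_double_cos)
      hence "2 * (1 + c)\<^sup>2 = 3 + 4 * c + cos (2 * (t * ln (Suc n)))"
        by (simp add: power2_eq_square algebra_simps)
      finally show ?thesis by (simp add: c_def algebra_simps)
    qed
    have "0 \<le> 3 * Re (M 0 \<sigma>) + 4 * Re (M 1 \<sigma>) + Re (M 2 \<sigma>)"
      by (rule sums_le[OF P sums_zero S])
    hence "0 \<le> (\<sigma> - 1) * (3 * Re (M 0 \<sigma>) + 4 * Re (M 1 \<sigma>) + Re (M 2 \<sigma>))" using elim by simp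
    thus ?case by (simp add: algebra_simps)
  qed
  \<comment> \<open>In the limit \<open>0 <= 3 - 4 * m 1 - m 2\<close>, where \<open>m 0 = 0\<close>
    was used; the assumed zero gives \<open>m 1 >= 1\<close>.\<close>
  ultimately have "0 \<le> 3 * ((if (0::nat) = 0 then 1 else 0) - m 0) + 4 * ((if (1::nat) = 0 then 1 else 0) - m 1) + ((if (2::nat) = 0 then 1 else 0) - m 2)"
    by (rule tendsto_lowerbound) simp
  moreover have "m 0 = 0" using zorder_zeta_entire_pos_iff[of 1] zorder_zeta_entire_nonneg[of 1] by (simp add: m_def)
  moreover have "m 1 \<ge> 1" using zorder_zeta_entire_pos_iff[of "1 + \<i> * of_real t"] z by (simp add: m_def)
  moreover have "m 2 \<ge> 0" using zorder_zeta_entire_nonneg by (simp add: m_def)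
  ultimately show False by simp
qed

lemma zeta_entire_nonzero:
  assumes "Re s \<ge> 1" shows "zeta_entire s \<noteq> 0"
proof (cases "Re s = 1")
  case True
  hence "s = 1 + \<i> * of_real (Im s)" by (simp add: complex_eq_iff)
  thus ?thesis using zeta_entire_nonzero_line_1 by metis
qed (use assms logderiv_zeta_entire(1) in simp)

section \<open>Zeros of entire functions in discs\<close>

text \<open>The map \<open>w / (2 M - w)\<close> sends the half-plane Re w < M into the unit disc
  and fixes 0. Composed with \<open>L\<close> and rescaled it satisfies the hypotheses of the
  Schwarz lemma, and solving back for \<open>L z\<close> gives the bound.\<close>

lemma borel_caratheodory:
  assumes L: "L holomorphic_on ball z0 R" "L z0 = 0" and R: "R > 0"
    and le: "\<And>z. z \<in> ball z0 R \<Longrightarrow> Re (L z) < M"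
    and z: "norm (z - z0) \<le> r" and r: "0 \<le> r" "r < R"
  shows "norm (L z) \<le> 2 * M * r / (R - r)"
proof -
  have M: "M > 0" using le[of z0] R L by simp
  define p where "p = (\<lambda>w. L (z0 + of_real R * w) / (2 * of_real M - L (z0 + of_real R * w)))"
  have inb: "z0 + of_real R * w \<in> ball z0 R" if "norm w < 1" for w
    using that R by (simp add: dist_norm norm_mult)
  have den: "2 * of_real M - L (z0 + of_real R * w) \<noteq> 0" if "norm w < 1" for w
    using le[OF inb[OF that]] M by (auto simp: complex_eq_iff)
  have hol: "(\<lambda>w. L (z0 + of_real R * w)) holomorphic_on ball 0 1"
  proof -
    have "(\<lambda>w. z0 + of_real R * w) holomorphic_on ball 0 1" by (intro holomorphic_intros)
    moreover have "(\<lambda>w. z0 + of_real R * w) ` ball 0 1 \<subseteq> ball z0 R" using inb by auto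
    ultimately show ?thesis using holomorphic_on_compose_gen[OF _ L(1)] by (fastforce simp: o_def)
  qed
  have "p holomorphic_on ball 0 1" unfolding p_def
    by (intro holomorphic_intros hol) (use den in auto)
  moreover have "p 0 = 0" using L by (simp add: p_def)
  moreover have "norm (p w) < 1" if "norm w < 1" for w
  proof -
    define x where "x = L (z0 + of_real R * w)"
    have x: "Re x < M" using le[OF inb[OF that]] by (simp add: x_def)
    have "(norm (2 * of_real M - x))\<^sup>2 - (norm x)\<^sup>2 = 4 * M * (M - Re x)"
      unfolding cmod_power2 by (simp add: power2_eq_square algebra_simps)
    moreover have "4 * M * (M - Re x) > 0" using x M by (intro mult_pos_pos) auto
    ultimately have "(norm x)\<^sup>2 < (norm (2 * of_real M - x))\<^sup>2" by linarith
    hence "norm x < norm (2 * of_real M - x)" by (rule power2_less_imp_less) simp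
    thus ?thesis unfolding p_def x_def[symmetric] norm_divide
      by (subst divide_less_eq_1_pos) (auto intro: le_less_trans[OF norm_ge_zero])
  qed
  moreover define w where "w = (z - z0) / of_real R"
  have w: "norm w \<le> r / R" using z R by (simp add: w_def norm_divide divide_right_mono)
  moreover have w1: "norm w < 1" using w r R by (simp add: order.strict_trans1)
  ultimately have pw: "norm (p w) \<le> norm w" using Schwarz_Lemma(1)[of p w] by blast
  have zw: "z0 + of_real R * w = z" using R by (simp add: w_def)
  have "p w * (2 * of_real M - L z) = L z" using den[OF w1] unfolding p_def zw by simp
  hence "L z = 2 * of_real M * p w - p w * L z" by (simp add: algebra_simps)
  hence "norm (L z) \<le> norm (2 * of_real M * p w) + norm (p w * L z)" by (metis norm_triangle_ineq4)
  also have "\<dots> = 2 * M * norm (p w) + norm (p w) * norm (L z)" using M by (simp add: norm_mult)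
  also have "\<dots> \<le> 2 * M * (r / R) + (r / R) * norm (L z)"
    using pw w M by (intro add_mono mult_left_mono mult_right_mono) auto
  finally have "norm (L z) * (R - r) \<le> 2 * M * r" using R by (simp add: field_simps)
  thus ?thesis using r by (simp add: field_simps)
qed

text \<open>Cauchy's inequality on a circle about \<open>z\<close> whose radius is half the gap
  \<open>R - r\<close>.\<close>

lemma borel_caratheodory_deriv:
  assumes L: "L holomorphic_on ball z0 R" "L z0 = 0"
    and le: "\<And>z. z \<in> ball z0 R \<Longrightarrow> Re (L z) < M"
    and z: "norm (z - z0) \<le> r" and r: "0 \<le> r" "r < R"
  shows "norm (deriv L z) \<le> 8 * M * R / (R - r) ^ 2"
proof -
  define d where "d = (R - r) / 2"
  have d: "d > 0" "r + d < R" using r by (auto simp: d_def field_simps)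
  have R: "R > 0" using r by linarith
  have M: "M > 0" using le[of z0] R L by simp
  have sub: "cball z d \<subseteq> ball z0 R"
  proof
    fix w assume "w \<in> cball z d"
    hence "norm (w - z0) \<le> d + r" using z norm_triangle_ineq[of "w - z" "z - z0"] by (simp add: dist_norm norm_minus_commute)
    thus "w \<in> ball z0 R" using d by (simp add: dist_norm norm_minus_commute)
  qed
  have "norm ((deriv ^^ 1) L z) \<le> fact 1 * (2 * M * (r + d) / (R - (r + d))) / d ^ 1"
  proof (rule Cauchy_inequality)
    show "L holomorphic_on ball z d" using L(1) sub by (meson ball_subset_cball holomorphic_on_subset)
    show "continuous_on (cball z d) L" using L(1) sub holomorphic_on_imp_continuous_on holomorphic_on_subset by blast
    fix x assume "norm (z - x) = d"
    hence "norm (x - z0) \<le> r + d" using z norm_triangle_ineq[of "x - z" "z - z0"] by (simp add: norm_minus_commute)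
    thus "norm (L x) \<le> 2 * M * (r + d) / (R - (r + d))"
      by (intro borel_caratheodory[OF L R le]) (use d r in auto)
  qed (use d in auto)
  also have "fact 1 * (2 * M * (r + d) / (R - (r + d))) / d ^ 1 = 2 * M * (r + d) / d ^ 2"
  proof -
    have "R - (r + d) = d" by (simp add: d_def field_simps)
    thus ?thesis by (simp add: power2_eq_square)
  qed
  also have "\<dots> \<le> 2 * M * R / d ^ 2" using d M r by (intro divide_right_mono mult_left_mono) auto
  also have "\<dots> = 8 * M * R / (R - r) ^ 2" using d r by (simp add: d_def field_simps power2_eq_square)
  finally show ?thesis by simp
qed

text \<open>The zeros are divided out one at a time. A quotient that vanished at some
  \<open>a\<close> would contradict the local factorisation at \<open>a\<close>, whose cofactor is
  nonzero there.\<close>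

lemma holomorphic_factor_zeros:
  assumes f: "f holomorphic_on UNIV" "\<exists>w. f w \<noteq> (0::complex)" and A: "finite A"
  obtains k where "k holomorphic_on UNIV" "\<And>z. f z = (\<Prod>a\<in>A. (z - a) ^ nat (zorder f a)) * k z"
    "\<And>a. a \<in> A \<Longrightarrow> k a \<noteq> 0"
proof -
  have fr: "\<exists>r>0. \<exists>g. g holomorphic_on ball a r \<and> g a \<noteq> 0 \<and> (\<forall>w\<in>ball a r. f w = (w - a) ^ nat (zorder f a) * g w)" for a
  proof -
    have "\<exists>r. r>0 \<and> cball a r \<subseteq> UNIV \<and> zor_poly f a holomorphic_on cball a r
      \<and> (\<forall>w\<in>cball a r. f w = zor_poly f a w * (w-a) ^ nat (zorder f a)  \<and> zor_poly f a w \<noteq> 0)"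
      using zorder_exist_zero[of f UNIV a] f by auto
    then obtain r where "r > 0" "zor_poly f a holomorphic_on cball a r"
      "\<forall>w\<in>cball a r. f w = zor_poly f a w * (w-a) ^ nat (zorder f a)  \<and> zor_poly f a w \<noteq> 0" by blast
    thus ?thesis
      by (intro exI[of _ r] conjI exI[of _ "zor_poly f a"]) (auto intro: holomorphic_on_subset)
  qed
  define P where "P = (\<lambda>z. \<Prod>a\<in>A. (z - a) ^ nat (zorder f a))"
  have "\<exists>k. k holomorphic_on UNIV \<and> (\<forall>z. f z = (\<Prod>a\<in>A. (z - a) ^ nat (zorder f a)) * k z)" using A
  proof (induction A rule: finite_induct)
    case empty
    thus ?case using f by (intro exI[of _ f]) auto
  next
    case (insert b B)
    then obtain k where k: "k holomorphic_on UNIV" "\<And>z. f z = (\<Prod>a\<in>B. (z - a) ^ nat (zorder f a)) * k z" by blast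
    define Q where "Q = (\<lambda>z. \<Prod>a\<in>B. (z - a) ^ nat (zorder f a))"
    have Qb: "Q b \<noteq> 0" using insert by (auto simp: Q_def)
    have hQ: "Q holomorphic_on UNIV" unfolding Q_def by (intro holomorphic_intros)
    obtain r g where r: "r > 0" "g holomorphic_on ball b r" "\<And>w. w \<in> ball b r \<Longrightarrow> f w = (w - b) ^ nat (zorder f b) * g w"
      using fr[of b] by blast
    obtain r' where r': "r' > 0" "r' \<le> r" "\<And>w. w \<in> ball b r' \<Longrightarrow> Q w \<noteq> 0"
    proof -
      have "open {w. Q w \<noteq> 0}" using hQ
        by (auto intro!: open_Collect_neq holomorphic_on_imp_continuous_on)
      then obtain e where "e > 0" "ball b e \<subseteq> {w. Q w \<noteq> 0}" using Qb openE[of "{w. Q w \<noteq> 0}" b] by blast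
      thus ?thesis using r(1) by (intro that[of "min e r"]) auto
    qed
    define n where "n = nat (zorder f b)"
    \<comment> \<open>Near \<open>b\<close> the quotient is taken from the local factorisation of
      \<open>f\<close>, on a disc so small that the earlier factors \<open>Q\<close> have no zero;
      elsewhere \<open>k\<close> is divided directly. On the overlap both agree.\<close>
    define k' where "k' = (\<lambda>w. if w \<in> ball b r' then g w / Q w else k w / (w - b) ^ n)"
    have eq: "g w / Q w = k w / (w - b) ^ n" if "w \<in> ball b r' - {b}" for w
    proof -
      have "f w = (w - b) ^ n * g w" "f w = Q w * k w" using r(3)[of w] r' that k(2)[of w] by (auto simp: n_def Q_def)
      thus ?thesis using r'(3)[of w] that by (simp add: field_simps)
    qed
    have hk': "k' holomorphic_on (ball b r' \<union> (- {b}))"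
    proof (rule holomorphic_on_Un)
      show "k' holomorphic_on ball b r'"
      proof (rule holomorphic_transform)
        show "(\<lambda>w. g w / Q w) holomorphic_on ball b r'"
          by (intro holomorphic_intros holomorphic_on_subset[OF r(2)] holomorphic_on_subset[OF hQ]) (use r' in auto)
      qed (auto simp: k'_def)
      show "k' holomorphic_on - {b}"
      proof (rule holomorphic_transform)
        show "(\<lambda>w. k w / (w - b) ^ n) holomorphic_on - {b}"
          by (intro holomorphic_intros holomorphic_on_subset[OF k(1)]) auto
      qed (use eq in \<open>auto simp: k'_def\<close>)
    qed auto
    have un: "ball b r' \<union> (- {b}) = UNIV" using r' by auto
    have ff: "f z = (z - b) ^ n * Q z * k' z" for z
    proof (cases "z \<in> ball b r'")
      case True
      thus ?thesis using r(3)[of z] r' by (auto simp: k'_def n_def)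
    next
      case False
      hence "z \<noteq> b" using r' by auto
      thus ?thesis using False k(2)[of z] by (auto simp: k'_def Q_def)
    qed
    have pr: "(\<Prod>a\<in>insert b B. (z - a) ^ nat (zorder f a)) = (z - b) ^ n * Q z" for z
      unfolding Q_def n_def by (rule prod.insert) (use insert in auto)
    show ?case
    proof (intro exI[of _ k'] conjI allI)
      show "k' holomorphic_on UNIV" using hk' unfolding un .
      show "f z = (\<Prod>a\<in>insert b B. (z - a) ^ nat (zorder f a)) * k' z" for z
        unfolding pr by (rule ff)
    qed
  qed
  then obtain k where k: "k holomorphic_on UNIV" "\<And>z. f z = (\<Prod>a\<in>A. (z - a) ^ nat (zorder f a)) * k z" by blast
  have "k a \<noteq> 0" if "a \<in> A" for a
  proof
    assume ka: "k a = 0"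
    define n where "n = nat (zorder f a)"
    define Q where "Q = (\<lambda>z. \<Prod>a\<in>A-{a}. (z - a) ^ nat (zorder f a))"
    obtain r g where r: "r > 0" "g holomorphic_on ball a r" "g a \<noteq> 0" "\<And>w. w \<in> ball a r \<Longrightarrow> f w = (w - a) ^ n * g w"
      using fr[of a] unfolding n_def by blast
    have "f w = (w - a) ^ n * Q w * k w" for w
      using k(2)[of w] A that by (simp add: Q_def n_def prod.remove)
    hence e: "g w = Q w * k w" if "w \<in> ball a r - {a}" for w
      using r(4)[of w] that by auto
    have "isCont g a"
      using r by (metis centre_in_ball continuous_on_interior holomorphic_on_imp_continuous_on interior_open open_ball)
    hence "(g \<longlongrightarrow> g a) (at a)" by (simp add: isCont_def)
    moreover have "isCont (\<lambda>w. Q w * k w) a"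
    proof -
      have "(\<lambda>w. Q w * k w) holomorphic_on UNIV" unfolding Q_def by (intro holomorphic_intros k)
      thus ?thesis by (metis UNIV_I continuous_on_eq_continuous_at holomorphic_on_imp_continuous_on open_UNIV)
    qed
    hence "((\<lambda>w. Q w * k w) \<longlongrightarrow> Q a * k a) (at a)" by (simp add: isCont_def)
    hence "(g \<longlongrightarrow> Q a * k a) (at a)"
      by (rule Lim_transform_within_open[of _ _ _ UNIV "ball a r"]) (use r e in auto)
    ultimately have "g a = Q a * k a" using tendsto_unique trivial_limit_at by blast
    thus False using ka r(3) by simp
  qed
  with k show ?thesis using that by blast
qed

lemma deriv_prod_power:
  fixes n :: "complex \<Rightarrow> nat"
  assumes "finite A" "z \<notin> A"
  shows "((\<lambda>z. \<Prod>a\<in>A. (z - a) ^ n a) has_field_derivative (\<Prod>a\<in>A. (z - a) ^ n a) * (\<Sum>a\<in>A. of_nat (n a) / (z - a))) (at z)"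
  using assms
proof (induction A rule: finite_induct)
  case (insert b B)
  have "((\<lambda>z. (z - b) ^ n b) has_field_derivative of_nat (n b) * (z - b) ^ (n b - 1)) (at z)"
    by (auto intro!: derivative_eq_intros)
  also have "of_nat (n b) * (z - b) ^ (n b - 1) = (z - b) ^ n b * (of_nat (n b) / (z - b))"
    using insert.prems by (cases "n b") auto
  finally have 1: "((\<lambda>z. (z - b) ^ n b) has_field_derivative (z - b) ^ n b * (of_nat (n b) / (z - b))) (at z)" .
  from DERIV_mult[OF 1 insert.IH] insert show ?case by (simp add: algebra_simps)
qed auto

text \<open>
  With the zeros of the inner disc divided out, the maximum principle on the circle of three times
  the radius bounds both the number of zeros and the real part of the logarithm of the quotient.
\<close>
lemma local_zeros_and_logderiv:
  assumes f: "f holomorphic_on UNIV" and f0: "f z0 \<noteq> (0::complex)"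
    and R: "0 \<le> r" "r < R"
    and bd: "\<And>z. z \<in> cball z0 (3 * R) \<Longrightarrow> norm (f z) \<le> exp M * norm (f z0)"
  defines "A \<equiv> {z \<in> cball z0 R. f z = 0}"
  shows "finite A" "(\<Sum>a\<in>A. real_of_int (zorder f a)) \<le> 2 * M"
    "\<And>z. norm (z - z0) \<le> r \<Longrightarrow> f z \<noteq> 0 \<Longrightarrow>
       norm (deriv f z / f z - (\<Sum>a\<in>A. of_int (zorder f a) / (z - a))) \<le> 8 * (M + 1) * R / (R - r) ^ 2"
proof -
  have nontriv: "\<exists>w. f w \<noteq> 0" using f0 by blast
  have nc: "\<not> f constant_on UNIV" if "A \<noteq> {}"
  proof
    assume "f constant_on UNIV"
    then obtain c where c: "\<And>x. f x = c" by (auto simp: constant_on_def)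
    from that obtain a where "f a = 0" by (auto simp: A_def)
    thus False using f0 c by metis
  qed
  show fin: "finite A"
  proof (cases "A = {}")
    case False
    have "finite {z \<in> cball z0 R. f z = 0}"
      by (rule holomorphic_compact_finite_zeros[OF f open_UNIV connected_UNIV]) (use nc[OF False] in auto)
    thus ?thesis by (simp add: A_def)
  qed auto
  have R0: "R > 0" using R by linarith
  define n where "n = (\<lambda>a. nat (zorder f a))"
  have ana: "f analytic_on {a}" for a using f by (metis UNIV_I analytic_at open_UNIV)
  have fq: "frequently (\<lambda>w. f w \<noteq> 0) (at a)" for a
  proof (rule eventually_frequently)
    from non_zero_neighbour_alt[OF f open_UNIV connected_UNIV UNIV_I UNIV_I f0, of a]
    show "\<forall>\<^sub>F w in at a. f w \<noteq> 0" by (rule eventually_mono) auto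
  qed simp
  have zo: "zorder f a = int (n a)" for a
    using zorder_ge_0[OF ana fq, of a] by (simp add: n_def)
  obtain k where k: "k holomorphic_on UNIV" "\<And>z. f z = (\<Prod>a\<in>A. (z - a) ^ n a) * k z" "\<And>a. a \<in> A \<Longrightarrow> k a \<noteq> 0"
    using holomorphic_factor_zeros[OF f nontriv fin] unfolding n_def by blast
  define N where "N = (\<Sum>a\<in>A. n a)"
  have knz: "k z \<noteq> 0" if "z \<in> cball z0 R" for z
  proof (cases "z \<in> A")
    case False
    hence "f z \<noteq> 0" using that by (auto simp: A_def)
    thus ?thesis using k(2)[of z] by auto
  qed (use k in auto)
  have k0: "norm (f z0) \<le> R ^ N * norm (k z0)"
  proof -
    have "norm (\<Prod>a\<in>A. (z0 - a) ^ n a) \<le> (\<Prod>a\<in>A. R ^ n a)"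
      unfolding prod_norm[symmetric]
      by (intro prod_mono) (auto simp: norm_power A_def dist_norm intro!: power_mono)
    also have "\<dots> = R ^ N" by (simp add: N_def power_sum)
    finally show ?thesis unfolding k(2)[of z0] norm_mult by (intro mult_right_mono) auto
  qed
  \<comment> \<open>On the circle of radius \<open>3 * R\<close> every divided zero is at distance
    at least \<open>2 * R\<close>, so the product of the linear factors is at least
    \<open>(2 * R) ^ N\<close> there.\<close>
  have kb: "norm (k z) \<le> exp M * norm (f z0) / (2 * R) ^ N" if "z \<in> cball z0 (3 * R)" for z
  proof (rule maximum_modulus_frontier[of k "cball z0 (3 * R)"])
    show "k holomorphic_on interior (cball z0 (3 * R))" by (rule holomorphic_on_subset[OF k(1)]) auto
    show "continuous_on (closure (cball z0 (3 * R))) k"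
      by (rule holomorphic_on_imp_continuous_on, rule holomorphic_on_subset[OF k(1)]) auto
    fix w assume "w \<in> frontier (cball z0 (3 * R))"
    hence w: "norm (w - z0) = 3 * R" using R0 by (simp add: dist_norm norm_minus_commute sphere_def)
    have "(2 * R) ^ N = (\<Prod>a\<in>A. (2 * R) ^ n a)" by (simp add: N_def power_sum)
    also have "\<dots> \<le> norm (\<Prod>a\<in>A. (w - a) ^ n a)"
      unfolding prod_norm[symmetric]
    proof (intro prod_mono conjI)
      fix a assume "a \<in> A"
      hence "norm (z0 - a) \<le> R" by (auto simp: A_def dist_norm)
      hence "2 * R \<le> norm (w - a)" using w norm_triangle_ineq4[of "w - a" "z0 - a"] by simp
      thus "(2 * R) ^ n a \<le> norm ((w - a) ^ n a)" unfolding norm_power using R0 by (intro power_mono) auto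
    qed (use R0 in auto)
    finally have "(2 * R) ^ N * norm (k w) \<le> norm (f w)"
      unfolding k(2)[of w] norm_mult by (intro mult_right_mono) auto
    also have "\<dots> \<le> exp M * norm (f z0)" by (rule bd) (use w in \<open>simp add: dist_norm norm_minus_commute\<close>)
    finally show "norm (k w) \<le> exp M * norm (f z0) / (2 * R) ^ N" using R0 by (simp add: field_simps)
  qed (use that in auto)
  \<comment> \<open>At the centre the linear factors are at most \<open>R ^ N\<close>. The surplus
    \<open>2 ^ N\<close> is what bounds the number of zeros: at the centre itself it gives
    \<open>2 ^ N <= exp M\<close>.\<close>
  have kk: "2 ^ N * norm (k z) \<le> exp M * norm (k z0)" if "z \<in> cball z0 (3 * R)" for z
  proof -
    have "(2 * R) ^ N * norm (k z) \<le> exp M * norm (f z0)" using kb[OF that] R0 by (simp add: field_simps)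
    also have "\<dots> \<le> exp M * (R ^ N * norm (k z0))" by (intro mult_left_mono k0) auto
    finally show ?thesis using R0 by (simp add: power_mult_distrib field_simps)
  qed
  have "2 ^ N * norm (k z0) \<le> exp M * norm (k z0)" by (rule kk) (use R0 in auto)
  hence N2: "2 ^ N \<le> exp M" using knz[of z0] R0 by simp
  hence "real N * ln 2 \<le> M" using ln_le_cancel_iff[of "2 ^ N" "exp M"] by (simp add: ln_realpow)
  moreover have "real N * (1/2) \<le> real N * ln 2"
  proof (rule mult_left_mono)
    have "ln (1/2::real) \<le> 1/2 - 1" by (rule ln_le_minus_one) simp
    thus "1/2 \<le> ln (2::real)" by (simp add: ln_div)
  qed simp
  ultimately have "real N \<le> 2 * M" by simp
  moreover have "(\<Sum>a\<in>A. real_of_int (zorder f a)) = real N" by (simp add: zo N_def)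
  ultimately show "(\<Sum>a\<in>A. real_of_int (zorder f a)) \<le> 2 * M" by simp
  have kr: "norm (k z) \<le> exp M * norm (k z0)" if "z \<in> cball z0 (3 * R)" for z
  proof -
    have "1 * norm (k z) \<le> 2 ^ N * norm (k z)" by (intro mult_right_mono) auto
    thus ?thesis using kk[OF that] by linarith
  qed
  have M0: "M \<ge> 0"
  proof -
    have "(1::real) \<le> 2 ^ N" by simp
    with N2 have "1 \<le> exp M" by linarith
    thus ?thesis by simp
  qed
  fix z assume z: "norm (z - z0) \<le> r" "f z \<noteq> 0"
  have zR: "z \<in> ball z0 R" using z R by (simp add: dist_norm norm_minus_commute)
  have hk: "k holomorphic_on ball z0 R" by (rule holomorphic_on_subset[OF k(1)]) auto
  have knz': "k z \<noteq> 0" if "z \<in> ball z0 R" for z using knz that by auto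
  obtain L0 where L0: "L0 holomorphic_on ball z0 R" "\<And>z. z \<in> ball z0 R \<Longrightarrow> exp (L0 z) = k z"
    using holomorphic_logarithm_exists[OF convex_ball open_ball hk knz', of z0] R0 by auto
  \<comment> \<open>Normalised to vanish at the centre, as Borel-Caratheodory requires. That lemma
    also asks for a strict bound on the real part, hence \<open>M + 1\<close> below.\<close>
  define L where "L = (\<lambda>z. L0 z - L0 z0)"
  have L: "L holomorphic_on ball z0 R" unfolding L_def by (intro holomorphic_intros L0)
  have eL: "k w = k z0 * exp (L w)" if "w \<in> ball z0 R" for w
    using L0(2)[OF that] L0(2)[of z0] R0 knz[of z0] by (simp add: L_def exp_diff)
  have "norm (deriv L z) \<le> 8 * (M + 1) * R / (R - r) ^ 2"
  proof (rule borel_caratheodory_deriv[OF L])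
    fix w assume w: "w \<in> ball z0 R"
    have "norm (k z0) * exp (Re (L w)) = norm (k w)" using eL[OF w] by (simp add: norm_mult)
    also have "\<dots> \<le> exp M * norm (k z0)" by (rule kr) (use w R0 in auto)
    finally have "exp (Re (L w)) \<le> exp M" using knz[of z0] R0 by simp
    thus "Re (L w) < M + 1" by simp
  qed (use z R in \<open>auto simp: L_def\<close>)
  moreover have "deriv f z / f z - (\<Sum>a\<in>A. of_int (zorder f a) / (z - a)) = deriv L z"
  proof -
    have zA: "z \<notin> A" using z by (auto simp: A_def)
    have "((\<lambda>w. k z0 * exp (L w)) has_field_derivative k z0 * (exp (L z) * deriv L z)) (at z)"
      by (intro DERIV_cmult DERIV_chain2[OF DERIV_exp] holomorphic_derivI[OF L open_ball zR])
    hence "(k has_field_derivative k z0 * (exp (L z) * deriv L z)) (at z)"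
      by (rule has_field_derivative_transform_within_open[of _ _ _ "ball z0 R"]) (use eL zR in auto)
    hence "(k has_field_derivative k z * deriv L z) (at z)" using eL[OF zR] by (simp add: mult_ac)
    note D = DERIV_mult[OF deriv_prod_power[OF fin zA, of n] this]
    have fe: "f = (\<lambda>z. (\<Prod>a\<in>A. (z - a) ^ n a) * k z)" by (rule ext) (rule k(2))
    have "f z * ((\<Sum>a\<in>A. of_nat (n a) / (z - a)) + deriv L z) =
       (\<Prod>a\<in>A. (z - a) ^ n a) * (\<Sum>a\<in>A. of_nat (n a) / (z - a)) * k z + k z * deriv L z * (\<Prod>a\<in>A. (z - a) ^ n a)"
      unfolding k(2)[of z] by (simp add: algebra_simps)
    hence "(f has_field_derivative f z * ((\<Sum>a\<in>A. of_nat (n a) / (z - a)) + deriv L z)) (at z)"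
      using D unfolding fe[symmetric] by simp
    from DERIV_imp_deriv[OF this] show ?thesis using z(2) by (simp add: zo)
  qed
  ultimately show "norm (deriv f z / f z - (\<Sum>a\<in>A. of_int (zorder f a) / (z - a))) \<le> 8 * (M + 1) * R / (R - r) ^ 2"
    by simp
qed

section \<open>Zeros of zeta in a strip\<close>

text \<open>A logarithm bounded below by 1/2 at every height, so that bounded terms can always be
  absorbed into it.\<close>

definition lg :: "real \<Rightarrow> real" where "lg t = ln (\<bar>t\<bar> + 2)"

lemma ln_2_ge_half: "ln (2::real) \<ge> 1/2"
proof -
  have "ln (1/2::real) \<le> 1/2 - 1" by (rule ln_le_minus_one) simp
  thus ?thesis by (simp add: ln_div)
qed

lemma lg_ge: "lg t \<ge> 1/2"
proof -
  have "ln 2 \<le> lg t" unfolding lg_def by (intro ln_mono) auto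
  thus ?thesis using ln_2_ge_half by linarith
qed

lemma lg_pos: "lg t > 0" using lg_ge[of t] by linarith

lemma lg_mono: "\<bar>s\<bar> \<le> \<bar>t\<bar> \<Longrightarrow> lg s \<le> lg t"
  unfolding lg_def by (intro ln_mono) auto

text \<open>Separates the shift \<open>j\<close> at the price of a power 1/4; weights of order -3/2
  in \<open>j\<close> remain summable after this loss.\<close>

lemma lg_add_le: "lg (t + of_int j) \<le> 9 * lg t * (1 + \<bar>of_int j\<bar>) powr (1/4)"
proof -
  have "lg (t + of_int j) \<le> ln ((\<bar>t\<bar> + 2) * (1 + \<bar>of_int j\<bar>))" unfolding lg_def
  proof (intro ln_mono)
    have "0 \<le> \<bar>t\<bar> * \<bar>real_of_int j\<bar>" by simp
    moreover have "\<bar>t + real_of_int j\<bar> \<le> \<bar>t\<bar> + \<bar>real_of_int j\<bar>" by (rule abs_triangle_ineq)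
    moreover have "(\<bar>t\<bar> + 2) * (1 + \<bar>real_of_int j\<bar>) = \<bar>t\<bar> * \<bar>real_of_int j\<bar> + \<bar>t\<bar> + 2 + 2 * \<bar>real_of_int j\<bar>"
      by (simp add: algebra_simps)
    ultimately show "\<bar>t + of_int j\<bar> + 2 \<le> (\<bar>t\<bar> + 2) * (1 + \<bar>of_int j\<bar>)" by linarith
  qed auto
  also have "\<dots> = lg t + ln (1 + \<bar>of_int j\<bar>)" unfolding lg_def by (rule ln_mult_pos) auto
  also have "ln (1 + \<bar>real_of_int j\<bar>) \<le> (1 + \<bar>of_int j\<bar>) powr (1/4) / (1/4)" by (rule ln_powr_bound) auto
  also have "lg t + (1 + \<bar>real_of_int j\<bar>) powr (1/4) / (1/4) \<le> lg t * (1 + \<bar>of_int j\<bar>) powr (1/4) + 8 * lg t * (1 + \<bar>of_int j\<bar>) powr (1/4)"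
  proof (rule add_mono)
    have "lg t * 1 \<le> lg t * (1 + \<bar>of_int j\<bar>) powr (1/4)"
      using lg_pos[of t] by (intro mult_left_mono ge_one_powr_ge_zero) auto
    thus "lg t \<le> lg t * (1 + \<bar>of_int j\<bar>) powr (1/4)" by simp
    have "4 * (1 + \<bar>real_of_int j\<bar>) powr (1/4) \<le> (8 * lg t) * (1 + \<bar>real_of_int j\<bar>) powr (1/4)"
      using lg_ge[of t] by (intro mult_right_mono) auto
    thus "(1 + \<bar>real_of_int j\<bar>) powr (1/4) / (1/4) \<le> 8 * lg t * (1 + \<bar>of_int j\<bar>) powr (1/4)" by simp
  qed
  finally show ?thesis by simp
qed

text \<open>
  The bound \<open>-7/8\<close> leaves room to move contours to the line \<open>Re s = -3/4\<close>. Zeros with nonpositive real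
  part are kept, since their contribution to the theorem is only \<open>O(N)\<close>.
\<close>
definition zeros :: "complex set" where
  "zeros = {\<rho>. zeta_entire \<rho> = 0 \<and> Re \<rho> > -7/8}"

definition zmult :: "complex \<Rightarrow> real" where
  "zmult \<rho> = real_of_int (zorder zeta_entire \<rho>)"

lemma zmult_nonneg: "zmult \<rho> \<ge> 0"
  using zorder_zeta_entire_nonneg by (simp add: zmult_def)

lemma zeros_Re: "\<rho> \<in> zeros \<Longrightarrow> Re \<rho> < 1 \<and> Re \<rho> > -7/8"
  using zeta_entire_nonzero[of \<rho>] by (force simp: zeros_def)

text \<open>The radius is fixed by two demands. A zero with real part in (-7/8, 1) and height within
  1 of \<open>t\<close> lies at distance at most \<open>sqrt ((23/8)^2 + 1) < 16/5\<close> from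
  \<open>2 + i t\<close>; and 16/5 exceeds 11/4, the distance from \<open>2 + i t\<close> to the
  line Re s = -3/4. The disc may also contain zeros left of -7/8.\<close>

definition disc_zeros :: "real \<Rightarrow> complex set" where
  "disc_zeros t = {a \<in> cball (2 + \<i> * of_real t) (16/5). zeta_entire a = 0}"

text \<open>The disc estimates with \<open>R = 16/5\<close> and \<open>r = 11/4\<close>. The outer
  disc of radius 48/5 stays in Re s >= -8, where polynomial growth over the lower bound 1/4 at the
  centre is \<open>exp (O(lg t))\<close>.\<close>

lemma zeta_entire_local:
  obtains C where "C > 0" "\<And>t. finite (disc_zeros t)"
    "\<And>t. (\<Sum>a\<in>disc_zeros t. zmult a) \<le> C * lg t"
    "\<And>t z. norm (z - (2 + \<i> * of_real t)) \<le> 11/4 \<Longrightarrow> zeta_entire z \<noteq> 0 \<Longrightarrow>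
       norm (deriv zeta_entire z / zeta_entire z - (\<Sum>a\<in>disc_zeros t. of_real (zmult a) / (z - a))) \<le> C * lg t"
proof -
  obtain K A where K: "K \<ge> 0" "\<And>s B. Re s \<ge> -8 \<Longrightarrow> B \<ge> A \<Longrightarrow> norm (zeta_entire s) \<le> K * (1 + norm s) ^ B"
    using poly_boundedE[OF poly_bounded_zeta_entire[of "-8"]] by blast
  define B where "B = ln (4 * K * 7 ^ A + 1)"
  have B0: "B \<ge> 0" unfolding B_def using K by simp
  have eB: "exp B = 4 * K * 7 ^ A + 1" unfolding B_def using K by (intro exp_ln) (auto intro!: add_nonneg_pos)
  define M where "M = (\<lambda>t. B + real A * lg t)"
  \<comment> \<open>The factor 200 covers both the 2 of the zero count and
    \<open>8 * (16/5) / (16/5 - 11/4)^2\<close>, which is about 126.4.\<close>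
  define C where "C = 200 * (2 * B + real A + 2)"
  have C: "C > 0" using B0 by (simp add: C_def add_nonneg_pos)
  have Mle: "M t + 1 \<le> (2 * B + real A + 2) * lg t" for t
  proof -
    have "B * 1 \<le> B * (2 * lg t)" using lg_ge[of t] B0 by (intro mult_left_mono) auto
    thus ?thesis using lg_ge[of t] by (simp add: M_def algebra_simps)
  qed
  have bd: "norm (zeta_entire z) \<le> exp (M t) * norm (zeta_entire (2 + \<i> * of_real t))"
    if "z \<in> cball (2 + \<i> * of_real t) (3 * (16/5))" for z t
  proof -
    have n: "norm (z - (2 + \<i> * of_real t)) \<le> 48/5" using that by (simp add: dist_norm norm_minus_commute)
    have "Re z \<ge> -8" using complex_Re_le_cmod[of "(2 + \<i> * of_real t) - z"] n by (simp add: norm_minus_commute)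
    hence "norm (zeta_entire z) \<le> K * (1 + norm z) ^ A" by (intro K) auto
    also have "\<dots> \<le> K * (7 * (\<bar>t\<bar> + 2)) ^ A"
    proof (intro mult_left_mono power_mono K)
      have "norm z \<le> norm (z - (2 + \<i> * of_real t)) + norm (2 + \<i> * of_real t)"
        using norm_triangle_ineq[of "z - (2 + \<i> * of_real t)" "2 + \<i> * of_real t"] by simp
      also have "norm (2 + \<i> * of_real t) \<le> 2 + \<bar>t\<bar>"
        using norm_triangle_ineq[of 2 "\<i> * of_real t"] by (simp add: norm_mult)
      finally show "1 + norm z \<le> 7 * (\<bar>t\<bar> + 2)" using n by simp
    qed auto
    also have "\<dots> \<le> (exp B * (\<bar>t\<bar> + 2) ^ A) * (1/4)"
    proof -
      have "4 * K * 7 ^ A * (\<bar>t\<bar> + 2) ^ A \<le> exp B * (\<bar>t\<bar> + 2) ^ A"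
        unfolding eB by (intro mult_right_mono) auto
      moreover have "K * (7 * (\<bar>t\<bar> + 2)) ^ A = K * 7 ^ A * (\<bar>t\<bar> + 2) ^ A"
        by (simp only: power_mult_distrib mult.assoc)
      ultimately show ?thesis by linarith
    qed
    also have "exp B * (\<bar>t\<bar> + 2) ^ A = exp (M t)"
      by (simp add: M_def exp_add lg_def exp_of_nat_mult)
    also have "exp (M t) * (1/4) \<le> exp (M t) * norm (zeta_entire (2 + \<i> * of_real t))"
      by (intro mult_left_mono norm_zeta_entire_2_ge) auto
    finally show ?thesis .
  qed
  have nz: "zeta_entire (2 + \<i> * of_real t) \<noteq> 0" for t using norm_zeta_entire_2_ge[of t] by auto
  note L = local_zeros_and_logderiv[OF holomorphic_zeta_entire nz, of "11/4" "16/5" _ "M _", folded disc_zeros_def, OF _ _ bd]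
  show ?thesis
  proof (rule that[of C])
    show "C > 0" by fact
    fix t
    show "finite (disc_zeros t)" by (rule L(1)) auto
    have "(\<Sum>a\<in>disc_zeros t. zmult a) \<le> 2 * M t" unfolding zmult_def by (rule L(2)) auto
    also have "\<dots> \<le> C * lg t"
    proof -
      have "2 * ((2 * B + real A + 2) * lg t) \<le> 200 * ((2 * B + real A + 2) * lg t)"
        using B0 lg_pos[of t] by (intro mult_right_mono mult_nonneg_nonneg) auto
      with Mle[of t] show ?thesis unfolding C_def mult.assoc by linarith
    qed
    finally show "(\<Sum>a\<in>disc_zeros t. zmult a) \<le> C * lg t" .
    fix z assume z: "norm (z - (2 + \<i> * of_real t)) \<le> 11/4" "zeta_entire z \<noteq> 0"
    have "norm (deriv zeta_entire z / zeta_entire z - (\<Sum>a\<in>disc_zeros t. of_real (zmult a) / (z - a))) \<le> 8 * (M t + 1) * (16/5) / (16/5 - 11/4) ^ 2"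
      using L(3)[of t z] z unfolding zmult_def of_real_of_int_eq by auto
    also have "\<dots> \<le> 200 * (M t + 1)"
    proof -
      have "M t + 1 \<ge> 0" using B0 lg_pos[of t] by (simp add: M_def add_nonneg_nonneg)
      thus ?thesis by (simp add: power2_eq_square field_simps)
    qed
    also have "\<dots> \<le> C * lg t" using mult_left_mono[OF Mle[of t], of 200] by (simp only: C_def mult.assoc)
    finally show "norm (deriv zeta_entire z / zeta_entire z - (\<Sum>a\<in>disc_zeros t. of_real (zmult a) / (z - a))) \<le> C * lg t" .
  qed
qed

lemma zeros_in_disc_zeros:
  assumes "\<rho> \<in> zeros" "\<bar>Im \<rho> - t\<bar> \<le> 1"
  shows "\<rho> \<in> disc_zeros t"
proof -
  have "(norm (2 + \<i> * of_real t - \<rho>))\<^sup>2 = (2 - Re \<rho>)\<^sup>2 + (t - Im \<rho>)\<^sup>2" unfolding cmod_power2 by simp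
  also have "\<dots> \<le> (23/8)\<^sup>2 + 1\<^sup>2"
    using zeros_Re[OF assms(1)] assms(2) by (intro add_mono abs_le_square_iff[THEN iffD1]) auto
  also have "\<dots> \<le> (16/5)\<^sup>2" by (simp add: power2_eq_square)
  finally have "norm (2 + \<i> * of_real t - \<rho>) \<le> 16/5" by (rule power2_le_imp_le) simp
  thus ?thesis using assms by (simp add: disc_zeros_def zeros_def dist_norm)
qed

section \<open>Sums over zeros with decaying weights\<close>

lemma half_le_aux: "a \<le> b + 1 \<Longrightarrow> 0 \<le> b \<Longrightarrow> (1 + a) / 2 \<le> 1 + (b::real)" by simp

lemma powr_neg_divide: "x \<ge> 0 \<Longrightarrow> y > 0 \<Longrightarrow> (x / y) powr (- p) = y powr p * x powr (- p :: real)"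
  by (simp add: powr_divide powr_minus_divide)

lemma minus_three_halves: "(-3/2 :: real) = - (3/2)" by simp

text \<open>Zeros are sorted by the integer part of their height relative to \<open>t\<close>; each
  class lies in one disc and so weighs at most \<open>C * lg\<close>. Finite sets are used because
  summability is still to be derived from this.\<close>

lemma zeros_partition_sum:
  obtains C where "C > 0"
    "\<And>F t f \<phi>. finite F \<Longrightarrow> F \<subseteq> zeros \<Longrightarrow> (\<And>\<rho>. \<rho> \<in> F \<Longrightarrow> f \<rho> \<le> \<phi> \<lfloor>Im \<rho> - t\<rfloor>) \<Longrightarrow> (\<And>j. \<phi> j \<ge> 0) \<Longrightarrow>
       (\<Sum>\<rho>\<in>F. zmult \<rho> * f \<rho>) \<le> (\<Sum>j\<in>(\<lambda>\<rho>. \<lfloor>Im \<rho> - t\<rfloor>) ` F. C * lg (t + of_int j) * \<phi> j)"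
proof -
  obtain C where C: "C > 0" "\<And>t. finite (disc_zeros t)" "\<And>t. (\<Sum>a\<in>disc_zeros t. zmult a) \<le> C * lg t"
    using zeta_entire_local by metis
  show ?thesis
  proof (rule that[of C])
    show "C > 0" by fact
    fix F t and f :: "complex \<Rightarrow> real" and \<phi> :: "int \<Rightarrow> real"
    assume F: "finite F" "F \<subseteq> zeros" and f: "\<And>\<rho>. \<rho> \<in> F \<Longrightarrow> f \<rho> \<le> \<phi> \<lfloor>Im \<rho> - t\<rfloor>" and \<phi>: "\<And>j. \<phi> j \<ge> 0"
    let ?j = "\<lambda>\<rho>. \<lfloor>Im \<rho> - t\<rfloor>"
    have "(\<Sum>\<rho>\<in>F. zmult \<rho> * f \<rho>) = (\<Sum>j\<in>?j ` F. \<Sum>\<rho>\<in>{\<rho>\<in>F. ?j \<rho> = j}. zmult \<rho> * f \<rho>)"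
      by (rule sum.image_gen) fact
    also have "\<dots> \<le> (\<Sum>j\<in>?j ` F. C * lg (t + of_int j) * \<phi> j)"
    proof (rule sum_mono)
      fix j
      have "(\<Sum>\<rho>\<in>{\<rho>\<in>F. ?j \<rho> = j}. zmult \<rho> * f \<rho>) \<le> (\<Sum>\<rho>\<in>{\<rho>\<in>F. ?j \<rho> = j}. zmult \<rho> * \<phi> j)"
        using f zmult_nonneg by (intro sum_mono mult_left_mono) auto
      also have "\<dots> = (\<Sum>\<rho>\<in>{\<rho>\<in>F. ?j \<rho> = j}. zmult \<rho>) * \<phi> j" by (simp add: sum_distrib_right)
      also have "(\<Sum>\<rho>\<in>{\<rho>\<in>F. ?j \<rho> = j}. zmult \<rho>) \<le> (\<Sum>\<rho>\<in>disc_zeros (t + of_int j). zmult \<rho>)"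
      proof (rule sum_mono2)
        show "{\<rho>\<in>F. ?j \<rho> = j} \<subseteq> disc_zeros (t + of_int j)"
        proof
          fix \<rho> assume "\<rho> \<in> {\<rho>\<in>F. ?j \<rho> = j}"
          hence "\<rho> \<in> zeros" "\<lfloor>Im \<rho> - t\<rfloor> = j" using F by auto
          moreover from this(2) have "\<bar>Im \<rho> - (t + of_int j)\<bar> \<le> 1" by linarith
          ultimately show "\<rho> \<in> disc_zeros (t + of_int j)" by (intro zeros_in_disc_zeros)
        qed
      qed (use C zmult_nonneg in auto)
      also have "\<dots> \<le> C * lg (t + of_int j)" by (rule C)
      finally show "(\<Sum>\<rho>\<in>{\<rho>\<in>F. ?j \<rho> = j}. zmult \<rho> * f \<rho>) \<le> C * lg (t + of_int j) * \<phi> j"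
        using \<phi>[of j] by (simp add: mult_right_mono)
    qed
    finally show "(\<Sum>\<rho>\<in>F. zmult \<rho> * f \<rho>) \<le> (\<Sum>j\<in>?j ` F. C * lg (t + of_int j) * \<phi> j)" .
  qed
qed

text \<open>Each absolute value is taken at most twice.\<close>

lemma sum_int_le_suminf:
  fixes h :: "nat \<Rightarrow> real"
  assumes "finite J" "summable h" "\<And>n. h n \<ge> 0"
  shows "(\<Sum>j\<in>J. h (nat \<bar>j\<bar>)) \<le> 2 * suminf h"
proof -
  have part: "(\<Sum>j\<in>I. h (nat \<bar>j\<bar>)) \<le> suminf h" if "finite I" "inj_on (\<lambda>j. nat \<bar>j\<bar>) I" for I :: "int set"
  proof -
    have "(\<Sum>j\<in>I. h (nat \<bar>j\<bar>)) = (\<Sum>n\<in>(\<lambda>j. nat \<bar>j\<bar>) ` I. h n)" by (simp add: sum.reindex[OF that(2)])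
    also have "\<dots> \<le> suminf h" by (rule sum_le_suminf) (use assms that in auto)
    finally show ?thesis .
  qed
  have "J = (J \<inter> {0..}) \<union> (J \<inter> {..<0})" by auto
  hence "(\<Sum>j\<in>J. h (nat \<bar>j\<bar>)) = (\<Sum>j\<in>(J \<inter> {0..}) \<union> (J \<inter> {..<0}). h (nat \<bar>j\<bar>))" by simp
  also have "\<dots> = (\<Sum>j\<in>J \<inter> {0..}. h (nat \<bar>j\<bar>)) + (\<Sum>j\<in>J \<inter> {..<0}. h (nat \<bar>j\<bar>))"
    by (rule sum.union_disjoint) (use assms in auto)
  also have "\<dots> \<le> suminf h + suminf h"
    by (intro add_mono part) (use assms in \<open>auto simp: inj_on_def\<close>)
  finally show ?thesis by simp
qed

text \<open>The logarithmic density of the zeros, uniform in the centre \<open>t\<close>. Passing to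
  integer heights costs \<open>2 powr (3/2) <= 4\<close>, \<open>lg_add_le\<close> costs 9 and a
  power 1/4, and the remaining exponent -5/4 is summable; with both signs of \<open>j\<close> this
  gives 72.\<close>

lemma zeros_weight_sum:
  obtains C where "C > 0"
    "\<And>F t. finite F \<Longrightarrow> F \<subseteq> zeros \<Longrightarrow> (\<Sum>\<rho>\<in>F. zmult \<rho> * (1 + \<bar>Im \<rho> - t\<bar>) powr (-3/2)) \<le> C * lg t"
proof -
  obtain C where C: "C > 0" "\<And>F t f \<phi>. finite F \<Longrightarrow> F \<subseteq> zeros \<Longrightarrow> (\<And>\<rho>. \<rho> \<in> F \<Longrightarrow> f \<rho> \<le> \<phi> \<lfloor>Im \<rho> - t\<rfloor>) \<Longrightarrow> (\<And>j. \<phi> j \<ge> 0) \<Longrightarrow>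
       (\<Sum>\<rho>\<in>F. zmult \<rho> * f \<rho>) \<le> (\<Sum>j\<in>(\<lambda>\<rho>. \<lfloor>Im \<rho> - t\<rfloor>) ` F. C * lg (t + of_int j) * \<phi> j)"
    using zeros_partition_sum by blast
  define h where "h = (\<lambda>n. real (Suc n) powr (-5/4))"
  have h: "summable h" "\<And>n. h n \<ge> 0" unfolding h_def by (rule summable_Suc_powr, simp) simp
  have hp: "suminf h \<ge> 0" by (rule suminf_nonneg) (use h in auto)
  define \<phi> where "\<phi> = (\<lambda>j::int. 4 * (1 + \<bar>of_int j\<bar>) powr (-3/2) :: real)"
  show ?thesis
  proof (rule that[of "72 * C * suminf h + 1"])
    show "72 * C * suminf h + 1 > 0" using hp C by (intro add_nonneg_pos) auto
    fix F t assume F: "finite F" "F \<subseteq> zeros"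
    have "(\<Sum>\<rho>\<in>F. zmult \<rho> * (1 + \<bar>Im \<rho> - t\<bar>) powr (-3/2)) \<le> (\<Sum>j\<in>(\<lambda>\<rho>. \<lfloor>Im \<rho> - t\<rfloor>) ` F. C * lg (t + of_int j) * \<phi> j)"
    proof (rule C(2)[OF F])
      fix \<rho> assume "\<rho> \<in> F"
      define j where "j = \<lfloor>Im \<rho> - t\<rfloor>"
      have "\<bar>of_int j\<bar> \<le> \<bar>Im \<rho> - t\<bar> + 1" unfolding j_def by linarith
      hence "(1 + \<bar>of_int j\<bar>) / 2 \<le> 1 + \<bar>Im \<rho> - t\<bar>" by (rule half_le_aux) simp
      hence "(1 + \<bar>Im \<rho> - t\<bar>) powr (-3/2) \<le> ((1 + \<bar>of_int j\<bar>) / 2) powr (-3/2)"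
        by (intro powr_mono2') auto
      also have "\<dots> = (1 + \<bar>of_int j\<bar>) powr (-3/2) * 2 powr (3/2)"
        unfolding minus_three_halves by (subst powr_neg_divide) auto
      also have "\<dots> \<le> (1 + \<bar>of_int j\<bar>) powr (-3/2) * 2 powr 2"
        by (intro mult_left_mono powr_mono) auto
      also have "\<dots> = \<phi> j" by (simp add: \<phi>_def)
      finally show "(1 + \<bar>Im \<rho> - t\<bar>) powr (-3/2) \<le> \<phi> \<lfloor>Im \<rho> - t\<rfloor>" unfolding j_def .
    qed (simp add: \<phi>_def)
    also have "\<dots> \<le> (\<Sum>j\<in>(\<lambda>\<rho>. \<lfloor>Im \<rho> - t\<rfloor>) ` F. (36 * C * lg t) * h (nat \<bar>j\<bar>))"
    proof (rule sum_mono)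
      fix j :: int
      have "C * lg (t + of_int j) * \<phi> j \<le> C * (9 * lg t * (1 + \<bar>of_int j\<bar>) powr (1/4)) * \<phi> j"
        using C lg_add_le[of t j] by (intro mult_right_mono mult_left_mono) (auto simp: \<phi>_def)
      also have "\<dots> = (36 * C * lg t) * ((1 + \<bar>of_int j\<bar>) powr (1/4) * (1 + \<bar>of_int j\<bar>) powr (-3/2))"
        by (simp add: \<phi>_def)
      also have "(1 + \<bar>of_int j\<bar>) powr (1/4) * (1 + \<bar>real_of_int j\<bar>) powr (-3/2) = h (nat \<bar>j\<bar>)"
        by (simp add: powr_add[symmetric] h_def)
      finally show "C * lg (t + of_int j) * \<phi> j \<le> (36 * C * lg t) * h (nat \<bar>j\<bar>)" .
    qed
    also have "\<dots> = (36 * C * lg t) * (\<Sum>j\<in>(\<lambda>\<rho>. \<lfloor>Im \<rho> - t\<rfloor>) ` F. h (nat \<bar>j\<bar>))" by (simp add: sum_distrib_left)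
    also have "\<dots> \<le> (36 * C * lg t) * (2 * suminf h)"
      using C lg_pos[of t] F h by (intro mult_left_mono sum_int_le_suminf) auto
    also have "\<dots> \<le> (72 * C * suminf h + 1) * lg t" using lg_pos[of t] by (simp add: algebra_simps)
    finally show "(\<Sum>\<rho>\<in>F. zmult \<rho> * (1 + \<bar>Im \<rho> - t\<bar>) powr (-3/2)) \<le> (72 * C * suminf h + 1) * lg t" .
  qed
qed

text \<open>The factor 2 leaves room: points within \<open>d\<close> of \<open>a\<close> still have
  distance at least \<open>d\<close> from all zeros other than \<open>a\<close>.\<close>

lemma zeros_isolated:
  obtains d where "d > 0" "d \<le> 1/2" "\<And>w. zeta_entire w = 0 \<Longrightarrow> w \<noteq> a \<Longrightarrow> dist a w \<ge> 2 * d"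
proof -
  obtain r g where r: "r > 0" "\<And>w. w \<in> ball a r - {a} \<Longrightarrow> zeta_entire w \<noteq> 0"
    using logderiv_near[OF holomorphic_zeta_entire zeta_entire_nontrivial, of a] by metis
  show ?thesis
  proof (rule that[of "min (1/2) (r/2)"])
    fix w assume "zeta_entire w = 0" "w \<noteq> a"
    with r(2)[of w] have "\<not> dist a w < r" by auto
    thus "dist a w \<ge> 2 * min (1/2) (r/2)" by linarith
  qed (use r in auto)
qed

text \<open>The point 0 is not a zero, and zeros do not accumulate there, so their moduli are
  bounded below; large heights are trivial.\<close>

lemma zeros_norm_ge:
  obtains c where "c > 0" "c \<le> 1" "\<And>\<rho>. \<rho> \<in> zeros \<Longrightarrow> c * (1 + \<bar>Im \<rho>\<bar>) \<le> norm \<rho>"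
proof -
  obtain d where d: "d > 0" "d \<le> 1/2" "\<And>w. zeta_entire w = 0 \<Longrightarrow> w \<noteq> 0 \<Longrightarrow> dist 0 w \<ge> 2 * d"
    using zeros_isolated[of 0] by metis
  show ?thesis
  proof (rule that[of d])
    fix \<rho> assume \<rho>: "\<rho> \<in> zeros"
    hence "zeta_entire \<rho> = 0" "\<rho> \<noteq> 0" using zeta_entire_0 by (auto simp: zeros_def)
    hence 1: "norm \<rho> \<ge> 2 * d" using d(3)[of \<rho>] by simp
    have "d * \<bar>Im \<rho>\<bar> \<le> (1/2) * norm \<rho>" using d abs_Im_le_cmod[of \<rho>] by (intro mult_mono) auto
    thus "d * (1 + \<bar>Im \<rho>\<bar>) \<le> norm \<rho>" using 1 by (simp add: algebra_simps)
  qed (use d in auto)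
qed

lemma zmult_weight_summable: "(\<lambda>\<rho>. zmult \<rho> * (1 + \<bar>Im \<rho>\<bar>) powr (-3/2)) summable_on zeros"
proof (rule nonneg_bdd_above_summable_on)
  obtain C where C: "C > 0" "\<And>F t. finite F \<Longrightarrow> F \<subseteq> zeros \<Longrightarrow> (\<Sum>\<rho>\<in>F. zmult \<rho> * (1 + \<bar>Im \<rho> - t\<bar>) powr (-3/2)) \<le> C * lg t"
    using zeros_weight_sum by blast
  show "bdd_above (sum (\<lambda>\<rho>. zmult \<rho> * (1 + \<bar>Im \<rho>\<bar>) powr (- 3 / 2)) ` {F. F \<subseteq> zeros \<and> finite F})"
    using C(2)[of _ 0] by (intro bdd_aboveI[of _ "C * lg 0"]) auto
qed (simp add: zmult_nonneg)

text \<open>Decouples the two distances in \<open>1 / (a * b)\<close>, so that each can be summed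
  over the zeros on its own with the summable exponent -3/2. The price is only
  \<open>sqrt S\<close>. In terms of \<open>x = 1 / sqrt a\<close> and \<open>y = 1 / sqrt b\<close>
  it rests on \<open>x y^2 + x^2 y <= x^3 + y^3\<close>.\<close>

lemma pole_pair_ineq:
  fixes a b S :: real
  assumes "a \<ge> 1" "b \<ge> 1" "0 < S" "S \<le> a + b"
  shows "S / (a * b) \<le> sqrt S * (a powr (-3/2) + b powr (-3/2))"
proof -
  define x y where "x = 1 / sqrt a" and "y = 1 / sqrt b"
  have xy: "x > 0" "y > 0" using assms by (auto simp: x_def y_def)
  have cube: "u powr (-3/2) = (1 / sqrt u) ^ 3" if "u \<ge> 1" for u :: real
  proof -
    have "1 / sqrt u = u powr (-(1/2))" unfolding powr_minus using that by (subst powr_half_sqrt) (auto simp: divide_inverse)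
    hence "(1 / sqrt u) ^ 3 = u powr (-(1/2)) * u powr (-(1/2)) * u powr (-(1/2))" by (simp only: power3_eq_cube)
    also have "\<dots> = u powr (-3/2)" unfolding powr_add[symmetric] by simp
    finally show ?thesis by simp
  qed
  have "sqrt S \<le> sqrt (a + b)" using assms by simp
  also have "\<dots> \<le> sqrt a + sqrt b" using assms by (intro sqrt_add_le_add_sqrt) auto
  finally have s: "sqrt S \<le> sqrt a + sqrt b" .
  have "S / (a * b) = sqrt S * (sqrt S / (a * b))" using assms by simp
  also have "\<dots> \<le> sqrt S * ((sqrt a + sqrt b) / (a * b))"
    using assms s by (intro mult_left_mono divide_right_mono) auto
  also have "(sqrt a + sqrt b) / (a * b) = x * y\<^sup>2 + x\<^sup>2 * y"
  proof -
    have "a = (sqrt a)\<^sup>2" "b = (sqrt b)\<^sup>2" using assms by auto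
    moreover have "sqrt a > 0" "sqrt b > 0" using assms by auto
    ultimately have "(sqrt a + sqrt b) / ((sqrt a)\<^sup>2 * (sqrt b)\<^sup>2) = x * y\<^sup>2 + x\<^sup>2 * y"
      unfolding x_def y_def by (simp add: field_simps power2_eq_square)
    thus ?thesis using assms by simp
  qed
  also have "x * y\<^sup>2 + x\<^sup>2 * y \<le> x ^ 3 + y ^ 3"
  proof -
    have "0 \<le> (x + y) * (x - y)\<^sup>2" using xy by simp
    also have "\<dots> = (x ^ 3 + y ^ 3) - (x * y\<^sup>2 + x\<^sup>2 * y)" by (simp add: power2_eq_square power3_eq_cube algebra_simps)
    finally show ?thesis by simp
  qed
  finally show ?thesis unfolding x_def y_def cube[OF assms(1)] cube[OF assms(2)] using assms by simp
qed

text \<open>The correction \<open>1 / \<rho>\<close> is that of a Hadamard product of genus one: the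
  two fractions combine to \<open>s / (\<rho> * (s - \<rho>))\<close>, which decays quadratically in
  the zero.\<close>

definition pole_term :: "complex \<Rightarrow> complex \<Rightarrow> complex" where
  "pole_term \<rho> s = of_real (zmult \<rho>) * (1 / (s - \<rho>) + 1 / \<rho>)"

text \<open>Both moduli in the denominator of \<open>s / (\<rho> * (s - \<rho>))\<close> are bounded
  below by multiples of \<open>1 + |Im \<rho>|\<close> and \<open>1 + |Im \<rho> - Im s|\<close>,
  and \<open>pole_pair_ineq\<close> separates them. The growth in Im s is a square root, well below
  the first power.\<close>

lemma pole_term_bound:
  assumes c: "c > 0" "c * (1 + \<bar>Im \<rho>\<bar>) \<le> norm \<rho>" and d: "0 < d" "d \<le> 1" "d \<le> norm (s - \<rho>)" and s: "\<bar>Re s\<bar> \<le> 3"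
  shows "norm (pole_term \<rho> s) \<le> 3 / (c * d) * sqrt (2 + \<bar>Im s\<bar>) *
           (zmult \<rho> * (1 + \<bar>Im \<rho>\<bar>) powr (-3/2) + zmult \<rho> * (1 + \<bar>Im \<rho> - Im s\<bar>) powr (-3/2))"
proof -
  define a b where "a = 1 + \<bar>Im \<rho>\<bar>" and "b = 1 + \<bar>Im \<rho> - Im s\<bar>"
  have ab: "a \<ge> 1" "b \<ge> 1" by (auto simp: a_def b_def)
  have \<rho>: "norm \<rho> > 0"
  proof -
    have "0 < c * a" using c ab by (intro mult_pos_pos) auto
    thus ?thesis using c unfolding a_def by linarith
  qed
  have "\<bar>Im s - Im \<rho>\<bar> \<le> norm (s - \<rho>)" using abs_Im_le_cmod[of "s - \<rho>"] by simp
  hence bb: "d / 2 * b \<le> norm (s - \<rho>)"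
  proof -
    have "d * \<bar>Im \<rho> - Im s\<bar> \<le> 1 * norm (s - \<rho>)" using d \<open>\<bar>Im s - Im \<rho>\<bar> \<le> _\<close>
      by (intro mult_mono) (auto simp: abs_minus_commute)
    thus ?thesis using d by (simp add: b_def algebra_simps)
  qed
  have "norm s \<le> \<bar>Re s\<bar> + \<bar>Im s\<bar>" by (rule cmod_le)
  hence ns: "norm s \<le> 3/2 * (2 + \<bar>Im s\<bar>)" using s by simp
  have "s - \<rho> \<noteq> 0" "\<rho> \<noteq> 0" using \<rho> d by auto
  hence "1 / (s - \<rho>) + 1 / \<rho> = s / (\<rho> * (s - \<rho>))" by (simp add: divide_simps)
  hence "norm (1 / (s - \<rho>) + 1 / \<rho>) = norm s / (norm \<rho> * norm (s - \<rho>))" by (simp add: norm_divide norm_mult)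
  also have "\<dots> \<le> (3/2 * (2 + \<bar>Im s\<bar>)) / ((c * a) * (d / 2 * b))"
    using c d bb ns ab by (intro frac_le mult_mono mult_pos_pos) (auto simp: a_def)
  also have "\<dots> = 3 / (c * d) * ((2 + \<bar>Im s\<bar>) / (a * b))" using c d ab by (simp add: field_simps)
  also have "\<dots> \<le> 3 / (c * d) * (sqrt (2 + \<bar>Im s\<bar>) * (a powr (-3/2) + b powr (-3/2)))"
    using c d ab by (intro mult_left_mono pole_pair_ineq) (auto simp: a_def b_def)
  finally have "zmult \<rho> * norm (1 / (s - \<rho>) + 1 / \<rho>) \<le> zmult \<rho> * (3 / (c * d) * (sqrt (2 + \<bar>Im s\<bar>) * (a powr (-3/2) + b powr (-3/2))))"
    by (intro mult_left_mono zmult_nonneg)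
  moreover have "norm (pole_term \<rho> s) = zmult \<rho> * norm (1 / (s - \<rho>) + 1 / \<rho>)"
    unfolding pole_term_def norm_mult using zmult_nonneg[of \<rho>] by simp
  ultimately show ?thesis by (simp add: a_def b_def algebra_simps)
qed

text \<open>Weierstrass M-test over the set of zeros. The distance \<open>2 * d\<close> from the
  centre leaves \<open>d\<close> for every point of the closed disc.\<close>

lemma holomorphic_pole_sum:
  assumes A: "A \<subseteq> zeros" and d: "0 < d" "d \<le> 1/2" and s0: "\<bar>Re s0\<bar> \<le> 5/2"
    and dist: "\<And>\<rho>. \<rho> \<in> A \<Longrightarrow> dist s0 \<rho> \<ge> 2 * d"
  shows "(\<lambda>s. \<Sum>\<^sub>\<infinity>\<rho>\<in>A. pole_term \<rho> s) holomorphic_on ball s0 d"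
    "\<And>s. s \<in> cball s0 d \<Longrightarrow> (\<lambda>\<rho>. pole_term \<rho> s) summable_on A"
proof -
  obtain c where c: "c > 0" "\<And>\<rho>. \<rho> \<in> zeros \<Longrightarrow> c * (1 + \<bar>Im \<rho>\<bar>) \<le> norm \<rho>"
    using zeros_norm_ge by metis
  define T where "T = 2 + \<bar>Im s0\<bar>"
  define K where "K = 3 / (c * d) * sqrt (1 + T) * (1 + T powr (3/2))"
  define M where "M = (\<lambda>\<rho>. K * (zmult \<rho> * (1 + \<bar>Im \<rho>\<bar>) powr (-3/2)))"
  have M: "M summable_on A" unfolding M_def
    by (intro summable_on_cmult_right summable_on_subset_banach[OF zmult_weight_summable A])
  have le: "norm (pole_term \<rho> s) \<le> M \<rho>" if "\<rho> \<in> A" "s \<in> cball s0 d" for \<rho> s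
  proof -
    have ds: "norm (s - s0) \<le> d" using that by (simp add: dist_norm norm_minus_commute)
    have "\<bar>Im s - Im s0\<bar> \<le> d" "\<bar>Re s - Re s0\<bar> \<le> d"
      using ds abs_Im_le_cmod[of "s - s0"] abs_Re_le_cmod[of "s - s0"] by auto
    hence Im: "1 + \<bar>Im s\<bar> \<le> T" "\<bar>Re s\<bar> \<le> 3" using d s0 by (auto simp: T_def)
    have far: "d \<le> norm (s - \<rho>)"
      using dist[OF that(1)] ds norm_triangle_ineq4[of "s - \<rho>" "s - s0"] by (simp add: dist_norm)
    have b: "(1 + \<bar>Im \<rho> - Im s\<bar>) powr (-3/2) \<le> T powr (3/2) * (1 + \<bar>Im \<rho>\<bar>) powr (-3/2)"
    proof -
      \<comment> \<open>Replaces the weight centred at Im s by the one centred at 0, losing a power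
        of \<open>T\<close>; the majorant then no longer depends on the point of the disc.\<close>
      have "1 + \<bar>Im \<rho>\<bar> \<le> T * (1 + \<bar>Im \<rho> - Im s\<bar>)"
      proof -
        have "(1 + \<bar>Im s\<bar>) * (1 + \<bar>Im \<rho> - Im s\<bar>) \<le> T * (1 + \<bar>Im \<rho> - Im s\<bar>)"
          using Im by (intro mult_right_mono) auto
        moreover have "0 \<le> \<bar>Im s\<bar> * \<bar>Im \<rho> - Im s\<bar>" by simp
        moreover have "(1 + \<bar>Im s\<bar>) * (1 + \<bar>Im \<rho> - Im s\<bar>) = 1 + \<bar>Im s\<bar> + \<bar>Im \<rho> - Im s\<bar> + \<bar>Im s\<bar> * \<bar>Im \<rho> - Im s\<bar>"
          by (simp add: algebra_simps)
        ultimately show ?thesis by linarith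
      qed
      hence "(1 + \<bar>Im \<rho>\<bar>) / T \<le> 1 + \<bar>Im \<rho> - Im s\<bar>" using Im by (simp add: field_simps T_def)
      hence "(1 + \<bar>Im \<rho> - Im s\<bar>) powr (-3/2) \<le> ((1 + \<bar>Im \<rho>\<bar>) / T) powr (-3/2)"
        by (intro powr_mono2') (auto simp: T_def add_nonneg_pos)
      also have "\<dots> = T powr (3/2) * (1 + \<bar>Im \<rho>\<bar>) powr (-3/2)"
        unfolding minus_three_halves by (rule powr_neg_divide) (auto simp: T_def add_nonneg_pos)
      finally show ?thesis .
    qed
    have "norm (pole_term \<rho> s) \<le> 3 / (c * d) * sqrt (2 + \<bar>Im s\<bar>) *
           (zmult \<rho> * (1 + \<bar>Im \<rho>\<bar>) powr (-3/2) + zmult \<rho> * (1 + \<bar>Im \<rho> - Im s\<bar>) powr (-3/2))"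
      by (rule pole_term_bound) (use c that A d far Im in auto)
    also have "\<dots> \<le> 3 / (c * d) * sqrt (1 + T) *
           (zmult \<rho> * (1 + \<bar>Im \<rho>\<bar>) powr (-3/2) + zmult \<rho> * (T powr (3/2) * (1 + \<bar>Im \<rho>\<bar>) powr (-3/2)))"
      using c d Im b zmult_nonneg[of \<rho>]
      by (intro mult_mono add_mono order.refl mult_nonneg_nonneg add_nonneg_nonneg) auto
    also have "\<dots> = M \<rho>" by (simp add: M_def K_def distrib_left distrib_right mult_ac add_divide_distrib)
    finally show ?thesis .
  qed
  show "(\<lambda>\<rho>. pole_term \<rho> s) summable_on A" if "s \<in> cball s0 d" for s
    by (rule abs_summable_summable, rule Infinite_Sum.abs_summable_on_comparison_test'[OF M]) (use le that in auto)
  have ul: "uniform_limit (cball s0 d) (\<lambda>X s. \<Sum>\<rho>\<in>X. pole_term \<rho> s) (\<lambda>s. \<Sum>\<^sub>\<infinity>\<rho>\<in>A. pole_term \<rho> s) (finite_subsets_at_top A)"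
    by (rule Weierstrass_m_test_general[OF le M])
  have ev: "\<forall>\<^sub>F X in finite_subsets_at_top A. continuous_on (cball s0 d) (\<lambda>s. \<Sum>\<rho>\<in>X. pole_term \<rho> s) \<and> (\<lambda>s. \<Sum>\<rho>\<in>X. pole_term \<rho> s) holomorphic_on ball s0 d"
  proof (rule eventually_finite_subsets_at_top_weakI)
    fix X assume X: "finite X" "X \<subseteq> A"
    have "(\<lambda>s. \<Sum>\<rho>\<in>X. pole_term \<rho> s) holomorphic_on cball s0 d" unfolding pole_term_def
    proof (intro holomorphic_intros)
      fix \<rho> s assume "\<rho> \<in> X" "s \<in> cball s0 d"
      thus "s - \<rho> \<noteq> 0" using dist[of \<rho>] X d by auto
    qed
    thus "continuous_on (cball s0 d) (\<lambda>s. \<Sum>\<rho>\<in>X. pole_term \<rho> s) \<and> (\<lambda>s. \<Sum>\<rho>\<in>X. pole_term \<rho> s) holomorphic_on ball s0 d"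
      using ball_subset_cball holomorphic_on_imp_continuous_on holomorphic_on_subset by blast
  qed
  show "(\<lambda>s. \<Sum>\<^sub>\<infinity>\<rho>\<in>A. pole_term \<rho> s) holomorphic_on ball s0 d"
    using holomorphic_uniform_limit[OF ev ul] by simp
qed

text \<open>
  On \<open>Re s = 2\<close> this is the Dirichlet series of the von Mangoldt function minus its pole at \<open>1\<close>, with the
  poles at the zeros removed; so it extends to the strip and grows slower than \<open>\<bar>Im s\<bar>\<close> there.
\<close>
definition zlog_rem0 :: "complex \<Rightarrow> complex" where
  "zlog_rem0 s = - deriv zeta_entire s / zeta_entire s + (\<Sum>\<^sub>\<infinity>\<rho>\<in>zeros. pole_term \<rho> s)"

text \<open>At a zero the formula for \<open>zlog_rem0\<close> only has the value given by division
  by 0; the limit is put in its place.\<close>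

definition zlog_rem :: "complex \<Rightarrow> complex" where
  "zlog_rem = remove_sings zlog_rem0"

lemma zlog_rem0_holomorphic_near:
  assumes s: "-7/8 < Re s" "Re s < 5/2" "zeta_entire s \<noteq> 0"
  shows "zlog_rem0 analytic_on {s}"
proof -
  obtain d where d: "d > 0" "d \<le> 1/2" "\<And>w. zeta_entire w = 0 \<Longrightarrow> w \<noteq> s \<Longrightarrow> dist s w \<ge> 2 * d"
    using zeros_isolated[of s] by metis
  have "(\<lambda>s. \<Sum>\<^sub>\<infinity>\<rho>\<in>zeros. pole_term \<rho> s) holomorphic_on ball s d"
  proof (rule holomorphic_pole_sum(1))
    show "dist s \<rho> \<ge> 2 * d" if "\<rho> \<in> zeros" for \<rho> using d(3)[of \<rho>] that s by (auto simp: zeros_def)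
  qed (use d s in auto)
  moreover have "zeta_entire w \<noteq> 0" if "w \<in> ball s d" for w using d(3)[of w] that d(1) s(3) by (cases "w = s") auto
  ultimately have "zlog_rem0 holomorphic_on ball s d" unfolding zlog_rem0_def
    by (intro holomorphic_intros holomorphic_deriv holomorphic_on_subset[OF holomorphic_zeta_entire]) auto
  thus ?thesis using d(1) by (metis analytic_at centre_in_ball open_ball)
qed

lemma zlog_rem_eq:
  assumes "-7/8 < Re s" "Re s < 5/2" "zeta_entire s \<noteq> 0"
  shows "zlog_rem s = zlog_rem0 s"
  unfolding zlog_rem_def using zlog_rem0_holomorphic_near[OF assms] by simp

text \<open>At a zero of order m the function \<open>- deriv zeta_entire / zeta_entire\<close> has
  the polar part \<open>-m / (w - s)\<close>, and the term of the pole sum belonging to that zero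
  has \<open>m / (w - s)\<close>.\<close>

lemma zlog_rem_analytic:
  assumes s: "-7/8 < Re s" "Re s < 5/2"
  shows "zlog_rem analytic_on {s}"
proof (cases "zeta_entire s = 0")
  case False
  thus ?thesis unfolding zlog_rem_def using zlog_rem0_holomorphic_near[OF s] remove_sings_analytic_on by blast
next
  case True
  hence sz: "s \<in> zeros" using s by (simp add: zeros_def)
  obtain d where d: "d > 0" "d \<le> 1/2" "\<And>w. zeta_entire w = 0 \<Longrightarrow> w \<noteq> s \<Longrightarrow> dist s w \<ge> 2 * d"
    using zeros_isolated[of s] by metis
  obtain r g where r: "r > 0" "g holomorphic_on ball s r" "\<And>w. w \<in> ball s r \<Longrightarrow> g w \<noteq> 0"
    "\<And>w. w \<in> ball s r - {s} \<Longrightarrow> zeta_entire w \<noteq> 0 \<and> deriv zeta_entire w / zeta_entire w = of_int (zorder zeta_entire s) / (w - s) + deriv g w / g w"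
    using logderiv_near[OF holomorphic_zeta_entire zeta_entire_nontrivial, of s] by metis
  define e where "e = min d r"
  have e: "e > 0" "ball s e \<subseteq> ball s d" "ball s e \<subseteq> ball s r" "ball s e \<subseteq> cball s d" using d r by (auto simp: e_def)
  \<comment> \<open>What is left after the cancellation: the constant of the term of
    \<open>s\<close>, the regular part of the logarithmic derivative, and the pole sum over the
    other zeros.\<close>
  define Q where "Q = (\<lambda>w. of_real (zmult s) / s - deriv g w / g w + (\<Sum>\<^sub>\<infinity>\<rho>\<in>zeros - {s}. pole_term \<rho> w))"
  note P = holomorphic_pole_sum[of "zeros - {s}" d s]
  have P1: "(\<lambda>w. \<Sum>\<^sub>\<infinity>\<rho>\<in>zeros - {s}. pole_term \<rho> w) holomorphic_on ball s d"
    by (rule P(1)) (use d s in \<open>auto simp: zeros_def\<close>)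
  have P2: "(\<lambda>\<rho>. pole_term \<rho> w) summable_on zeros - {s}" if "w \<in> cball s d" for w
    by (rule P(2)) (use d s that in \<open>auto simp: zeros_def\<close>)
  have hQ: "Q holomorphic_on ball s e" unfolding Q_def
    by (intro holomorphic_intros holomorphic_on_subset[OF P1 e(2)] holomorphic_on_subset[OF r(2) e(3)]
          holomorphic_deriv open_ball) (use e r(3) sz zeta_entire_0 in \<open>auto simp: zeros_def\<close>)
  have eq: "zlog_rem0 w = Q w" if w: "w \<in> ball s e - {s}" for w
  proof -
    have "(\<Sum>\<^sub>\<infinity>\<rho>\<in>insert s (zeros - {s}). pole_term \<rho> w) = pole_term s w + (\<Sum>\<^sub>\<infinity>\<rho>\<in>zeros - {s}. pole_term \<rho> w)"
      by (rule infsum_insert) (use P2[of w] w e in auto)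
    moreover have "insert s (zeros - {s}) = zeros" using sz by auto
    ultimately have "(\<Sum>\<^sub>\<infinity>\<rho>\<in>zeros. pole_term \<rho> w) = pole_term s w + (\<Sum>\<^sub>\<infinity>\<rho>\<in>zeros - {s}. pole_term \<rho> w)" by simp
    moreover have "deriv zeta_entire w / zeta_entire w = of_int (zorder zeta_entire s) / (w - s) + deriv g w / g w"
      using r(4)[of w] w e by auto
    ultimately show ?thesis
      by (simp add: zlog_rem0_def Q_def pole_term_def zmult_def algebra_simps)
  qed
  have "isCont Q s" using hQ e(1)
    by (metis centre_in_ball continuous_on_interior holomorphic_on_imp_continuous_on interior_open open_ball)
  hence "(Q \<longlongrightarrow> Q s) (at s)" by (simp add: isCont_def)
  hence lim: "(zlog_rem0 \<longlongrightarrow> Q s) (at s)"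
    by (rule Lim_transform_within_open[of _ _ _ UNIV "ball s e"]) (use e eq in auto)
  have "zlog_rem0 holomorphic_on ball s e - {s}"
    by (rule holomorphic_transform[of Q]) (use eq holomorphic_on_subset[OF hQ, of "ball s e - {s}"] in auto)
  hence "isolated_singularity_at zlog_rem0 s"
    using e(1) unfolding isolated_singularity_at_def by (metis analytic_on_open open_ball open_delete)
  thus ?thesis unfolding zlog_rem_def by (rule remove_sings_analytic_at[OF _ lim])
qed

lemma zlog_rem_holomorphic: "zlog_rem holomorphic_on {s. -7/8 < Re s \<and> Re s < 5/2}"
  using zlog_rem_analytic by (intro analytic_imp_holomorphic) (auto intro: analytic_on_analytic_at[THEN iffD2])

lemma lg_le_powr: "lg t \<le> 8 * (2 + \<bar>t\<bar>) powr (1/8)"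
  using ln_powr_bound[of "\<bar>t\<bar> + 2" "1/8"] by (simp add: lg_def add.commute)

text \<open>Zeros in the disc at height \<open>t\<close> cancel against the local formula for the
  logarithmic derivative, up to their constants \<open>1 / \<rho>\<close> and up to the zeros of the
  disc left of -7/8. Zeros outside the disc are summed by \<open>pole_term_bound\<close>. The
  exponent 5/8 is 1/2 from there plus 1/8 for a logarithm.\<close>

lemma zlog_rem_bound:
  obtains C where "C > 0" "\<And>s. -3/4 \<le> Re s \<Longrightarrow> Re s \<le> 2 \<Longrightarrow> norm (zlog_rem s) \<le> C * (2 + \<bar>Im s\<bar>) powr (5/8)"
proof -
  obtain c where c: "c > 0" "c \<le> 1" "\<And>\<rho>. \<rho> \<in> zeros \<Longrightarrow> c * (1 + \<bar>Im \<rho>\<bar>) \<le> norm \<rho>"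
    using zeros_norm_ge by metis
  obtain C1 where C1: "C1 > 0" "\<And>t. finite (disc_zeros t)"
    "\<And>t. (\<Sum>a\<in>disc_zeros t. zmult a) \<le> C1 * lg t"
    "\<And>t z. norm (z - (2 + \<i> * of_real t)) \<le> 11/4 \<Longrightarrow> zeta_entire z \<noteq> 0 \<Longrightarrow>
       norm (deriv zeta_entire z / zeta_entire z - (\<Sum>a\<in>disc_zeros t. of_real (zmult a) / (z - a))) \<le> C1 * lg t"
    by (rule zeta_entire_local) blast
  obtain C2 where C2: "C2 > 0" "\<And>F t. finite F \<Longrightarrow> F \<subseteq> zeros \<Longrightarrow> (\<Sum>\<rho>\<in>F. zmult \<rho> * (1 + \<bar>Im \<rho> - t\<bar>) powr (-3/2)) \<le> C2 * lg t"
    using zeros_weight_sum by blast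
  define C where "C = 8 * (C1 + (8 + 1 / c) * C1 + 3 / (c * (9/20)) * (2 * C2))"
  have b0: "norm (zlog_rem s) \<le> C * (2 + \<bar>Im s\<bar>) powr (5/8)" if s: "-3/4 \<le> Re s" "Re s \<le> 2" and nz: "zeta_entire s \<noteq> 0" for s
  proof -
    define t where "t = Im s"
    define A where "A = disc_zeros t"
    have fA: "finite A" using C1 by (simp add: A_def)
    have "s - (2 + \<i> * of_real t) = of_real (Re s - 2)" by (simp add: complex_eq_iff t_def)
    hence s2: "norm (s - (2 + \<i> * of_real t)) \<le> 11/4" using s by (simp only: \<open>s - (2 + \<i> * of_real t) = of_real (Re s - 2)\<close> norm_of_real)
    define D where "D = deriv zeta_entire s / zeta_entire s - (\<Sum>a\<in>A. of_real (zmult a) / (s - a))"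
    have D: "norm D \<le> C1 * lg t" unfolding D_def A_def by (rule C1(4)[OF s2 nz])
    \<comment> \<open>9/20 is the gap \<open>16/5 - 11/4\<close> between the two radii.\<close>
    have far: "9/20 \<le> norm (s - \<rho>)" if "\<rho> \<in> zeros - A" for \<rho>
    proof -
      have "norm (2 + \<i> * of_real t - \<rho>) > 16/5" using that by (auto simp: A_def disc_zeros_def zeros_def dist_norm)
      thus ?thesis using s2 norm_triangle_ineq[of "s - \<rho>" "2 + \<i> * of_real t - s"] by (simp add: norm_minus_commute)
    qed
    have fin_bd: "(\<Sum>\<rho>\<in>F. norm (pole_term \<rho> s)) \<le> 3 / (c * (9/20)) * sqrt (2 + \<bar>t\<bar>) * (2 * C2 * lg t)"
      if F: "finite F" "F \<subseteq> zeros - A" for F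
    proof -
      have F': "F \<subseteq> zeros" using F by auto
      have "(\<Sum>\<rho>\<in>F. norm (pole_term \<rho> s)) \<le> (\<Sum>\<rho>\<in>F. 3 / (c * (9/20)) * sqrt (2 + \<bar>t\<bar>) *
           (zmult \<rho> * (1 + \<bar>Im \<rho>\<bar>) powr (-3/2) + zmult \<rho> * (1 + \<bar>Im \<rho> - t\<bar>) powr (-3/2)))"
        unfolding t_def
        by (intro sum_mono pole_term_bound) (use F c far s in auto)
      also have "\<dots> = 3 / (c * (9/20)) * sqrt (2 + \<bar>t\<bar>) * ((\<Sum>\<rho>\<in>F. zmult \<rho> * (1 + \<bar>Im \<rho> - 0\<bar>) powr (-3/2))
           + (\<Sum>\<rho>\<in>F. zmult \<rho> * (1 + \<bar>Im \<rho> - t\<bar>) powr (-3/2)))"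
        by (simp only: sum_distrib_left sum.distrib[symmetric] diff_0_right)
      also have "\<dots> \<le> 3 / (c * (9/20)) * sqrt (2 + \<bar>t\<bar>) * (C2 * lg 0 + C2 * lg t)"
        using c by (intro mult_left_mono add_mono C2 F F') auto
      also have "\<dots> \<le> 3 / (c * (9/20)) * sqrt (2 + \<bar>t\<bar>) * (2 * C2 * lg t)"
        using c C2(1) lg_mono[of 0 t] by (intro mult_left_mono) (auto simp: algebra_simps)
      finally show ?thesis .
    qed
    have summ: "(\<lambda>\<rho>. norm (pole_term \<rho> s)) summable_on (zeros - A)"
    proof (rule nonneg_bdd_above_summable_on)
      show "bdd_above (sum (\<lambda>\<rho>. norm (pole_term \<rho> s)) ` {F. F \<subseteq> zeros - A \<and> finite F})"
      proof (rule bdd_aboveI)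
        fix x assume "x \<in> sum (\<lambda>\<rho>. norm (pole_term \<rho> s)) ` {F. F \<subseteq> zeros - A \<and> finite F}"
        then obtain F where "finite F" "F \<subseteq> zeros - A" "x = (\<Sum>\<rho>\<in>F. norm (pole_term \<rho> s))" by blast
        thus "x \<le> 3 / (c * (9/20)) * sqrt (2 + \<bar>t\<bar>) * (2 * C2 * lg t)" using fin_bd by simp
      qed
    qed simp
    have "norm (\<Sum>\<^sub>\<infinity>\<rho>\<in>zeros - A. pole_term \<rho> s) \<le> (\<Sum>\<^sub>\<infinity>\<rho>\<in>zeros - A. norm (pole_term \<rho> s))"
      by (rule norm_infsum_bound) (use summ in simp)
    also have "\<dots> \<le> 3 / (c * (9/20)) * sqrt (2 + \<bar>t\<bar>) * (2 * C2 * lg t)"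
      by (rule infsum_le_finite_sums[OF summ]) (use fin_bd in auto)
    finally have E: "norm (\<Sum>\<^sub>\<infinity>\<rho>\<in>zeros - A. pole_term \<rho> s) \<le> 3 / (c * (9/20)) * sqrt (2 + \<bar>t\<bar>) * (2 * C2 * lg t)" .
    have "zeros = (zeros \<inter> A) \<union> (zeros - A)" by auto
    hence "(\<Sum>\<^sub>\<infinity>\<rho>\<in>zeros. pole_term \<rho> s) = (\<Sum>\<^sub>\<infinity>\<rho>\<in>(zeros \<inter> A) \<union> (zeros - A). pole_term \<rho> s)" by simp
    also have "\<dots> = (\<Sum>\<^sub>\<infinity>\<rho>\<in>zeros \<inter> A. pole_term \<rho> s) + (\<Sum>\<^sub>\<infinity>\<rho>\<in>zeros - A. pole_term \<rho> s)"
      by (rule infsum_Un_disjoint) (use fA abs_summable_summable[OF summ] in auto)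
    also have "(\<Sum>\<^sub>\<infinity>\<rho>\<in>zeros \<inter> A. pole_term \<rho> s) = (\<Sum>\<rho>\<in>zeros \<inter> A. of_real (zmult \<rho>) / (s - \<rho>) + of_real (zmult \<rho>) / \<rho>)"
      using fA by (simp add: pole_term_def algebra_simps)
    finally have split: "(\<Sum>\<^sub>\<infinity>\<rho>\<in>zeros. pole_term \<rho> s) = (\<Sum>\<rho>\<in>zeros \<inter> A. of_real (zmult \<rho>) / (s - \<rho>)) + (\<Sum>\<rho>\<in>zeros \<inter> A. of_real (zmult \<rho>) / \<rho>)
       + (\<Sum>\<^sub>\<infinity>\<rho>\<in>zeros - A. pole_term \<rho> s)" by (simp add: sum.distrib)
    have "A = (A - zeros) \<union> (zeros \<inter> A)" by auto
    hence "(\<Sum>\<rho>\<in>A. of_real (zmult \<rho>) / (s - \<rho>)) = (\<Sum>\<rho>\<in>(A - zeros) \<union> (zeros \<inter> A). of_real (zmult \<rho>) / (s - \<rho>))" by simp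
    also have "\<dots> = (\<Sum>\<rho>\<in>A - zeros. of_real (zmult \<rho>) / (s - \<rho>)) + (\<Sum>\<rho>\<in>zeros \<inter> A. of_real (zmult \<rho>) / (s - \<rho>))"
      by (rule sum.union_disjoint) (use fA in auto)
    finally have split2: "(\<Sum>\<rho>\<in>A. of_real (zmult \<rho>) / (s - \<rho>)) = (\<Sum>\<rho>\<in>A - zeros. of_real (zmult \<rho>) / (s - \<rho>)) + (\<Sum>\<rho>\<in>zeros \<inter> A. of_real (zmult \<rho>) / (s - \<rho>))" .
    have cnt: "(\<Sum>\<rho>\<in>B. zmult \<rho>) \<le> C1 * lg t" if "B \<subseteq> A" for B
      using sum_mono2[OF fA that, of zmult] zmult_nonneg C1(3)[of t] by (force simp: A_def)
    \<comment> \<open>These zeros occur in the local formula but not in the pole sum. They have real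
      part at most -7/8, hence distance at least 1/8 from the strip Re s >= -3/4.\<close>
    have E1: "norm (\<Sum>\<rho>\<in>A - zeros. of_real (zmult \<rho>) / (s - \<rho>)) \<le> 8 * (C1 * lg t)"
    proof -
      have "norm (of_real (zmult \<rho>) / (s - \<rho>)) \<le> 8 * zmult \<rho>" if "\<rho> \<in> A - zeros" for \<rho>
      proof -
        have "Re \<rho> \<le> -7/8" using that by (auto simp: A_def disc_zeros_def zeros_def)
        hence "1/8 \<le> norm (s - \<rho>)" using complex_Re_le_cmod[of "s - \<rho>"] s by simp
        hence "zmult \<rho> / norm (s - \<rho>) \<le> zmult \<rho> / (1/8)" using zmult_nonneg by (intro divide_left_mono) auto
        thus ?thesis using zmult_nonneg[of \<rho>] by (simp add: norm_divide)
      qed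
      hence "norm (\<Sum>\<rho>\<in>A - zeros. of_real (zmult \<rho>) / (s - \<rho>)) \<le> (\<Sum>\<rho>\<in>A - zeros. 8 * zmult \<rho>)" by (intro sum_norm_le)
      also have "\<dots> \<le> 8 * (C1 * lg t)" using cnt[of "A - zeros"] by (simp add: sum_distrib_left[symmetric])
      finally show ?thesis .
    qed
    have E2: "norm (\<Sum>\<rho>\<in>zeros \<inter> A. of_real (zmult \<rho>) / \<rho>) \<le> (1 / c) * (C1 * lg t)"
    proof -
      have "norm (of_real (zmult \<rho>) / \<rho>) \<le> (1 / c) * zmult \<rho>" if "\<rho> \<in> zeros \<inter> A" for \<rho>
      proof -
        have "c * 1 \<le> c * (1 + \<bar>Im \<rho>\<bar>)" using c by (intro mult_left_mono) auto
        hence "c \<le> norm \<rho>" using c(3)[of \<rho>] that by auto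
        hence "zmult \<rho> / norm \<rho> \<le> zmult \<rho> / c" using zmult_nonneg c
          by (intro divide_left_mono mult_pos_pos) (auto intro: less_le_trans)
        thus ?thesis using zmult_nonneg[of \<rho>] by (simp add: norm_divide)
      qed
      hence "norm (\<Sum>\<rho>\<in>zeros \<inter> A. of_real (zmult \<rho>) / \<rho>) \<le> (\<Sum>\<rho>\<in>zeros \<inter> A. (1/c) * zmult \<rho>)" by (intro sum_norm_le)
      also have "\<dots> \<le> (1/c) * (C1 * lg t)" unfolding sum_distrib_left[symmetric]
        using c by (intro mult_left_mono cnt) auto
      finally show ?thesis .
    qed
    have "zlog_rem s = - D - (\<Sum>\<rho>\<in>A - zeros. of_real (zmult \<rho>) / (s - \<rho>)) + (\<Sum>\<rho>\<in>zeros \<inter> A. of_real (zmult \<rho>) / \<rho>)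
       + (\<Sum>\<^sub>\<infinity>\<rho>\<in>zeros - A. pole_term \<rho> s)"
      using zlog_rem_eq[of s] s nz by (simp add: zlog_rem0_def split D_def split2)
    hence "norm (zlog_rem s) \<le> norm D + norm (\<Sum>\<rho>\<in>A - zeros. of_real (zmult \<rho>) / (s - \<rho>)) + norm (\<Sum>\<rho>\<in>zeros \<inter> A. of_real (zmult \<rho>) / \<rho>)
       + norm (\<Sum>\<^sub>\<infinity>\<rho>\<in>zeros - A. pole_term \<rho> s)"
      by (metis (no_types, lifting) norm_minus_cancel norm_triangle_le norm_triangle_le_diff order.refl add_mono)
    also have "\<dots> \<le> C1 * lg t + 8 * (C1 * lg t) + (1/c) * (C1 * lg t) + 3 / (c * (9/20)) * sqrt (2 + \<bar>t\<bar>) * (2 * C2 * lg t)"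
      by (intro add_mono D E E1 E2)
    also have "\<dots> \<le> (C1 * lg t + 8 * (C1 * lg t) + (1/c) * (C1 * lg t)) * sqrt (2 + \<bar>t\<bar>) + 3 / (c * (9/20)) * sqrt (2 + \<bar>t\<bar>) * (2 * C2 * lg t)"
    proof (rule add_right_mono)
      have "(C1 * lg t + 8 * (C1 * lg t) + (1/c) * (C1 * lg t)) * 1 \<le> (C1 * lg t + 8 * (C1 * lg t) + (1/c) * (C1 * lg t)) * sqrt (2 + \<bar>t\<bar>)"
        using C1(1) c lg_pos[of t] by (intro mult_left_mono add_nonneg_nonneg mult_nonneg_nonneg) auto
      thus "C1 * lg t + 8 * (C1 * lg t) + (1/c) * (C1 * lg t) \<le> (C1 * lg t + 8 * (C1 * lg t) + (1/c) * (C1 * lg t)) * sqrt (2 + \<bar>t\<bar>)" by simp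
    qed
    also have "\<dots> = (C / 8) * (lg t * sqrt (2 + \<bar>t\<bar>))" by (simp add: C_def algebra_simps)
    also have "\<dots> \<le> (C / 8) * (8 * (2 + \<bar>t\<bar>) powr (1/8) * (2 + \<bar>t\<bar>) powr (1/2))"
      using c C1 C2 by (intro mult_left_mono mult_mono lg_le_powr) (auto simp: C_def powr_half_sqrt add_nonneg_nonneg)
    also have "\<dots> = C * (2 + \<bar>t\<bar>) powr (5/8)"
    proof -
      have "(2 + \<bar>t\<bar>) powr (1/8) * (2 + \<bar>t\<bar>) powr (1/2) = (2 + \<bar>t\<bar>) powr (5/8)"
        by (simp add: powr_add[symmetric])
      thus ?thesis by simp
    qed
    finally show ?thesis by (simp add: t_def)
  qed
  show ?thesis
  proof (rule that[of C])
    show "C > 0" unfolding C_def using c C1 C2 by (intro mult_pos_pos add_pos_pos) auto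
    fix s assume s: "-3/4 \<le> Re s" "Re s \<le> 2"
    \<comment> \<open>At a zero of \<open>zeta_entire\<close> the bound follows by continuity,
      approaching the point vertically so that the real part stays in the allowed range.\<close>
    let ?w = "\<lambda>e::real. s + \<i> * of_real e"
    have fl: "filterlim ?w (at s) (at_right 0)" unfolding filterlim_at
    proof
      show "(?w \<longlongrightarrow> s) (at_right 0)" by (auto intro!: tendsto_eq_intros)
      show "\<forall>\<^sub>F x in at_right 0. ?w x \<in> UNIV \<and> ?w x \<noteq> s"
        using eventually_at_right_less[of "0::real"] by eventually_elim auto
    qed
    have "isCont zlog_rem s" using zlog_rem_analytic[of s] s by (intro analytic_at_imp_isCont) auto
    hence 1: "((\<lambda>e. norm (zlog_rem (?w e))) \<longlongrightarrow> norm (zlog_rem s)) (at_right 0)"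
      by (intro tendsto_norm filterlim_compose[OF _ fl]) (simp add: isCont_def)
    have 2: "((\<lambda>e. C * (2 + \<bar>Im (?w e)\<bar>) powr (5/8)) \<longlongrightarrow> C * (2 + \<bar>Im s\<bar>) powr (5/8)) (at_right 0)"
      by (auto intro!: tendsto_eq_intros)
    obtain d where d: "d > 0" "\<And>w. zeta_entire w = 0 \<Longrightarrow> w \<noteq> s \<Longrightarrow> dist s w \<ge> 2 * d"
      using zeros_isolated[of s] by metis
    have "\<forall>\<^sub>F e in at_right 0. norm (zlog_rem (?w e)) \<le> C * (2 + \<bar>Im (?w e)\<bar>) powr (5/8)"
      using eventually_at_right_less[of "0::real"] eventually_at_right_real[OF d(1)]
    proof eventually_elim
      case (elim e)
      have "zeta_entire (?w e) \<noteq> 0" using d(2)[of "?w e"] elim by (auto simp: dist_norm norm_mult)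
      thus ?case using b0[of "?w e"] s by simp
    qed
    thus "norm (zlog_rem s) \<le> C * (2 + \<bar>Im s\<bar>) powr (5/8)"
      by (intro tendsto_le[OF _ 2 1]) auto
  qed
qed

section \<open>Integrals along vertical lines\<close>

lemma integrable_decay:
  fixes p :: real
  assumes p: "p < -1"
  shows "integrable lborel (\<lambda>t. (1 + \<bar>t\<bar>) powr p)"
proof -
  let ?f = "\<lambda>t. (1 + \<bar>t\<bar>) powr p"
  have "(\<integral>\<^sup>+ x. ennreal (?f x) * indicator {0..} x \<partial>lborel) = ennreal (0 - (1 + 0) powr (p + 1) / (p + 1))"
  proof (rule nn_integral_FTC_atLeast[where F = "\<lambda>x. (1 + x) powr (p + 1) / (p + 1)"])
    show "((\<lambda>x. (1 + x) powr (p + 1) / (p + 1)) has_real_derivative (1 + \<bar>x\<bar>) powr p) (at x)" if "0 \<le> x" for x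
      using that p by (auto intro!: derivative_eq_intros)
    show "((\<lambda>x. (1 + x) powr (p + 1) / (p + 1)) \<longlongrightarrow> 0) at_top"
      using p by real_asymp
  qed auto
  hence 1: "set_integrable lborel {0..} ?f"
    unfolding set_integrable_def
    by (intro integrableI_bounded) (auto simp: mult.commute indicator_mult_ennreal[symmetric] ennreal_mult'' less_top[symmetric] ennreal_indicator[symmetric])
  hence 2: "integrable lborel (\<lambda>x. indicator {0..} x * ?f x)" by (simp add: set_integrable_def)
  hence 3: "integrable lborel (\<lambda>x. indicator {0..} (-x) * ?f (-x))"
    using lborel_integrable_real_affine[OF 2, of "-1" 0] by simp
  show ?thesis
  proof (rule Bochner_Integration.integrable_bound[OF Bochner_Integration.integrable_add[OF 2 3]])
    show "AE x in lborel. norm (?f x) \<le> norm (indicator {0..} x * ?f x + indicator {0..} (-x) * ?f (-x))"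
      by (intro AE_I2) (auto simp: indicator_def)
  qed auto
qed

lemma integrable_of_decay:
  fixes f :: "real \<Rightarrow> complex"
  assumes "continuous_on UNIV f" "\<And>t. norm (f t) \<le> C * (1 + \<bar>t\<bar>) powr p" "p < -1"
  shows "integrable lborel f"
proof (rule Bochner_Integration.integrable_bound[of lborel "\<lambda>t. C * (1 + \<bar>t\<bar>) powr p"])
  show "integrable lborel (\<lambda>t. C * (1 + \<bar>t\<bar>) powr p)" by (intro integrable_mult_right integrable_decay assms)
  show "AE t in lborel. norm (f t) \<le> norm (C * (1 + \<bar>t\<bar>) powr p)"
    using order_trans[OF assms(2) abs_ge_self] by (intro AE_I2) simp
qed (use assms(1) borel_measurable_continuous_onI in auto)

lemma integral_truncated_tendsto:
  fixes f :: "real \<Rightarrow> complex"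
  assumes "integrable lborel f" "continuous_on UNIV f"
  shows "(\<lambda>n::nat. integral {-real n..real n} f) \<longlonglongrightarrow> (LINT t|lborel. f t)"
proof -
  have "(\<lambda>n::nat. LINT t|lborel. indicator {-real n..real n} t *\<^sub>R f t) \<longlonglongrightarrow> (LINT t|lborel. f t)"
  proof (rule integral_dominated_convergence[where w = "\<lambda>t. norm (f t)"])
    show "AE t in lborel. (\<lambda>n. indicator {-real n..real n} t *\<^sub>R f t) \<longlonglongrightarrow> f t"
    proof (rule AE_I2)
      fix t :: real
      obtain N :: nat where N: "\<bar>t\<bar> \<le> real N" using real_arch_simple by blast
      have "\<forall>\<^sub>F n in sequentially. f t = indicator {-real n..real n} t *\<^sub>R f t"
        using eventually_ge_at_top[of N] by eventually_elim (use N in \<open>auto simp: indicator_def\<close>)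
      thus "(\<lambda>n. indicator {-real n..real n} t *\<^sub>R f t) \<longlonglongrightarrow> f t"
        by (rule Lim_transform_eventually[OF tendsto_const])
    qed
    show "AE t in lborel. norm (indicator {-real n..real n} t *\<^sub>R f t) \<le> norm (f t)" for n
      by (intro AE_I2) (auto simp: indicator_def)
  qed (use assms in auto)
  also have "(\<lambda>n::nat. LINT t|lborel. indicator {-real n..real n} t *\<^sub>R f t) = (\<lambda>n. integral {-real n..real n} f)"
  proof
    fix n :: nat
    have "set_integrable lborel {-real n..real n} f"
      unfolding set_integrable_def by (intro integrable_mult_indicator assms) auto
    from set_borel_integral_eq_integral(2)[OF this]
    show "(LINT t|lborel. indicator {-real n..real n} t *\<^sub>R f t) = integral {-real n..real n} f"
      by (simp add: set_lebesgue_integral_def)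
  qed
  finally show ?thesis .
qed

lemma contour_integral_rectpath:
  assumes c: "c1 < c2" "n > 0" and f: "continuous_on (path_image (rectpath (Complex c1 (-n)) (Complex c2 n))) f"
  shows "contour_integral (rectpath (Complex c1 (-n)) (Complex c2 n)) f =
    contour_integral (linepath (Complex c1 (-n)) (Complex c2 (-n))) f + \<i> * integral {-n..n} (\<lambda>t. f (Complex c2 t))
    + contour_integral (linepath (Complex c2 n) (Complex c1 n)) f - \<i> * integral {-n..n} (\<lambda>t. f (Complex c1 t))"
proof -
  let ?a1 = "Complex c1 (-n)" and ?a2 = "Complex c2 (-n)" and ?a3 = "Complex c2 n" and ?a4 = "Complex c1 n"
  have im: "path_image (rectpath ?a1 ?a3) = closed_segment ?a1 ?a2 \<union> closed_segment ?a2 ?a3 \<union> closed_segment ?a3 ?a4 \<union> closed_segment ?a4 ?a1"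
    by (simp add: rectpath_def Let_def path_image_join Un_assoc)
  have i: "f contour_integrable_on linepath ?a1 ?a2" "f contour_integrable_on linepath ?a2 ?a3"
    "f contour_integrable_on linepath ?a3 ?a4" "f contour_integrable_on linepath ?a4 ?a1"
    by (auto intro!: contour_integrable_continuous_linepath continuous_on_subset[OF f] simp: im)
  have "contour_integral (rectpath ?a1 ?a3) f = contour_integral (linepath ?a1 ?a2) f + (contour_integral (linepath ?a2 ?a3) f
      + (contour_integral (linepath ?a3 ?a4) f + contour_integral (linepath ?a4 ?a1) f))"
    using i by (simp add: rectpath_def Let_def contour_integrable_join valid_path_join)
  moreover have "contour_integral (linepath ?a2 ?a3) f = \<i> * integral {-n..n} (\<lambda>t. f (Complex c2 t))"
    by (rule contour_integral_linepath_same_Re) (use c in auto)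
  moreover have "contour_integral (linepath ?a1 ?a4) f = \<i> * integral {-n..n} (\<lambda>t. f (Complex c1 t))"
    by (rule contour_integral_linepath_same_Re) (use c in auto)
  moreover have "contour_integral (linepath ?a4 ?a1) f = - contour_integral (linepath ?a1 ?a4) f"
    using contour_integral_reversepath[of "linepath ?a1 ?a4" f] by simp
  ultimately show ?thesis by simp
qed

lemma continuous_on_vertical:
  assumes "continuous_on S f" "\<And>t. Complex c t \<in> S"
  shows "continuous_on UNIV (\<lambda>t. f (Complex c t))"
proof (rule continuous_on_compose2[OF assms(1)])
  show "continuous_on UNIV (\<lambda>t. Complex c t)" unfolding Complex_eq by (intro continuous_intros)
  show "range (\<lambda>t. Complex c t) \<subseteq> S" using assms(2) by blast
qed

lemma norm_contour_integral_horizontal_le: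
  assumes f: "continuous_on (closed_segment (Complex c1 y) (Complex c2 y)) f"
    and bd: "\<And>c. c \<in> closed_segment c1 c2 \<Longrightarrow> norm (f (Complex c y)) \<le> B"
  shows "norm (contour_integral (linepath (Complex c1 y) (Complex c2 y)) f) \<le> B * \<bar>c2 - c1\<bar>"
proof -
  have B: "B \<ge> 0" using order_trans[OF norm_ge_zero bd[of c1]] by simp
  have "norm (contour_integral (linepath (Complex c1 y) (Complex c2 y)) f) \<le> B * norm (Complex c2 y - Complex c1 y)"
  proof (rule contour_integral_bound_linepath)
    show "f contour_integrable_on linepath (Complex c1 y) (Complex c2 y)"
      by (rule contour_integrable_continuous_linepath[OF f])
    fix x assume x: "x \<in> closed_segment (Complex c1 y) (Complex c2 y)"
    hence "Im x = y" "Re x \<in> closed_segment c1 c2" by (auto simp: closed_segment_same_Im)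
    thus "norm (f x) \<le> B" using bd[of "Re x"] by (metis complex.collapse)
  qed (use B in auto)
  also have "Complex c2 y - Complex c1 y = of_real (c2 - c1)" by (simp add: complex_eq_iff)
  finally show ?thesis by (simp only: norm_of_real)
qed

text \<open>Cauchy's theorem on rectangles of growing height; the decay makes the horizontal sides
  vanish.\<close>

lemma line_integral_shift:
  assumes f: "f holomorphic_on {z. a0 < Re z \<and> Re z < b0}" and ab: "a0 < a" "a < b" "b < b0" and p: "p < -1"
    and bd: "\<And>z. a \<le> Re z \<Longrightarrow> Re z \<le> b \<Longrightarrow> norm (f z) \<le> C * (1 + \<bar>Im z\<bar>) powr p"
  shows "(LINT t|lborel. f (Complex a t)) = (LINT t|lborel. f (Complex b t))"
proof -
  let ?S = "{z. a0 < Re z \<and> Re z < b0}"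
  have S: "convex ?S"
  proof -
    have "?S = {z. a0 < Re z} \<inter> {z. Re z < b0}" by auto
    thus ?thesis by (simp add: convex_Int convex_halfspace_Re_gt convex_halfspace_Re_lt)
  qed
  have cont: "continuous_on ?S f" by (rule holomorphic_on_imp_continuous_on[OF f])
  have ca: "continuous_on UNIV (\<lambda>t. f (Complex a t))" "continuous_on UNIV (\<lambda>t. f (Complex b t))"
    by (rule continuous_on_vertical[OF cont]; use ab in simp)+
  have ia: "integrable lborel (\<lambda>t. f (Complex a t))"
    by (rule integrable_of_decay[OF ca(1), of C p]) (use bd[of "Complex a _"] ab p in auto)
  have ib: "integrable lborel (\<lambda>t. f (Complex b t))"
    by (rule integrable_of_decay[OF ca(2), of C p]) (use bd[of "Complex b _"] ab p in auto)
  have lim: "(\<lambda>n::nat. integral {-real n..real n} (\<lambda>t. f (Complex b t)) - integral {-real n..real n} (\<lambda>t. f (Complex a t)))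
      \<longlonglongrightarrow> (LINT t|lborel. f (Complex b t)) - (LINT t|lborel. f (Complex a t))"
    by (intro tendsto_diff integral_truncated_tendsto ia ib ca)
  have "(\<lambda>n::nat. integral {-real n..real n} (\<lambda>t. f (Complex b t)) - integral {-real n..real n} (\<lambda>t. f (Complex a t))) \<longlonglongrightarrow> 0"
  proof (rule Lim_null_comparison)
    show "(\<lambda>n::nat. 2 * (C * (1 + real n) powr p * (b - a))) \<longlonglongrightarrow> 0" using p by real_asymp
    show "\<forall>\<^sub>F n::nat in sequentially. norm (integral {-real n..real n} (\<lambda>t. f (Complex b t)) - integral {-real n..real n} (\<lambda>t. f (Complex a t)))
        \<le> 2 * (C * (1 + real n) powr p * (b - a))"
      using eventually_gt_at_top[of "0::nat"]
    proof eventually_elim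
      case (elim n)
      let ?R = "rectpath (Complex a (-real n)) (Complex b (real n))"
      have im: "path_image ?R \<subseteq> ?S"
      proof -
        have "path_image ?R \<subseteq> cbox (Complex a (-real n)) (Complex b (real n))"
          by (rule path_image_rectpath_subset_cbox) (use ab elim in auto)
        also have "\<dots> \<subseteq> ?S" using ab by (auto simp: in_cbox_complex_iff)
        finally show ?thesis .
      qed
      have "(f has_contour_integral 0) ?R"
        by (rule Cauchy_theorem_convex_simple[OF f S _ im]) auto
      hence 0: "contour_integral ?R f = 0" by (rule contour_integral_unique)
      let ?B = "contour_integral (linepath (Complex a (-real n)) (Complex b (-real n))) f"
      let ?T = "contour_integral (linepath (Complex b (real n)) (Complex a (real n))) f"
      have seg: "closed_segment (Complex a y) (Complex b y) \<subseteq> ?S" "closed_segment (Complex b y) (Complex a y) \<subseteq> ?S" for y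
        using ab by (auto simp: closed_segment_same_Im closed_segment_eq_real_ivl split: if_splits)
      have "norm ?B \<le> (C * (1 + real n) powr p) * \<bar>b - a\<bar>"
        by (rule norm_contour_integral_horizontal_le[OF continuous_on_subset[OF cont seg(1)]])
           (use bd[of "Complex _ (-real n)"] ab in \<open>auto simp: closed_segment_eq_real_ivl\<close>)
      moreover have "norm ?T \<le> (C * (1 + real n) powr p) * \<bar>a - b\<bar>"
        by (rule norm_contour_integral_horizontal_le[OF continuous_on_subset[OF cont seg(2)]])
           (use bd[of "Complex _ (real n)"] ab in \<open>auto simp: closed_segment_eq_real_ivl\<close>)
      ultimately have "norm (?B + ?T) \<le> 2 * (C * (1 + real n) powr p * (b - a))"
        using norm_triangle_ineq[of ?B ?T] ab by simp
      moreover have "\<i> * (integral {-real n..real n} (\<lambda>t. f (Complex b t)) - integral {-real n..real n} (\<lambda>t. f (Complex a t))) = - (?B + ?T)"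
        using contour_integral_rectpath[of a b "real n" f] continuous_on_subset[OF cont im] elim ab 0 by (simp add: algebra_simps)
      hence "norm (\<i> * (integral {-real n..real n} (\<lambda>t. f (Complex b t)) - integral {-real n..real n} (\<lambda>t. f (Complex a t)))) = norm (?B + ?T)"
        by (simp only: norm_minus_cancel)
      ultimately show ?case by (simp add: norm_mult)
    qed
  qed
  with lim have "(LINT t|lborel. f (Complex b t)) - (LINT t|lborel. f (Complex a t)) = 0"
    by (rule LIMSEQ_unique)
  thus ?thesis by simp
qed

text \<open>One constant serves all abscissas \<open>c' >= c\<close>, so that the line of
  integration can be pushed to infinity.\<close>

lemma vertical_kernel_bound:
  fixes a b :: complex
  assumes "c > Re a" "c > Re b"
  obtains C where "C > 0" "\<And>c' t. c' \<ge> c \<Longrightarrow> norm (1 / ((Complex c' t - a) * (Complex c' t - b))) \<le> C * (1 + \<bar>t\<bar>) powr (-2)"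
proof -
  have one: "\<exists>k>0. \<forall>c' t. c' \<ge> c \<longrightarrow> k * (1 + \<bar>t\<bar>) \<le> norm (Complex c' t - a)" if "c > Re a" for a
  proof -
    define d where "d = c - Re a"
    have d: "d > 0" using that by (simp add: d_def)
    define k where "k = d / (1 + d + \<bar>Im a\<bar>)"
    have "k * (1 + \<bar>t\<bar>) \<le> norm (Complex c' t - a)" if c': "c' \<ge> c" for c' t
    proof -
      have 1: "d \<le> norm (Complex c' t - a)" using complex_Re_le_cmod[of "Complex c' t - a"] c' by (simp add: d_def)
      have 2: "\<bar>t - Im a\<bar> \<le> norm (Complex c' t - a)" using abs_Im_le_cmod[of "Complex c' t - a"] by simp
      have "d * (1 + \<bar>t\<bar>) \<le> d * (1 + \<bar>Im a\<bar>) + d * \<bar>t - Im a\<bar>"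
        using d mult_left_mono[of "\<bar>t\<bar>" "\<bar>Im a\<bar> + \<bar>t - Im a\<bar>" d] by (simp add: algebra_simps)
      also have "\<dots> \<le> norm (Complex c' t - a) * (1 + \<bar>Im a\<bar>) + d * norm (Complex c' t - a)"
        using 1 2 d by (intro add_mono mult_left_mono mult_right_mono) auto
      finally show ?thesis using d by (simp add: k_def field_simps)
    qed
    moreover have "k > 0" using d by (simp add: k_def)
    ultimately show ?thesis by blast
  qed
  obtain k1 where k1: "k1 > 0" "\<And>c' t. c' \<ge> c \<Longrightarrow> k1 * (1 + \<bar>t\<bar>) \<le> norm (Complex c' t - a)" using one[OF assms(1)] by blast
  obtain k2 where k2: "k2 > 0" "\<And>c' t. c' \<ge> c \<Longrightarrow> k2 * (1 + \<bar>t\<bar>) \<le> norm (Complex c' t - b)" using one[OF assms(2)] by blast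
  show ?thesis
  proof (rule that[of "1 / (k1 * k2)"])
    show "1 / (k1 * k2) > 0" using k1 k2 by simp
    fix c' t assume c': "c' \<ge> c"
    have "0 < k1 * (1 + \<bar>t\<bar>)" "0 < k2 * (1 + \<bar>t\<bar>)" using k1 k2 by (auto intro!: mult_pos_pos)
    hence pos: "0 < norm (Complex c' t - a)" "0 < norm (Complex c' t - b)"
      using k1(2)[OF c', of t] k2(2)[OF c', of t] by linarith+
    have "norm (1 / ((Complex c' t - a) * (Complex c' t - b))) = 1 / (norm (Complex c' t - a) * norm (Complex c' t - b))"
      by (simp add: norm_divide norm_mult)
    also have "\<dots> \<le> 1 / ((k1 * (1 + \<bar>t\<bar>)) * (k2 * (1 + \<bar>t\<bar>)))"
      using k1 k2 c' pos by (intro divide_left_mono mult_mono mult_pos_pos) auto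
    also have "\<dots> = 1 / (k1 * k2) * (1 + \<bar>t\<bar>) powr (-2)"
    proof -
      have "(1 + \<bar>t\<bar>) powr (-2) = 1 / (1 + \<bar>t\<bar>)\<^sup>2" by (simp add: powr_minus divide_inverse powr_numeral)
      thus ?thesis by (simp add: power2_eq_square)
    qed
    finally show "norm (1 / ((Complex c' t - a) * (Complex c' t - b))) \<le> 1 / (k1 * k2) * (1 + \<bar>t\<bar>) powr (-2)" .
  qed
qed

lemma vertical_kernel_integrable:
  fixes a b :: complex
  assumes c: "c > Re a" "c > Re b"
  shows "integrable lborel (\<lambda>t. exp (Complex c t * of_real u) / ((Complex c t - a) * (Complex c t - b)))"
proof -
  obtain C where C: "C > 0" "\<And>c' t. c' \<ge> c \<Longrightarrow> norm (1 / ((Complex c' t - a) * (Complex c' t - b))) \<le> C * (1 + \<bar>t\<bar>) powr (-2)"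
    using vertical_kernel_bound[OF c] by metis
  show ?thesis
  proof (rule integrable_of_decay[where C = "exp (c * u) * C" and p = "-2"])
    have nz: "Complex c t - a \<noteq> 0" "Complex c t - b \<noteq> 0" for t using c by (auto simp: complex_eq_iff)
    show "continuous_on UNIV (\<lambda>t. exp (Complex c t * of_real u) / ((Complex c t - a) * (Complex c t - b)))"
      using nz unfolding Complex_eq by (intro continuous_intros) auto
    fix t
    have "norm (exp (Complex c t * of_real u) / ((Complex c t - a) * (Complex c t - b))) = exp (c * u) * norm (1 / ((Complex c t - a) * (Complex c t - b)))"
      by (simp add: norm_divide)
    also have "\<dots> \<le> exp (c * u) * (C * (1 + \<bar>t\<bar>) powr (-2))" by (intro mult_left_mono C) auto
    finally show "norm (exp (Complex c t * of_real u) / ((Complex c t - a) * (Complex c t - b))) \<le> exp (c * u) * C * (1 + \<bar>t\<bar>) powr (-2)"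
      by (simp add: mult.assoc)
  qed simp
qed

text \<open>No pole lies to the right of the line. Moving the line to the right multiplies the bound
  by \<open>exp (c' * u)\<close>, which tends to 0.\<close>

lemma vertical_kernel_neg:
  fixes a b :: complex
  assumes c: "c > Re a" "c > Re b" and u: "u < 0"
  shows "(LINT t|lborel. exp (Complex c t * of_real u) / ((Complex c t - a) * (Complex c t - b))) = 0"
proof -
  obtain C where C: "C > 0" "\<And>c' t. c' \<ge> c \<Longrightarrow> norm (1 / ((Complex c' t - a) * (Complex c' t - b))) \<le> C * (1 + \<bar>t\<bar>) powr (-2)"
    using vertical_kernel_bound[OF c] by metis
  define f :: "complex \<Rightarrow> complex" where "f = (\<lambda>s::complex. exp (s * of_real u) / ((s - a) * (s - b)))"
  define J where "J = (LINT t|lborel. C * (1 + \<bar>t\<bar>) powr (-2))"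
  have bd: "norm (f (Complex c' t)) \<le> exp (c' * u) * (C * (1 + \<bar>t\<bar>) powr (-2))" if "c' \<ge> c" for c' t
  proof -
    have "norm (f (Complex c' t)) = exp (c' * u) * norm (1 / ((Complex c' t - a) * (Complex c' t - b)))"
      by (simp add: f_def norm_divide)
    also have "\<dots> \<le> exp (c' * u) * (C * (1 + \<bar>t\<bar>) powr (-2))" by (intro mult_left_mono C that) auto
    finally show ?thesis .
  qed
  define m where "m = max (Re a) (Re b)"
  have sh: "(LINT t|lborel. f (Complex c t)) = (LINT t|lborel. f (Complex c' t))" if "c' > c" for c'
  proof (rule line_integral_shift[where f = f and a = c and b = c' and a0 = m and b0 = "c' + 1" and p = "-2" and C = "exp (c * u) * C"])
    show "f holomorphic_on {z. m < Re z \<and> Re z < c' + 1}" unfolding f_def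
      by (intro holomorphic_intros) (auto simp: m_def)
    fix z assume z: "c \<le> Re z" "Re z \<le> c'"
    have "norm (f z) \<le> exp (Re z * u) * (C * (1 + \<bar>Im z\<bar>) powr (-2))"
      using bd[of "Re z" "Im z"] z by simp
    also have "\<dots> \<le> exp (c * u) * (C * (1 + \<bar>Im z\<bar>) powr (-2))"
      using z u C by (intro mult_right_mono) (auto intro: mult_right_mono_neg)
    finally show "norm (f z) \<le> exp (c * u) * C * (1 + \<bar>Im z\<bar>) powr (-2)" by (simp add: mult.assoc)
  qed (use c that in \<open>auto simp: m_def\<close>)
  have le: "norm (LINT t|lborel. f (Complex c t)) \<le> exp (c' * u) * J" if "c' > c" for c'
  proof -
    have "norm (LINT t|lborel. f (Complex c' t)) \<le> (LINT t|lborel. norm (f (Complex c' t)))" by (rule integral_norm_bound)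
    also have "\<dots> \<le> (LINT t|lborel. exp (c' * u) * (C * (1 + \<bar>t\<bar>) powr (-2)))"
    proof (rule integral_mono)
      show "integrable lborel (\<lambda>t. norm (f (Complex c' t)))" unfolding f_def
        by (intro integrable_norm vertical_kernel_integrable) (use c that in auto)
      show "integrable lborel (\<lambda>t. exp (c' * u) * (C * (1 + \<bar>t\<bar>) powr (-2)))"
        by (intro integrable_mult_right integrable_decay) auto
    qed (use bd that in auto)
    also have "\<dots> = exp (c' * u) * J" unfolding J_def by simp
    finally show ?thesis using sh[OF that] by simp
  qed
  have "((\<lambda>c'. exp (c' * u) * J) \<longlongrightarrow> 0) at_top" using u by real_asymp
  moreover have "\<forall>\<^sub>F c' in at_top. norm (LINT t|lborel. f (Complex c t)) \<le> exp (c' * u) * J"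
    using eventually_gt_at_top[of c] by eventually_elim (rule le)
  ultimately have "norm (LINT t|lborel. f (Complex c t)) \<le> 0" by (rule tendsto_lowerbound) simp
  thus ?thesis by (simp add: f_def)
qed

text \<open>For \<open>u >= 0\<close> the contour is closed to the left, where the exponential stays
  bounded. Partial fractions, possible because \<open>a \<noteq> b\<close>, reduce the two residues
  to Cauchy's integral formula.\<close>

lemma vertical_kernel_nonneg:
  fixes a b :: complex
  assumes c: "c > Re a" "c > Re b" and ab: "a \<noteq> b" and u: "u \<ge> 0"
  shows "(LINT t|lborel. exp (Complex c t * of_real u) / ((Complex c t - a) * (Complex c t - b)))
         = 2 * pi * ((exp (a * of_real u) - exp (b * of_real u)) / (a - b))"
proof -
  define f :: "complex \<Rightarrow> complex" where "f = (\<lambda>s::complex. exp (s * of_real u) / ((s - a) * (s - b)))"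
  \<comment> \<open>For \<open>n > 2 * m\<close> both poles lie inside the rectangle and at distance
    at least \<open>n / 2\<close> from its left, upper and lower sides.\<close>
  define m where "m = max (c - Re a) (max (c - Re b) (max \<bar>Im a\<bar> \<bar>Im b\<bar>))"
  let ?V = "2 * pi * ((exp (a * of_real u) - exp (b * of_real u)) / (a - b))"
  have cf: "continuous_on (- {a, b}) f" unfolding f_def by (intro continuous_intros) auto
  have lim: "(\<lambda>n::nat. integral {-real n..real n} (\<lambda>t. f (Complex c t))) \<longlonglongrightarrow> (LINT t|lborel. f (Complex c t))"
  proof (rule integral_truncated_tendsto)
    show "integrable lborel (\<lambda>t. f (Complex c t))" unfolding f_def by (rule vertical_kernel_integrable[OF c])
    show "continuous_on UNIV (\<lambda>t. f (Complex c t))" by (rule continuous_on_vertical[OF cf]) (use c in auto)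
  qed
  have "(\<lambda>n::nat. integral {-real n..real n} (\<lambda>t. f (Complex c t)) - ?V) \<longlonglongrightarrow> 0"
  proof (rule Lim_null_comparison)
    \<comment> \<open>On these three sides, of total length \<open>4 * n\<close>, the integrand is
      at most \<open>4 * exp (c * u) / n^2\<close>.\<close>
    show "(\<lambda>n::nat. 16 * exp (c * u) / real n) \<longlonglongrightarrow> 0" by real_asymp
    show "\<forall>\<^sub>F n::nat in sequentially. norm (integral {-real n..real n} (\<lambda>t. f (Complex c t)) - ?V) \<le> 16 * exp (c * u) / real n"
      using eventually_gt_at_top[of "nat \<lceil>2 * m\<rceil> + 1"]
    proof eventually_elim
      case (elim n)
      have n: "real n > 2 * m" "real n > 0" using elim by linarith+
      have nm: "real n > 2 * (c - Re a)" "real n > 2 * (c - Re b)" "real n > 2 * \<bar>Im a\<bar>" "real n > 2 * \<bar>Im b\<bar>"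
      proof -
        have "c - Re a \<le> m" "c - Re b \<le> m" "\<bar>Im a\<bar> \<le> m" "\<bar>Im b\<bar> \<le> m" by (auto simp: m_def le_max_iff_disj)
        thus "real n > 2 * (c - Re a)" "real n > 2 * (c - Re b)" "real n > 2 * \<bar>Im a\<bar>" "real n > 2 * \<bar>Im b\<bar>"
          using n by auto
      qed
      let ?a1 = "Complex (c - real n) (-real n)" and ?a3 = "Complex c (real n)"
      let ?R = "rectpath ?a1 ?a3"
      have box: "a \<in> box ?a1 ?a3" "b \<in> box ?a1 ?a3" using nm c n by (auto simp: in_box_complex_iff)
      have im: "path_image ?R \<subseteq> - {a, b}"
        using path_image_rectpath_inter_box[of ?a1 ?a3] box n by auto
      have E: "((\<lambda>w. exp (w * of_real u) / (w - z)) has_contour_integral (2*pi * \<i> * winding_number ?R z * exp (z * of_real u))) ?R"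
        if "z \<in> {a, b}" for z
        by (rule Cauchy_integral_formula_convex_simple[of UNIV]) (use that im in \<open>auto intro!: holomorphic_intros\<close>)
      have W: "winding_number ?R a = 1" "winding_number ?R b = 1" by (rule winding_number_rectpath, rule box)+
      have "((\<lambda>w. (1 / (a - b)) * (exp (w * of_real u) / (w - a) - exp (w * of_real u) / (w - b))) has_contour_integral
          (1 / (a - b)) * (2*pi * \<i> * winding_number ?R a * exp (a * of_real u) - 2*pi * \<i> * winding_number ?R b * exp (b * of_real u))) ?R"
        by (intro has_contour_integral_lmul has_contour_integral_diff E) auto
      moreover have "(1 / (a - b)) * (exp (w * of_real u) / (w - a) - exp (w * of_real u) / (w - b)) = f w" if "w \<in> path_image ?R" for w
      proof -
        have "w - a \<noteq> 0" "w - b \<noteq> 0" "a - b \<noteq> 0" using that im ab by auto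
        thus ?thesis unfolding f_def by (simp add: divide_simps) (simp add: algebra_simps)
      qed
      ultimately have "(f has_contour_integral
          (1 / (a - b)) * (2*pi * \<i> * winding_number ?R a * exp (a * of_real u) - 2*pi * \<i> * winding_number ?R b * exp (b * of_real u))) ?R"
        by (rule has_contour_integral_eq)
      hence CI: "contour_integral ?R f = \<i> * ?V"
        unfolding W by (subst contour_integral_unique, assumption) (simp add: algebra_simps diff_divide_distrib)
      have fb: "norm (f z) \<le> 4 * exp (c * u) / (real n)\<^sup>2" if "Re z \<le> c" "real n / 2 \<le> norm (z - a)" "real n / 2 \<le> norm (z - b)" for z
      proof -
        have "norm (f z) = exp (Re z * u) / (norm (z - a) * norm (z - b))" by (simp add: f_def norm_divide norm_mult)
        also have "\<dots> \<le> exp (c * u) / ((real n / 2) * (real n / 2))"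
          using that u n by (intro frac_le mult_mono) (auto intro: mult_right_mono)
        also have "\<dots> = 4 * exp (c * u) / (real n)\<^sup>2" by (simp add: power2_eq_square)
        finally show ?thesis .
      qed
      have far1: "real n / 2 \<le> norm (z - a)" "real n / 2 \<le> norm (z - b)" if "\<bar>Im z\<bar> = real n" for z
        using abs_Im_le_cmod[of "z - a"] abs_Im_le_cmod[of "z - b"] that nm by auto
      have far2: "real n / 2 \<le> norm (z - a)" "real n / 2 \<le> norm (z - b)" if "Re z = c - real n" for z
        using abs_Re_le_cmod[of "z - a"] abs_Re_le_cmod[of "z - b"] that nm by auto
      let ?B = "contour_integral (linepath (Complex (c - real n) (-real n)) (Complex c (-real n))) f"
      let ?T = "contour_integral (linepath (Complex c (real n)) (Complex (c - real n) (real n))) f"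
      let ?L = "integral {-real n..real n} (\<lambda>t. f (Complex (c - real n) t))"
      have segs: "closed_segment (Complex c1 y) (Complex c2 y) \<subseteq> - {a, b}" if "\<bar>y\<bar> = real n" for c1 c2 y
        using that nm by (auto simp: closed_segment_same_Im)
      have B: "norm ?B \<le> 4 * exp (c * u) / (real n)\<^sup>2 * \<bar>c - (c - real n)\<bar>"
        by (rule norm_contour_integral_horizontal_le[OF continuous_on_subset[OF cf segs]])
           (use n in \<open>auto simp: closed_segment_eq_real_ivl intro!: fb far1\<close>)
      have T: "norm ?T \<le> 4 * exp (c * u) / (real n)\<^sup>2 * \<bar>(c - real n) - c\<bar>"
        by (rule norm_contour_integral_horizontal_le[OF continuous_on_subset[OF cf segs]])
           (use n in \<open>auto simp: closed_segment_eq_real_ivl intro!: fb far1\<close>)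
      have cL: "continuous_on UNIV (\<lambda>t. f (Complex (c - real n) t))"
        by (rule continuous_on_vertical[OF cf]) (use nm in auto)
      have L: "norm ?L \<le> 4 * exp (c * u) / (real n)\<^sup>2 * (real n - (- real n))"
        by (rule integral_bound) (use n in \<open>auto intro!: fb far2 continuous_on_subset[OF cL]\<close>)
      have "\<i> * ?V = ?B + \<i> * integral {-real n..real n} (\<lambda>t. f (Complex c t)) + ?T - \<i> * ?L"
        unfolding CI[symmetric] by (rule contour_integral_rectpath) (use n continuous_on_subset[OF cf im] in auto)
      hence "\<i> * (integral {-real n..real n} (\<lambda>t. f (Complex c t)) - ?V) = \<i> * ?L - ?B - ?T" by (simp add: algebra_simps)
      hence "norm (\<i> * (integral {-real n..real n} (\<lambda>t. f (Complex c t)) - ?V)) = norm (\<i> * ?L - ?B - ?T)" by (simp only:)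
      hence "norm (integral {-real n..real n} (\<lambda>t. f (Complex c t)) - ?V) \<le> norm ?L + norm ?B + norm ?T"
        using norm_triangle_ineq4[of "\<i> * ?L - ?B" ?T] norm_triangle_ineq4[of "\<i> * ?L" ?B] by (simp add: norm_mult)
      also have "\<dots> \<le> 4 * exp (c * u) / (real n)\<^sup>2 * (2 * real n) + 4 * exp (c * u) / (real n)\<^sup>2 * real n + 4 * exp (c * u) / (real n)\<^sup>2 * real n"
      proof -
        have e: "real n - (- real n) = 2 * real n" "\<bar>c - (c - real n)\<bar> = real n" "\<bar>(c - real n) - c\<bar> = real n" by auto
        show ?thesis using L B T unfolding e by (intro add_mono)
      qed
      also have "\<dots> = 16 * exp (c * u) / real n" using n by (simp add: power2_eq_square field_simps)
      finally show ?case .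
    qed
  qed
  hence "(\<lambda>n::nat. integral {-real n..real n} (\<lambda>t. f (Complex c t))) \<longlonglongrightarrow> ?V" by (simp only: LIM_zero_iff)
  from LIMSEQ_unique[OF lim this] show ?thesis by (simp only: f_def)
qed

section \<open>The explicit formula\<close>

lemma filterlim_exhaustion:
  assumes "\<And>n. finite (E n)" "\<And>n. E n \<subseteq> A" "\<And>x. x \<in> A \<Longrightarrow> \<forall>\<^sub>F n in sequentially. x \<in> E n"
  shows "filterlim E (finite_subsets_at_top A) sequentially"
  unfolding filterlim_finite_subsets_at_top
proof (intro allI impI)
  fix X assume X: "finite X \<and> X \<subseteq> A"
  hence "\<forall>\<^sub>F n in sequentially. \<forall>x\<in>X. x \<in> E n"
    using assms(3) by (intro eventually_ball_finite) auto
  thus "\<forall>\<^sub>F n in sequentially. finite (E n) \<and> X \<subseteq> E n \<and> E n \<subseteq> A"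
    by eventually_elim (use assms in auto)
qed

text \<open>A sequence exhausting the zeros, so that dominated convergence, stated for sequences,
  can exchange the sum over zeros with an integral.\<close>

definition zeros_upto :: "nat \<Rightarrow> complex set" where
  "zeros_upto n = {\<rho> \<in> zeros. \<bar>Im \<rho>\<bar> \<le> real n}"

lemma finite_zeros_upto: "finite (zeros_upto n)"
proof (rule finite_subset)
  show "finite (\<Union>j\<in>{-int n..int n}. disc_zeros (of_int j))"
  proof (intro finite_UN_I)
    show "finite (disc_zeros (of_int j))" for j
      by (rule zeta_entire_local) blast
  qed auto
  show "zeros_upto n \<subseteq> (\<Union>j\<in>{-int n..int n}. disc_zeros (of_int j))"
  proof
    fix \<rho> assume \<rho>: "\<rho> \<in> zeros_upto n"
    hence "\<lfloor>Im \<rho>\<rfloor> \<in> {-int n..int n}" by (auto simp: zeros_upto_def abs_le_iff) linarith+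
    moreover have "\<rho> \<in> disc_zeros (of_int \<lfloor>Im \<rho>\<rfloor>)"
      by (rule zeros_in_disc_zeros) (use \<rho> in \<open>auto simp: zeros_upto_def\<close>, linarith)
    ultimately show "\<rho> \<in> (\<Union>j\<in>{-int n..int n}. disc_zeros (of_int j))" by blast
  qed
qed

lemma zeros_upto_subset: "zeros_upto n \<subseteq> zeros" by (auto simp: zeros_upto_def)

lemma sum_zeros_upto_tendsto:
  fixes f :: "complex \<Rightarrow> complex"
  assumes "f summable_on zeros"
  shows "(\<lambda>n. \<Sum>\<rho>\<in>zeros_upto n. f \<rho>) \<longlonglongrightarrow> (\<Sum>\<^sub>\<infinity>\<rho>\<in>zeros. f \<rho>)"
proof -
  have "filterlim zeros_upto (finite_subsets_at_top zeros) sequentially"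
  proof (rule filterlim_exhaustion[OF finite_zeros_upto zeros_upto_subset])
    fix \<rho> assume \<rho>: "\<rho> \<in> zeros"
    obtain N :: nat where N: "\<bar>Im \<rho>\<bar> \<le> real N" using real_arch_simple by blast
    show "\<forall>\<^sub>F n in sequentially. \<rho> \<in> zeros_upto n"
      using eventually_ge_at_top[of N] by eventually_elim (use \<rho> N in \<open>auto simp: zeros_upto_def\<close>)
  qed
  moreover have "(sum f \<longlongrightarrow> (\<Sum>\<^sub>\<infinity>\<rho>\<in>zeros. f \<rho>)) (finite_subsets_at_top zeros)"
    using has_sum_infsum[OF assms] by (simp add: has_sum_def)
  ultimately show ?thesis by (rule filterlim_compose[rotated])
qed

lemma zeros_neq: "\<rho> \<in> zeros \<Longrightarrow> \<rho> \<noteq> 0 \<and> \<rho> \<noteq> -1"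
  using zeta_entire_0 by (auto simp: zeros_def)

text \<open>The bound Re \<rho> > -7/8 keeps \<open>\<rho> + 1\<close> at distance at least 1/8 from
  0; together with the bound by the height this gives the factor 9.\<close>

lemma zeros_quad_le:
  obtains K where "K > 0" "\<And>\<rho>. \<rho> \<in> zeros \<Longrightarrow> norm (1 / (\<rho> * (\<rho> + 1))) \<le> K * (1 + \<bar>Im \<rho>\<bar>) powr (-2)"
proof -
  obtain c where c: "c > 0" "\<And>\<rho>. \<rho> \<in> zeros \<Longrightarrow> c * (1 + \<bar>Im \<rho>\<bar>) \<le> norm \<rho>"
    using zeros_norm_ge by metis
  show ?thesis
  proof (rule that[of "9 / c"])
    fix \<rho> assume \<rho>: "\<rho> \<in> zeros"
    have "1/8 \<le> norm (\<rho> + 1)" using complex_Re_le_cmod[of "\<rho> + 1"] zeros_Re[OF \<rho>] by simp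
    moreover have "\<bar>Im \<rho>\<bar> \<le> norm (\<rho> + 1)" using abs_Im_le_cmod[of "\<rho> + 1"] by simp
    ultimately have 1: "(1 + \<bar>Im \<rho>\<bar>) / 9 \<le> norm (\<rho> + 1)" by simp
    have 2: "c * (1 + \<bar>Im \<rho>\<bar>) \<le> norm \<rho>" by (rule c) fact
    have "norm (1 / (\<rho> * (\<rho> + 1))) = 1 / (norm \<rho> * norm (\<rho> + 1))" by (simp add: norm_divide norm_mult)
    also have "\<dots> \<le> 1 / ((c * (1 + \<bar>Im \<rho>\<bar>)) * ((1 + \<bar>Im \<rho>\<bar>) / 9))"
      using 1 2 c zeros_neq[OF \<rho>] by (intro divide_left_mono mult_mono mult_pos_pos) (auto simp: add_eq_0_iff2)
    also have "\<dots> = 9 / c * (1 + \<bar>Im \<rho>\<bar>) powr (-2)"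
    proof -
      have "(1 + \<bar>Im \<rho>\<bar>) powr (-2) = 1 / (1 + \<bar>Im \<rho>\<bar>)\<^sup>2" by (simp add: powr_minus divide_inverse powr_numeral)
      thus ?thesis by (simp add: power2_eq_square)
    qed
    finally show "norm (1 / (\<rho> * (\<rho> + 1))) \<le> 9 / c * (1 + \<bar>Im \<rho>\<bar>) powr (-2)" .
  qed (use c in auto)
qed

lemma zeros_quad_summable:
  fixes g :: "complex \<Rightarrow> complex"
  assumes g: "\<And>\<rho>. \<rho> \<in> zeros \<Longrightarrow> norm (g \<rho>) \<le> B"
  shows "(\<lambda>\<rho>. norm (of_real (zmult \<rho>) * g \<rho> / (\<rho> * (\<rho> + 1)))) summable_on zeros"
    "(\<lambda>\<rho>. of_real (zmult \<rho>) * g \<rho> / (\<rho> * (\<rho> + 1))) summable_on zeros"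
proof -
  obtain K where K: "K > 0" "\<And>\<rho>. \<rho> \<in> zeros \<Longrightarrow> norm (1 / (\<rho> * (\<rho> + 1))) \<le> K * (1 + \<bar>Im \<rho>\<bar>) powr (-2)"
    using zeros_quad_le by metis
  show 1: "(\<lambda>\<rho>. norm (of_real (zmult \<rho>) * g \<rho> / (\<rho> * (\<rho> + 1)))) summable_on zeros"
  proof (rule Infinite_Sum.abs_summable_on_comparison_test'[OF summable_on_cmult_right[OF zmult_weight_summable, of "\<bar>B\<bar> * K"]])
    fix \<rho> assume \<rho>: "\<rho> \<in> zeros"
    have "norm (of_real (zmult \<rho>) * g \<rho> / (\<rho> * (\<rho> + 1))) = zmult \<rho> * norm (g \<rho>) * norm (1 / (\<rho> * (\<rho> + 1)))"
      using zmult_nonneg[of \<rho>] by (simp add: norm_mult norm_divide)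
    also have "\<dots> \<le> zmult \<rho> * \<bar>B\<bar> * (K * (1 + \<bar>Im \<rho>\<bar>) powr (-3/2))"
    proof (intro mult_mono)
      show "norm (g \<rho>) \<le> \<bar>B\<bar>" using g[OF \<rho>] by linarith
      have "norm (1 / (\<rho> * (\<rho> + 1))) \<le> K * (1 + \<bar>Im \<rho>\<bar>) powr (-2)" by (rule K) fact
      also have "\<dots> \<le> K * (1 + \<bar>Im \<rho>\<bar>) powr (-3/2)" using K by (intro mult_left_mono powr_mono) auto
      finally show "norm (1 / (\<rho> * (\<rho> + 1))) \<le> K * (1 + \<bar>Im \<rho>\<bar>) powr (-3/2)" .
    qed (use zmult_nonneg K in auto)
    finally show "norm (of_real (zmult \<rho>) * g \<rho> / (\<rho> * (\<rho> + 1))) \<le> \<bar>B\<bar> * K * (zmult \<rho> * (1 + \<bar>Im \<rho>\<bar>) powr (- 3 / 2))"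
      by (simp add: mult_ac)
  qed
  show "(\<lambda>\<rho>. of_real (zmult \<rho>) * g \<rho> / (\<rho> * (\<rho> + 1))) summable_on zeros"
    by (rule abs_summable_summable[OF 1])
qed

text \<open>The primitive of Chebyshev's psi. Its Mellin kernel \<open>1 / (s * (s + 1))\<close>
  decays quadratically, so all integrals along vertical lines converge absolutely.\<close>

definition psi1 :: "real \<Rightarrow> real" where
  "psi1 x = (\<Sum>n = 1..nat \<lfloor>x\<rfloor>. mangoldt n * (x - real n))"

section \<open>Mellin integrals on the line Re s = 2\<close>

abbreviation line2 :: "real \<Rightarrow> complex" where "line2 \<equiv> Complex 2"

definition mellin_kernel :: "real \<Rightarrow> real \<Rightarrow> complex" where
  "mellin_kernel u t = exp (line2 t * of_real u) / (line2 t * (line2 t + 1))"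

lemma line2_nonzero: "line2 t \<noteq> 0" "line2 t + 1 \<noteq> 0" "line2 t - 1 \<noteq> 0"
  by (auto simp: complex_eq_iff)

lemma mellin_kernel_integrable: "integrable lborel (mellin_kernel u)"
  using vertical_kernel_integrable[of 0 2 "-1" u] by (simp add: mellin_kernel_def[abs_def])

lemma mellin_kernel_integral:
  "(LINT t|lborel. mellin_kernel u t) = (if u \<ge> 0 then 2 * of_real pi * (1 - exp (- complex_of_real u)) else 0)"
  using vertical_kernel_nonneg[of 0 2 "-1" u] vertical_kernel_neg[of 0 2 "-1" u]
  by (simp add: mellin_kernel_def)

lemma mellin_kernel_bound:
  obtains C where "C > 0" "\<And>t. norm (mellin_kernel u t) \<le> C * (1 + \<bar>t\<bar>) powr (-2)"
proof -
  obtain C where C: "C > 0" "\<And>c' t. c' \<ge> 2 \<Longrightarrow> norm (1 / ((Complex c' t - 0) * (Complex c' t - (-1)))) \<le> C * (1 + \<bar>t\<bar>) powr (-2)"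
    using vertical_kernel_bound[of 0 2 "-1"] by auto
  show ?thesis
  proof (rule that[of "exp (2 * u) * C"])
    fix t
    have "norm (mellin_kernel u t) = exp (2 * u) * norm (1 / ((line2 t - 0) * (line2 t - (-1))))"
      by (simp add: mellin_kernel_def norm_divide)
    also have "\<dots> \<le> exp (2 * u) * (C * (1 + \<bar>t\<bar>) powr (-2))" by (intro mult_left_mono C) auto
    finally show "norm (mellin_kernel u t) \<le> exp (2 * u) * C * (1 + \<bar>t\<bar>) powr (-2)" by (simp add: mult.assoc)
  qed (use C in auto)
qed

text \<open>The factor \<open>n powr (- s)\<close> shifts \<open>u\<close> by \<open>ln n\<close>,
  so the integral of the n-th term is \<open>2 * pi * mangoldt n * (1 - n / x)\<close> for
  \<open>n <= x = exp u\<close> and 0 beyond. The sum of \<open>mangoldt n * (1 - n / x)\<close>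
  over \<open>n <= x\<close> is \<open>psi1 x / x\<close>.\<close>

lemma mangoldt_mellin:
  assumes u: "u \<ge> 0"
  shows "integrable lborel (\<lambda>t. mangoldt_series (line2 t) * mellin_kernel u t)"
    "(LINT t|lborel. mangoldt_series (line2 t) * mellin_kernel u t) = 2 * complex_of_real pi * complex_of_real (psi1 (exp u) / exp u)"
proof -
  define T where "T = (\<lambda>n t. mangoldt (Suc n) / of_nat (Suc n) powr line2 t * mellin_kernel u t :: complex)"
  have Teq: "T n = (\<lambda>t. mangoldt (Suc n) * mellin_kernel (u - ln (real (Suc n))) t)" for n
  proof
    fix t
    have "1 / of_nat (Suc n) powr line2 t = exp (- line2 t * of_real (ln (real (Suc n))))"
      by (simp add: powr_def exp_minus divide_inverse Ln_of_nat del: of_nat_Suc)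
    moreover have "exp (- line2 t * of_real (ln (real (Suc n)))) * exp (line2 t * of_real u) = exp (line2 t * of_real (u - ln (real (Suc n))))"
      by (simp add: exp_add[symmetric] algebra_simps)
    moreover have "T n t = mangoldt (Suc n) * ((1 / of_nat (Suc n) powr line2 t) * exp (line2 t * of_real u) / (line2 t * (line2 t + 1)))"
      by (simp add: T_def mellin_kernel_def)
    ultimately show "T n t = mangoldt (Suc n) * mellin_kernel (u - ln (real (Suc n))) t"
      by (simp only: mellin_kernel_def)
  qed
  have int: "integrable lborel (T n)" for n
    unfolding Teq by (intro integrable_mult_right mellin_kernel_integrable)
  have nT: "norm (T n t) = mangoldt (Suc n) * real (Suc n) powr (-2) * norm (mellin_kernel u t)" for n t
    unfolding T_def norm_mult norm_mangoldt_summand by simp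
  have sm: "summable (\<lambda>n. mangoldt (Suc n) * real (Suc n) powr (-2))"
    by (rule summable_mangoldt_norm) simp
  have s1: "AE t in lborel. summable (\<lambda>n. norm (T n t))"
    unfolding nT by (intro AE_I2 summable_mult2 sm)
  have s2: "summable (\<lambda>n. LINT t|lborel. norm (T n t))"
    unfolding nT integral_mult_right_zero by (rule summable_mult2[OF sm])
  have suminf: "(\<Sum>n. T n t) = mangoldt_series (line2 t) * mellin_kernel u t" for t
    using sums_mult2[OF mangoldt_series_sums[of "line2 t"], of "mellin_kernel u t"] by (simp add: T_def sums_iff)
  show "integrable lborel (\<lambda>t. mangoldt_series (line2 t) * mellin_kernel u t)"
    using integrable_suminf[OF int s1 s2] unfolding suminf .
  have "(\<lambda>n. LINT t|lborel. T n t) sums (LINT t|lborel. (\<Sum>n. T n t))"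
    by (rule sums_integral[OF int s1 s2])
  hence 1: "(\<lambda>n. LINT t|lborel. T n t) sums (LINT t|lborel. mangoldt_series (line2 t) * mellin_kernel u t)"
    unfolding suminf .
  let ?x = "exp u"
  have val: "(LINT t|lborel. T n t) = (if real (Suc n) \<le> ?x then 2 * of_real pi * (mangoldt (Suc n) * (1 - complex_of_real (real (Suc n) / ?x))) else 0)" for n
  proof -
    have "u - ln (real (Suc n)) \<ge> 0 \<longleftrightarrow> real (Suc n) \<le> ?x"
    proof -
      have "ln (real (Suc n)) \<le> u \<longleftrightarrow> exp (ln (real (Suc n))) \<le> exp u" by (simp only: exp_le_cancel_iff)
      also have "exp (ln (real (Suc n))) = real (Suc n)" by simp
      finally show ?thesis by simp
    qed
    moreover have "exp (- complex_of_real (u - ln (real (Suc n)))) = of_real (real (Suc n) / ?x)"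
    proof -
      have "exp (- (u - ln (real (Suc n)))) = real (Suc n) / ?x" by (simp add: exp_diff del: of_nat_Suc)
      thus ?thesis by (metis exp_of_real of_real_minus)
    qed
    ultimately show ?thesis unfolding Teq integral_mult_right_zero mellin_kernel_integral
      by (simp only: if_distrib[of "\<lambda>z. mangoldt (Suc n) * z"] mult_zero_right mult.left_commute[of "mangoldt (Suc n)"])
  qed
  have "(\<lambda>n. LINT t|lborel. T n t) sums (\<Sum>n<nat \<lfloor>?x\<rfloor>. LINT t|lborel. T n t)"
  proof (rule sums_finite)
    fix n assume "n \<notin> {..<nat \<lfloor>?x\<rfloor>}"
    hence "nat \<lfloor>?x\<rfloor> < Suc n" by simp
    hence "\<not> real (Suc n) \<le> ?x" by linarith
    thus "(LINT t|lborel. T n t) = 0" unfolding val by simp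
  qed simp
  hence "(LINT t|lborel. mangoldt_series (line2 t) * mellin_kernel u t) = (\<Sum>n<nat \<lfloor>?x\<rfloor>. LINT t|lborel. T n t)"
    using 1 sums_unique2 by blast
  also have "\<dots> = (\<Sum>n<nat \<lfloor>?x\<rfloor>. 2 * of_real pi * complex_of_real (mangoldt (Suc n) * (?x - real (Suc n)) / ?x))"
  proof (rule sum.cong[OF refl])
    fix n assume "n \<in> {..<nat \<lfloor>?x\<rfloor>}"
    hence "Suc n \<le> nat \<lfloor>?x\<rfloor>" by simp
    hence "real (Suc n) \<le> ?x" by linarith
    moreover have "mangoldt (Suc n) * (1 - real (Suc n) / ?x) = mangoldt (Suc n) * (?x - real (Suc n)) / ?x"
      by (simp add: field_simps)
    hence "mangoldt (Suc n) * (1 - complex_of_real (real (Suc n) / ?x)) = of_real (mangoldt (Suc n) * (?x - real (Suc n)) / ?x)"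
      by (metis of_real_1 of_real_diff of_real_mangoldt of_real_mult)
    ultimately show "(LINT t|lborel. T n t) = 2 * of_real pi * complex_of_real (mangoldt (Suc n) * (?x - real (Suc n)) / ?x)"
      unfolding val by (simp only: if_True)
  qed
  also have "\<dots> = 2 * complex_of_real pi * complex_of_real (psi1 ?x / ?x)"
  proof -
    have "psi1 ?x = (\<Sum>n<nat \<lfloor>?x\<rfloor>. mangoldt (Suc n) * (?x - real (Suc n)))"
      by (simp add: psi1_def sum.atLeast1_atMost_eq)
    thus ?thesis by (simp only: sum_divide_distrib of_real_sum sum_distrib_left)
  qed
  finally show "(LINT t|lborel. mangoldt_series (line2 t) * mellin_kernel u t) = 2 * complex_of_real pi * complex_of_real (psi1 ?x / ?x)" .
qed

text \<open>Bounds all finite partial sums at once; the exponent 5/8 against the -2 of the kernel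
  leaves the integrable -11/8.\<close>

lemma pole_terms_line2_bound:
  obtains C where "C > 0"
    "\<And>F t. finite F \<Longrightarrow> F \<subseteq> zeros \<Longrightarrow> (\<Sum>\<rho>\<in>F. norm (pole_term \<rho> (line2 t))) \<le> C * (1 + \<bar>t\<bar>) powr (5/8)"
proof -
  obtain c where c: "c > 0" "c \<le> 1" "\<And>\<rho>. \<rho> \<in> zeros \<Longrightarrow> c * (1 + \<bar>Im \<rho>\<bar>) \<le> norm \<rho>"
    using zeros_norm_ge by metis
  obtain C2 where C2: "C2 > 0" "\<And>F t. finite F \<Longrightarrow> F \<subseteq> zeros \<Longrightarrow> (\<Sum>\<rho>\<in>F. zmult \<rho> * (1 + \<bar>Im \<rho> - t\<bar>) powr (-3/2)) \<le> C2 * lg t"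
    using zeros_weight_sum by blast
  show ?thesis
  proof (rule that[of "3 / c * (16 * C2) * 2"])
    show "3 / c * (16 * C2) * 2 > 0" using c C2 by simp
    fix F t assume F: "finite F" "F \<subseteq> zeros"
    have far: "1 \<le> norm (line2 t - \<rho>)" if "\<rho> \<in> zeros" for \<rho>
      using complex_Re_le_cmod[of "line2 t - \<rho>"] zeros_Re[OF that] by simp
    have "(\<Sum>\<rho>\<in>F. norm (pole_term \<rho> (line2 t))) \<le> (\<Sum>\<rho>\<in>F. 3 / (c * 1) * sqrt (2 + \<bar>Im (line2 t)\<bar>) *
           (zmult \<rho> * (1 + \<bar>Im \<rho>\<bar>) powr (-3/2) + zmult \<rho> * (1 + \<bar>Im \<rho> - Im (line2 t)\<bar>) powr (-3/2)))"
      by (intro sum_mono pole_term_bound) (use F c far in auto)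
    also have "\<dots> = 3 / c * sqrt (2 + \<bar>t\<bar>) * ((\<Sum>\<rho>\<in>F. zmult \<rho> * (1 + \<bar>Im \<rho> - 0\<bar>) powr (-3/2))
         + (\<Sum>\<rho>\<in>F. zmult \<rho> * (1 + \<bar>Im \<rho> - t\<bar>) powr (-3/2)))"
      by (simp only: sum_distrib_left sum.distrib[symmetric] diff_0_right complex.sel mult_1_right)
    also have "\<dots> \<le> 3 / c * sqrt (2 + \<bar>t\<bar>) * (C2 * lg 0 + C2 * lg t)"
      using c by (intro mult_left_mono add_mono C2 F) auto
    also have "\<dots> \<le> 3 / c * sqrt (2 + \<bar>t\<bar>) * (C2 * (8 * (2 + \<bar>t\<bar>) powr (1/8)) + C2 * (8 * (2 + \<bar>t\<bar>) powr (1/8)))"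
      using c C2(1) lg_mono[of 0 t] lg_le_powr[of t] by (intro mult_left_mono add_mono) auto
    also have "\<dots> = 3 / c * (16 * C2) * ((2 + \<bar>t\<bar>) powr (1/2) * (2 + \<bar>t\<bar>) powr (1/8))"
      by (simp add: powr_half_sqrt)
    also have "(2 + \<bar>t\<bar>) powr (1/2) * (2 + \<bar>t\<bar>) powr (1/8) = (2 + \<bar>t\<bar>) powr (5/8)"
      by (simp add: powr_add[symmetric])
    also have "3 / c * (16 * C2) * (2 + \<bar>t\<bar>) powr (5/8) \<le> 3 / c * (16 * C2) * (2 * (1 + \<bar>t\<bar>) powr (5/8))"
    proof (intro mult_left_mono)
      have "(2 + \<bar>t\<bar>) powr (5/8) \<le> (2 * (1 + \<bar>t\<bar>)) powr (5/8)" by (intro powr_mono2) auto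
      also have "\<dots> = 2 powr (5/8) * (1 + \<bar>t\<bar>) powr (5/8)" by (subst powr_mult) auto
      also have "\<dots> \<le> 2 powr 1 * (1 + \<bar>t\<bar>) powr (5/8)" by (intro mult_right_mono powr_mono) auto
      finally show "(2 + \<bar>t\<bar>) powr (5/8) \<le> 2 * (1 + \<bar>t\<bar>) powr (5/8)" by simp
    qed (use c C2 in auto)
    finally show "(\<Sum>\<rho>\<in>F. norm (pole_term \<rho> (line2 t))) \<le> 3 / c * (16 * C2) * 2 * (1 + \<bar>t\<bar>) powr (5/8)"
      by (simp add: mult_ac)
  qed
qed

lemma pole_terms_line2_summable: "(\<lambda>\<rho>. pole_term \<rho> (line2 t)) summable_on zeros"
proof -
  obtain C where C: "\<And>F t. finite F \<Longrightarrow> F \<subseteq> zeros \<Longrightarrow> (\<Sum>\<rho>\<in>F. norm (pole_term \<rho> (line2 t))) \<le> C * (1 + \<bar>t\<bar>) powr (5/8)"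
    using pole_terms_line2_bound by metis
  have "(\<lambda>\<rho>. norm (pole_term \<rho> (line2 t))) summable_on zeros"
  proof (rule nonneg_bdd_above_summable_on)
    show "bdd_above (sum (\<lambda>\<rho>. norm (pole_term \<rho> (line2 t))) ` {F. F \<subseteq> zeros \<and> finite F})"
      by (rule bdd_aboveI[of _ "C * (1 + \<bar>t\<bar>) powr (5/8)"]) (use C[of _ t] in \<open>auto simp del: powr_ge_zero\<close>)
  qed simp
  thus ?thesis by (rule abs_summable_summable)
qed

text \<open>The numerator \<open>s\<close> of \<open>s / (\<rho> * (s - \<rho>))\<close> cancels the
  factor \<open>s\<close> of the kernel, leaving a kernel with the two poles \<open>\<rho>\<close>
  and -1. Sum and integral are exchanged by dominated convergence along
  \<open>zeros_upto\<close>.\<close>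

lemma pole_mellin:
  assumes u: "u \<ge> 0"
  shows "integrable lborel (\<lambda>t. (\<Sum>\<^sub>\<infinity>\<rho>\<in>zeros. pole_term \<rho> (line2 t)) * mellin_kernel u t)"
    "(LINT t|lborel. (\<Sum>\<^sub>\<infinity>\<rho>\<in>zeros. pole_term \<rho> (line2 t)) * mellin_kernel u t) =
       2 * pi * (\<Sum>\<^sub>\<infinity>\<rho>\<in>zeros. of_real (zmult \<rho>) * (exp (\<rho> * of_real u) - exp (- complex_of_real u)) / (\<rho> * (\<rho> + 1)))"
proof -
  obtain C where C: "C > 0" "\<And>F t. finite F \<Longrightarrow> F \<subseteq> zeros \<Longrightarrow> (\<Sum>\<rho>\<in>F. norm (pole_term \<rho> (line2 t))) \<le> C * (1 + \<bar>t\<bar>) powr (5/8)"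
    using pole_terms_line2_bound by metis
  obtain K where K: "K > 0" "\<And>t. norm (mellin_kernel u t) \<le> K * (1 + \<bar>t\<bar>) powr (-2)"
    using mellin_kernel_bound[of u] by metis
  define s where "s = (\<lambda>n t. (\<Sum>\<rho>\<in>zeros_upto n. pole_term \<rho> (line2 t)) * mellin_kernel u t)"
  define V where "V = (\<lambda>\<rho>. of_real (zmult \<rho>) * (exp (\<rho> * of_real u) - exp (- complex_of_real u)) / (\<rho> * (\<rho> + 1)))"
  have one: "integrable lborel (\<lambda>t. pole_term \<rho> (line2 t) * mellin_kernel u t)"
    "(LINT t|lborel. pole_term \<rho> (line2 t) * mellin_kernel u t) = 2 * pi * V \<rho>" if \<rho>: "\<rho> \<in> zeros" for \<rho>
  proof -
    have e: "pole_term \<rho> (line2 t) * mellin_kernel u t = (of_real (zmult \<rho>) / \<rho>) * (exp (line2 t * of_real u) / ((line2 t - \<rho>) * (line2 t - (-1))))" for t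
    proof -
      have nz: "line2 t - \<rho> \<noteq> 0" using zeros_Re[OF \<rho>] by (auto simp: complex_eq_iff)
      have "1 / (line2 t - \<rho>) + 1 / \<rho> = line2 t / (\<rho> * (line2 t - \<rho>))"
        using nz zeros_neq[OF \<rho>] by (simp add: divide_simps)
      thus ?thesis using nz line2_nonzero[of t] zeros_neq[OF \<rho>] by (simp add: pole_term_def mellin_kernel_def)
    qed
    have c: "2 > Re \<rho>" "2 > Re (-1)" "\<rho> \<noteq> -1" using zeros_Re[OF \<rho>] zeros_neq[OF \<rho>] by auto
    show "integrable lborel (\<lambda>t. pole_term \<rho> (line2 t) * mellin_kernel u t)"
      unfolding e by (intro integrable_mult_right vertical_kernel_integrable c)
    show "(LINT t|lborel. pole_term \<rho> (line2 t) * mellin_kernel u t) = 2 * pi * V \<rho>"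
      unfolding e integral_mult_right_zero vertical_kernel_nonneg[OF c u] V_def by simp
  qed
  have sint: "integrable lborel (s n)" "(LINT t|lborel. s n t) = 2 * pi * (\<Sum>\<rho>\<in>zeros_upto n. V \<rho>)" for n
  proof -
    show "integrable lborel (s n)" unfolding s_def sum_distrib_right
      by (intro Bochner_Integration.integrable_sum one) (use zeros_upto_subset in auto)
    have "(LINT t|lborel. s n t) = (\<Sum>\<rho>\<in>zeros_upto n. LINT t|lborel. pole_term \<rho> (line2 t) * mellin_kernel u t)"
      unfolding s_def sum_distrib_right by (rule Bochner_Integration.integral_sum) (use one zeros_upto_subset in auto)
    also have "\<dots> = (\<Sum>\<rho>\<in>zeros_upto n. 2 * pi * V \<rho>)"
      by (intro sum.cong refl one) (use zeros_upto_subset in auto)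
    finally show "(LINT t|lborel. s n t) = 2 * pi * (\<Sum>\<rho>\<in>zeros_upto n. V \<rho>)" by (simp add: sum_distrib_left)
  qed
  have lim: "(\<lambda>n. s n t) \<longlonglongrightarrow> (\<Sum>\<^sub>\<infinity>\<rho>\<in>zeros. pole_term \<rho> (line2 t)) * mellin_kernel u t" for t
    unfolding s_def by (intro tendsto_mult_right sum_zeros_upto_tendsto pole_terms_line2_summable)
  have meas: "(\<lambda>t. (\<Sum>\<^sub>\<infinity>\<rho>\<in>zeros. pole_term \<rho> (line2 t)) * mellin_kernel u t) \<in> borel_measurable lborel"
    by (rule borel_measurable_LIMSEQ_metric[where f = s]) (use sint lim in auto)
  have dom: "integrable lborel (\<lambda>t. C * K * (1 + \<bar>t\<bar>) powr (-11/8))"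
    by (intro integrable_mult_right integrable_decay) auto
  have bd: "norm (s n t) \<le> C * K * (1 + \<bar>t\<bar>) powr (-11/8)" for n t
  proof -
    have "norm (s n t) \<le> (\<Sum>\<rho>\<in>zeros_upto n. norm (pole_term \<rho> (line2 t))) * norm (mellin_kernel u t)"
      unfolding s_def norm_mult by (intro mult_right_mono norm_sum) auto
    also have "\<dots> \<le> (C * (1 + \<bar>t\<bar>) powr (5/8)) * (K * (1 + \<bar>t\<bar>) powr (-2))"
      using C(1) by (intro mult_mono C K finite_zeros_upto zeros_upto_subset) (auto intro!: mult_nonneg_nonneg)
    also have "\<dots> = C * K * ((1 + \<bar>t\<bar>) powr (5/8) * (1 + \<bar>t\<bar>) powr (-2))" by simp
    also have "(1 + \<bar>t\<bar>) powr (5/8) * (1 + \<bar>t\<bar>) powr (-2) = (1 + \<bar>t\<bar>) powr (-11/8)"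
      unfolding powr_add[symmetric] by simp
    finally show ?thesis .
  qed
  show "integrable lborel (\<lambda>t. (\<Sum>\<^sub>\<infinity>\<rho>\<in>zeros. pole_term \<rho> (line2 t)) * mellin_kernel u t)"
    by (rule integrable_dominated_convergence[OF meas _ dom, of s]) (use sint lim bd in auto)
  have L: "(\<lambda>n. LINT t|lborel. s n t) \<longlonglongrightarrow> (LINT t|lborel. (\<Sum>\<^sub>\<infinity>\<rho>\<in>zeros. pole_term \<rho> (line2 t)) * mellin_kernel u t)"
    by (rule integral_dominated_convergence[OF meas _ dom, of s]) (use sint lim bd in auto)
  have "(\<lambda>n. 2 * pi * (\<Sum>\<rho>\<in>zeros_upto n. V \<rho>)) \<longlonglongrightarrow> 2 * pi * (\<Sum>\<^sub>\<infinity>\<rho>\<in>zeros. V \<rho>)"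
  proof (intro tendsto_mult_left sum_zeros_upto_tendsto)
    show "V summable_on zeros" unfolding V_def
    proof (rule zeros_quad_summable(2))
      fix \<rho> assume \<rho>: "\<rho> \<in> zeros"
      have "norm (exp (\<rho> * of_real u) - exp (- complex_of_real u)) \<le> norm (exp (\<rho> * of_real u)) + norm (exp (- complex_of_real u))"
        by (rule norm_triangle_ineq4)
      also have "\<dots> \<le> exp u + 1"
      proof (rule add_mono)
        have "Re \<rho> * u \<le> 1 * u" using zeros_Re[OF \<rho>] u by (intro mult_right_mono) auto
        thus "norm (exp (\<rho> * of_real u)) \<le> exp u" by simp
        show "norm (exp (- complex_of_real u)) \<le> 1" using u by simp
      qed
      finally show "norm (exp (\<rho> * of_real u) - exp (- complex_of_real u)) \<le> exp u + 1" .
    qed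
  qed
  with L show "(LINT t|lborel. (\<Sum>\<^sub>\<infinity>\<rho>\<in>zeros. pole_term \<rho> (line2 t)) * mellin_kernel u t) =
       2 * pi * (\<Sum>\<^sub>\<infinity>\<rho>\<in>zeros. of_real (zmult \<rho>) * (exp (\<rho> * of_real u) - exp (- complex_of_real u)) / (\<rho> * (\<rho> + 1)))"
    unfolding sint(2) V_def by (rule LIMSEQ_unique)
qed

lemma pole_one_mellin:
  assumes u: "u \<ge> 0"
  shows "integrable lborel (\<lambda>t. 1 / (line2 t - 1) * mellin_kernel u t)"
    "(LINT t|lborel. 1 / (line2 t - 1) * mellin_kernel u t) = 2 * pi * ((exp (complex_of_real u) - 2 + exp (- complex_of_real u)) / 2)"
proof -
  \<comment> \<open>Partial fractions with three poles: 1 / ((s - 1) s (s + 1)) is half the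
    difference of 1 / ((s - 1) s) and 1 / (s (s + 1)).\<close>
  have e: "1 / (line2 t - 1) * mellin_kernel u t = (1/2) * (exp (line2 t * of_real u) / ((line2 t - 1) * (line2 t - 0)) - mellin_kernel u t)" for t
    using line2_nonzero[of t] unfolding mellin_kernel_def by (simp add: divide_simps) (simp add: algebra_simps)
  have c: "2 > Re (1::complex)" "2 > Re (0::complex)" "(1::complex) \<noteq> 0" by auto
  have i: "integrable lborel (\<lambda>t. exp (line2 t * of_real u) / ((line2 t - 1) * (line2 t - 0)))"
    by (rule vertical_kernel_integrable[OF c(1,2)])
  show "integrable lborel (\<lambda>t. 1 / (line2 t - 1) * mellin_kernel u t)"
    unfolding e by (intro integrable_mult_right Bochner_Integration.integrable_diff i mellin_kernel_integrable)
  show "(LINT t|lborel. 1 / (line2 t - 1) * mellin_kernel u t) = 2 * pi * ((exp (complex_of_real u) - 2 + exp (- complex_of_real u)) / 2)"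
    unfolding e integral_mult_right_zero Bochner_Integration.integral_diff[OF i mellin_kernel_integrable]
      vertical_kernel_nonneg[OF c u] mellin_kernel_integral using u by (simp add: algebra_simps)
qed

text \<open>
  Subtracting the value at 0 lets the contour pass the pole of \<open>1 / (s (s + 1))\<close> at 0.
\<close>
definition zlog_quot :: "complex \<Rightarrow> complex" where
  "zlog_quot s = (if s = 0 then deriv zlog_rem 0 else (zlog_rem s - zlog_rem 0) / (s - 0))"

lemma zlog_quot_holomorphic: "zlog_quot holomorphic_on {s. -7/8 < Re s \<and> Re s < 5/2}"
proof -
  have "{s. -7/8 < Re s \<and> Re s < 5/2} = {s. -7/8 < Re s} \<inter> {s. Re s < 5/2}" by auto
  moreover have "open ({s. -7/8 < Re s} \<inter> {s. Re s < 5/2})"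
    by (intro open_Int open_halfspace_Re_gt open_halfspace_Re_lt)
  ultimately have "open {s. -7/8 < Re s \<and> Re s < 5/2}" by (simp only:)
  from pole_lemma_open[OF zlog_rem_holomorphic this, of 0] show ?thesis
    by (simp add: zlog_quot_def[abs_def])
qed

text \<open>For |Im s| <= 1 compactness suffices. Above that, the growth 5/8 of
  \<open>zlog_rem\<close> is divided by two factors of size Im s.\<close>

lemma zlog_quot_bound:
  obtains C where "C > 0"
    "\<And>s. -3/4 \<le> Re s \<Longrightarrow> Re s \<le> 2 \<Longrightarrow> norm (zlog_quot s / (s + 1)) \<le> C * (1 + \<bar>Im s\<bar>) powr (-11/8)"
proof -
  obtain C0 where C0: "C0 > 0" "\<And>s. -3/4 \<le> Re s \<Longrightarrow> Re s \<le> 2 \<Longrightarrow> norm (zlog_rem s) \<le> C0 * (2 + \<bar>Im s\<bar>) powr (5/8)"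
    using zlog_rem_bound by metis
  define Q where "Q = cbox (Complex (-3/4) (-1)) (Complex 2 1)"
  have "continuous_on Q zlog_quot"
    by (rule continuous_on_subset[OF holomorphic_on_imp_continuous_on[OF zlog_quot_holomorphic]])
       (auto simp: Q_def in_cbox_complex_iff)
  hence "bounded (zlog_quot ` Q)" by (intro compact_imp_bounded compact_continuous_image) (auto simp: Q_def)
  then obtain B where B: "\<And>s. s \<in> Q \<Longrightarrow> norm (zlog_quot s) \<le> B" by (auto simp: bounded_iff)
  define n0 where "n0 = norm (zlog_rem 0)"
  define C where "C = 16 * \<bar>B\<bar> + 8 * (2 * C0 + n0) + 1"
  show ?thesis
  proof (rule that[of C])
    show "C > 0" using C0 by (simp add: C_def n0_def add_nonneg_pos)
    fix s assume s: "-3/4 \<le> Re s" "Re s \<le> 2"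
    show "norm (zlog_quot s / (s + 1)) \<le> C * (1 + \<bar>Im s\<bar>) powr (-11/8)"
    proof (cases "\<bar>Im s\<bar> \<le> 1")
      case True
      hence "s \<in> Q" using s by (auto simp: Q_def in_cbox_complex_iff)
      hence b: "norm (zlog_quot s) \<le> \<bar>B\<bar>" using B[of s] by linarith
      have "1/4 \<le> norm (s + 1)" using complex_Re_le_cmod[of "s + 1"] s by simp
      hence "norm (zlog_quot s / (s + 1)) \<le> \<bar>B\<bar> / (1/4)" unfolding norm_divide using b by (intro frac_le) auto
      also have "\<dots> = 16 * \<bar>B\<bar> * (1/4)" by simp
      also have "\<dots> \<le> C * (1 + \<bar>Im s\<bar>) powr (-11/8)"
      proof (intro mult_mono)
        have "1/4 = (2::real) powr (-2)" by (simp add: powr_minus powr_numeral)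
        also have "\<dots> \<le> (1 + \<bar>Im s\<bar>) powr (-2)" using True by (intro powr_mono2') auto
        also have "\<dots> \<le> (1 + \<bar>Im s\<bar>) powr (-11/8)" by (intro powr_mono) auto
        finally show "1/4 \<le> (1 + \<bar>Im s\<bar>) powr (-11/8)" .
      qed (use C0 in \<open>auto simp: C_def n0_def\<close>)
      finally show ?thesis .
    next
      case False
      define a where "a = 1 + \<bar>Im s\<bar>"
      have a: "a > 2" using False by (simp add: a_def)
      have ns: "a / 2 \<le> norm s" "a / 2 \<le> norm (s + 1)"
        using False abs_Im_le_cmod[of s] abs_Im_le_cmod[of "s + 1"] by (auto simp: a_def)
      have "s \<noteq> 0" using ns a by auto
      have "norm (zlog_rem s - zlog_rem 0) \<le> C0 * (2 + \<bar>Im s\<bar>) powr (5/8) + n0"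
        using norm_triangle_ineq4[of "zlog_rem s" "zlog_rem 0"] C0(2)[OF s] by (simp add: n0_def)
      also have "\<dots> \<le> C0 * (2 * a powr (5/8)) + n0 * a powr (5/8)"
      proof (rule add_mono)
        have "(2 + \<bar>Im s\<bar>) powr (5/8) \<le> (2 * a) powr (5/8)" by (intro powr_mono2) (auto simp: a_def)
        also have "\<dots> = 2 powr (5/8) * a powr (5/8)" using a by (simp add: powr_mult)
        also have "\<dots> \<le> 2 powr 1 * a powr (5/8)" by (intro mult_right_mono powr_mono) auto
        finally show "C0 * (2 + \<bar>Im s\<bar>) powr (5/8) \<le> C0 * (2 * a powr (5/8))" using C0 by simp
        have "1 \<le> a powr (5/8)" using a by (intro ge_one_powr_ge_zero) auto
        thus "n0 \<le> n0 * a powr (5/8)" using mult_left_mono[of 1 "a powr (5/8)" n0] by (simp add: n0_def)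
      qed
      finally have num: "norm (zlog_rem s - zlog_rem 0) \<le> (2 * C0 + n0) * a powr (5/8)" by (simp add: algebra_simps)
      have "norm (zlog_quot s / (s + 1)) = norm (zlog_rem s - zlog_rem 0) / (norm s * norm (s + 1))"
        using \<open>s \<noteq> 0\<close> by (simp add: zlog_quot_def norm_divide norm_mult)
      also have "\<dots> \<le> ((2 * C0 + n0) * a powr (5/8)) / ((a / 2) * (a / 2))"
        using num ns a C0(1) by (intro frac_le mult_mono) (auto simp: n0_def)
      also have "\<dots> = 4 * (2 * C0 + n0) * (a powr (5/8) / a powr 2)"
        using a by (simp add: powr_numeral power2_eq_square field_simps)
      also have "a powr (5/8) / a powr 2 = a powr (-11/8)"
        unfolding powr_diff[symmetric] by simp
      also have "4 * (2 * C0 + n0) * a powr (-11/8) \<le> C * a powr (-11/8)"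
        using C0 by (intro mult_right_mono) (auto simp: C_def n0_def)
      finally show ?thesis by (simp add: a_def)
    qed
  qed
qed

text \<open>Mellin inversion on Re s = 2, where the logarithmic derivative is split into the pole at
  1, the poles at the zeros and \<open>zlog_rem\<close>; only the last part is moved, to Re s =
  -3/4. Undoing the division of \<open>psi1\<close> by \<open>exp u\<close> raises this abscissa to
  1/4. The constant \<open>\<beta>\<close> collects the residues of the kernel at -1.\<close>

theorem explicit_formula:
  obtains \<alpha> \<beta> :: complex and G :: "real \<Rightarrow> complex" and C :: real where
    "C > 0" "continuous_on UNIV G" "\<And>t. norm (G t) \<le> C * (1 + \<bar>t\<bar>) powr (-11/8)"
    "\<And>u. u \<ge> 0 \<Longrightarrow> of_real (psi1 (exp u)) = exp (2 * complex_of_real u) / 2 + \<alpha> * exp (complex_of_real u) + \<beta>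
        - (\<Sum>\<^sub>\<infinity>\<rho>\<in>zeros. of_real (zmult \<rho>) * exp ((\<rho> + 1) * of_real u) / (\<rho> * (\<rho> + 1)))
        + (LINT t|lborel. G t * exp (Complex (1/4) t * of_real u))"
proof -
  obtain C where C: "C > 0"
    "\<And>s. -3/4 \<le> Re s \<Longrightarrow> Re s \<le> 2 \<Longrightarrow> norm (zlog_quot s / (s + 1)) \<le> C * (1 + \<bar>Im s\<bar>) powr (-11/8)"
    using zlog_quot_bound by metis
  let ?S = "{s. -7/8 < Re s \<and> Re s < 5/2}"
  define Q where "Q = (\<lambda>s. zlog_quot s / (s + 1))"
  have Q: "Q holomorphic_on ?S" unfolding Q_def
    by (intro holomorphic_intros zlog_quot_holomorphic) (auto simp: complex_eq_iff)
  define c0 where "c0 = zlog_rem 0"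
  define G where "G = (\<lambda>t. Q (Complex (-3/4) t) / (2 * pi))"
  define Z1 where "Z1 = (\<Sum>\<^sub>\<infinity>\<rho>\<in>zeros. of_real (zmult \<rho>) * 1 / (\<rho> * (\<rho> + 1)))"
  have contQ: "continuous_on UNIV (\<lambda>t. Q (Complex (-3/4) t))"
    by (rule continuous_on_vertical[OF holomorphic_on_imp_continuous_on[OF Q]]) auto
  show ?thesis
  proof (rule that[of "C" G "c0 - 1" "1/2 - c0 + Z1"])
    show "C > 0" by fact
    show "continuous_on UNIV G" unfolding G_def by (intro continuous_intros contQ) auto
    fix t
    have "norm (G t) \<le> norm (Q (Complex (-3/4) t)) / 1" unfolding G_def norm_divide
      using pi_gt3 by (intro frac_le) (auto simp: norm_mult)
    also have "\<dots> \<le> C * (1 + \<bar>t\<bar>) powr (-11/8)" using C(2)[of "Complex (-3/4) t"] by (simp add: Q_def)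
    finally show "norm (G t) \<le> C * (1 + \<bar>t\<bar>) powr (-11/8)" .
  next
    fix u :: real assume u: "u \<ge> 0"
    define E where "E = (LINT t|lborel. Q (line2 t) * exp (line2 t * of_real u))"
    define V where "V = (\<Sum>\<^sub>\<infinity>\<rho>\<in>zeros. of_real (zmult \<rho>) * (exp (\<rho> * of_real u) - exp (- complex_of_real u)) / (\<rho> * (\<rho> + 1)))"
    \<comment> \<open>\<open>zlog_rem s = s * zlog_quot s + c0\<close>: the multiple of the kernel
      is integrated explicitly, the quotient part has no pole at 0 and can be shifted.\<close>
    have QE: "zlog_rem (line2 t) * mellin_kernel u t = Q (line2 t) * exp (line2 t * of_real u) + c0 * mellin_kernel u t" for t
      using line2_nonzero[of t] by (simp add: Q_def zlog_quot_def c0_def mellin_kernel_def divide_simps) (simp add: algebra_simps)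
    have iQ: "integrable lborel (\<lambda>t. Q (line2 t) * exp (line2 t * of_real u))"
    proof (rule integrable_of_decay[where C = "C * exp (2 * u)" and p = "-11/8"])
      have "continuous_on UNIV (\<lambda>t. Q (line2 t))"
        by (rule continuous_on_vertical[OF holomorphic_on_imp_continuous_on[OF Q]]) auto
      moreover have "continuous_on UNIV (\<lambda>t. exp (line2 t * of_real u))" unfolding Complex_eq by (intro continuous_intros)
      ultimately show "continuous_on UNIV (\<lambda>t. Q (line2 t) * exp (line2 t * of_real u))" by (rule continuous_on_mult)
      fix t
      show "norm (Q (line2 t) * exp (line2 t * of_real u)) \<le> C * exp (2 * u) * (1 + \<bar>t\<bar>) powr (-11/8)"
      proof -
        have "norm (Q (line2 t)) \<le> C * (1 + \<bar>t\<bar>) powr (-11/8)" using C(2)[of "line2 t"] by (simp add: Q_def)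
        hence "norm (Q (line2 t)) * exp (2 * u) \<le> C * (1 + \<bar>t\<bar>) powr (-11/8) * exp (2 * u)" by (rule mult_right_mono) simp
        thus ?thesis by (simp add: norm_mult mult_ac)
      qed
    qed simp
    have rel: "mangoldt_series (line2 t) = zlog_rem (line2 t) + 1 / (line2 t - 1) - (\<Sum>\<^sub>\<infinity>\<rho>\<in>zeros. pole_term \<rho> (line2 t))" for t
      using zlog_rem_eq[of "line2 t"] logderiv_zeta_entire[of "line2 t"] by (simp add: zlog_rem0_def)
    have "mangoldt_series (line2 t) * mellin_kernel u t = (Q (line2 t) * exp (line2 t * of_real u) + c0 * mellin_kernel u t)
        + 1 / (line2 t - 1) * mellin_kernel u t - (\<Sum>\<^sub>\<infinity>\<rho>\<in>zeros. pole_term \<rho> (line2 t)) * mellin_kernel u t" for t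
      unfolding rel QE[symmetric] by (simp add: algebra_simps)
    hence "(LINT t|lborel. mangoldt_series (line2 t) * mellin_kernel u t) = (LINT t|lborel. (Q (line2 t) * exp (line2 t * of_real u) + c0 * mellin_kernel u t)
        + 1 / (line2 t - 1) * mellin_kernel u t - (\<Sum>\<^sub>\<infinity>\<rho>\<in>zeros. pole_term \<rho> (line2 t)) * mellin_kernel u t)" by simp
    also have "\<dots> = (LINT t|lborel. (Q (line2 t) * exp (line2 t * of_real u) + c0 * mellin_kernel u t)
        + 1 / (line2 t - 1) * mellin_kernel u t) - (LINT t|lborel. (\<Sum>\<^sub>\<infinity>\<rho>\<in>zeros. pole_term \<rho> (line2 t)) * mellin_kernel u t)"
      by (intro Bochner_Integration.integral_diff Bochner_Integration.integrable_add integrable_mult_right iQ mellin_kernel_integrable pole_one_mellin pole_mellin u)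
    also have "(LINT t|lborel. (Q (line2 t) * exp (line2 t * of_real u) + c0 * mellin_kernel u t) + 1 / (line2 t - 1) * mellin_kernel u t)
        = (LINT t|lborel. Q (line2 t) * exp (line2 t * of_real u) + c0 * mellin_kernel u t) + (LINT t|lborel. 1 / (line2 t - 1) * mellin_kernel u t)"
      by (intro Bochner_Integration.integral_add Bochner_Integration.integrable_add integrable_mult_right iQ mellin_kernel_integrable pole_one_mellin u)
    also have "(LINT t|lborel. Q (line2 t) * exp (line2 t * of_real u) + c0 * mellin_kernel u t) = E + (LINT t|lborel. c0 * mellin_kernel u t)"
      unfolding E_def by (intro Bochner_Integration.integral_add integrable_mult_right iQ mellin_kernel_integrable)
    also have "(LINT t|lborel. c0 * mellin_kernel u t) = c0 * (2 * pi * (1 - exp (- complex_of_real u)))"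
      unfolding integral_mult_right_zero mellin_kernel_integral using u by simp
    finally have main: "2 * complex_of_real pi * complex_of_real (psi1 (exp u) / exp u) = E + c0 * (2 * pi * (1 - exp (- complex_of_real u)))
        + 2 * pi * ((exp (complex_of_real u) - 2 + exp (- complex_of_real u)) / 2) - 2 * pi * V"
      unfolding mangoldt_mellin(2)[OF u] pole_one_mellin(2)[OF u] pole_mellin(2)[OF u] V_def .
    have E: "E = (LINT t|lborel. Q (Complex (-3/4) t) * exp (Complex (-3/4) t * of_real u))"
    proof -
      define f where "f = (\<lambda>s::complex. Q s * exp (s * of_real u))"
      have "(LINT t|lborel. f (Complex (-3/4) t)) = (LINT t|lborel. f (Complex 2 t))"
    proof (rule line_integral_shift[where f = f and a = "-3/4" and b = 2 and a0 = "-7/8" and b0 = "5/2" and p = "-11/8" and C = "C * exp (2 * u)"])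
      show "f holomorphic_on {z. -7/8 < Re z \<and> Re z < 5/2}"
        unfolding f_def by (intro holomorphic_intros Q)
      fix z assume z: "-3/4 \<le> Re z" "Re z \<le> 2"
      have "norm (Q z) * exp (Re z * u) \<le> (C * (1 + \<bar>Im z\<bar>) powr (-11/8)) * exp (2 * u)"
        using C(2)[OF z] z u C(1) by (intro mult_mono) (auto simp: Q_def intro: mult_right_mono)
      thus "norm (f z) \<le> C * exp (2 * u) * (1 + \<bar>Im z\<bar>) powr (-11/8)"
        by (simp add: norm_mult mult_ac f_def)
    qed auto
      thus ?thesis by (simp add: E_def f_def)
    qed
    \<comment> \<open>The factor \<open>exp u\<close> adds 1 to the abscissa -3/4.\<close>
    have EG: "exp (complex_of_real u) * E = 2 * pi * (LINT t|lborel. G t * exp (Complex (1/4) t * of_real u))"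
    proof -
      have "exp (complex_of_real u) * (Q (Complex (-3/4) t) * exp (Complex (-3/4) t * of_real u)) = 2 * pi * (G t * exp (Complex (1/4) t * of_real u))" for t
      proof -
        have "Complex (1/4) t * of_real u = of_real u + Complex (-3/4) t * of_real u" by (simp add: complex_eq_iff)
        thus ?thesis by (simp add: G_def exp_add)
      qed
      hence "(LINT t|lborel. exp (complex_of_real u) * (Q (Complex (-3/4) t) * exp (Complex (-3/4) t * of_real u))) =
        (LINT t|lborel. 2 * pi * (G t * exp (Complex (1/4) t * of_real u)))" by simp
      thus ?thesis unfolding E integral_mult_right_zero .
    qed
    define W where "W = (\<Sum>\<^sub>\<infinity>\<rho>\<in>zeros. of_real (zmult \<rho>) * exp ((\<rho> + 1) * of_real u) / (\<rho> * (\<rho> + 1)))"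
    have VW: "exp (complex_of_real u) * V = W - Z1"
    proof -
      have sW: "(\<lambda>\<rho>. of_real (zmult \<rho>) * exp ((\<rho> + 1) * of_real u) / (\<rho> * (\<rho> + 1))) summable_on zeros"
      proof (rule zeros_quad_summable(2)[where B = "exp (2 * u)"])
        fix \<rho> assume \<rho>: "\<rho> \<in> zeros"
        have "(Re \<rho> + 1) * u \<le> 2 * u" using zeros_Re[OF \<rho>] u by (intro mult_right_mono) auto
        thus "norm (exp ((\<rho> + 1) * of_real u)) \<le> exp (2 * u)" by simp
      qed
      have s1: "(\<lambda>\<rho>. of_real (zmult \<rho>) * 1 / (\<rho> * (\<rho> + 1))) summable_on zeros"
        by (rule zeros_quad_summable(2)[where B = 1]) simp
      have "exp (complex_of_real u) * V = (\<Sum>\<^sub>\<infinity>\<rho>\<in>zeros. exp (complex_of_real u) * (of_real (zmult \<rho>) * (exp (\<rho> * of_real u) - exp (- complex_of_real u)) / (\<rho> * (\<rho> + 1))))"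
        unfolding V_def by (rule infsum_cmult_right'[symmetric])
      also have "\<dots> = (\<Sum>\<^sub>\<infinity>\<rho>\<in>zeros. of_real (zmult \<rho>) * exp ((\<rho> + 1) * of_real u) / (\<rho> * (\<rho> + 1)) + - (of_real (zmult \<rho>) * 1 / (\<rho> * (\<rho> + 1))))"
      proof (rule infsum_cong)
        fix \<rho> assume "\<rho> \<in> zeros"
        have "exp (complex_of_real u) * (exp (\<rho> * of_real u) - exp (- complex_of_real u)) = exp ((\<rho> + 1) * of_real u) - 1"
          by (simp add: algebra_simps exp_add[symmetric])
        thus "exp (complex_of_real u) * (of_real (zmult \<rho>) * (exp (\<rho> * of_real u) - exp (- complex_of_real u)) / (\<rho> * (\<rho> + 1))) =
          of_real (zmult \<rho>) * exp ((\<rho> + 1) * of_real u) / (\<rho> * (\<rho> + 1)) + - (of_real (zmult \<rho>) * 1 / (\<rho> * (\<rho> + 1)))"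
          by (metis (no_types, lifting) add_uminus_conv_diff diff_divide_distrib mult.left_commute right_diff_distrib times_divide_eq_right)
      qed
      also have "\<dots> = W + (\<Sum>\<^sub>\<infinity>\<rho>\<in>zeros. - (of_real (zmult \<rho>) * 1 / (\<rho> * (\<rho> + 1))))"
        unfolding W_def by (rule infsum_add[OF sW]) (use s1 in \<open>simp add: summable_on_uminus\<close>)
      also have "(\<Sum>\<^sub>\<infinity>\<rho>\<in>zeros. - (of_real (zmult \<rho>) * 1 / (\<rho> * (\<rho> + 1)))) = - Z1"
        unfolding Z1_def by (rule infsum_uminus)
      finally show ?thesis by simp
    qed
    define x where "x = exp (complex_of_real u)"
    have x: "x \<noteq> 0" "exp (- complex_of_real u) = 1 / x" "exp (2 * complex_of_real u) = x\<^sup>2" "complex_of_real (exp u) = x"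
      by (auto simp: x_def exp_minus divide_inverse exp_double exp_of_real)
    define I where "I = (LINT t|lborel. G t * exp (Complex (1/4) t * of_real u))"
    have p: "2 * complex_of_real pi \<noteq> 0" by simp
    have EGx: "x * E = 2 * complex_of_real pi * I" and VWx: "x * V = W - Z1" using EG VW unfolding x_def I_def by auto
    have "(2 * complex_of_real pi) * (complex_of_real (psi1 (exp u) / exp u) * x) = x * (E + c0 * (2 * complex_of_real pi * (1 - 1 / x))
        + 2 * complex_of_real pi * ((x - 2 + 1 / x) / 2) - 2 * complex_of_real pi * V)"
      using arg_cong[OF main, of "\<lambda>z. x * z"] unfolding x(2) x_def[symmetric]
      by (simp only: mult_ac of_real_mult of_real_numeral)
    also have "\<dots> = x * E + 2 * complex_of_real pi * (c0 * (x - 1) + (x\<^sup>2 - 2 * x + 1) / 2 - x * V)"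
      using x(1) by (simp add: field_simps power2_eq_square)
    also have "\<dots> = 2 * complex_of_real pi * (I + c0 * (x - 1) + (x\<^sup>2 - 2 * x + 1) / 2 - (W - Z1))"
      unfolding EGx VWx by (simp add: algebra_simps)
    finally have F: "(2 * complex_of_real pi) * (complex_of_real (psi1 (exp u) / exp u) * x) =
      2 * complex_of_real pi * (I + c0 * (x - 1) + (x\<^sup>2 - 2 * x + 1) / 2 - (W - Z1))" .
    have F1: "complex_of_real (psi1 (exp u) / exp u) * x = I + c0 * (x - 1) + (x\<^sup>2 - 2 * x + 1) / 2 - (W - Z1)"
      by (rule mult_left_cancel[OF p, THEN iffD1, OF F])
    have "complex_of_real (psi1 (exp u) / exp u) * x = of_real (psi1 (exp u))" using x(1,4) by simp
    hence F2: "complex_of_real (psi1 (exp u)) = I + c0 * (x - 1) + (x\<^sup>2 - 2 * x + 1) / 2 - (W - Z1)"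
      using F1 by (rule trans[OF sym])
    show "of_real (psi1 (exp u)) = exp (2 * complex_of_real u) / 2 + (c0 - 1) * exp (complex_of_real u) + (1/2 - c0 + Z1)
        - (\<Sum>\<^sub>\<infinity>\<rho>\<in>zeros. of_real (zmult \<rho>) * exp ((\<rho> + 1) * of_real u) / (\<rho> * (\<rho> + 1)))
        + (LINT t|lborel. G t * exp (Complex (1/4) t * of_real u))"
      unfolding x(3) x_def[symmetric] I_def[symmetric] W_def[symmetric] F2
      by (simp add: algebra_simps diff_divide_distrib add_divide_distrib)
  qed
qed

section \<open>Mean squares of sums over zeros\<close>

text \<open>The power through the real logarithm, so that no branch of the complex one enters the
  calculus in \<open>x > 0\<close>.\<close>

definition cpow :: "complex \<Rightarrow> real \<Rightarrow> complex" where
  "cpow z x = exp (z * of_real (ln x))"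

lemma norm_cpow: "x > 0 \<Longrightarrow> norm (cpow z x) = x powr Re z"
  by (simp add: cpow_def powr_def)

lemma cpow_add: "x > 0 \<Longrightarrow> cpow (z + w) x = cpow z x * cpow w x"
  by (simp add: cpow_def algebra_simps exp_add)

lemma cpow_1: "x > 0 \<Longrightarrow> cpow 1 x = of_real x"
  by (simp add: cpow_def exp_of_real)

lemma cpow_add_1: "x > 0 \<Longrightarrow> cpow (z + 1) x = cpow z x * of_real x"
  by (simp add: cpow_add cpow_1)

lemma cnj_cpow: "cnj (cpow z x) = cpow (cnj z) x"
  by (simp add: cpow_def exp_cnj)

lemma cpow_deriv:
  assumes "x > 0"
  shows "(cpow z has_vector_derivative z * cpow (z - 1) x) (at x within S)"
proof -
  have 1: "((\<lambda>x. z * complex_of_real (ln x)) has_vector_derivative z * complex_of_real (1 / x)) (at x within S)"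
    using assms by (intro has_vector_derivative_mult_right has_vector_derivative_of_real)
      (auto intro!: derivative_eq_intros simp: has_real_derivative_iff_has_vector_derivative[symmetric] field_simps)
  have "((exp \<circ> (\<lambda>x. z * complex_of_real (ln x))) has_vector_derivative (z * complex_of_real (1 / x)) * exp (z * complex_of_real (ln x))) (at x within S)"
    by (rule field_vector_diff_chain_within[OF 1]) (auto intro: DERIV_subset[OF DERIV_exp])
  moreover have "(z * complex_of_real (1 / x)) * exp (z * complex_of_real (ln x)) = z * cpow (z - 1) x"
    using cpow_add_1[OF assms, of "z - 1"] assms by (simp add: cpow_def)
  ultimately show ?thesis by (simp add: cpow_def[abs_def] o_def)
qed

lemma continuous_on_cpow: "(\<And>x. x \<in> S \<Longrightarrow> x > 0) \<Longrightarrow> continuous_on S (cpow z)"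
  using cpow_deriv by (metis continuous_on_eq_continuous_within has_vector_derivative_continuous)

text \<open>Cauchy-Schwarz from the nonnegative integral of the squared deviation of
  \<open>g\<close> from its mean.\<close>

lemma integral_square_le:
  fixes g :: "real \<Rightarrow> real"
  assumes "c \<le> d" "continuous_on {c..d} g"
  shows "(integral {c..d} g)\<^sup>2 \<le> (d - c) * integral {c..d} (\<lambda>x. (g x)\<^sup>2)"
proof (cases "c = d")
  case False
  define L where "L = d - c"
  define I where "I = integral {c..d} g"
  have L: "L > 0" using False assms by (simp add: L_def)
  have i: "g integrable_on {c..d}" "(\<lambda>x. (g x)\<^sup>2) integrable_on {c..d}"
    by (intro integrable_continuous_real continuous_intros assms)+
  have "((\<lambda>x. (g x)\<^sup>2 - 2 * (I / L) * g x + (I / L)\<^sup>2) has_integral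
      integral {c..d} (\<lambda>x. (g x)\<^sup>2) - 2 * (I / L) * I + (d - c) * (I / L)\<^sup>2) {c..d}"
    unfolding I_def using assms(1) i
    by (intro has_integral_add has_integral_diff has_integral_mult_right integrable_integral)
      (use has_integral_const_real[of "(integral {c..d} g / L)\<^sup>2" c d] in simp_all)
  moreover have "(g x)\<^sup>2 - 2 * (I / L) * g x + (I / L)\<^sup>2 \<ge> 0" for x
    using zero_le_power2[of "g x - I / L"] by (simp add: power2_diff algebra_simps)
  ultimately have "0 \<le> integral {c..d} (\<lambda>x. (g x)\<^sup>2) - 2 * (I / L) * I + (d - c) * (I / L)\<^sup>2"
    by (rule has_integral_nonneg)
  also have "\<dots> = integral {c..d} (\<lambda>x. (g x)\<^sup>2) - I\<^sup>2 / L"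
    using L by (simp add: L_def[symmetric] power2_eq_square field_simps)
  finally have "I\<^sup>2 / L \<le> integral {c..d} (\<lambda>x. (g x)\<^sup>2)" by simp
  thus ?thesis using L by (simp add: I_def L_def field_simps)
qed simp

lemma integral_shift_real:
  fixes f :: "real \<Rightarrow> real"
  shows "integral {a..b} (\<lambda>x. f (x + h)) = integral {a + h..b + h} f"
  using integral_shift_Icc_real[of a b f h] by (simp add: o_def add.commute)

text \<open>Cauchy-Schwarz on each interval \<open>{x..x + h}\<close> gives one factor
  \<open>h\<close>; integrating over \<open>x\<close>, each point is covered for a length at most
  \<open>h\<close>, which gives the other. The primitive \<open>P\<close> of the squared derivative
  replaces the double integral.\<close>

lemma integral_diff_square_le:
  fixes f f' :: "real \<Rightarrow> complex"
  assumes ab: "a \<le> b" and h: "h \<ge> 0"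
    and d: "\<And>x. x \<in> {a..b + h} \<Longrightarrow> (f has_vector_derivative f' x) (at x within {a..b + h})"
    and c: "continuous_on {a..b + h} f'"
  shows "integral {a..b} (\<lambda>x. (norm (f (x + h) - f x))\<^sup>2) \<le> h\<^sup>2 * integral {a..b + h} (\<lambda>x. (norm (f' x))\<^sup>2)"
proof -
  define P where "P = (\<lambda>y. integral {a..y} (\<lambda>x. (norm (f' x))\<^sup>2))"
  have ci: "continuous_on {a..b + h} (\<lambda>x. (norm (f' x))\<^sup>2)" by (intro continuous_intros c)
  have int: "(\<lambda>x. (norm (f' x))\<^sup>2) integrable_on {c..d}" if "a \<le> c" "d \<le> b + h" for c d
    using that by (intro integrable_continuous_real continuous_on_subset[OF ci]) auto
  have Pc: "continuous_on {a..b + h} P"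
    unfolding P_def by (rule indefinite_integral_continuous_1) (rule int, auto)
  have fc: "continuous_on {a..b + h} f"
    using d by (meson continuous_on_eq_continuous_within has_vector_derivative_continuous)
  have Pm: "P x \<le> P y" if "a \<le> x" "x \<le> y" "y \<le> b + h" for x y
    unfolding P_def using that by (intro integral_subset_le int) auto
  have P0: "P x \<ge> 0" if "a \<le> x" "x \<le> b + h" for x
    unfolding P_def using that by (intro integral_nonneg int) auto
  have pt: "(norm (f (x + h) - f x))\<^sup>2 \<le> h * (P (x + h) - P x)" if x: "x \<in> {a..b}" for x
  proof -
    have "(f' has_integral (f (x + h) - f x)) {x..x + h}"
      using x h by (intro fundamental_theorem_of_calculus has_vector_derivative_within_subset[OF d]) auto
    hence "norm (f (x + h) - f x) = norm (integral {x..x+h} f')" by (simp add: integral_unique)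
    also have cx: "continuous_on {x..x+h} f'" by (rule continuous_on_subset[OF c]) (use x h in auto)
    hence "norm (integral {x..x+h} f') \<le> integral {x..x+h} (\<lambda>y. norm (f' y))"
      by (intro integral_norm_bound_integral integrable_continuous_real continuous_intros) auto
    finally have "(norm (f (x + h) - f x))\<^sup>2 \<le> (integral {x..x+h} (\<lambda>y. norm (f' y)))\<^sup>2"
      by (rule power_mono) simp
    also have "\<dots> \<le> (x + h - x) * integral {x..x+h} (\<lambda>y. (norm (f' y))\<^sup>2)"
      by (rule integral_square_le) (use h cx in \<open>auto intro: continuous_intros\<close>)
    also have "integral {x..x+h} (\<lambda>y. (norm (f' y))\<^sup>2) = P (x + h) - P x"
      unfolding P_def using Henstock_Kurzweil_Integration.integral_combine[where a = a and c = x and b = "x + h" and f = "\<lambda>y. (norm (f' y))\<^sup>2", OF _ _ int] x h by simp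
    finally show ?thesis by simp
  qed
  have c1: "continuous_on {a..b} (\<lambda>x. P (x + h))"
    by (rule continuous_on_compose2[OF Pc]) (use h in \<open>auto intro!: continuous_intros\<close>)
  have c2: "continuous_on {a..b} P" by (rule continuous_on_subset[OF Pc]) (use h in auto)
  have "integral {a..b} (\<lambda>x. (norm (f (x + h) - f x))\<^sup>2) \<le> integral {a..b} (\<lambda>x. h * (P (x + h) - P x))"
  proof (rule integral_le)
    have "continuous_on {a..b} (\<lambda>x. f (x + h))"
      by (rule continuous_on_compose2[OF fc]) (use h in \<open>auto intro!: continuous_intros\<close>)
    moreover have "continuous_on {a..b} f" by (rule continuous_on_subset[OF fc]) (use h in auto)
    ultimately show "(\<lambda>x. (norm (f (x + h) - f x))\<^sup>2) integrable_on {a..b}"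
      by (intro integrable_continuous_real continuous_intros)
    show "(\<lambda>x. h * (P (x + h) - P x)) integrable_on {a..b}"
      by (intro integrable_continuous_real continuous_intros c1 c2)
  qed (use pt in auto)
  also have "\<dots> = h * (integral {a..b} (\<lambda>x. P (x + h)) - integral {a..b} P)"
    by (simp add: Henstock_Kurzweil_Integration.integral_diff integrable_continuous_real c1 c2)
  also have "integral {a..b} (\<lambda>x. P (x + h)) = integral {a + h..b + h} P"
    by (rule integral_shift_real)
  also have "integral {a + h..b + h} P - integral {a..b} P = integral {b..b + h} P - integral {a..a + h} P"
  proof -
    have Pi: "P integrable_on {c..d}" if "a \<le> c" "d \<le> b + h" for c d
      using that by (intro integrable_continuous_real continuous_on_subset[OF Pc]) auto
    have "integral {a..b} P + integral {b..b + h} P = integral {a..b + h} P"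
      using Henstock_Kurzweil_Integration.integral_combine[where a = a and c = b and b = "b + h" and f = P] Pi ab h by auto
    moreover have "integral {a..a + h} P + integral {a + h..b + h} P = integral {a..b + h} P"
      using Henstock_Kurzweil_Integration.integral_combine[where a = a and c = "a + h" and b = "b + h" and f = P] Pi ab h by auto
    ultimately show ?thesis by simp
  qed
  also have "integral {b..b + h} P - integral {a..a + h} P \<le> h * P (b + h)"
  proof -
    have Pi: "P integrable_on {c..d}" if "a \<le> c" "d \<le> b + h" for c d
      using that by (intro integrable_continuous_real continuous_on_subset[OF Pc]) auto
    have "integral {b..b + h} P \<le> integral {b..b + h} (\<lambda>_. P (b + h))"
      by (rule integral_le) (use Pi ab h Pm in auto)
    moreover have "integral {a..a + h} P \<ge> 0"
      by (rule integral_nonneg) (use Pi ab h P0 in auto)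
    ultimately show ?thesis using h by simp
  qed
  finally show ?thesis using h by (simp add: P_def power2_eq_square mult_left_mono mult.assoc)
qed

text \<open>
  A polynomial weight vanishing to second order at 1/2 and 5 and at least 1 on \<open>[1, 4]\<close>, so that two
  integrations by parts have no boundary terms.
\<close>
definition bump :: "real \<Rightarrow> real" where "bump y = ((y - 1/2) * (5 - y))\<^sup>2"

text \<open>Integrating by parts twice gains \<open>1 / (Im z)^2\<close> when |Im z| >= 1; otherwise
  the trivial bound does. The range of Re z is that of \<open>\<rho> + cnj \<sigma>\<close> for
  zeros with real part above -7/8 and at most 1/2.\<close>

lemma bump_kernel:
  fixes X :: real
  assumes X: "X \<ge> 1" and z: "-2 \<le> Re z" "Re z \<le> 1"
  shows "norm (integral {X/2..5*X} (\<lambda>x. of_real (bump (x / X)) * cpow z x)) \<le> 140000 * X\<^sup>2 * (1 + \<bar>Im z\<bar>) powr (-3/2)"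
proof -
  let ?S = "{X/2..5*X}"
  define b1 where "b1 = (\<lambda>y::real. 2 * ((y - 1/2) * (5 - y)) * (11/2 - 2 * y))"
  define b2 where "b2 = (\<lambda>y::real. 2 * (11/2 - 2 * y)\<^sup>2 - 4 * ((y - 1/2) * (5 - y)))"
  have pos: "x > 0" if "x \<in> ?S" for x using that X by auto
  \<comment> \<open>For x >= 1 the exponent is at most 1. For x < 1 the exponent is at least -2 and
    x >= X/2 >= 1/2, so the power is at most 4.\<close>
  have cz: "norm (cpow z x) \<le> 5 * X" if x: "x \<in> ?S" for x
  proof (cases "x \<ge> 1")
    case True
    have "x powr Re z \<le> x powr 1" using True z by (intro powr_mono) auto
    thus ?thesis using x pos[OF x] by (simp add: norm_cpow)
  next
    case False
    have "x powr Re z = (1 / x) powr (- Re z)" using pos[OF x] by (simp add: powr_minus powr_divide field_simps)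
    also have "\<dots> \<le> (1 / x) powr 2" using False pos[OF x] z by (intro powr_mono) auto
    also have "\<dots> = (1 / x)\<^sup>2" using pos[OF x] by simp
    also have "\<dots> \<le> 2\<^sup>2" using x X False pos[OF x] by (intro power_mono) (auto simp: field_simps)
    finally show ?thesis using X pos[OF x] by (simp add: norm_cpow)
  qed
  have y: "1/2 \<le> x / X" "x / X \<le> 5" if "x \<in> ?S" for x using that X by (auto simp: field_simps)
  have q: "0 \<le> (y - 1/2) * (5 - y)" "(y - 1/2) * (5 - y) \<le> 81/16" if "1/2 \<le> y" "y \<le> 5" for y :: real
  proof -
    show "0 \<le> (y - 1/2) * (5 - y)" using that by simp
    have "81/16 - (y - 1/2) * (5 - y) = (y - 11/4)\<^sup>2" by (simp add: power2_eq_square algebra_simps)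
    moreover have "(y - 11/4)\<^sup>2 \<ge> 0" by simp
    ultimately show "(y - 1/2) * (5 - y) \<le> 81/16" by linarith
  qed
  have bb: "\<bar>bump y\<bar> \<le> 26" if "1/2 \<le> y" "y \<le> 5" for y
  proof -
    have "bump y \<le> (81/16)\<^sup>2" unfolding bump_def using q[OF that] by (intro power_mono)
    thus ?thesis by (simp add: bump_def power2_eq_square)
  qed
  \<comment> \<open>\<open>b1\<close> and \<open>b2\<close> are the first two derivatives of
    \<open>bump\<close>. Both parts of \<open>b2\<close> are extreme on [1/2, 5] with values 81/2
    and 81/4, together below 61.\<close>
  have bb2: "\<bar>b2 y\<bar> \<le> 61" if "1/2 \<le> y" "y \<le> 5" for y
  proof -
    have "\<bar>11/2 - 2 * y\<bar> \<le> \<bar>9/2\<bar>" using that unfolding abs_le_iff by simp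
    hence "(11/2 - 2 * y)\<^sup>2 \<le> (9/2)\<^sup>2" by (simp only: abs_le_square_iff)
    moreover have "(11/2 - 2 * y)\<^sup>2 \<ge> 0" by simp
    ultimately show ?thesis unfolding b2_def abs_le_iff power2_eq_square[of "9/2::real"] using q[OF that] by linarith
  qed
  have bc: "continuous_on ?S (\<lambda>x. complex_of_real (bump (x / X)))"
    unfolding bump_def using X by (intro continuous_intros) auto
  have b2c: "continuous_on ?S (\<lambda>x. complex_of_real (b2 (x / X)))"
    unfolding b2_def using X by (intro continuous_intros) auto
  have pm: "(1 + \<bar>Im z\<bar>) powr (-2) \<le> (1 + \<bar>Im z\<bar>) powr (-3/2)" by (intro powr_mono) auto
  show ?thesis
  proof (cases "\<bar>Im z\<bar> \<ge> 1")
    case True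
    have nz: "z + 1 \<noteq> 0" "z + 2 \<noteq> 0" using True by (auto simp: complex_eq_iff)
    \<comment> \<open>The boundary terms of the two integrations by parts, zero at both ends since
      \<open>bump\<close> and \<open>b1\<close> vanish there; \<open>r\<close> is the integrand that
      remains.\<close>
    define F where "F = (\<lambda>x. of_real (bump (x / X)) * (cpow (z + 1) x / (z + 1)) - of_real (b1 (x / X) / X) * (cpow (z + 2) x / ((z + 1) * (z + 2))))"
    define r where "r = (\<lambda>x. of_real (b2 (x / X) / X\<^sup>2) * (cpow (z + 2) x / ((z + 1) * (z + 2))))"
    have F: "(F has_vector_derivative of_real (bump (x / X)) * cpow z x - r x) (at x within ?S)" if x: "x \<in> ?S" for x
    proof -
      have d1: "((\<lambda>x. complex_of_real (bump (x / X))) has_vector_derivative of_real (b1 (x / X) / X)) (at x within ?S)"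
        by (rule has_vector_derivative_of_real)
          (use X in \<open>auto simp: bump_def b1_def has_real_derivative_iff_has_vector_derivative[symmetric] power2_eq_square field_simps intro!: derivative_eq_intros\<close>)
      have d2: "((\<lambda>x. complex_of_real (b1 (x / X) / X)) has_vector_derivative of_real (b2 (x / X) / X\<^sup>2)) (at x within ?S)"
        by (rule has_vector_derivative_of_real)
          (use X in \<open>auto simp: b2_def b1_def has_real_derivative_iff_has_vector_derivative[symmetric] power2_eq_square field_simps intro!: derivative_eq_intros\<close>)
      have d3: "((\<lambda>x. cpow (z + 1) x / (z + 1)) has_vector_derivative cpow z x) (at x within ?S)"
        using has_vector_derivative_mult_left[OF cpow_deriv[OF pos[OF x], of "z + 1" ?S], of "1 / (z + 1)"] nz by simp
      have d4: "((\<lambda>x. cpow (z + 2) x / ((z + 1) * (z + 2))) has_vector_derivative cpow (z + 1) x / (z + 1)) (at x within ?S)"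
        using has_vector_derivative_mult_left[OF cpow_deriv[OF pos[OF x], of "z + 2" ?S], of "1 / ((z + 1) * (z + 2))"] nz
        by (simp add: add.commute)
      show ?thesis unfolding F_def
        by (rule has_vector_derivative_eq_rhs[OF has_vector_derivative_diff[OF has_vector_derivative_mult[OF d1 d3] has_vector_derivative_mult[OF d2 d4]]])
          (simp add: r_def)
    qed
    have "((\<lambda>x. of_real (bump (x / X)) * cpow z x - r x) has_integral (F (5 * X) - F (X / 2))) ?S"
      using X by (intro fundamental_theorem_of_calculus F) auto
    moreover have "F (5 * X) = 0" "F (X / 2) = 0" using X by (auto simp: F_def bump_def b1_def)
    ultimately have i0: "((\<lambda>x. of_real (bump (x / X)) * cpow z x - r x) has_integral 0) ?S" by simp
    have rc: "continuous_on ?S r" unfolding r_def using X nz pos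
      by (intro continuous_intros continuous_on_cpow) (auto simp: b2_def intro!: continuous_intros)
    have ib: "(\<lambda>x. complex_of_real (bump (x / X)) * cpow z x) integrable_on ?S"
      by (intro integrable_continuous_real continuous_on_mult bc continuous_on_cpow pos)
    have "integral ?S (\<lambda>x. of_real (bump (x / X)) * cpow z x) - integral ?S r = 0"
      using integral_unique[OF i0] Henstock_Kurzweil_Integration.integral_diff[OF ib integrable_continuous_real[OF rc]] by simp
    hence "norm (integral ?S (\<lambda>x. of_real (bump (x / X)) * cpow z x)) = norm (integral ?S r)" by simp
    also have "\<dots> \<le> (61 * 125 * X / (Im z)\<^sup>2) * (5 * X - X / 2)"
    proof (rule integral_bound)
      fix x assume x: "x \<in> ?S"
      have "(Im z)\<^sup>2 = \<bar>Im (z + 1)\<bar> * \<bar>Im (z + 2)\<bar>" by (simp add: power2_eq_square abs_mult[symmetric])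
      also have "\<dots> \<le> norm (z + 1) * norm (z + 2)" by (intro mult_mono abs_Im_le_cmod) auto
      finally have dn: "(Im z)\<^sup>2 \<le> norm ((z + 1) * (z + 2))" by (simp add: norm_mult)
      have "norm (cpow (z + 2) x) = norm (cpow z x) * x\<^sup>2"
        using pos[OF x] cpow_add_1[of x z] cpow_add_1[of x "z + 1"] by (simp add: norm_mult power2_eq_square add.assoc)
      also have "\<dots> \<le> (5 * X) * (5 * X)\<^sup>2" using x pos[OF x] by (intro mult_mono cz power_mono) auto
      finally have n2: "norm (cpow (z + 2) x) \<le> 125 * X ^ 3" by (simp add: power2_eq_square power3_eq_cube)
      have "norm (r x) = \<bar>b2 (x / X)\<bar> / X\<^sup>2 * (norm (cpow (z + 2) x) / norm ((z + 1) * (z + 2)))"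
        by (simp add: r_def norm_mult norm_divide norm_power)
      also have "\<dots> \<le> 61 / X\<^sup>2 * (125 * X ^ 3 / (Im z)\<^sup>2)"
      proof (intro mult_mono)
        show "\<bar>b2 (x / X)\<bar> / X\<^sup>2 \<le> 61 / X\<^sup>2" by (intro divide_right_mono bb2 y[OF x]) simp
        show "norm (cpow (z + 2) x) / norm ((z + 1) * (z + 2)) \<le> 125 * X ^ 3 / (Im z)\<^sup>2"
          by (rule frac_le[OF _ n2 _ dn]) (use X True in auto)
      qed auto
      also have "\<dots> = 61 * 125 * X / (Im z)\<^sup>2" using X by (simp add: power2_eq_square power3_eq_cube)
      finally show "norm (r x) \<le> 61 * 125 * X / (Im z)\<^sup>2" .
    qed (use X rc in auto)
    also have "\<dots> \<le> 35000 * X\<^sup>2 * (1 / (Im z)\<^sup>2)"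
    proof -
      have "61 * 125 * X / (Im z)\<^sup>2 * (5 * X - X / 2) = (68625/2) * (X\<^sup>2 * (1 / (Im z)\<^sup>2))"
        by (simp add: power2_eq_square)
      also have "\<dots> \<le> 35000 * (X\<^sup>2 * (1 / (Im z)\<^sup>2))" by (rule mult_right_mono) auto
      finally show ?thesis by simp
    qed
    also have "1 / (Im z)\<^sup>2 \<le> 4 * (1 + \<bar>Im z\<bar>) powr (-3/2)"
    proof -
      have "(1 + \<bar>Im z\<bar>)\<^sup>2 \<le> (2 * \<bar>Im z\<bar>)\<^sup>2" using True by (intro power_mono) auto
      hence "(1 + \<bar>Im z\<bar>)\<^sup>2 \<le> 4 * (Im z)\<^sup>2" by (simp add: power_mult_distrib)
      hence "1 / (Im z)\<^sup>2 \<le> 4 / (1 + \<bar>Im z\<bar>)\<^sup>2" using True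
        by (simp add: divide_simps add_pos_nonneg zero_less_power) (auto simp: add_pos_nonneg not_less)?
      also have "\<dots> = 4 * (1 + \<bar>Im z\<bar>) powr (-2)" by (simp add: powr_minus_divide)
      finally show ?thesis using pm by linarith
    qed
    hence "35000 * X\<^sup>2 * (1 / (Im z)\<^sup>2) \<le> 35000 * X\<^sup>2 * (4 * (1 + \<bar>Im z\<bar>) powr (-3/2))"
      by (rule mult_left_mono) simp
    finally show ?thesis by simp
  next
    case False
    have "norm (integral ?S (\<lambda>x. of_real (bump (x / X)) * cpow z x)) \<le> (26 * (5 * X)) * (5 * X - X / 2)"
    proof (rule integral_bound)
      show "norm (of_real (bump (x / X)) * cpow z x) \<le> 26 * (5 * X)" if x: "x \<in> ?S" for x
        unfolding norm_mult norm_of_real by (intro mult_mono cz x bb y[OF x]) auto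
    qed (use X pos in \<open>auto intro!: continuous_intros bc continuous_on_cpow\<close>)
    also have "\<dots> = 585 * X\<^sup>2 * 1" by (simp add: power2_eq_square)
    also have "\<dots> \<le> 585 * X\<^sup>2 * (4 * (1 + \<bar>Im z\<bar>) powr (-3/2))"
    proof (rule mult_left_mono)
      have "(2::real) powr (-2) \<le> (1 + \<bar>Im z\<bar>) powr (-2)" using False by (intro powr_mono2') auto
      moreover have "(2::real) powr (-2) = 1/4" by (simp add: powr_minus_divide)
      ultimately show "1 \<le> 4 * (1 + \<bar>Im z\<bar>) powr (-3/2)" using pm by linarith
    qed simp
    also have "\<dots> \<le> 140000 * X\<^sup>2 * (1 + \<bar>Im z\<bar>) powr (-3/2)"
      by (simp add: mult_mono)
    finally show ?thesis .
  qed
qed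

text \<open>Expanding the square gives a double sum over zeros in which \<open>bump_kernel\<close>
  damps pairs of distant heights. The inequality \<open>2 |c c'| <= |c|^2 + |c'|^2\<close> and
  symmetry leave, for every zero, the weighted number of zeros near it, which is O(lg). This is
  Schur's test.\<close>

lemma zeros_mean_square:
  obtains C where "C > 0"
    "\<And>A X c. finite A \<Longrightarrow> A \<subseteq> zeros \<Longrightarrow> (\<And>\<rho>. \<rho> \<in> A \<Longrightarrow> Re \<rho> \<le> 1/2) \<Longrightarrow> X \<ge> 1 \<Longrightarrow>
      integral {X..4*X} (\<lambda>x. (norm (\<Sum>\<rho>\<in>A. of_real (zmult \<rho>) * c \<rho> * cpow \<rho> x))\<^sup>2) \<le> C * X\<^sup>2 * (\<Sum>\<rho>\<in>A. zmult \<rho> * (norm (c \<rho>))\<^sup>2 * lg (Im \<rho>))"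
proof -
  obtain C where C: "C > 0" "\<And>F t. finite F \<Longrightarrow> F \<subseteq> zeros \<Longrightarrow> (\<Sum>\<rho>\<in>F. zmult \<rho> * (1 + \<bar>Im \<rho> - t\<bar>) powr (-3/2)) \<le> C * lg t"
    by (rule zeros_weight_sum) blast
  show ?thesis
  proof (rule that[of "140000 * C"])
    fix A X and c :: "complex \<Rightarrow> complex"
    assume A: "finite A" "A \<subseteq> zeros" and rh: "\<And>\<rho>. \<rho> \<in> A \<Longrightarrow> Re \<rho> \<le> 1/2" and X: "X \<ge> (1::real)"
    let ?S = "{X/2..5*X}"
    have pos: "x > 0" if "x \<in> ?S" for x using that X by auto
    define a where "a = (\<lambda>\<rho>. of_real (zmult \<rho>) * c \<rho>)"
    define f where "f = (\<lambda>x. \<Sum>\<rho>\<in>A. a \<rho> * cpow \<rho> x)"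
    define k where "k = (\<lambda>\<rho> \<sigma>. (1 + \<bar>Im \<rho> - Im \<sigma>\<bar>) powr (-3/2))"
    have fc: "continuous_on ?S f" unfolding f_def
      by (intro continuous_on_sum continuous_on_mult_left continuous_on_cpow pos)
    have bc: "continuous_on ?S (\<lambda>x. bump (x / X))" unfolding bump_def using X by (intro continuous_intros) auto
    have sub: "{X..4*X} \<subseteq> ?S" using X by auto
    have ic: "(\<lambda>x. bump (x / X) * (norm (f x))\<^sup>2) integrable_on {p..q}" if "{p..q} \<subseteq> ?S" for p q
      by (intro integrable_continuous_real continuous_on_subset[OF _ that] continuous_intros bc fc)
    have "integral {X..4*X} (\<lambda>x. (norm (f x))\<^sup>2) \<le> integral {X..4*X} (\<lambda>x. bump (x / X) * (norm (f x))\<^sup>2)"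
    proof (rule integral_le)
      show "(\<lambda>x. (norm (f x))\<^sup>2) integrable_on {X..4*X}"
        by (intro integrable_continuous_real continuous_on_subset[OF _ sub] continuous_intros fc)
      fix x assume x: "x \<in> {X..4*X}"
      have y: "1 \<le> x / X" "x / X \<le> 4" using x X by (auto simp: field_simps)
      have "(v - 1/2) * (5 - v) = 3/2 + (v - 1) * (4 - v) + (1/2) * v" for v :: real
        by (simp add: algebra_simps)
      note this[of "x / X"]
      moreover have "(x / X - 1) * (4 - x / X) \<ge> 0" using y by simp
      ultimately have "((x / X) - 1/2) * (5 - x / X) \<ge> 1" using y by linarith
      hence "bump (x / X) \<ge> 1" unfolding bump_def by (rule one_le_power)
      thus "(norm (f x))\<^sup>2 \<le> bump (x / X) * (norm (f x))\<^sup>2" using mult_right_mono[of 1 "bump (x / X)" "(norm (f x))\<^sup>2"] by simp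
    qed (rule ic[OF sub])
    also have "\<dots> \<le> integral ?S (\<lambda>x. bump (x / X) * (norm (f x))\<^sup>2)"
      by (rule integral_subset_le[OF sub]) (use ic sub in \<open>auto simp: bump_def\<close>)
    also have "\<dots> = norm (complex_of_real (integral ?S (\<lambda>x. bump (x / X) * (norm (f x))\<^sup>2)))"
      unfolding norm_of_real by (rule abs_of_nonneg[symmetric], rule integral_nonneg) (use ic in \<open>auto simp: bump_def\<close>)
    also have "complex_of_real (integral ?S (\<lambda>x. bump (x / X) * (norm (f x))\<^sup>2)) = integral ?S (\<lambda>x. complex_of_real (bump (x / X) * (norm (f x))\<^sup>2))"
      by (rule integral_unique[symmetric], rule has_integral_of_real, rule integrable_integral, rule ic) simp
    \<comment> \<open>The conjugate of \<open>cpow \<sigma> x\<close> is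
      \<open>cpow (cnj \<sigma>) x\<close>, so each product is a single power with exponent
      \<open>\<rho> + cnj \<sigma>\<close>, whose imaginary part is the difference of the
      heights.\<close>
    also have "\<dots> = integral ?S (\<lambda>x. \<Sum>\<rho>\<in>A. \<Sum>\<sigma>\<in>A. a \<rho> * cnj (a \<sigma>) * (of_real (bump (x / X)) * cpow (\<rho> + cnj \<sigma>) x))"
    proof (rule integral_cong)
      fix x assume x: "x \<in> ?S"
      have "complex_of_real (bump (x / X) * (norm (f x))\<^sup>2) = of_real (bump (x / X)) * (f x * cnj (f x))"
        unfolding of_real_mult of_real_power complex_norm_square[symmetric] by (rule refl)
      also have "f x * cnj (f x) = (\<Sum>\<rho>\<in>A. \<Sum>\<sigma>\<in>A. (a \<rho> * cpow \<rho> x) * (cnj (a \<sigma>) * cpow (cnj \<sigma>) x))"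
        unfolding f_def by (simp add: sum_product cnj_cpow)
      also have "of_real (bump (x / X)) * \<dots> = (\<Sum>\<rho>\<in>A. \<Sum>\<sigma>\<in>A. a \<rho> * cnj (a \<sigma>) * (of_real (bump (x / X)) * cpow (\<rho> + cnj \<sigma>) x))"
        unfolding sum_distrib_left by (intro sum.cong refl) (simp add: cpow_add[OF pos[OF x]])
      finally show "complex_of_real (bump (x / X) * (norm (f x))\<^sup>2) = (\<Sum>\<rho>\<in>A. \<Sum>\<sigma>\<in>A. a \<rho> * cnj (a \<sigma>) * (of_real (bump (x / X)) * cpow (\<rho> + cnj \<sigma>) x))" .
    qed
    also have "\<dots> = (\<Sum>\<rho>\<in>A. \<Sum>\<sigma>\<in>A. a \<rho> * cnj (a \<sigma>) * integral ?S (\<lambda>x. of_real (bump (x / X)) * cpow (\<rho> + cnj \<sigma>) x))"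
    proof -
      have i1: "(\<lambda>x. complex_of_real (bump (x / X)) * cpow (\<rho> + cnj \<sigma>) x) integrable_on ?S" for \<rho> \<sigma>
        by (intro integrable_continuous_real continuous_on_mult continuous_on_of_real bc continuous_on_cpow pos)
      have "((\<lambda>x. \<Sum>\<rho>\<in>A. \<Sum>\<sigma>\<in>A. a \<rho> * cnj (a \<sigma>) * (of_real (bump (x / X)) * cpow (\<rho> + cnj \<sigma>) x)) has_integral
        (\<Sum>\<rho>\<in>A. \<Sum>\<sigma>\<in>A. a \<rho> * cnj (a \<sigma>) * integral ?S (\<lambda>x. of_real (bump (x / X)) * cpow (\<rho> + cnj \<sigma>) x))) ?S"
        by (intro has_integral_sum A has_integral_mult_right integrable_integral i1)
      thus ?thesis by (rule integral_unique)
    qed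
    also have "norm \<dots> \<le> (\<Sum>\<rho>\<in>A. \<Sum>\<sigma>\<in>A. norm (a \<rho> * cnj (a \<sigma>) * integral ?S (\<lambda>x. of_real (bump (x / X)) * cpow (\<rho> + cnj \<sigma>) x)))"
      by (intro order_trans[OF norm_sum] sum_mono norm_sum)
    also have "\<dots> \<le> (\<Sum>\<rho>\<in>A. \<Sum>\<sigma>\<in>A. 70000 * X\<^sup>2 * (zmult \<rho> * (norm (c \<rho>))\<^sup>2 * (zmult \<sigma> * k \<sigma> \<rho>) + zmult \<sigma> * (norm (c \<sigma>))\<^sup>2 * (zmult \<rho> * k \<rho> \<sigma>)))"
    proof (intro sum_mono)
      fix \<rho> \<sigma> assume m: "\<rho> \<in> A" "\<sigma> \<in> A"
      have ks: "k \<rho> \<sigma> = k \<sigma> \<rho>" by (simp add: k_def abs_minus_commute)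
      have nI: "norm (integral ?S (\<lambda>x. of_real (bump (x / X)) * cpow (\<rho> + cnj \<sigma>) x)) \<le> 140000 * X\<^sup>2 * k \<rho> \<sigma>"
        unfolding k_def using bump_kernel[OF X, of "\<rho> + cnj \<sigma>"] rh[OF m(1)] rh[OF m(2)]
          zeros_Re[OF subsetD[OF A(2) m(1)]] zeros_Re[OF subsetD[OF A(2) m(2)]] by simp
      have "norm (a \<rho> * cnj (a \<sigma>) * integral ?S (\<lambda>x. of_real (bump (x / X)) * cpow (\<rho> + cnj \<sigma>) x)) \<le>
        (zmult \<rho> * zmult \<sigma> * (norm (c \<rho>) * norm (c \<sigma>))) * (140000 * X\<^sup>2 * k \<rho> \<sigma>)"
      proof -
        have "norm (a \<rho> * cnj (a \<sigma>)) = zmult \<rho> * zmult \<sigma> * (norm (c \<rho>) * norm (c \<sigma>))"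
          by (simp add: a_def norm_mult zmult_nonneg mult_ac)
        thus ?thesis unfolding norm_mult[of "a \<rho> * cnj (a \<sigma>)"] using nI
          by (simp add: mult_left_mono zmult_nonneg)
      qed
      also have "\<dots> \<le> (zmult \<rho> * zmult \<sigma> * (((norm (c \<rho>))\<^sup>2 + (norm (c \<sigma>))\<^sup>2) / 2)) * (140000 * X\<^sup>2 * k \<rho> \<sigma>)"
      proof (intro mult_right_mono mult_left_mono)
        show "norm (c \<rho>) * norm (c \<sigma>) \<le> ((norm (c \<rho>))\<^sup>2 + (norm (c \<sigma>))\<^sup>2) / 2"
          using sum_squares_bound[of "norm (c \<rho>)" "norm (c \<sigma>)"] by simp
      qed (auto simp: zmult_nonneg k_def)
      also have "\<dots> = 70000 * X\<^sup>2 * (zmult \<rho> * (norm (c \<rho>))\<^sup>2 * (zmult \<sigma> * k \<sigma> \<rho>) + zmult \<sigma> * (norm (c \<sigma>))\<^sup>2 * (zmult \<rho> * k \<rho> \<sigma>))"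
        unfolding ks by (simp add: algebra_simps)
      finally show "norm (a \<rho> * cnj (a \<sigma>) * integral ?S (\<lambda>x. of_real (bump (x / X)) * cpow (\<rho> + cnj \<sigma>) x)) \<le>
        70000 * X\<^sup>2 * (zmult \<rho> * (norm (c \<rho>))\<^sup>2 * (zmult \<sigma> * k \<sigma> \<rho>) + zmult \<sigma> * (norm (c \<sigma>))\<^sup>2 * (zmult \<rho> * k \<rho> \<sigma>))" .
    qed
    also have "\<dots> = 70000 * X\<^sup>2 * ((\<Sum>\<rho>\<in>A. \<Sum>\<sigma>\<in>A. zmult \<rho> * (norm (c \<rho>))\<^sup>2 * (zmult \<sigma> * k \<sigma> \<rho>)) + (\<Sum>\<rho>\<in>A. \<Sum>\<sigma>\<in>A. zmult \<sigma> * (norm (c \<sigma>))\<^sup>2 * (zmult \<rho> * k \<rho> \<sigma>)))"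
      by (simp only: sum_distrib_left[symmetric] sum.distrib)
    also have "(\<Sum>\<rho>\<in>A. \<Sum>\<sigma>\<in>A. zmult \<sigma> * (norm (c \<sigma>))\<^sup>2 * (zmult \<rho> * k \<rho> \<sigma>)) = (\<Sum>\<rho>\<in>A. \<Sum>\<sigma>\<in>A. zmult \<rho> * (norm (c \<rho>))\<^sup>2 * (zmult \<sigma> * k \<sigma> \<rho>))"
      by (rule sum.swap)
    also have "70000 * X\<^sup>2 * ((\<Sum>\<rho>\<in>A. \<Sum>\<sigma>\<in>A. zmult \<rho> * (norm (c \<rho>))\<^sup>2 * (zmult \<sigma> * k \<sigma> \<rho>)) + (\<Sum>\<rho>\<in>A. \<Sum>\<sigma>\<in>A. zmult \<rho> * (norm (c \<rho>))\<^sup>2 * (zmult \<sigma> * k \<sigma> \<rho>)))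
       = 140000 * X\<^sup>2 * (\<Sum>\<rho>\<in>A. zmult \<rho> * (norm (c \<rho>))\<^sup>2 * (\<Sum>\<sigma>\<in>A. zmult \<sigma> * k \<sigma> \<rho>))"
      by (simp add: sum_distrib_left mult.assoc)
    also have "\<dots> \<le> 140000 * X\<^sup>2 * (\<Sum>\<rho>\<in>A. zmult \<rho> * (norm (c \<rho>))\<^sup>2 * (C * lg (Im \<rho>)))"
      unfolding k_def by (intro mult_left_mono sum_mono C A) (auto simp: zmult_nonneg)
    also have "\<dots> = 140000 * C * X\<^sup>2 * (\<Sum>\<rho>\<in>A. zmult \<rho> * (norm (c \<rho>))\<^sup>2 * lg (Im \<rho>))"
      by (simp add: sum_distrib_left mult_ac)
    finally show "integral {X..4*X} (\<lambda>x. (norm (\<Sum>\<rho>\<in>A. of_real (zmult \<rho>) * c \<rho> * cpow \<rho> x))\<^sup>2) \<le> 140000 * C * X\<^sup>2 * (\<Sum>\<rho>\<in>A. zmult \<rho> * (norm (c \<rho>))\<^sup>2 * lg (Im \<rho>))"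
      by (simp add: f_def a_def)
  qed (use C in simp)
qed

text \<open>Replaces a logarithm at an arbitrary height by the one at scale \<open>T\<close>, losing
  a power 1/4 only beyond that scale.\<close>

lemma lg_scale_le:
  assumes T: "T \<ge> 1"
  shows "lg t \<le> 9 * lg T * (1 + \<bar>t\<bar> / T) powr (1/4)"
proof -
  have "\<bar>t\<bar> + 2 \<le> (\<bar>T\<bar> + 2) * (1 + \<bar>t\<bar> / T)" using T by (simp add: field_simps)
  hence "lg t \<le> ln ((\<bar>T\<bar> + 2) * (1 + \<bar>t\<bar> / T))" unfolding lg_def by (intro ln_mono) auto
  also have "\<dots> = lg T + ln (1 + \<bar>t\<bar> / T)" unfolding lg_def using T by (intro ln_mult_pos) (auto intro: add_pos_nonneg)
  also have "ln (1 + \<bar>t\<bar> / T) \<le> (1 + \<bar>t\<bar> / T) powr (1/4) / (1/4)" using T by (intro ln_powr_bound) auto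
  also have "\<dots> = 4 * (1 + \<bar>t\<bar> / T) powr (1/4)" by simp
  also have "\<dots> \<le> 8 * lg T * (1 + \<bar>t\<bar> / T) powr (1/4)" using lg_ge[of T] by (intro mult_right_mono) auto
  finally have 1: "lg t \<le> lg T + 8 * lg T * (1 + \<bar>t\<bar> / T) powr (1/4)" by simp
  have "1 \<le> (1 + \<bar>t\<bar> / T) powr (1/4)" using T by (intro ge_one_powr_ge_zero) auto
  hence "lg T * 1 \<le> lg T * (1 + \<bar>t\<bar> / T) powr (1/4)" using lg_pos[of T] by (intro mult_left_mono) auto
  thus ?thesis using 1 by linarith
qed

text \<open>Comparison with the integral of \<open>(1 + x / T) powr (-3/2)\<close>, which is
  \<open>2 * T\<close>, carried out as a telescoping bound by induction.\<close>

lemma sum_scaled_powr_le: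
  fixes T :: real
  assumes T: "T \<ge> 1"
  shows "summable (\<lambda>n. (1 + real n / T) powr (-3/2))" "(\<Sum>n. (1 + real n / T) powr (-3/2)) \<le> 3 * T"
proof -
  have ind: "(\<Sum>n\<le>N. (1 + real n / T) powr (-3/2)) \<le> 1 + 2 * T - 2 * T / sqrt (1 + real N / T)" for N
  proof (induction N)
    case (Suc N)
    define p q where "p = sqrt (1 + real N / T)" and "q = sqrt (1 + real (Suc N) / T)"
    have pq: "0 < p" "p \<le> q" "p\<^sup>2 = 1 + real N / T" "q\<^sup>2 = 1 + real (Suc N) / T"
      using T by (auto simp: p_def q_def divide_right_mono add_pos_nonneg)
    have 1: "T * (q\<^sup>2 - p\<^sup>2) = 1" unfolding pq using T by (simp add: field_simps)
    have "(1 + real (Suc N) / T) powr (-3/2) = (q powr 2) powr (-3/2)" using pq by simp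
    also have "\<dots> = q powr (-3)" unfolding powr_powr by simp
    also have "\<dots> = 1 / q ^ 3" using pq by (simp add: powr_minus_divide)
    also have "\<dots> = T * (q - p) * ((q + p) / q ^ 3)" using 1 by (simp add: power2_eq_square algebra_simps)
    also have "\<dots> \<le> T * (q - p) * (2 / (p * q))"
    proof (rule mult_left_mono)
      have "(q + p) * p \<le> (q + q) * q" using pq by (intro mult_mono) auto
      hence "(q + p) * p * q \<le> (q + q) * q * q" using pq by (intro mult_right_mono) auto
      thus "(q + p) / q ^ 3 \<le> 2 / (p * q)" using pq by (simp add: divide_simps power3_eq_cube algebra_simps)
    qed (use T pq in auto)
    also have "\<dots> = 2 * T / p - 2 * T / q" using pq by (simp add: field_simps)
    finally show ?case using Suc.IH by (simp add: p_def q_def)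
  qed (use T in simp)
  have b: "(\<Sum>n<N. (1 + real n / T) powr (-3/2)) \<le> 3 * T" for N
  proof -
    have "(\<Sum>n<N. (1 + real n / T) powr (-3/2)) \<le> (\<Sum>n\<le>N. (1 + real n / T) powr (-3/2))" by (intro sum_mono2) auto
    also have "\<dots> \<le> 1 + 2 * T - 2 * T / sqrt (1 + real N / T)" by (rule ind)
    also have "\<dots> \<le> 1 + 2 * T - 0" using T by (intro diff_left_mono divide_nonneg_nonneg) auto
    also have "\<dots> \<le> 3 * T" using T by simp
    finally show ?thesis .
  qed
  show s: "summable (\<lambda>n. (1 + real n / T) powr (-3/2))" by (rule summableI_nonneg_bounded[OF _ b]) simp
  show "(\<Sum>n. (1 + real n / T) powr (-3/2)) \<le> 3 * T" by (rule suminf_le_const[OF s b])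
qed

text \<open>About \<open>T * lg T\<close> zeros are effective, each weighted by \<open>lg T\<close>.
  The weight -2 loses 1/4 for the logarithm of the height and 1/4 for the zero count, which leaves
  the exponent -3/2 of \<open>sum_scaled_powr_le\<close>.\<close>

lemma zeros_scaled_sum:
  obtains C where "C > 0"
    "\<And>F T. finite F \<Longrightarrow> F \<subseteq> zeros \<Longrightarrow> T \<ge> 1 \<Longrightarrow> (\<Sum>\<rho>\<in>F. zmult \<rho> * (lg (Im \<rho>) * (1 + \<bar>Im \<rho>\<bar> / T) powr (-2))) \<le> C * T * (lg T)\<^sup>2"
proof -
  obtain C where C: "C > 0" "\<And>F t f \<phi>. finite F \<Longrightarrow> F \<subseteq> zeros \<Longrightarrow> (\<And>\<rho>. \<rho> \<in> F \<Longrightarrow> f \<rho> \<le> \<phi> \<lfloor>Im \<rho> - t\<rfloor>) \<Longrightarrow> (\<And>j. \<phi> j \<ge> 0) \<Longrightarrow>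
       (\<Sum>\<rho>\<in>F. zmult \<rho> * f \<rho>) \<le> (\<Sum>j\<in>(\<lambda>\<rho>. \<lfloor>Im \<rho> - t\<rfloor>) ` F. C * lg (t + of_int j) * \<phi> j)"
    by (rule zeros_partition_sum) blast
  show ?thesis
  proof (rule that[of "2000 * C"])
    fix F and T :: real assume F: "finite F" "F \<subseteq> zeros" and T: "T \<ge> 1"
    define \<phi> where "\<phi> = (\<lambda>j::int. 36 * lg T * (1 + \<bar>of_int j\<bar> / T) powr (-7/4))"
    define h where "h = (\<lambda>n::nat. 324 * C * (lg T)\<^sup>2 * (1 + real n / T) powr (-3/2))"
    have h: "summable h" "suminf h \<le> 324 * C * (lg T)\<^sup>2 * (3 * T)"
      unfolding h_def suminf_mult[OF sum_scaled_powr_le(1)[OF T]]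
      by (rule summable_mult[OF sum_scaled_powr_le(1)[OF T]])
        (rule mult_left_mono[OF sum_scaled_powr_le(2)[OF T]], use C in simp)
    have "(\<Sum>\<rho>\<in>F. zmult \<rho> * (lg (Im \<rho>) * (1 + \<bar>Im \<rho>\<bar> / T) powr (-2))) \<le> (\<Sum>j\<in>(\<lambda>\<rho>. \<lfloor>Im \<rho> - 0\<rfloor>) ` F. C * lg (0 + of_int j) * \<phi> j)"
    proof (rule C(2)[OF F])
      fix \<rho>
      let ?g = "\<bar>Im \<rho>\<bar>" and ?j = "\<bar>of_int \<lfloor>Im \<rho> - 0\<rfloor>\<bar> :: real"
      have pg: "1 + ?g / T > 0" using T by (auto intro: add_pos_nonneg)
      have "?j \<le> ?g + 1" by linarith
      hence "?j / T \<le> (?g + 1) / T" using T by (intro divide_right_mono) auto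
      also have "\<dots> \<le> ?g / T + 1" using T by (simp add: field_simps)
      finally have "?j / T \<le> ?g / T + 1" .
      moreover have "?g / T \<ge> 0" using T by simp
      ultimately have "1 + ?j / T \<le> (1 + ?g / T) * 2" by argo
      hence jg: "(1 + ?j / T) / 2 \<le> 1 + ?g / T" by simp
      have "lg (Im \<rho>) * (1 + ?g / T) powr (-2) \<le> 9 * lg T * (1 + ?g / T) powr (1/4) * (1 + ?g / T) powr (-2)"
        by (intro mult_right_mono lg_scale_le T) auto
      also have "\<dots> = 9 * lg T * (1 + ?g / T) powr (-7/4)" using pg by (simp add: powr_add[symmetric])
      also have "\<dots> \<le> 9 * lg T * ((1 + ?j / T) / 2) powr (-7/4)"
        using T lg_pos[of T] jg by (intro mult_left_mono powr_mono2') (auto intro: add_pos_nonneg)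
      also have "((1 + ?j / T) / 2) powr (-7/4) = 2 powr (7/4) * (1 + ?j / T) powr (-7/4)"
        using powr_neg_divide[of "1 + ?j / T" 2 "7/4"] T by simp
      also have "9 * lg T * (2 powr (7/4) * (1 + ?j / T) powr (-7/4)) \<le> 9 * lg T * (4 * (1 + ?j / T) powr (-7/4))"
        using powr_mono[of "7/4" 2 "2::real"] lg_pos[of T] by (intro mult_left_mono mult_right_mono) auto
      finally show "lg (Im \<rho>) * (1 + ?g / T) powr (-2) \<le> \<phi> \<lfloor>Im \<rho> - 0\<rfloor>" by (simp add: \<phi>_def)
    qed (use lg_pos[of T] in \<open>auto simp: \<phi>_def\<close>)
    also have "\<dots> \<le> (\<Sum>j\<in>(\<lambda>\<rho>. \<lfloor>Im \<rho> - 0\<rfloor>) ` F. h (nat \<bar>j\<bar>))"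
    proof (rule sum_mono)
      fix j :: int
      have pj: "1 + \<bar>of_int j\<bar> / T > 0" using T by (auto intro: add_pos_nonneg)
      have "C * lg (0 + of_int j) * \<phi> j \<le> C * (9 * lg T * (1 + \<bar>of_int j\<bar> / T) powr (1/4)) * \<phi> j"
        using C(1) lg_scale_le[OF T, of "of_int j"] lg_pos[of T] by (intro mult_right_mono mult_left_mono) (auto simp: \<phi>_def)
      also have "\<dots> = 324 * C * (lg T)\<^sup>2 * ((1 + \<bar>of_int j\<bar> / T) powr (1/4) * (1 + \<bar>of_int j\<bar> / T) powr (-7/4))"
        by (simp add: \<phi>_def power2_eq_square)
      also have "(1 + \<bar>of_int j\<bar> / T) powr (1/4) * (1 + \<bar>of_int j\<bar> / T) powr (-7/4) = (1 + \<bar>of_int j\<bar> / T) powr (-3/2)"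
        using pj by (simp add: powr_add[symmetric])
      also have "324 * C * (lg T)\<^sup>2 * (1 + \<bar>of_int j\<bar> / T) powr (-3/2) = h (nat \<bar>j\<bar>)" by (simp add: h_def)
      finally show "C * lg (0 + of_int j) * \<phi> j \<le> h (nat \<bar>j\<bar>)" .
    qed
    also have "\<dots> \<le> 2 * suminf h" by (rule sum_int_le_suminf) (use F h C in \<open>auto simp: h_def\<close>)
    also have "\<dots> \<le> 2 * (324 * C * (lg T)\<^sup>2 * (3 * T))" using h(2) by (rule mult_left_mono) simp
    also have "\<dots> \<le> 2000 * C * T * (lg T)\<^sup>2" using C T by (simp add: mult_ac mult_right_mono)
    finally show "(\<Sum>\<rho>\<in>F. zmult \<rho> * (lg (Im \<rho>) * (1 + \<bar>Im \<rho>\<bar> / T) powr (-2))) \<le> 2000 * C * T * (lg T)\<^sup>2" .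
  qed (use C in simp)
qed

text \<open>
  The trivial bound and the mean value bound are interpolated, with weights 3/4 and 1/4: the powers of
  \<open>x\<close> cancel, and the loss in \<open>t\<close> is small enough to be integrated against \<open>(1 + \<bar>t\<bar>) powr (-11/8)\<close>.
\<close>
lemma cpow_diff_le:
  assumes x: "x \<ge> 1"
  shows "norm (cpow (Complex (1/4) t) (x + 1) - cpow (Complex (1/4) t) x) \<le> 4 * (1 + \<bar>t\<bar>) powr (1/4)"
proof -
  let ?s = "Complex (1/4) t"
  define a where "a = norm (cpow ?s (x + 1) - cpow ?s x)"
  define w where "w = x powr (1/4)"
  have w: "w > 0" using x by (simp add: w_def)
  have w3: "x powr (-3/4) = 1 / w ^ 3" using x by (simp add: w_def powr_power powr_minus_divide)
  have n: "norm ?s \<le> 1 + \<bar>t\<bar>" using cmod_le[of ?s] by simp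
  have p: "a \<le> (1 + \<bar>t\<bar>) / w ^ 3"
  proof -
    have "((\<lambda>y. ?s * cpow (?s - 1) y) has_integral (cpow ?s (x + 1) - cpow ?s x)) {x..x+1}"
      using x by (intro fundamental_theorem_of_calculus cpow_deriv) auto
    hence "a = norm (integral {x..x+1} (\<lambda>y. ?s * cpow (?s - 1) y))" unfolding a_def by (simp only: integral_unique)
    also have "\<dots> \<le> ((1 + \<bar>t\<bar>) / w ^ 3) * (x + 1 - x)"
    proof (rule integral_bound)
      show "continuous_on {x..x + 1} (\<lambda>y. ?s * cpow (?s - 1) y)"
        by (intro continuous_on_mult_left continuous_on_cpow) (use x in auto)
      fix y assume y: "y \<in> {x..x+1}"
      have "norm (cpow (?s - 1) y) = y powr (-3/4)" using y x by (simp add: norm_cpow)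
      also have "\<dots> \<le> x powr (-3/4)" using y x by (intro powr_mono2') auto
      finally show "norm (?s * cpow (?s - 1) y) \<le> (1 + \<bar>t\<bar>) / w ^ 3"
        unfolding norm_mult w3 using mult_mono[OF n, of "norm (cpow (?s - 1) y)" "1 / w ^ 3"] by simp
    qed simp
    finally show ?thesis by simp
  qed
  have q: "a \<le> 4 * w"
  proof -
    have "(x + 1) powr (1/4) \<le> (2 * x) powr (1/4)" using x by (intro powr_mono2) auto
    also have "\<dots> = 2 powr (1/4) * w" using x by (simp add: w_def powr_mult)
    also have "\<dots> \<le> 2 * w" using powr_mono[of "1/4" 1 "2::real"] w by (intro mult_right_mono) auto
    finally have "norm (cpow ?s (x + 1)) \<le> 2 * w" using x by (simp add: norm_cpow)
    moreover have "norm (cpow ?s x) = w" using x by (simp add: norm_cpow w_def)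
    moreover have "a \<le> norm (cpow ?s (x + 1)) + norm (cpow ?s x)" unfolding a_def by (rule norm_triangle_ineq4)
    ultimately show ?thesis using w by linarith
  qed
  have a0: "a \<ge> 0" by (simp add: a_def)
  have "a ^ Suc 3 = a * a ^ 3" by (rule power_Suc)
  also have "\<dots> \<le> ((1 + \<bar>t\<bar>) / w ^ 3) * (4 * w) ^ 3"
    using w a0 by (intro mult_mono p power_mono q) auto
  also have "\<dots> = 64 * (1 + \<bar>t\<bar>)" using w by (simp add: power_mult_distrib)
  also have "\<dots> \<le> 256 * (1 + \<bar>t\<bar>)" by simp
  also have "\<dots> = (4 * (1 + \<bar>t\<bar>) powr (1/4)) ^ Suc 3"
    by (simp add: power_mult_distrib powr_power)
  finally have "a \<le> 4 * (1 + \<bar>t\<bar>) powr (1/4)" by (rule power_le_imp_le_base) simp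
  thus ?thesis by (simp add: a_def)
qed

text \<open>Unit differences of the error are bounded because \<open>cpow_diff_le\<close> costs only
  a power 1/4 of the height, and -11/8 + 1/4 = -9/8 is still integrable. The bound for
  \<open>e x\<close> itself is crude but sufficient for an O(N) term.\<close>

lemma explicit_formula_real:
  obtains \<alpha> \<beta> :: complex and e :: "real \<Rightarrow> complex" and C :: real where
    "C > 0" "\<And>x. x \<ge> 1 \<Longrightarrow> norm (e (x + 1) - e x) \<le> C" "\<And>x. x \<ge> 1 \<Longrightarrow> norm (e x) \<le> C * x"
    "\<And>x. x \<ge> 1 \<Longrightarrow> complex_of_real (psi1 x) = of_real (x\<^sup>2 / 2) + \<alpha> * of_real x + \<beta>
        - (\<Sum>\<^sub>\<infinity>\<rho>\<in>zeros. of_real (zmult \<rho>) * cpow (\<rho> + 1) x / (\<rho> * (\<rho> + 1))) + e x"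
proof -
  obtain \<alpha> \<beta> :: complex and G :: "real \<Rightarrow> complex" and C :: real where
    C: "C > 0" "continuous_on UNIV G" "\<And>t. norm (G t) \<le> C * (1 + \<bar>t\<bar>) powr (-11/8)"
    and EF: "\<And>u. u \<ge> 0 \<Longrightarrow> of_real (psi1 (exp u)) = exp (2 * complex_of_real u) / 2 + \<alpha> * exp (complex_of_real u) + \<beta>
        - (\<Sum>\<^sub>\<infinity>\<rho>\<in>zeros. of_real (zmult \<rho>) * exp ((\<rho> + 1) * of_real u) / (\<rho> * (\<rho> + 1)))
        + (LINT t|lborel. G t * exp (Complex (1/4) t * of_real u))"
    by (rule explicit_formula) blast
  define e where "e = (\<lambda>x. LINT t|lborel. G t * cpow (Complex (1/4) t) x)"
  have tc: "continuous_on UNIV (\<lambda>t. cpow (Complex (1/4) t) x)" for x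
  proof -
    have "Complex (1/4) t = 1/4 + \<i> * of_real t" for t by (simp add: complex_eq_iff)
    thus ?thesis unfolding cpow_def by (auto intro!: continuous_intros)
  qed
  have bd: "norm (G t * cpow (Complex (1/4) t) x) \<le> C * x * (1 + \<bar>t\<bar>) powr (-11/8)" if x: "x \<ge> 1" for x t
  proof -
    have "x powr (1/4) \<le> x powr 1" using x by (intro powr_mono) auto
    hence "norm (cpow (Complex (1/4) t) x) \<le> x" using x by (simp add: norm_cpow)
    hence "norm (G t) * norm (cpow (Complex (1/4) t) x) \<le> (C * (1 + \<bar>t\<bar>) powr (-11/8)) * x"
      using C(1) by (intro mult_mono C(3)) auto
    thus ?thesis by (simp add: norm_mult mult_ac)
  qed
  have int: "integrable lborel (\<lambda>t. G t * cpow (Complex (1/4) t) x)" if "x \<ge> 1" for x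
    by (rule integrable_of_decay[OF continuous_on_mult[OF C(2) tc] bd[OF that]]) simp
  define K where "K = (LINT t|lborel. (1 + \<bar>t::real\<bar>) powr (-9/8))"
  define L where "L = (LINT t|lborel. (1 + \<bar>t::real\<bar>) powr (-11/8))"
  have K0: "K \<ge> 0" "L \<ge> 0" by (auto simp: K_def L_def intro!: Bochner_Integration.integral_nonneg)
  show ?thesis
  proof (rule that[of "1 + 4 * C * K + C * L" e \<alpha> \<beta>])
    show "1 + 4 * C * K + C * L > 0" using C K0 by (intro add_pos_nonneg) auto
    fix x :: real assume x: "x \<ge> 1"
    have "e (x + 1) - e x = (LINT t|lborel. G t * cpow (Complex (1/4) t) (x + 1) - G t * cpow (Complex (1/4) t) x)"
      unfolding e_def using x by (intro Bochner_Integration.integral_diff[symmetric] int) auto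
    also have "norm \<dots> \<le> (LINT t|lborel. 4 * C * (1 + \<bar>t\<bar>) powr (-9/8))"
    proof (rule Bochner_Integration.integral_norm_bound_integral)
      show "integrable lborel (\<lambda>t. G t * cpow (Complex (1/4) t) (x + 1) - G t * cpow (Complex (1/4) t) x)"
        using x by (intro Bochner_Integration.integrable_diff int) auto
      show "integrable lborel (\<lambda>t. 4 * C * (1 + \<bar>t\<bar>) powr (-9/8))"
        by (intro integrable_mult_right integrable_decay) simp
      fix t :: real
      have "norm (G t * cpow (Complex (1/4) t) (x + 1) - G t * cpow (Complex (1/4) t) x) =
        norm (G t) * norm (cpow (Complex (1/4) t) (x + 1) - cpow (Complex (1/4) t) x)"
        unfolding right_diff_distrib[symmetric] norm_mult ..
      also have "\<dots> \<le> (C * (1 + \<bar>t\<bar>) powr (-11/8)) * (4 * (1 + \<bar>t\<bar>) powr (1/4))"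
        using C(1) by (intro mult_mono C(3) cpow_diff_le x) auto
      also have "\<dots> = 4 * C * ((1 + \<bar>t\<bar>) powr (-11/8) * (1 + \<bar>t\<bar>) powr (1/4))" by simp
      also have "(1 + \<bar>t\<bar>) powr (-11/8) * (1 + \<bar>t\<bar>) powr (1/4) = (1 + \<bar>t\<bar>) powr (-9/8)"
        by (simp add: powr_add[symmetric])
      finally show "norm (G t * cpow (Complex (1/4) t) (x + 1) - G t * cpow (Complex (1/4) t) x) \<le> 4 * C * (1 + \<bar>t\<bar>) powr (-9/8)" .
    qed
    also have "\<dots> = 4 * C * K" unfolding K_def by (rule integral_mult_right_zero)
    also have "\<dots> \<le> 1 + 4 * C * K + C * L" using C K0 by simp
    finally show "norm (e (x + 1) - e x) \<le> 1 + 4 * C * K + C * L" .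
    have "norm (e x) \<le> (LINT t|lborel. C * x * (1 + \<bar>t\<bar>) powr (-11/8))"
      unfolding e_def
    proof (rule Bochner_Integration.integral_norm_bound_integral[OF int[OF x] _ bd[OF x]])
      show "integrable lborel (\<lambda>t. C * x * (1 + \<bar>t\<bar>) powr (-11/8))"
        by (intro integrable_mult_right integrable_decay) simp
    qed
    also have "\<dots> = C * x * L" unfolding L_def by (rule integral_mult_right_zero)
    also have "\<dots> = (C * L) * x" by simp
    also have "\<dots> \<le> (1 + 4 * C * K + C * L) * x" using C K0 x by (intro mult_right_mono) auto
    finally show "norm (e x) \<le> (1 + 4 * C * K + C * L) * x" .
    have 1: "exp (2 * complex_of_real (ln x)) = of_real (x\<^sup>2)" "exp (complex_of_real (ln x)) = of_real x"
      using x by (simp_all add: exp_double exp_of_real)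
    show "complex_of_real (psi1 x) = of_real (x\<^sup>2 / 2) + \<alpha> * of_real x + \<beta>
        - (\<Sum>\<^sub>\<infinity>\<rho>\<in>zeros. of_real (zmult \<rho>) * cpow (\<rho> + 1) x / (\<rho> * (\<rho> + 1))) + e x"
      using EF[of "ln x"] x unfolding 1 e_def cpow_def by simp
  qed
qed

text \<open>First of three sums, each the derivative of the preceding one. The terms are written as
  multiplicity times coefficient times power to match \<open>zeros_mean_square\<close>.\<close>

definition zero_sum2 :: "complex set \<Rightarrow> real \<Rightarrow> complex" where
  "zero_sum2 A x = (\<Sum>\<rho>\<in>A. of_real (zmult \<rho>) * (1 / (\<rho> * (\<rho> + 1))) * cpow (\<rho> + 1) x)"

definition zero_sum1 :: "complex set \<Rightarrow> real \<Rightarrow> complex" where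
  "zero_sum1 A x = (\<Sum>\<rho>\<in>A. of_real (zmult \<rho>) * (1 / \<rho>) * cpow \<rho> x)"

text \<open>The exponent \<open>\<rho> - 1\<close> is expressed by a division by \<open>x\<close>,
  because the mean square lemma is about powers with exponent \<open>\<rho>\<close>.\<close>

definition zero_sum0 :: "complex set \<Rightarrow> real \<Rightarrow> complex" where
  "zero_sum0 A x = (\<Sum>\<rho>\<in>A. of_real (zmult \<rho>) * 1 * cpow \<rho> x) / of_real x"

lemma zero_sum2_deriv:
  assumes "A \<subseteq> zeros" "x > 0"
  shows "(zero_sum2 A has_vector_derivative zero_sum1 A x) (at x within S)"
  unfolding zero_sum2_def[abs_def] zero_sum1_def
proof (rule has_vector_derivative_sum)
  fix \<rho> assume "\<rho> \<in> A"
  hence nz: "\<rho> \<noteq> 0" "\<rho> + 1 \<noteq> 0" using assms zeros_neq[of \<rho>] by (auto simp: add_eq_0_iff2)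
  have "((\<lambda>x. of_real (zmult \<rho>) * (1 / (\<rho> * (\<rho> + 1))) * cpow (\<rho> + 1) x) has_vector_derivative
     of_real (zmult \<rho>) * (1 / (\<rho> * (\<rho> + 1))) * ((\<rho> + 1) * cpow (\<rho> + 1 - 1) x)) (at x within S)"
    by (intro has_vector_derivative_mult_right cpow_deriv assms)
  moreover have "of_real (zmult \<rho>) * (1 / (\<rho> * (\<rho> + 1))) * ((\<rho> + 1) * cpow (\<rho> + 1 - 1) x) = of_real (zmult \<rho>) * (1 / \<rho>) * cpow \<rho> x"
    using nz by simp
  ultimately show "((\<lambda>x. of_real (zmult \<rho>) * (1 / (\<rho> * (\<rho> + 1))) * cpow (\<rho> + 1) x) has_vector_derivative
     of_real (zmult \<rho>) * (1 / \<rho>) * cpow \<rho> x) (at x within S)" by simp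
qed

lemma zero_sum1_deriv:
  assumes "A \<subseteq> zeros" "x > 0"
  shows "(zero_sum1 A has_vector_derivative zero_sum0 A x) (at x within S)"
  unfolding zero_sum1_def[abs_def] zero_sum0_def sum_divide_distrib
proof (rule has_vector_derivative_sum)
  fix \<rho> assume "\<rho> \<in> A"
  hence nz: "\<rho> \<noteq> 0" using assms zeros_neq[of \<rho>] by auto
  have "((\<lambda>x. of_real (zmult \<rho>) * (1 / \<rho>) * cpow \<rho> x) has_vector_derivative
     of_real (zmult \<rho>) * (1 / \<rho>) * (\<rho> * cpow (\<rho> - 1) x)) (at x within S)"
    by (intro has_vector_derivative_mult_right cpow_deriv assms)
  moreover have "of_real (zmult \<rho>) * (1 / \<rho>) * (\<rho> * cpow (\<rho> - 1) x) = of_real (zmult \<rho>) * 1 * cpow \<rho> x / of_real x"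
    using nz assms(2) cpow_add_1[of x "\<rho> - 1"] by simp
  ultimately show "((\<lambda>x. of_real (zmult \<rho>) * (1 / \<rho>) * cpow \<rho> x) has_vector_derivative
     of_real (zmult \<rho>) * 1 * cpow \<rho> x / of_real x) (at x within S)" by simp
qed

lemma continuous_on_zero_sum:
  assumes "A \<subseteq> zeros" "\<And>x. x \<in> S \<Longrightarrow> x > 0"
  shows "continuous_on S (zero_sum2 A)" "continuous_on S (zero_sum1 A)" "continuous_on S (zero_sum0 A)"
proof -
  show "continuous_on S (zero_sum2 A)" "continuous_on S (zero_sum1 A)"
    using zero_sum2_deriv[OF assms(1)] zero_sum1_deriv[OF assms(1)] assms(2)
    by (meson continuous_on_eq_continuous_within has_vector_derivative_continuous)+
  show "continuous_on S (zero_sum0 A)"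
    unfolding zero_sum0_def[abs_def]
    by (intro continuous_on_divide continuous_on_sum continuous_on_mult_left continuous_on_cpow continuous_on_of_real continuous_on_id assms(2))
      (use assms(2) in force)+
qed

text \<open>The zeros' part, up to sign, of \<open>psi1 (x + 1) - psi1 x\<close>.\<close>

definition zero_sum_diff :: "complex set \<Rightarrow> real \<Rightarrow> complex" where
  "zero_sum_diff A x = zero_sum2 A (x + 1) - zero_sum2 A x"

lemma continuous_on_zero_sum_diff:
  assumes "A \<subseteq> zeros" "a > 0" "h \<ge> 0"
  shows "continuous_on {a..b} (\<lambda>x. zero_sum_diff A (x + h))"
proof -
  have c: "continuous_on {0<..} (zero_sum2 A)" by (rule continuous_on_zero_sum) (use assms in auto)
  show ?thesis unfolding zero_sum_diff_def
    by (intro continuous_on_diff continuous_on_compose2[OF c] continuous_intros) (use assms in auto)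
qed

lemma norm_add_square_le: "(norm (a + b :: 'a :: real_normed_vector))\<^sup>2 \<le> 2 * (norm a)\<^sup>2 + 2 * (norm b)\<^sup>2"
proof -
  have "(norm (a + b))\<^sup>2 \<le> (norm a + norm b)\<^sup>2" by (intro power_mono norm_triangle_ineq) auto
  also have "\<dots> \<le> 2 * (norm a)\<^sup>2 + 2 * (norm b)\<^sup>2"
    using sum_squares_bound[of "norm a" "norm b"] by (simp add: power2_sum)
  finally show ?thesis .
qed

text \<open>
  Zeros of height at most \<open>X / h\<close> are differentiated in \<open>h\<close>; for the higher ones the difference in \<open>h\<close> is
  bounded by its two terms.
\<close>
lemma zero_sum_diff_mean:
  assumes rh: "\<And>\<rho>. \<rho> \<in> zeros \<Longrightarrow> Re \<rho> \<le> 1/2"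
  obtains C where "C > 0"
    "\<And>A X. finite A \<Longrightarrow> A \<subseteq> zeros \<Longrightarrow> X \<ge> 1 \<Longrightarrow> integral {X..2*X} (\<lambda>x. (norm (zero_sum_diff A x))\<^sup>2) \<le> C * X\<^sup>2"
    "\<And>A X h. finite A \<Longrightarrow> A \<subseteq> zeros \<Longrightarrow> 1 \<le> h \<Longrightarrow> h \<le> X \<Longrightarrow>
      integral {X..2*X} (\<lambda>x. (norm (zero_sum_diff A (x + h) - zero_sum_diff A x))\<^sup>2) \<le> C * h * X * (lg X)\<^sup>2"
proof -
  obtain C where C: "C > 0"
    "\<And>A X c. finite A \<Longrightarrow> A \<subseteq> zeros \<Longrightarrow> (\<And>\<rho>. \<rho> \<in> A \<Longrightarrow> Re \<rho> \<le> 1/2) \<Longrightarrow> X \<ge> 1 \<Longrightarrow>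
      integral {X..4*X} (\<lambda>x. (norm (\<Sum>\<rho>\<in>A. of_real (zmult \<rho>) * c \<rho> * cpow \<rho> x))\<^sup>2) \<le> C * X\<^sup>2 * (\<Sum>\<rho>\<in>A. zmult \<rho> * (norm (c \<rho>))\<^sup>2 * lg (Im \<rho>))"
    by (rule zeros_mean_square) blast
  obtain c where c: "c > 0" "c \<le> 1" "\<And>\<rho>. \<rho> \<in> zeros \<Longrightarrow> c * (1 + \<bar>Im \<rho>\<bar>) \<le> norm \<rho>"
    by (rule zeros_norm_ge) blast
  obtain B where B: "B > 0"
    "\<And>F T. finite F \<Longrightarrow> F \<subseteq> zeros \<Longrightarrow> T \<ge> 1 \<Longrightarrow> (\<Sum>\<rho>\<in>F. zmult \<rho> * (lg (Im \<rho>) * (1 + \<bar>Im \<rho>\<bar> / T) powr (-2))) \<le> B * T * (lg T)\<^sup>2"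
    by (rule zeros_scaled_sum) blast
  \<comment> \<open>The unit difference is replaced by the derivative, with coefficients
    \<open>1 / \<rho>\<close>. The interval up to \<open>3 * X\<close> also accommodates the
    arguments \<open>x + h\<close>.\<close>
  have hi: "integral {X..3*X} (\<lambda>x. (norm (zero_sum_diff A x))\<^sup>2) \<le> C * X\<^sup>2 * (\<Sum>\<rho>\<in>A. zmult \<rho> * (norm (1 / \<rho>))\<^sup>2 * lg (Im \<rho>))"
    if A: "finite A" "A \<subseteq> zeros" and X: "X \<ge> 1" for A X
  proof -
    have "integral {X..3*X} (\<lambda>x. (norm (zero_sum_diff A x))\<^sup>2) \<le> 1\<^sup>2 * integral {X..3*X+1} (\<lambda>x. (norm (zero_sum1 A x))\<^sup>2)"
      unfolding zero_sum_diff_def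
      by (rule integral_diff_square_le) (use A X in \<open>auto intro!: zero_sum2_deriv continuous_on_zero_sum\<close>)
    also have "\<dots> = integral {X..3*X+1} (\<lambda>x. (norm (zero_sum1 A x))\<^sup>2)" by simp
    also have "\<dots> \<le> integral {X..4*X} (\<lambda>x. (norm (zero_sum1 A x))\<^sup>2)"
      by (rule integral_subset_le)
        (use A X in \<open>auto intro!: integrable_continuous_real continuous_on_power continuous_on_norm continuous_on_zero_sum\<close>)
    also have "\<dots> \<le> C * X\<^sup>2 * (\<Sum>\<rho>\<in>A. zmult \<rho> * (norm (1 / \<rho>))\<^sup>2 * lg (Im \<rho>))"
      unfolding zero_sum1_def by (rule C(2)) (use A X rh in auto)
    finally show ?thesis .
  qed
  \<comment> \<open>Both differences, of lengths \<open>h\<close> and 1, become derivatives: this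
    gives \<open>h\<^sup>2\<close> and coefficients 1. The division by \<open>x\<close> in
    \<open>zero_sum0\<close> cancels the \<open>X\<^sup>2\<close> of the mean square.\<close>
  have lo: "integral {X..2*X} (\<lambda>x. (norm (zero_sum_diff A (x + h) - zero_sum_diff A x))\<^sup>2) \<le> h\<^sup>2 * (C * (\<Sum>\<rho>\<in>A. zmult \<rho> * lg (Im \<rho>)))"
    if A: "finite A" "A \<subseteq> zeros" and h: "1 \<le> h" "h \<le> X" for A X h
  proof -
    have X: "X \<ge> 1" using h by simp
    define W where "W = (\<lambda>x. \<Sum>\<rho>\<in>A. of_real (zmult \<rho>) * 1 * cpow \<rho> x)"
    have Wc: "continuous_on {X..4*X} W" unfolding W_def
      by (intro continuous_on_sum continuous_on_mult_left continuous_on_cpow) (use X in auto)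
    have d: "(zero_sum_diff A has_vector_derivative zero_sum1 A (x + 1) - zero_sum1 A x) (at x within S)" if "x > 0" for x S
    proof -
      have "((\<lambda>x. zero_sum2 A (x + 1)) has_vector_derivative zero_sum1 A (x + 1)) (at x within S)"
      proof -
        have "((zero_sum2 A \<circ> (\<lambda>x. x + 1)) has_vector_derivative (1 *\<^sub>R zero_sum1 A (x + 1))) (at x within S)"
          by (rule vector_diff_chain_within)
            (use A that in \<open>auto intro!: derivative_eq_intros zero_sum2_deriv\<close>)
        thus ?thesis by (simp add: o_def)
      qed
      thus ?thesis unfolding zero_sum_diff_def[abs_def]
        by (intro has_vector_derivative_diff zero_sum2_deriv A that)
    qed
    have "integral {X..2*X} (\<lambda>x. (norm (zero_sum_diff A (x + h) - zero_sum_diff A x))\<^sup>2) \<le>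
      h\<^sup>2 * integral {X..2*X+h} (\<lambda>x. (norm (zero_sum1 A (x + 1) - zero_sum1 A x))\<^sup>2)"
    proof (rule integral_diff_square_le)
      have c: "continuous_on {0<..} (zero_sum1 A)" by (rule continuous_on_zero_sum) (use A in auto)
      show "continuous_on {X..2*X+h} (\<lambda>x. zero_sum1 A (x + 1) - zero_sum1 A x)"
        by (intro continuous_on_diff continuous_on_compose2[OF c] continuous_intros) (use X in auto)
    qed (use h X in \<open>auto intro!: d\<close>)
    also have "integral {X..2*X+h} (\<lambda>x. (norm (zero_sum1 A (x + 1) - zero_sum1 A x))\<^sup>2) \<le> 1\<^sup>2 * integral {X..2*X+h+1} (\<lambda>x. (norm (zero_sum0 A x))\<^sup>2)"
      by (rule integral_diff_square_le) (use A X h in \<open>auto intro!: zero_sum1_deriv continuous_on_zero_sum\<close>)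
    also have "\<dots> = integral {X..2*X+h+1} (\<lambda>x. (norm (zero_sum0 A x))\<^sup>2)" by simp
    also have "\<dots> \<le> integral {X..4*X} (\<lambda>x. (norm (zero_sum0 A x))\<^sup>2)"
      by (rule integral_subset_le)
        (use A X h in \<open>auto intro!: integrable_continuous_real continuous_on_power continuous_on_norm continuous_on_zero_sum\<close>)
    also have "\<dots> \<le> integral {X..4*X} (\<lambda>x. 1 / X\<^sup>2 * (norm (W x))\<^sup>2)"
    proof (rule integral_le)
      show "(\<lambda>x. (norm (zero_sum0 A x))\<^sup>2) integrable_on {X..4*X}"
        using A X by (auto intro!: integrable_continuous_real continuous_on_power continuous_on_norm continuous_on_zero_sum)
      show "(\<lambda>x. 1 / X\<^sup>2 * (norm (W x))\<^sup>2) integrable_on {X..4*X}"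
        by (intro integrable_continuous_real continuous_on_mult_left continuous_on_power continuous_on_norm Wc)
      fix x assume x: "x \<in> {X..4*X}"
      have "(norm (zero_sum0 A x))\<^sup>2 = (norm (W x))\<^sup>2 / x\<^sup>2"
        using x X by (simp add: zero_sum0_def W_def norm_divide power_divide)
      also have "\<dots> \<le> (norm (W x))\<^sup>2 / X\<^sup>2" using x X by (intro divide_left_mono power_mono) auto
      finally show "(norm (zero_sum0 A x))\<^sup>2 \<le> 1 / X\<^sup>2 * (norm (W x))\<^sup>2" by simp
    qed
    also have "\<dots> = 1 / X\<^sup>2 * integral {X..4*X} (\<lambda>x. (norm (W x))\<^sup>2)" by (rule integral_mult_right)
    also have "\<dots> \<le> 1 / X\<^sup>2 * (C * X\<^sup>2 * (\<Sum>\<rho>\<in>A. zmult \<rho> * (norm (1::complex))\<^sup>2 * lg (Im \<rho>)))"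
      unfolding W_def by (intro mult_left_mono C(2)) (use A X rh in auto)
    also have "\<dots> = C * (\<Sum>\<rho>\<in>A. zmult \<rho> * lg (Im \<rho>))" using X by simp
    finally show ?thesis by (simp add: mult_left_mono)
  qed
  \<comment> \<open>For a zero of height at least about \<open>T\<close>,
    \<open>1 + |Im \<rho>|\<close> is at least half of \<open>T + |Im \<rho>|\<close>, so
    \<open>1 / |\<rho>|^2\<close> is \<open>1 / T^2\<close> times the weight of
    \<open>zeros_scaled_sum\<close>.\<close>
  have inv: "zmult \<rho> * (norm (1 / \<rho>))\<^sup>2 * lg (Im \<rho>) \<le> 4 / (c\<^sup>2 * T\<^sup>2) * (zmult \<rho> * (lg (Im \<rho>) * (1 + \<bar>Im \<rho>\<bar> / T) powr (-2)))"
    if \<rho>: "\<rho> \<in> zeros" and T: "T \<ge> 1" "T \<le> 1 + \<bar>Im \<rho>\<bar>" for \<rho> T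
  proof -
    let ?g = "\<bar>Im \<rho>\<bar>"
    have "T * (1 + ?g / T) = T + ?g" using T by (simp add: field_simps)
    also have "\<dots> \<le> 2 * (1 + ?g)" using T by simp
    finally have "c * (T * (1 + ?g / T)) \<le> c * (2 * (1 + ?g))" using c by (intro mult_left_mono) auto
    also have "\<dots> = 2 * (c * (1 + ?g))" by simp
    also have "\<dots> \<le> 2 * norm \<rho>" using c(3)[OF \<rho>] by (rule mult_left_mono) simp
    finally have "(c * (T * (1 + ?g / T)))\<^sup>2 \<le> (2 * norm \<rho>)\<^sup>2" using c T by (intro power_mono) auto
    hence le: "c\<^sup>2 * T\<^sup>2 * (1 + ?g / T)\<^sup>2 \<le> 4 * (norm \<rho>)\<^sup>2" by (simp add: power_mult_distrib mult_ac)
    have pos: "c\<^sup>2 * T\<^sup>2 * (1 + ?g / T)\<^sup>2 > 0" using c T by (auto intro!: mult_pos_pos zero_less_power add_pos_nonneg)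
    have "(norm (1 / \<rho>))\<^sup>2 = 4 / (4 * (norm \<rho>)\<^sup>2)" by (simp add: norm_divide power_divide)
    also have "\<dots> \<le> 4 / (c\<^sup>2 * T\<^sup>2 * (1 + ?g / T)\<^sup>2)" by (rule divide_left_mono[OF le _ mult_pos_pos[OF order_less_le_trans[OF pos le] pos]]) simp
    also have "\<dots> = 4 / (c\<^sup>2 * T\<^sup>2) * (1 + ?g / T) powr (-2)"
      using T by (simp add: powr_minus_divide add_pos_nonneg)
    finally have "(zmult \<rho> * lg (Im \<rho>)) * (norm (1 / \<rho>))\<^sup>2 \<le> (zmult \<rho> * lg (Im \<rho>)) * (4 / (c\<^sup>2 * T\<^sup>2) * (1 + ?g / T) powr (-2))"
      using zmult_nonneg[of \<rho>] lg_pos[of "Im \<rho>"] by (intro mult_left_mono) auto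
    thus ?thesis by (simp add: mult_ac)
  qed
  have hiT: "integral {X..3*X} (\<lambda>x. (norm (zero_sum_diff A x))\<^sup>2) \<le> 4 * B * C / c\<^sup>2 * X\<^sup>2 / T * (lg T)\<^sup>2"
    if A: "finite A" "A \<subseteq> zeros" and X: "X \<ge> 1" and T: "T \<ge> 1" "\<And>\<rho>. \<rho> \<in> A \<Longrightarrow> T \<le> 1 + \<bar>Im \<rho>\<bar>" for A X T
  proof -
    have "(\<Sum>\<rho>\<in>A. zmult \<rho> * (norm (1 / \<rho>))\<^sup>2 * lg (Im \<rho>)) \<le> (\<Sum>\<rho>\<in>A. 4 / (c\<^sup>2 * T\<^sup>2) * (zmult \<rho> * (lg (Im \<rho>) * (1 + \<bar>Im \<rho>\<bar> / T) powr (-2))))"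
      by (intro sum_mono inv) (use A T in auto)
    also have "\<dots> = 4 / (c\<^sup>2 * T\<^sup>2) * (\<Sum>\<rho>\<in>A. zmult \<rho> * (lg (Im \<rho>) * (1 + \<bar>Im \<rho>\<bar> / T) powr (-2)))"
      by (rule sum_distrib_left[symmetric])
    also have "\<dots> \<le> 4 / (c\<^sup>2 * T\<^sup>2) * (B * T * (lg T)\<^sup>2)" by (intro mult_left_mono B A T) auto
    also have "\<dots> = 4 * B / c\<^sup>2 / T * (lg T)\<^sup>2" using T by (simp add: power2_eq_square)
    finally have "C * X\<^sup>2 * (\<Sum>\<rho>\<in>A. zmult \<rho> * (norm (1 / \<rho>))\<^sup>2 * lg (Im \<rho>)) \<le> C * X\<^sup>2 * (4 * B / c\<^sup>2 / T * (lg T)\<^sup>2)"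
      using C by (intro mult_left_mono) auto
    with hi[OF A X] show ?thesis by (simp add: mult_ac)
  qed
  define K where "K = 4 * B * C / c\<^sup>2"
  have K: "K > 0" using B C c by (simp add: K_def)
  show ?thesis
  \<comment> \<open>The first summand serves the claim without \<open>h\<close>, where all zeros
    count as high with \<open>T = 1\<close>; the others serve the low and the high zeros of the
    second claim.\<close>
  proof (rule that[of "K * (lg 1)\<^sup>2 + 8 * B * C + 8 * K"])
    show pos: "K * (lg 1)\<^sup>2 + 8 * B * C + 8 * K > 0" using K B C by (intro add_nonneg_pos) auto
    fix A and X :: real assume A: "finite A" "A \<subseteq> zeros"
    have int: "(\<lambda>x. (norm (zero_sum_diff A' x))\<^sup>2) integrable_on {a..b}" if "A' \<subseteq> zeros" "a > 0" for A' a b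
      using continuous_on_zero_sum_diff[of A' a 0 b] that by (auto intro!: integrable_continuous_real continuous_on_power continuous_on_norm)
    {
      assume X: "X \<ge> 1"
      have "integral {X..2*X} (\<lambda>x. (norm (zero_sum_diff A x))\<^sup>2) \<le> integral {X..3*X} (\<lambda>x. (norm (zero_sum_diff A x))\<^sup>2)"
        by (rule integral_subset_le) (use A X int in auto)
      also have "\<dots> \<le> K * X\<^sup>2 / 1 * (lg 1)\<^sup>2" unfolding K_def by (rule hiT) (use A X in auto)
      also have "\<dots> = (K * (lg 1)\<^sup>2) * X\<^sup>2" by simp
      also have "\<dots> \<le> (K * (lg 1)\<^sup>2 + 8 * B * C + 8 * K) * X\<^sup>2" using K B C by (intro mult_right_mono) auto
      finally show "integral {X..2*X} (\<lambda>x. (norm (zero_sum_diff A x))\<^sup>2) \<le> (K * (lg 1)\<^sup>2 + 8 * B * C + 8 * K) * X\<^sup>2" .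
    }
    fix h :: real assume h: "1 \<le> h" "h \<le> X"
    have X: "X \<ge> 1" using h by simp
    \<comment> \<open>With this choice both \<open>h\<^sup>2 * T\<close> and
      \<open>X\<^sup>2 / T\<close> equal \<open>h * X\<close>.\<close>
    define T where "T = X / h"
    have T: "T \<ge> 1" "h\<^sup>2 * T = h * X" "X\<^sup>2 / T = h * X" using h by (auto simp: T_def power2_eq_square)
    have lT: "(lg T)\<^sup>2 \<le> (lg X)\<^sup>2"
    proof -
      have "T \<le> X" using h X unfolding T_def by (simp add: divide_le_eq mult_le_cancel_left1)
      hence "lg T \<le> lg X" using T by (intro lg_mono) auto
      thus ?thesis using lg_pos[of T] by (intro power_mono) auto
    qed
    define A1 A2 where "A1 = {\<rho> \<in> A. \<bar>Im \<rho>\<bar> \<le> T}" and "A2 = {\<rho> \<in> A. \<not> \<bar>Im \<rho>\<bar> \<le> T}"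
    have A1: "finite A1" "A1 \<subseteq> zeros" and A2: "finite A2" "A2 \<subseteq> zeros" using A by (auto simp: A1_def A2_def)
    have split2: "zero_sum2 A x = zero_sum2 A1 x + zero_sum2 A2 x" for x
    proof -
      have "A = A1 \<union> A2" "A1 \<inter> A2 = {}" by (auto simp: A1_def A2_def)
      thus ?thesis unfolding zero_sum2_def using A1 A2 by (simp add: sum.union_disjoint)
    qed
    let ?D = zero_sum_diff
    have split: "?D A x = ?D A1 x + ?D A2 x" for x by (simp add: zero_sum_diff_def split2)
    have pt: "(norm (?D A (x + h) - ?D A x))\<^sup>2 \<le> 2 * (norm (?D A1 (x + h) - ?D A1 x))\<^sup>2 + (4 * (norm (?D A2 (x + h)))\<^sup>2 + 4 * (norm (?D A2 x))\<^sup>2)" for x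
    proof -
      have "(norm (?D A (x + h) - ?D A x))\<^sup>2 \<le> 2 * (norm (?D A1 (x + h) - ?D A1 x))\<^sup>2 + 2 * (norm (?D A2 (x + h) - ?D A2 x))\<^sup>2"
        using norm_add_square_le[of "?D A1 (x + h) - ?D A1 x" "?D A2 (x + h) - ?D A2 x"] by (simp add: split algebra_simps)
      moreover have "(norm (?D A2 (x + h) - ?D A2 x))\<^sup>2 \<le> 2 * (norm (?D A2 (x + h)))\<^sup>2 + 2 * (norm (?D A2 x))\<^sup>2"
        using norm_add_square_le[of "?D A2 (x + h)" "- ?D A2 x"] by simp
      ultimately show ?thesis by linarith
    qed
    have ch: "continuous_on {X..2*X} (\<lambda>x. ?D A' (x + h))" "continuous_on {X..2*X} (?D A')" if "A' \<subseteq> zeros" for A'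
      using continuous_on_zero_sum_diff[of A' X h "2*X"] continuous_on_zero_sum_diff[of A' X 0 "2*X"] that X h by auto
    have I1: "(\<lambda>x. (norm (?D A' (x + h) - ?D A' x))\<^sup>2) integrable_on {X..2*X}"
      "(\<lambda>x. (norm (?D A' (x + h)))\<^sup>2) integrable_on {X..2*X}" "(\<lambda>x. (norm (?D A' x))\<^sup>2) integrable_on {X..2*X}" if "A' \<subseteq> zeros" for A'
      by (intro integrable_continuous_real continuous_on_power continuous_on_norm continuous_on_diff ch that)+
    have "integral {X..2*X} (\<lambda>x. (norm (?D A (x + h) - ?D A x))\<^sup>2) \<le>
       integral {X..2*X} (\<lambda>x. 2 * (norm (?D A1 (x + h) - ?D A1 x))\<^sup>2 + (4 * (norm (?D A2 (x + h)))\<^sup>2 + 4 * (norm (?D A2 x))\<^sup>2))"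
      by (intro integral_le integrable_add integrable_on_mult_right I1 A A1 A2 pt)
    also have "\<dots> = 2 * integral {X..2*X} (\<lambda>x. (norm (?D A1 (x + h) - ?D A1 x))\<^sup>2) +
      (4 * integral {X..2*X} (\<lambda>x. (norm (?D A2 (x + h)))\<^sup>2) + 4 * integral {X..2*X} (\<lambda>x. (norm (?D A2 x))\<^sup>2))"
      by (intro integral_unique has_integral_add has_integral_mult_right integrable_integral I1 A1 A2)
    also have "integral {X..2*X} (\<lambda>x. (norm (?D A2 (x + h)))\<^sup>2) = integral {X+h..2*X+h} (\<lambda>x. (norm (?D A2 x))\<^sup>2)"
      by (rule integral_shift_real)
    also have "2 * integral {X..2*X} (\<lambda>x. (norm (?D A1 (x + h) - ?D A1 x))\<^sup>2) +
      (4 * integral {X+h..2*X+h} (\<lambda>x. (norm (?D A2 x))\<^sup>2) + 4 * integral {X..2*X} (\<lambda>x. (norm (?D A2 x))\<^sup>2)) \<le>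
      2 * (4 * B * C * (h * X * (lg X)\<^sup>2)) + (4 * (K * (h * X * (lg X)\<^sup>2)) + 4 * (K * (h * X * (lg X)\<^sup>2)))"
    proof -
      have hb: "integral {X..3*X} (\<lambda>x. (norm (?D A2 x))\<^sup>2) \<le> K * (h * X * (lg X)\<^sup>2)"
      proof -
        have "integral {X..3*X} (\<lambda>x. (norm (?D A2 x))\<^sup>2) \<le> K * X\<^sup>2 / T * (lg T)\<^sup>2"
          unfolding K_def by (rule hiT) (use A2 X T in \<open>auto simp: A2_def\<close>)
        also have "\<dots> = K * (X\<^sup>2 / T) * (lg T)\<^sup>2" by simp
        also have "\<dots> \<le> K * (X\<^sup>2 / T) * (lg X)\<^sup>2" using K T(1) by (intro mult_left_mono lT mult_nonneg_nonneg) auto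
        finally show ?thesis unfolding T(3) by (simp add: mult_ac)
      qed
      have s1: "integral {X+h..2*X+h} (\<lambda>x. (norm (?D A2 x))\<^sup>2) \<le> integral {X..3*X} (\<lambda>x. (norm (?D A2 x))\<^sup>2)"
        by (rule integral_subset_le) (use A2 X h int in auto)
      have s2: "integral {X..2*X} (\<lambda>x. (norm (?D A2 x))\<^sup>2) \<le> integral {X..3*X} (\<lambda>x. (norm (?D A2 x))\<^sup>2)"
        by (rule integral_subset_le) (use A2 X h int in auto)
      have s3: "integral {X..2*X} (\<lambda>x. (norm (?D A1 (x + h) - ?D A1 x))\<^sup>2) \<le> 4 * B * C * (h * X * (lg X)\<^sup>2)"
      proof -
        have "(\<Sum>\<rho>\<in>A1. zmult \<rho> * lg (Im \<rho>)) \<le> (\<Sum>\<rho>\<in>A1. 4 * (zmult \<rho> * (lg (Im \<rho>) * (1 + \<bar>Im \<rho>\<bar> / T) powr (-2))))"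
        proof (rule sum_mono)
          fix \<rho> assume "\<rho> \<in> A1"
          hence "\<bar>Im \<rho>\<bar> / T \<le> 1" using T by (simp add: A1_def)
          hence "2 powr (-2) \<le> (1 + \<bar>Im \<rho>\<bar> / T) powr (-2)" using T by (intro powr_mono2') (auto intro: add_pos_nonneg)
          moreover have "(2::real) powr (-2) = 1/4" by (simp add: powr_minus_divide)
          ultimately have "1 \<le> 4 * (1 + \<bar>Im \<rho>\<bar> / T) powr (-2)" by linarith
          hence "zmult \<rho> * lg (Im \<rho>) * 1 \<le> zmult \<rho> * lg (Im \<rho>) * (4 * (1 + \<bar>Im \<rho>\<bar> / T) powr (-2))"
            using zmult_nonneg[of \<rho>] lg_pos[of "Im \<rho>"] by (intro mult_left_mono) auto
          thus "zmult \<rho> * lg (Im \<rho>) \<le> 4 * (zmult \<rho> * (lg (Im \<rho>) * (1 + \<bar>Im \<rho>\<bar> / T) powr (-2)))" by (simp add: mult_ac)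
        qed
        also have "\<dots> = 4 * (\<Sum>\<rho>\<in>A1. zmult \<rho> * (lg (Im \<rho>) * (1 + \<bar>Im \<rho>\<bar> / T) powr (-2)))"
          by (rule sum_distrib_left[symmetric])
        also have "\<dots> \<le> 4 * (B * T * (lg T)\<^sup>2)" by (intro mult_left_mono B A1 T) auto
        also have "\<dots> \<le> 4 * (B * T * (lg X)\<^sup>2)" using B T by (intro mult_left_mono lT) auto
        finally have "h\<^sup>2 * (C * (\<Sum>\<rho>\<in>A1. zmult \<rho> * lg (Im \<rho>))) \<le> h\<^sup>2 * (C * (4 * (B * T * (lg X)\<^sup>2)))"
          using C by (intro mult_left_mono) auto
        also have "\<dots> = 4 * B * C * ((h\<^sup>2 * T) * (lg X)\<^sup>2)" by (simp add: mult_ac)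
        finally show ?thesis using lo[OF A1 h] unfolding T(2) by simp
      qed
      show ?thesis using hb s1 s2 s3 by argo
    qed
    also have "\<dots> = (8 * B * C + 8 * K) * (h * X * (lg X)\<^sup>2)" by (simp add: algebra_simps)
    also have "\<dots> \<le> (K * (lg 1)\<^sup>2 + 8 * B * C + 8 * K) * (h * X * (lg X)\<^sup>2)" using K h by (intro mult_right_mono) auto
    also have "\<dots> = (K * (lg 1)\<^sup>2 + 8 * B * C + 8 * K) * h * X * (lg X)\<^sup>2" by (simp add: mult_ac)
    finally show "integral {X..2*X} (\<lambda>x. (norm (?D A (x + h) - ?D A x))\<^sup>2) \<le> (K * (lg 1)\<^sup>2 + 8 * B * C + 8 * K) * h * X * (lg X)\<^sup>2" .
  qed
qed

section \<open>Mean squares of the error in the prime number theorem\<close>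

definition mdev :: "nat \<Rightarrow> real" where "mdev n = mangoldt n - 1"

definition Delta :: "nat \<Rightarrow> real" where "Delta n = (\<Sum>k=1..n. mdev k)"

lemma Delta_eq: "Delta n = (\<Sum>k=1..n. mangoldt k) - real n"
  by (simp add: Delta_def mdev_def sum_subtractf)

lemma psi1_eq:
  assumes "real n \<le> x" "x < real n + 1"
  shows "psi1 x = (\<Sum>k=1..n. mangoldt k * (x - real k))"
proof -
  have "\<lfloor>x\<rfloor> = int n" using assms by (auto simp: floor_eq_iff)
  thus ?thesis by (simp only: psi1_def nat_int)
qed

text \<open>The difference is the average of psi over \<open>{x..x + 1}\<close>, hence linear
  between integers. Subtracting \<open>x\<close> instead of \<open>x + 1/2\<close> makes the value
  at each integer \<open>n\<close> exactly \<open>Delta n\<close>.\<close>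

lemma psi1_diff:
  assumes x: "real n \<le> x" "x \<le> real n + 1"
  shows "psi1 (x + 1) - psi1 x - x = (real n + 1 - x) * Delta n + (x - real n) * Delta (n + 1)"
proof -
  define S where "S = (\<Sum>k=1..n. mangoldt k :: real)"
  have *: "(\<Sum>k=1..n. mangoldt k * (x + 1 - real k)) - (\<Sum>k=1..n. mangoldt k * (x - real k)) = S"
    unfolding S_def sum_subtractf[symmetric] by (intro sum.cong) (auto simp: algebra_simps)
  have D: "Delta n = S - real n" "Delta (n + 1) = S + mangoldt (Suc n) - real n - 1"
    by (auto simp: Delta_eq S_def)
  show ?thesis
  proof (cases "x < real n + 1")
    case True
    have "psi1 x = (\<Sum>k=1..n. mangoldt k * (x - real k))"
      "psi1 (x + 1) = (\<Sum>k=1..n. mangoldt k * (x + 1 - real k)) + mangoldt (Suc n) * (x - real n)"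
      using psi1_eq[of n x] psi1_eq[of "Suc n" "x + 1"] x True by simp_all
    thus ?thesis using * unfolding D by (simp add: algebra_simps)
  next
    \<comment> \<open>At the right end \<open>x = n + 1\<close> the floor has already jumped, but
      the term it adds to \<open>psi1 x\<close> is zero.\<close>
    case False
    hence xe: "x = real n + 1" using x by simp
    have "psi1 x = (\<Sum>k=1..n. mangoldt k * (x - real k)) + mangoldt (Suc n) * (x - real (Suc n))"
      "psi1 (x + 1) = (\<Sum>k=1..n. mangoldt k * (x + 1 - real k)) + mangoldt (Suc n) * (x + 1 - real (Suc n))
         + mangoldt (Suc (Suc n)) * (x + 1 - real (Suc (Suc n)))"
      using psi1_eq[of "Suc n" x] psi1_eq[of "Suc (Suc n)" "x + 1"] unfolding xe by simp_all
    thus ?thesis using * unfolding D by (simp add: xe algebra_simps)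
  qed
qed

text \<open>The mean square bounds are for finite sets of zeros, with constants independent of the
  set. On a bounded range the powers are at most \<open>Y\<^sup>2\<close>, so it suffices to drop a
  tail of weight at most \<open>1 / Y\<^sup>2\<close>.\<close>

lemma zero_sum2_approx:
  assumes Y: "Y \<ge> 1"
  shows "\<exists>A. finite A \<and> A \<subseteq> zeros \<and> (\<forall>x. 1 \<le> x \<longrightarrow> x \<le> Y \<longrightarrow>
    norm ((\<Sum>\<^sub>\<infinity>\<rho>\<in>zeros. of_real (zmult \<rho>) * cpow (\<rho> + 1) x / (\<rho> * (\<rho> + 1))) - zero_sum2 A x) \<le> 1)"
proof -
  define w where "w = (\<lambda>\<rho>. norm (complex_of_real (zmult \<rho>) * 1 / (\<rho> * (\<rho> + 1))))"
  have w: "w summable_on zeros" unfolding w_def by (rule zeros_quad_summable(1)[where B = 1]) simp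
  obtain F where F: "finite F" "F \<subseteq> zeros" "dist (sum w F) (infsum w zeros) \<le> 1 / Y\<^sup>2"
    using infsum_finite_approximation[OF w, of "1 / Y\<^sup>2"] Y by auto
  have wd: "w summable_on (zeros - F)" by (rule summable_on_subset_banach[OF w]) auto
  have U: "F \<union> (zeros - F) = zeros" using F by auto
  have "infsum w zeros = sum w F + infsum w (zeros - F)"
    using infsum_Un_disjoint[of w F "zeros - F"] F wd unfolding U by simp
  hence wF: "infsum w (zeros - F) \<le> 1 / Y\<^sup>2" using F(3) by (simp add: dist_norm)
  show ?thesis
  proof (intro exI[of _ F] conjI allI impI F)
    fix x assume x: "1 \<le> x" "x \<le> Y"
    define f where "f = (\<lambda>\<rho>. of_real (zmult \<rho>) * cpow (\<rho> + 1) x / (\<rho> * (\<rho> + 1)))"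
    have bd: "norm (cpow (\<rho> + 1) x) \<le> Y\<^sup>2" if "\<rho> \<in> zeros" for \<rho>
    proof -
      have "x powr (Re \<rho> + 1) \<le> x powr 2" using zeros_Re[OF that] x by (intro powr_mono) auto
      also have "\<dots> = x\<^sup>2" using x by simp
      also have "\<dots> \<le> Y\<^sup>2" using x by (intro power_mono) auto
      finally show ?thesis using x by (simp add: norm_cpow)
    qed
    have f: "f summable_on zeros" "(\<lambda>\<rho>. norm (f \<rho>)) summable_on zeros"
      unfolding f_def by (rule zeros_quad_summable[OF bd], assumption)+
    have fd: "f summable_on (zeros - F)" "(\<lambda>\<rho>. norm (f \<rho>)) summable_on (zeros - F)"
      by (rule summable_on_subset_banach[OF f(1)], simp, rule summable_on_subset_banach[OF f(2)], simp)
    have "infsum f zeros = sum f F + infsum f (zeros - F)"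
      using infsum_Un_disjoint[of f F "zeros - F"] F fd unfolding U by simp
    moreover have "sum f F = zero_sum2 F x" by (simp add: f_def zero_sum2_def)
    ultimately have "infsum f zeros - zero_sum2 F x = infsum f (zeros - F)" by simp
    also have "norm \<dots> \<le> infsum (\<lambda>\<rho>. norm (f \<rho>)) (zeros - F)" by (rule norm_infsum_bound[OF fd(2)])
    also have "\<dots> \<le> infsum (\<lambda>\<rho>. w \<rho> * Y\<^sup>2) (zeros - F)"
    proof (rule infsum_mono[OF fd(2) summable_on_cmult_left[OF wd]])
      fix \<rho> assume "\<rho> \<in> zeros - F"
      hence "w \<rho> * norm (cpow (\<rho> + 1) x) \<le> w \<rho> * Y\<^sup>2" using bd by (intro mult_left_mono) (auto simp: w_def)
      thus "norm (f \<rho>) \<le> w \<rho> * Y\<^sup>2" by (simp add: f_def w_def norm_mult norm_divide)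
    qed
    also have "\<dots> = infsum w (zeros - F) * Y\<^sup>2" by (rule infsum_cmult_left')
    also have "\<dots> \<le> 1 / Y\<^sup>2 * Y\<^sup>2" by (rule mult_right_mono[OF wF]) simp
    also have "\<dots> = 1" using Y by simp
    finally show "norm ((\<Sum>\<^sub>\<infinity>\<rho>\<in>zeros. of_real (zmult \<rho>) * cpow (\<rho> + 1) x / (\<rho> * (\<rho> + 1))) - zero_sum2 F x) \<le> 1"
      by (simp add: f_def)
  qed
qed

text \<open>In the unit difference of the explicit formula the quadratic term leaves
  \<open>x + 1/2\<close>, the linear one \<alpha>, and the constant cancels; the finite
  approximation costs 1 at each of the two points.\<close>

lemma psi1_diff_approx:
  obtains K where "K > 0" "\<And>Y. Y \<ge> 1 \<Longrightarrow> \<exists>A. finite A \<and> A \<subseteq> zeros \<and> (\<forall>x. 1 \<le> x \<longrightarrow> x \<le> Y \<longrightarrow>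
    norm (complex_of_real (psi1 (x + 1) - psi1 x - x) + zero_sum_diff A x) \<le> K)"
proof -
  obtain \<alpha> \<beta> :: complex and e :: "real \<Rightarrow> complex" and C :: real where
    C: "C > 0" "\<And>x. x \<ge> 1 \<Longrightarrow> norm (e (x + 1) - e x) \<le> C"
    and EF: "\<And>x. x \<ge> 1 \<Longrightarrow> complex_of_real (psi1 x) = of_real (x\<^sup>2 / 2) + \<alpha> * of_real x + \<beta>
        - (\<Sum>\<^sub>\<infinity>\<rho>\<in>zeros. of_real (zmult \<rho>) * cpow (\<rho> + 1) x / (\<rho> * (\<rho> + 1))) + e x"
    by (rule explicit_formula_real) blast
  show ?thesis
  proof (rule that[of "norm (1/2 + \<alpha>) + 2 + C"])
    show "norm (1/2 + \<alpha>) + 2 + C > 0" using C by (simp add: add_nonneg_pos)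
    fix Y :: real assume Y: "Y \<ge> 1"
    define Z where "Z = (\<lambda>x. \<Sum>\<^sub>\<infinity>\<rho>\<in>zeros. of_real (zmult \<rho>) * cpow (\<rho> + 1) x / (\<rho> * (\<rho> + 1)))"
    obtain A where A: "finite A" "A \<subseteq> zeros" "\<And>x. 1 \<le> x \<Longrightarrow> x \<le> Y + 1 \<Longrightarrow> norm (Z x - zero_sum2 A x) \<le> 1"
      using zero_sum2_approx[of "Y + 1"] Y unfolding Z_def by auto
    show "\<exists>A. finite A \<and> A \<subseteq> zeros \<and> (\<forall>x. 1 \<le> x \<longrightarrow> x \<le> Y \<longrightarrow>
      norm (complex_of_real (psi1 (x + 1) - psi1 x - x) + zero_sum_diff A x) \<le> norm (1/2 + \<alpha>) + 2 + C)"
    proof (intro exI[of _ A] conjI allI impI A)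
      fix x assume x: "1 \<le> x" "x \<le> Y"
      have sq: "complex_of_real ((x + 1)\<^sup>2 / 2) = of_real (x\<^sup>2 / 2) + of_real x + 1/2"
        by (simp add: power2_eq_square algebra_simps add_divide_distrib)
      have e1: "complex_of_real (psi1 x) = of_real (x\<^sup>2 / 2) + \<alpha> * of_real x + \<beta> - Z x + e x"
        using EF[OF x(1)] by (simp add: Z_def)
      have e2: "complex_of_real (psi1 (x + 1)) = of_real (x\<^sup>2 / 2) + of_real x + 1/2 + \<alpha> * of_real (x + 1) + \<beta> - Z (x + 1) + e (x + 1)"
        using EF[of "x + 1"] x(1) unfolding sq by (simp add: Z_def)
      have "complex_of_real (psi1 (x + 1) - psi1 x - x) + zero_sum_diff A x =
        (1/2 + \<alpha>) + (- (Z (x + 1) - zero_sum2 A (x + 1)) + (Z x - zero_sum2 A x)) + (e (x + 1) - e x)"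
        unfolding of_real_diff e1 e2 zero_sum_diff_def by (simp add: algebra_simps)
      also have "norm \<dots> \<le> norm (1/2 + \<alpha>) + (norm (Z (x + 1) - zero_sum2 A (x + 1)) + norm (Z x - zero_sum2 A x)) + norm (e (x + 1) - e x)"
        by (intro order_trans[OF norm_triangle_ineq] add_mono order_refl) (simp add: norm_minus_commute)
      also have "\<dots> \<le> norm (1/2 + \<alpha>) + (1 + 1) + C"
        using x by (intro add_mono A C order_refl) auto
      finally show "norm (complex_of_real (psi1 (x + 1) - psi1 x - x) + zero_sum_diff A x) \<le> norm (1/2 + \<alpha>) + 2 + C" by simp
    qed
  qed
qed

lemma integral_linear_square:
  fixes a b c :: real
  shows "((\<lambda>x. ((c + 1 - x) * a + (x - c) * b)\<^sup>2) has_integral (a\<^sup>2 + a * b + b\<^sup>2) / 3) {c..c+1}"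
proof -
  define F where "F = (\<lambda>x. a\<^sup>2 * (x - c) + a * (b - a) * (x - c)\<^sup>2 + (b - a)\<^sup>2 * (x - c) ^ 3 / 3)"
  have "((\<lambda>x. ((c + 1 - x) * a + (x - c) * b)\<^sup>2) has_integral (F (c + 1) - F c)) {c..c+1}"
  proof (rule fundamental_theorem_of_calculus)
    fix x
    have "(F has_real_derivative a\<^sup>2 + a * (b - a) * (2 * (x - c)) + (b - a)\<^sup>2 * (x - c)\<^sup>2) (at x within {c..c + 1})"
      unfolding F_def by (auto intro!: derivative_eq_intros simp: power2_eq_square)
    also have "a\<^sup>2 + a * (b - a) * (2 * (x - c)) + (b - a)\<^sup>2 * (x - c)\<^sup>2 = ((c + 1 - x) * a + (x - c) * b)\<^sup>2"
      by (simp add: power2_eq_square algebra_simps)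
    finally show "(F has_vector_derivative ((c + 1 - x) * a + (x - c) * b)\<^sup>2) (at x within {c..c + 1})"
      by (simp add: has_real_derivative_iff_has_vector_derivative)
  qed simp
  moreover have "F (c + 1) - F c = (a\<^sup>2 + a * b + b\<^sup>2) / 3"
    by (simp add: F_def power2_eq_square field_simps)
  ultimately show ?thesis by simp
qed

text \<open>The square of the linear interpolation integrates over a unit interval to
  \<open>(a^2 + a b + b^2) / 3\<close>, and this exceeds \<open>a^2 / 4\<close> by
  \<open>(a + 2 b)^2 / 12\<close>.\<close>

lemma sum_square_le_integral:
  fixes a :: "nat \<Rightarrow> real" and g :: "real \<Rightarrow> real"
  assumes g: "continuous_on {real X..real M} g"
    and le: "\<And>n x. X \<le> n \<Longrightarrow> n < M \<Longrightarrow> real n \<le> x \<Longrightarrow> x \<le> real n + 1 \<Longrightarrow>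
      ((real n + 1 - x) * a n + (x - real n) * a (n + 1))\<^sup>2 \<le> g x"
    and XM: "X \<le> M"
  shows "(\<Sum>n\<in>{X..<M}. (a n)\<^sup>2) \<le> 4 * integral {real X..real M} g"
proof -
  have int: "g integrable_on {c..d}" if "real X \<le> c" "d \<le> real M" for c d
    using that by (intro integrable_continuous_real continuous_on_subset[OF g]) auto
  have "(\<Sum>n\<in>{X..<m}. (a n)\<^sup>2) \<le> 4 * integral {real X..real m} g" if "X \<le> m" "m \<le> M" for m
    using that
  proof (induction m rule: dec_induct)
    case (step n)
    have "(a n)\<^sup>2 / 4 \<le> ((a n)\<^sup>2 + a n * a (n + 1) + (a (n + 1))\<^sup>2) / 3"
      using zero_le_power2[of "a n / 2 + a (n + 1)"] by (simp add: power2_eq_square algebra_simps)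
    also have "\<dots> \<le> integral {real n..real n + 1} g"
      by (rule has_integral_le[OF integral_linear_square integrable_integral[OF int]]) (use step le in auto)
    finally have "(a n)\<^sup>2 \<le> 4 * integral {real n..real n + 1} g" by simp
    moreover have "integral {real X..real n} g + integral {real n..real (Suc n)} g = integral {real X..real (Suc n)} g"
      by (rule Henstock_Kurzweil_Integration.integral_combine) (use step int in auto)
    ultimately show ?case using step by (simp add: add.commute)
  qed simp
  thus ?thesis using XM by simp
qed

text \<open>Interpolation carries the integral bounds over to sums at integers; the bounded error of
  the explicit formula enters with its square. The zeros are cut for the range up to
  \<open>3 * X\<close>, which contains the points \<open>x + h\<close>.\<close>

theorem Delta_mean_square:
  assumes rh: "\<And>\<rho>. \<rho> \<in> zeros \<Longrightarrow> Re \<rho> \<le> 1/2"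
  obtains C where "C > 0"
    "\<And>X. X \<ge> 1 \<Longrightarrow> (\<Sum>n\<in>{X..<2*X}. (Delta n)\<^sup>2) \<le> C * (real X)\<^sup>2"
    "\<And>X h. 1 \<le> h \<Longrightarrow> h \<le> X \<Longrightarrow> (\<Sum>n\<in>{X..<2*X}. (Delta (n + h) - Delta n)\<^sup>2) \<le> C * real h * real X * (lg (real X))\<^sup>2"
proof -
  obtain C where C: "C > 0"
    "\<And>A X. finite A \<Longrightarrow> A \<subseteq> zeros \<Longrightarrow> X \<ge> 1 \<Longrightarrow> integral {X..2*X} (\<lambda>x. (norm (zero_sum_diff A x))\<^sup>2) \<le> C * X\<^sup>2"
    "\<And>A X h. finite A \<Longrightarrow> A \<subseteq> zeros \<Longrightarrow> 1 \<le> h \<Longrightarrow> h \<le> X \<Longrightarrow>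
      integral {X..2*X} (\<lambda>x. (norm (zero_sum_diff A (x + h) - zero_sum_diff A x))\<^sup>2) \<le> C * h * X * (lg X)\<^sup>2"
    by (rule zero_sum_diff_mean[OF rh]) blast+
  obtain K where K: "K > 0" "\<And>Y. Y \<ge> 1 \<Longrightarrow> \<exists>A. finite A \<and> A \<subseteq> zeros \<and> (\<forall>x. 1 \<le> x \<longrightarrow> x \<le> Y \<longrightarrow>
    norm (complex_of_real (psi1 (x + 1) - psi1 x - x) + zero_sum_diff A x) \<le> K)"
    by (rule psi1_diff_approx) blast
  define V where "V = (\<lambda>x. psi1 (x + 1) - psi1 x - x)"
  have V: "V x = (real n + 1 - x) * Delta n + (x - real n) * Delta (n + 1)" if "real n \<le> x" "x \<le> real n + 1" for n x
    unfolding V_def by (rule psi1_diff[OF that])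
  show ?thesis
  proof (rule that[of "8 * C + 128 * K\<^sup>2"])
    show "8 * C + 128 * K\<^sup>2 > 0" using C by (simp add: add_pos_nonneg)
    fix X :: nat assume X: "X \<ge> 1"
    obtain A where A: "finite A" "A \<subseteq> zeros" and D: "\<And>x. 1 \<le> x \<Longrightarrow> x \<le> 3 * real X \<Longrightarrow> norm (complex_of_real (V x) + zero_sum_diff A x) \<le> K"
      using K(2)[of "3 * real X"] X unfolding V_def by auto
    have "(\<Sum>n\<in>{X..<2*X}. (Delta n)\<^sup>2) \<le> 4 * integral {real X..real (2 * X)} (\<lambda>x. 2 * (norm (zero_sum_diff A x))\<^sup>2 + 2 * K\<^sup>2)"
    proof (rule sum_square_le_integral)
      show "continuous_on {real X..real (2 * X)} (\<lambda>x. 2 * (norm (zero_sum_diff A x))\<^sup>2 + 2 * K\<^sup>2)"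
        using continuous_on_zero_sum_diff[OF A(2), of "real X" 0 "real (2 * X)"] X
        by (intro continuous_on_add continuous_on_mult_left continuous_on_power continuous_on_norm continuous_on_const) auto
      fix n x assume n: "X \<le> n" "n < 2 * X" "real n \<le> x" "x \<le> real n + 1"
      have "real n + 1 \<le> 2 * real X" using n(2) by linarith
      hence x: "1 \<le> x" "x \<le> 3 * real X" using n X by auto
      have "(V x)\<^sup>2 = (norm ((complex_of_real (V x) + zero_sum_diff A x) + (- zero_sum_diff A x)))\<^sup>2" by simp
      also have "\<dots> \<le> 2 * (norm (complex_of_real (V x) + zero_sum_diff A x))\<^sup>2 + 2 * (norm (- zero_sum_diff A x))\<^sup>2"
        by (rule norm_add_square_le)
      also have "\<dots> \<le> 2 * K\<^sup>2 + 2 * (norm (- zero_sum_diff A x))\<^sup>2"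
        by (intro add_mono mult_left_mono power_mono D x) auto
      finally show "((real n + 1 - x) * Delta n + (x - real n) * Delta (n + 1))\<^sup>2 \<le> 2 * (norm (zero_sum_diff A x))\<^sup>2 + 2 * K\<^sup>2"
        by (simp add: V[OF n(3,4)])
    qed simp
    also have "integral {real X..real (2 * X)} (\<lambda>x. 2 * (norm (zero_sum_diff A x))\<^sup>2 + 2 * K\<^sup>2) =
      2 * integral {real X..2 * real X} (\<lambda>x. (norm (zero_sum_diff A x))\<^sup>2) + 2 * K\<^sup>2 * real X"
    proof -
      have i: "(\<lambda>x. (norm (zero_sum_diff A x))\<^sup>2) integrable_on {real X..2 * real X}"
        using continuous_on_zero_sum_diff[OF A(2), of "real X" 0 "2 * real X"] X
        by (intro integrable_continuous_real continuous_on_power continuous_on_norm) auto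
      have c: "((\<lambda>x. 2 * K\<^sup>2) has_integral (2 * K\<^sup>2 * real X)) {real X..2 * real X}"
        using has_integral_const_real[of "2 * K\<^sup>2" "real X" "2 * real X"] by (simp add: mult.commute)
      show ?thesis using integral_unique[OF has_integral_add[OF has_integral_mult_right[OF integrable_integral[OF i]] c]] by simp
    qed
    also have "4 * (2 * integral {real X..2 * real X} (\<lambda>x. (norm (zero_sum_diff A x))\<^sup>2) + 2 * K\<^sup>2 * real X) \<le>
      4 * (2 * (C * (real X)\<^sup>2) + 2 * K\<^sup>2 * (real X)\<^sup>2)"
      using X by (intro mult_left_mono add_mono C A) (auto simp: power2_eq_square)
    also have "\<dots> = (8 * C + 8 * K\<^sup>2) * (real X)\<^sup>2" by (simp add: algebra_simps)
    also have "\<dots> \<le> (8 * C + 128 * K\<^sup>2) * (real X)\<^sup>2" by (intro mult_right_mono) auto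
    finally show "(\<Sum>n\<in>{X..<2*X}. (Delta n)\<^sup>2) \<le> (8 * C + 128 * K\<^sup>2) * (real X)\<^sup>2" .
  next
    fix X h :: nat assume h: "1 \<le> h" "h \<le> X"
    hence X: "X \<ge> 1" by simp
    obtain A where A: "finite A" "A \<subseteq> zeros" and D: "\<And>x. 1 \<le> x \<Longrightarrow> x \<le> 3 * real X \<Longrightarrow> norm (complex_of_real (V x) + zero_sum_diff A x) \<le> K"
      using K(2)[of "3 * real X"] X unfolding V_def by auto
    let ?D = "\<lambda>x. zero_sum_diff A (x + real h) - zero_sum_diff A x"
    have cD: "continuous_on {real X..2 * real X} ?D"
      using continuous_on_zero_sum_diff[OF A(2), of "real X" 0 "2 * real X"] X
      by (intro continuous_on_diff continuous_on_zero_sum_diff A) auto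
    have "(\<Sum>n\<in>{X..<2*X}. (Delta (n + h) - Delta n)\<^sup>2) \<le> 4 * integral {real X..real (2 * X)} (\<lambda>x. 2 * (norm (?D x))\<^sup>2 + 8 * K\<^sup>2)"
    proof (rule sum_square_le_integral)
      show "continuous_on {real X..real (2 * X)} (\<lambda>x. 2 * (norm (?D x))\<^sup>2 + 8 * K\<^sup>2)"
        using cD by (intro continuous_on_add continuous_on_mult_left continuous_on_power continuous_on_norm continuous_on_const) simp
      fix n x assume n: "X \<le> n" "n < 2 * X" "real n \<le> x" "x \<le> real n + 1"
      have "real n + 1 \<le> 2 * real X" using n(2) by linarith
      hence x: "1 \<le> x" "x \<le> 3 * real X" "1 \<le> x + real h" "x + real h \<le> 3 * real X" using n X h by auto
      have "V (x + real h) = (real n + 1 - x) * Delta (n + h) + (x - real n) * Delta (n + 1 + h)"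
        using V[of "n + h" "x + real h"] n by (simp add: add_ac)
      hence Ve: "(real n + 1 - x) * (Delta (n + h) - Delta n) + (x - real n) * (Delta (n + 1 + h) - Delta (n + 1)) = V (x + real h) - V x"
        using V[OF n(3,4)] by (simp add: algebra_simps)
      have n1: "norm (complex_of_real (V (x + real h) - V x) + ?D x) \<le> 2 * K"
      proof -
        have "complex_of_real (V (x + real h) - V x) + ?D x = (complex_of_real (V (x + real h)) + zero_sum_diff A (x + real h)) - (complex_of_real (V x) + zero_sum_diff A x)"
          by simp
        also have "norm \<dots> \<le> K + K" by (intro order_trans[OF norm_triangle_ineq4] add_mono D x)
        finally show ?thesis by simp
      qed
      have "(V (x + real h) - V x)\<^sup>2 = (norm (complex_of_real (V (x + real h) - V x)))\<^sup>2" by (simp only: norm_of_real power2_abs)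
      also have "\<dots> = (norm ((complex_of_real (V (x + real h) - V x) + ?D x) + (- ?D x)))\<^sup>2" by simp
      also have "\<dots> \<le> 2 * (norm (complex_of_real (V (x + real h) - V x) + ?D x))\<^sup>2 + 2 * (norm (- ?D x))\<^sup>2"
        by (rule norm_add_square_le)
      also have "\<dots> \<le> 2 * (2 * K)\<^sup>2 + 2 * (norm (- ?D x))\<^sup>2"
        by (intro add_mono mult_left_mono power_mono n1) auto
      also have "\<dots> = 2 * (norm (?D x))\<^sup>2 + 8 * K\<^sup>2" by (simp add: power_mult_distrib norm_minus_commute)
      finally show "((real n + 1 - x) * (Delta (n + h) - Delta n) + (x - real n) * (Delta (n + 1 + h) - Delta (n + 1)))\<^sup>2 \<le> 2 * (norm (?D x))\<^sup>2 + 8 * K\<^sup>2"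
        unfolding Ve .
    qed simp
    also have "integral {real X..real (2 * X)} (\<lambda>x. 2 * (norm (?D x))\<^sup>2 + 8 * K\<^sup>2) =
      2 * integral {real X..2 * real X} (\<lambda>x. (norm (?D x))\<^sup>2) + 8 * K\<^sup>2 * real X"
    proof -
      have i: "(\<lambda>x. (norm (?D x))\<^sup>2) integrable_on {real X..2 * real X}"
        by (intro integrable_continuous_real continuous_on_power continuous_on_norm cD)
      have c: "((\<lambda>x. 8 * K\<^sup>2) has_integral (8 * K\<^sup>2 * real X)) {real X..2 * real X}"
        using has_integral_const_real[of "8 * K\<^sup>2" "real X" "2 * real X"] by (simp add: mult.commute)
      show ?thesis using integral_unique[OF has_integral_add[OF has_integral_mult_right[OF integrable_integral[OF i]] c]] by simp
    qed
    also have "4 * (2 * integral {real X..2 * real X} (\<lambda>x. (norm (?D x))\<^sup>2) + 8 * K\<^sup>2 * real X) \<le>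
      4 * (2 * (C * real h * real X * (lg (real X))\<^sup>2) + 8 * K\<^sup>2 * (4 * (real h * real X * (lg (real X))\<^sup>2)))"
    proof (intro mult_left_mono add_mono C A)
      \<comment> \<open>The contribution of the bounded error is a multiple of \<open>X\<close>; it
        is absorbed because \<open>lg\<close> is at least 1/2 and \<open>h\<close> at least 1. This
        is the factor 4 in 128 = 4 * 8 * 4.\<close>
      have "(1/2)\<^sup>2 \<le> (lg (real X))\<^sup>2" using lg_ge[of "real X"] by (intro power_mono) auto
      hence "1 \<le> 4 * (lg (real X))\<^sup>2" by (simp add: power2_eq_square)
      moreover have "real X * 1 \<le> real X * real h" using h by (intro mult_left_mono) simp_all
      ultimately have "(real X * 1) * 1 \<le> (real X * real h) * (4 * (lg (real X))\<^sup>2)" by (intro mult_mono) (use h in auto)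
      thus "real X \<le> 4 * (real h * real X * (lg (real X))\<^sup>2)" by (simp add: mult_ac)
    qed (use h in auto)
    also have "\<dots> = (8 * C + 128 * K\<^sup>2) * real h * real X * (lg (real X))\<^sup>2" by (simp add: algebra_simps)
    finally show "(\<Sum>n\<in>{X..<2*X}. (Delta (n + h) - Delta n)\<^sup>2) \<le> (8 * C + 128 * K\<^sup>2) * real h * real X * (lg (real X))\<^sup>2" .
  qed
qed

section \<open>From windows to the Goldbach sum\<close>

definition tent :: "int \<Rightarrow> int \<Rightarrow> real" where
  "tent h u = of_int (max 0 (h - \<bar>u\<bar>))"

definition ramp :: "int \<Rightarrow> int \<Rightarrow> real" where
  "ramp h t = (if t \<ge> 0 then 1 else if t \<le> - h then 0 else of_int (t + h) / of_int h)"

lemma ramp_1: "ramp 1 t = (if t \<ge> 0 then 1 else 0)"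
  by (auto simp: ramp_def)

text \<open>The ramps of lengths \<open>2 * h\<close> and \<open>h\<close> differ by a triangle on
  the interval from \<open>-2 * h\<close> to 0 whose peak at \<open>-h\<close> has height 1/2, while
  \<open>tent\<close> has height \<open>h\<close>.\<close>

lemma ramp_double:
  assumes "h > 0"
  shows "ramp h t = ramp (2 * h) t - tent h (t + h) / (2 * of_int h)"
proof -
  consider "t \<ge> 0" | "t < 0" "t > -h" | "t \<le> -h" "t > -2 * h" | "t \<le> -2 * h" using assms by linarith
  thus ?thesis
  proof cases
    case 2
    hence "tent h (t + h) = - of_int t" by (simp add: tent_def max_def)
    thus ?thesis using 2 assms by (simp add: ramp_def field_simps)
  next
    case 3
    hence "tent h (t + h) = of_int (t + 2 * h)" by (simp add: tent_def max_def)
    thus ?thesis using 3 assms by (simp add: ramp_def field_simps)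
  qed (use assms in \<open>auto simp: ramp_def tent_def max_def\<close>)
qed

text \<open>
  For integers \<open>t\<close> the condition \<open>t \<ge> 0\<close> is a ramp of length 1; doubling the length of a ramp costs one tent.
\<close>
lemma ramp_dyadic:
  "ramp 1 t = ramp (2 ^ K) t - (\<Sum>k<K. tent (2 ^ k) (t + 2 ^ k) / (2 * 2 ^ k))"
proof (induction K)
  case (Suc K)
  have "ramp (2 ^ K) t = ramp (2 ^ Suc K) t - tent (2 ^ K) (t + 2 ^ K) / (2 * 2 ^ K)"
    using ramp_double[of "2 ^ K" t] by simp
  thus ?case using Suc.IH by simp
qed simp

text \<open>Two tents with centres 0 and \<open>h\<close> add up to a constant between the centres.
  This serves the coarsest scale, where no argument exceeds \<open>h\<close>.\<close>

lemma ramp_tent: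
  assumes "h > 0" "t \<le> h"
  shows "ramp h t = (tent h t + tent h (t - h)) / of_int h"
proof -
  consider "t \<ge> 0" | "t < 0" "t > -h" | "t \<le> -h" by linarith
  thus ?thesis using assms by cases (auto simp: ramp_def tent_def max_def field_simps)
qed

text \<open>Negative positions are sent to 0 by \<open>nat\<close>, and \<open>Delta 0 = 0\<close>,
  so windows reaching below 0 see only their positive part.\<close>

definition win :: "int \<Rightarrow> int \<Rightarrow> real" where
  "win h x = Delta (nat (x + h)) - Delta (nat x)"

text \<open>The range contains every \<open>x\<close> at which both windows can be nonzero:
  \<open>win h x\<close> vanishes for \<open>x <= - h\<close>, the other factor for
  \<open>x >= M + h\<close>.\<close>

definition corr :: "int \<Rightarrow> int \<Rightarrow> real" where
  "corr h M = (\<Sum>x\<in>{1 - h..M + h - 1}. win h x * win h (M - x))"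

lemma win_eq_sum:
  assumes h: "h \<ge> 1" and L: "x + h \<le> int L"
  shows "win h x = (\<Sum>a=1..L. mdev a * of_bool (x < int a \<and> int a \<le> x + h))"
proof -
  have D: "Delta (nat z) = (\<Sum>a=1..L. mdev a * of_bool (int a \<le> z))" if "z \<le> int L" for z
  proof -
    have "(\<Sum>a=1..L. mdev a * of_bool (int a \<le> z)) = (\<Sum>a\<in>{1..nat z}. mdev a * of_bool (int a \<le> z))"
      by (rule sum.mono_neutral_right) (use that in auto)
    also have "\<dots> = Delta (nat z)" unfolding Delta_def by (intro sum.cong) auto
    finally show ?thesis by simp
  qed
  have "win h x = (\<Sum>a=1..L. mdev a * of_bool (int a \<le> x + h) - mdev a * of_bool (int a \<le> x))"
    unfolding win_def using D[of "x + h"] D[of x] L h by (simp add: sum_subtractf)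
  also have "\<dots> = (\<Sum>a=1..L. mdev a * of_bool (x < int a \<and> int a \<le> x + h))"
    using h by (intro sum.cong) auto
  finally show ?thesis .
qed

text \<open>The tent counts the \<open>x\<close> such that the window at \<open>x\<close> contains \<open>a\<close> and the window at \<open>M - x\<close> contains \<open>b\<close>.\<close>
lemma corr_eq_sum:
  assumes h: "h \<ge> 1" and L: "M + 2 * h - 1 \<le> int L"
  shows "corr h M = (\<Sum>a=1..L. \<Sum>b=1..L. mdev a * mdev b * tent h (M + 1 + h - int a - int b))"
proof -
  let ?S = "{1 - h..M + h - 1}"
  let ?A = "\<lambda>x a. of_bool (x < int a \<and> int a \<le> x + h) :: real"
  have "corr h M = (\<Sum>x\<in>?S. (\<Sum>a=1..L. mdev a * ?A x a) * (\<Sum>b=1..L. mdev b * ?A (M - x) b))"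
    unfolding corr_def
  proof (rule sum.cong)
    fix x assume "x \<in> ?S"
    hence "x + h \<le> int L" "M - x + h \<le> int L" using L by auto
    thus "win h x * win h (M - x) = (\<Sum>a=1..L. mdev a * ?A x a) * (\<Sum>b=1..L. mdev b * ?A (M - x) b)"
      by (simp only: win_eq_sum[OF h])
  qed simp
  also have "\<dots> = (\<Sum>x\<in>?S. \<Sum>a=1..L. \<Sum>b=1..L. mdev a * mdev b * (?A x a * ?A (M - x) b))"
    unfolding sum_product by (intro sum.cong refl) simp
  also have "\<dots> = (\<Sum>a=1..L. \<Sum>x\<in>?S. \<Sum>b=1..L. mdev a * mdev b * (?A x a * ?A (M - x) b))"
    by (rule sum.swap)
  also have "\<dots> = (\<Sum>a=1..L. \<Sum>b=1..L. \<Sum>x\<in>?S. mdev a * mdev b * (?A x a * ?A (M - x) b))"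
    by (intro sum.cong refl sum.swap)
  also have "\<dots> = (\<Sum>a=1..L. \<Sum>b=1..L. mdev a * mdev b * tent h (M + 1 + h - int a - int b))"
  proof (intro sum.cong refl)
    fix a b assume ab: "a \<in> {1..L}" "b \<in> {1..L}"
    \<comment> \<open>The two windows confine \<open>x\<close> to two intervals of \<open>h\<close>
      integers each; their overlap has the length of the tent.\<close>
    have "(\<Sum>x\<in>?S. ?A x a * ?A (M - x) b) = (\<Sum>x\<in>?S. of_bool (x \<in> {max (int a - h) (M - int b + 1)..min (int a - 1) (M - int b + h)}))"
      by (intro sum.cong) auto
    also have "\<dots> = real (card (?S \<inter> {max (int a - h) (M - int b + 1)..min (int a - 1) (M - int b + h)}))"
      by (simp add: sum_of_bool_eq Int_def)
    also have "?S \<inter> {max (int a - h) (M - int b + 1)..min (int a - 1) (M - int b + h)} = {max (int a - h) (M - int b + 1)..min (int a - 1) (M - int b + h)}"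
      using ab by auto
    also have "real (card {max (int a - h) (M - int b + 1)..min (int a - 1) (M - int b + h)}) = tent h (M + 1 + h - int a - int b)"
      unfolding tent_def card_atLeastAtMost_int by (simp add: max_def min_def abs_if)
    finally show "(\<Sum>x\<in>?S. mdev a * mdev b * (?A x a * ?A (M - x) b)) = mdev a * mdev b * tent h (M + 1 + h - int a - int b)"
      by (simp only: sum_distrib_left[symmetric])
  qed
  finally show ?thesis .
qed

text \<open>The arithmetic-geometric mean inequality; the reflection of \<open>x\<close> to
  \<open>M - x\<close> maps the range to itself and identifies the two sums of squares.\<close>

lemma corr_le: "\<bar>corr h M\<bar> \<le> (\<Sum>x\<in>{1 - h..M + h - 1}. (win h x)\<^sup>2)"
proof -
  let ?S = "{1 - h..M + h - 1}"
  have "\<bar>corr h M\<bar> \<le> (\<Sum>x\<in>?S. \<bar>win h x * win h (M - x)\<bar>)" unfolding corr_def by (rule sum_abs)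
  also have "\<dots> \<le> (\<Sum>x\<in>?S. ((win h x)\<^sup>2 + (win h (M - x))\<^sup>2) / 2)"
  proof (rule sum_mono)
    fix x
    show "\<bar>win h x * win h (M - x)\<bar> \<le> ((win h x)\<^sup>2 + (win h (M - x))\<^sup>2) / 2"
      using sum_squares_bound[of "\<bar>win h x\<bar>" "\<bar>win h (M - x)\<bar>"] by (simp add: abs_mult)
  qed
  also have "\<dots> = ((\<Sum>x\<in>?S. (win h x)\<^sup>2) + (\<Sum>x\<in>?S. (win h (M - x))\<^sup>2)) / 2"
    by (simp add: sum_divide_distrib[symmetric] sum.distrib)
  also have "(\<Sum>x\<in>?S. (win h (M - x))\<^sup>2) = (\<Sum>x\<in>?S. (win h x)\<^sup>2)"
    by (rule sum.reindex_bij_witness[of _ "\<lambda>x. M - x" "\<lambda>x. M - x"]) auto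
  finally show ?thesis by simp
qed

section \<open>Summation over dyadic scales\<close>

lemma sum_dyadic:
  fixes f :: "nat \<Rightarrow> real"
  shows "(\<Sum>n\<in>{2 ^ k..<2 ^ (k + j)}. f n) = (\<Sum>i\<in>{k..<k + j}. \<Sum>n\<in>{2 ^ i..<2 * 2 ^ i}. f n)"
proof (induction j)
  case (Suc j)
  have "{2 ^ k..<2 ^ (k + Suc j)} = {2 ^ k..<2 ^ (k + j)} \<union> {2 ^ (k + j)..<2 * 2 ^ (k + j) :: nat}"
    using power_increasing[of k "k + j" "2::nat"] by (auto simp: ivl_disj_un)
  moreover have "{2 ^ k..<2 ^ (k + j)} \<inter> {2 ^ (k + j)..<2 * 2 ^ (k + j) :: nat} = {}" by auto
  ultimately have "(\<Sum>n\<in>{2 ^ k..<2 ^ (k + Suc j)}. f n) = (\<Sum>n\<in>{2 ^ k..<2 ^ (k + j)}. f n) + (\<Sum>n\<in>{2 ^ (k + j)..<2 * 2 ^ (k + j)}. f n)"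
    by (simp only: sum.union_disjoint finite_atLeastLessThan)
  thus ?case using Suc.IH by simp
qed simp

lemma sum_int_interval:
  "(\<Sum>x\<in>{int p..<int q}. f x) = (\<Sum>n\<in>{p..<q}. f (int n))"
  by (simp add: image_int_atLeastLessThan[symmetric] sum.reindex)

text \<open>All that the elementary part takes from the zeros of zeta.\<close>

locale mean_square =
  fixes C :: real
  assumes C_pos: "C > 0"
    and Delta_square: "\<And>X. X \<ge> 1 \<Longrightarrow> (\<Sum>n\<in>{X..<2*X}. (Delta n)\<^sup>2) \<le> C * (real X)\<^sup>2"
    and Delta_diff_square: "\<And>X h. 1 \<le> h \<Longrightarrow> h \<le> X \<Longrightarrow>
      (\<Sum>n\<in>{X..<2*X}. (Delta (n + h) - Delta n)\<^sup>2) \<le> C * real h * real X * (lg (real X))\<^sup>2"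
begin

lemma Delta_square_upto: "(\<Sum>n\<in>{1..<2 ^ j}. (Delta n)\<^sup>2) \<le> C * 4 ^ j"
proof (induction j)
  case (Suc j)
  have "(\<Sum>n\<in>{1..<2 ^ Suc j}. (Delta n)\<^sup>2) = (\<Sum>n\<in>{1..<2 ^ j}. (Delta n)\<^sup>2) + (\<Sum>n\<in>{2 ^ j..<2 * 2 ^ j}. (Delta n)\<^sup>2)"
    by (simp add: sum.atLeastLessThan_concat)
  also have "\<dots> \<le> C * 4 ^ j + C * (real (2 ^ j))\<^sup>2" by (intro add_mono Suc.IH Delta_square) simp
  also have "(real (2 ^ j))\<^sup>2 = 4 ^ j" by (simp add: power2_eq_square power_mult_distrib[symmetric])
  also have "C * 4 ^ j + C * 4 ^ j \<le> C * 4 ^ Suc j" using C_pos by simp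
  finally show ?case .
qed (use C_pos in simp)

lemma win_square_sum:
  assumes k: "k \<le> K"
  shows "(\<Sum>x\<in>{1 - 2 ^ k..<int (4 * 2 ^ K)}. (win (2 ^ k) x)\<^sup>2) \<le> 100 * C * 2 ^ k * 2 ^ K * (lg (4 * 2 ^ K))\<^sup>2"
proof -
  define h :: nat where "h = 2 ^ k"
  define H :: nat where "H = 2 ^ K"
  have hH: "1 \<le> h" "h \<le> H" using k by (auto simp: h_def H_def intro: power_increasing)
  have sp: "{1 - int h..<int (4 * H)} = {1 - int h..<int h} \<union> {int h..<int (4 * H)}" using hH by auto
  have "(\<Sum>x\<in>{1 - int h..<int (4 * H)}. (win (int h) x)\<^sup>2) = (\<Sum>x\<in>{1 - int h..<int h}. (win (int h) x)\<^sup>2) + (\<Sum>x\<in>{int h..<int (4 * H)}. (win (int h) x)\<^sup>2)"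
    unfolding sp by (rule sum.union_disjoint) auto
  also have "(\<Sum>x\<in>{1 - int h..<int h}. (win (int h) x)\<^sup>2) \<le> 4 * (C * 4 ^ Suc k)"
  proof -
    have h2: "2 ^ Suc k = 2 * h" by (simp add: h_def)
    have "(\<Sum>x\<in>{1 - int h..<int h}. (win (int h) x)\<^sup>2) \<le> (\<Sum>x\<in>{1 - int h..<int h}. 2 * (Delta (nat (x + int h)))\<^sup>2 + 2 * (Delta (nat x))\<^sup>2)"
    proof (rule sum_mono)
      fix x
      show "(win (int h) x)\<^sup>2 \<le> 2 * (Delta (nat (x + int h)))\<^sup>2 + 2 * (Delta (nat x))\<^sup>2"
        using norm_add_square_le[of "Delta (nat (x + int h))" "- Delta (nat x)"] by (simp add: win_def)
    qed
    also have "\<dots> = 2 * (\<Sum>x\<in>{1 - int h..<int h}. (Delta (nat (x + int h)))\<^sup>2) + 2 * (\<Sum>x\<in>{1 - int h..<int h}. (Delta (nat x))\<^sup>2)"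
      by (simp add: sum.distrib sum_distrib_left)
    also have "(\<Sum>x\<in>{1 - int h..<int h}. (Delta (nat (x + int h)))\<^sup>2) = (\<Sum>n\<in>{1..<2 * h}. (Delta n)\<^sup>2)"
      by (rule sum.reindex_bij_witness[of _ "\<lambda>n. int n - int h" "\<lambda>x. nat (x + int h)"]) auto
    \<comment> \<open>Positions \<open>x <= 0\<close> contribute nothing, since
      \<open>Delta 0 = 0\<close>.\<close>
    also have "(\<Sum>x\<in>{1 - int h..<int h}. (Delta (nat x))\<^sup>2) = (\<Sum>x\<in>{int 1..<int h}. (Delta (nat x))\<^sup>2)"
      by (rule sum.mono_neutral_right) (use hH in \<open>auto simp: Delta_def\<close>)
    also have "\<dots> = (\<Sum>n\<in>{1..<h}. (Delta n)\<^sup>2)" by (simp only: sum_int_interval nat_int)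
    also have "\<dots> \<le> (\<Sum>n\<in>{1..<2 ^ Suc k}. (Delta n)\<^sup>2)" by (rule sum_mono2) (auto simp: h_def)
    also have "2 * (\<Sum>n\<in>{1..<2 * h}. (Delta n)\<^sup>2) + 2 * (\<Sum>n\<in>{1..<2 ^ Suc k}. (Delta n)\<^sup>2) = 4 * (\<Sum>n\<in>{1..<2 ^ Suc k}. (Delta n)\<^sup>2)" unfolding h2 by simp
    also have "\<dots> \<le> 4 * (C * 4 ^ Suc k)" by (intro mult_left_mono Delta_square_upto) simp
    finally show ?thesis by simp
  qed
  also have "4 * (C * 4 ^ Suc k) = 16 * C * (real h * real h)"
    by (simp add: h_def power_mult_distrib[symmetric])
  also have "\<dots> \<le> 16 * C * (real h * real H)" using hH C_pos by (intro mult_left_mono) auto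
  also have "\<dots> \<le> 16 * C * (real h * real H) * (4 * (lg (4 * real H))\<^sup>2)"
  proof -
    have "(1/2)\<^sup>2 \<le> (lg (4 * real H))\<^sup>2" using lg_ge by (intro power_mono) auto
    hence "1 \<le> 4 * (lg (4 * real H))\<^sup>2" by (simp add: power2_eq_square)
    thus ?thesis using C_pos mult_left_mono[of 1 "4 * (lg (4 * real H))\<^sup>2" "16 * C * (real h * real H)"] by simp
  qed
  also have "(\<Sum>x\<in>{int h..<int (4 * H)}. (win (int h) x)\<^sup>2) \<le> 4 * C * (real h * real H) * (lg (4 * real H))\<^sup>2"
  proof -
    define j where "j = K + 2 - k"
    have H4: "4 * H = 2 ^ (k + j)" using k by (simp add: H_def j_def power_add)
    have "(\<Sum>x\<in>{int h..<int (4 * H)}. (win (int h) x)\<^sup>2) = (\<Sum>n\<in>{h..<4 * H}. (Delta (n + h) - Delta n)\<^sup>2)"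
      unfolding sum_int_interval win_def by (simp only: nat_int of_nat_add[symmetric])
    also have "\<dots> = (\<Sum>i\<in>{k..<k + j}. \<Sum>n\<in>{2 ^ i..<2 * 2 ^ i}. (Delta (n + h) - Delta n)\<^sup>2)"
      unfolding H4 h_def by (rule sum_dyadic)
    also have "\<dots> \<le> (\<Sum>i\<in>{k..<k + j}. C * real h * (lg (4 * real H))\<^sup>2 * 2 ^ i)"
    proof (rule sum_mono)
      fix i assume i: "i \<in> {k..<k + j}"
      have hi: "h \<le> 2 ^ i" unfolding h_def using i by (intro power_increasing) auto
      have "(2::nat) ^ i \<le> 2 ^ (k + j)" using i by (intro power_increasing) auto
      hence "real (2 ^ i) \<le> 4 * real H" unfolding H4[symmetric] by linarith
      hence "lg (real (2 ^ i)) \<le> lg (4 * real H)" by (intro lg_mono) auto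
      hence l: "(lg (real (2 ^ i)))\<^sup>2 \<le> (lg (4 * real H))\<^sup>2" using lg_pos[of "real (2 ^ i)"] by (intro power_mono) auto
      have "(\<Sum>n\<in>{2 ^ i..<2 * 2 ^ i}. (Delta (n + h) - Delta n)\<^sup>2) \<le> C * real h * real (2 ^ i) * (lg (real (2 ^ i)))\<^sup>2"
        by (rule Delta_diff_square[OF hH(1) hi])
      also have "\<dots> \<le> C * real h * real (2 ^ i) * (lg (4 * real H))\<^sup>2" using C_pos by (intro mult_left_mono l) auto
      finally show "(\<Sum>n\<in>{2 ^ i..<2 * 2 ^ i}. (Delta (n + h) - Delta n)\<^sup>2) \<le> C * real h * (lg (4 * real H))\<^sup>2 * 2 ^ i"
        by (simp add: mult_ac)
    qed
    also have "\<dots> = C * real h * (lg (4 * real H))\<^sup>2 * (\<Sum>i\<in>{k..<k + j}. 2 ^ i)" by (rule sum_distrib_left[symmetric])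
    also have "\<dots> \<le> C * real h * (lg (4 * real H))\<^sup>2 * (4 * real H)"
    proof (rule mult_left_mono)
      have "(\<Sum>i\<in>{k..<k + j}. (2::real) ^ i) \<le> (\<Sum>i<k + j. 2 ^ i)" by (rule sum_mono2) auto
      also have "\<dots> = 2 ^ (k + j) - 1" using geometric_sum[of "2::real" "k + j"] by simp
      also have "\<dots> \<le> real (4 * H)" unfolding H4 by simp
      finally show "(\<Sum>i\<in>{k..<k + j}. (2::real) ^ i) \<le> 4 * real H" by simp
    qed (use C_pos in auto)
    finally show ?thesis by (simp add: mult_ac)
  qed
  finally have "(\<Sum>x\<in>{1 - int h..<int (4 * H)}. (win (int h) x)\<^sup>2) \<le> 68 * (C * (real h * real H) * (lg (4 * real H))\<^sup>2)"
    by (simp add: mult_ac)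
  also have "\<dots> \<le> 100 * (C * (real h * real H) * (lg (4 * real H))\<^sup>2)" using C_pos by (intro mult_right_mono) auto
  finally show ?thesis by (simp add: h_def H_def mult_ac)
qed

lemma corr_bound:
  assumes k: "k \<le> K" and M: "M < 2 ^ K"
  shows "\<bar>corr (2 ^ k) M\<bar> \<le> 100 * C * 2 ^ k * 2 ^ K * (lg (4 * 2 ^ K))\<^sup>2"
proof -
  have "(2::int) ^ k \<le> 2 ^ K" using k by (intro power_increasing) auto
  have "\<bar>corr (2 ^ k) M\<bar> \<le> (\<Sum>x\<in>{1 - 2 ^ k..M + 2 ^ k - 1}. (win (2 ^ k) x)\<^sup>2)" by (rule corr_le)
  also have "\<dots> \<le> (\<Sum>x\<in>{1 - 2 ^ k..<int (4 * 2 ^ K)}. (win (2 ^ k) x)\<^sup>2)"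
  proof (rule sum_mono2)
    show "{1 - 2 ^ k..M + 2 ^ k - 1} \<subseteq> {1 - 2 ^ k..<int (4 * 2 ^ K)}"
    proof
      fix x :: int assume "x \<in> {1 - 2 ^ k..M + 2 ^ k - 1}"
      hence "1 - 2 ^ k \<le> x" "x \<le> M + 2 ^ k - 1" by auto
      moreover have "0 < (2::int) ^ K" by simp
      ultimately have "x < 4 * 2 ^ K" using M \<open>(2::int) ^ k \<le> 2 ^ K\<close> by linarith
      thus "x \<in> {1 - 2 ^ k..<int (4 * 2 ^ K)}" using \<open>1 - 2 ^ k \<le> x\<close> by simp
    qed
  qed auto
  also have "\<dots> \<le> 100 * C * 2 ^ k * 2 ^ K * (lg (4 * 2 ^ K))\<^sup>2" by (rule win_square_sum[OF k])
  finally show ?thesis .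
qed

text \<open>With N <= 2^K <= 2 N, the tent of scale \<open>2 ^ k\<close> carries the weight
  \<open>1 / (2 * 2 ^ k)\<close>, which cancels the factor \<open>2 ^ k\<close> of
  \<open>corr_bound\<close>. All scales therefore contribute equally, and there are O(log N) of
  them.\<close>

theorem mdev_pair_sum:
  assumes N: "N \<ge> 2"
  shows "\<bar>\<Sum>a=1..N. \<Sum>b=1..N. mdev a * mdev b * of_bool (a + b \<le> N)\<bar> \<le> 125000 * C * real N * ln (real N) ^ 3"
proof -
  define K where "K = (LEAST K. N \<le> 2 ^ K)"
  have K1: "N \<le> 2 ^ K" unfolding K_def by (rule LeastI[of _ N]) (simp add: less_imp_le)
  have K2: "2 ^ K \<le> 2 * N"
  proof (cases K)
    case (Suc K')
    have "\<not> N \<le> 2 ^ K'" by (rule not_less_Least) (simp add: Suc K_def[symmetric])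
    thus ?thesis by (simp add: Suc)
  qed (use N in simp)
  \<comment> \<open>Large enough for \<open>corr_eq_sum\<close>:
    \<open>M + 2 * h - 1 <= 5 * N\<close> whenever \<open>M < N\<close> and
    \<open>h <= 2 ^ K <= 2 * N\<close>.\<close>
  define L where "L = 5 * N"
  let ?t = "\<lambda>a b. int N - int a - int b"
  have p2: "(2::int) ^ K > 0" by simp
  have K1i: "int N \<le> 2 ^ K" using K1 by (metis of_nat_le_iff of_nat_numeral of_nat_power)
  have K2i: "2 ^ K \<le> 2 * int N" using K2 by (metis of_nat_le_iff of_nat_mult of_nat_numeral of_nat_power)
  define E where "E = (\<Sum>a=1..N. \<Sum>b=1..N. mdev a * mdev b * of_bool (a + b \<le> N))"
  have E1: "E = (\<Sum>a=1..L. \<Sum>b=1..L. mdev a * mdev b * ramp 1 (?t a b))"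
  proof -
    have "E = (\<Sum>a=1..N. \<Sum>b=1..L. mdev a * mdev b * of_bool (a + b \<le> N))"
      unfolding E_def by (intro sum.cong refl sum.mono_neutral_left) (auto simp: L_def)
    also have "\<dots> = (\<Sum>a=1..L. \<Sum>b=1..L. mdev a * mdev b * of_bool (a + b \<le> N))"
      by (rule sum.mono_neutral_left) (auto simp: L_def)
    also have "\<dots> = (\<Sum>a=1..L. \<Sum>b=1..L. mdev a * mdev b * ramp 1 (?t a b))"
      by (intro sum.cong refl) (auto simp: ramp_1)
    finally show ?thesis .
  qed
  have corr: "corr h M = (\<Sum>a=1..L. \<Sum>b=1..L. mdev a * mdev b * tent h (M + 1 + h - int a - int b))"
    if "h \<ge> 1" "h \<le> 2 ^ K" "M < int N" for h M
    by (rule corr_eq_sum) (use that K2i in \<open>auto simp: L_def\<close>)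
  \<comment> \<open>The arguments are left unsimplified so that they read
    \<open>M + 1 + h - a - b\<close>, with \<open>M\<close> equal to \<open>N - 2 ^ K - 1\<close>,
    \<open>N - 2 * 2 ^ K - 1\<close> or \<open>N - 1\<close>.\<close>
  have rp: "ramp 1 (?t a b) = (tent (2 ^ K) (int N - 2 ^ K - 1 + 1 + 2 ^ K - int a - int b) + tent (2 ^ K) (int N - 2 * 2 ^ K - 1 + 1 + 2 ^ K - int a - int b)) / 2 ^ K
      - (\<Sum>k<K. tent (2 ^ k) (int N - 1 + 1 + 2 ^ k - int a - int b) / (2 * 2 ^ k))" for a b
    unfolding ramp_dyadic[of "?t a b" K] using ramp_tent[of "2 ^ K" "?t a b"] K1i by (simp add: algebra_simps)
  have "E = (\<Sum>a=1..L. \<Sum>b=1..L. (mdev a * mdev b * tent (2 ^ K) (int N - 2 ^ K - 1 + 1 + 2 ^ K - int a - int b)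
      + mdev a * mdev b * tent (2 ^ K) (int N - 2 * 2 ^ K - 1 + 1 + 2 ^ K - int a - int b)) / 2 ^ K
      - (\<Sum>k<K. mdev a * mdev b * tent (2 ^ k) (int N - 1 + 1 + 2 ^ k - int a - int b) / (2 * 2 ^ k)))"
    unfolding E1 rp by (intro sum.cong refl) (simp only: right_diff_distrib sum_distrib_left distrib_left times_divide_eq_right)
  also have "\<dots> = ((\<Sum>a=1..L. \<Sum>b=1..L. mdev a * mdev b * tent (2 ^ K) (int N - 2 ^ K - 1 + 1 + 2 ^ K - int a - int b))
      + (\<Sum>a=1..L. \<Sum>b=1..L. mdev a * mdev b * tent (2 ^ K) (int N - 2 * 2 ^ K - 1 + 1 + 2 ^ K - int a - int b))) / 2 ^ K
      - (\<Sum>a=1..L. \<Sum>b=1..L. \<Sum>k<K. mdev a * mdev b * tent (2 ^ k) (int N - 1 + 1 + 2 ^ k - int a - int b) / (2 * 2 ^ k))"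
    by (simp only: sum_subtractf sum_divide_distrib[symmetric] sum.distrib)
  also have "(\<Sum>a=1..L. \<Sum>b=1..L. \<Sum>k<K. mdev a * mdev b * tent (2 ^ k) (int N - 1 + 1 + 2 ^ k - int a - int b) / (2 * 2 ^ k)) =
     (\<Sum>a=1..L. \<Sum>k<K. \<Sum>b=1..L. mdev a * mdev b * tent (2 ^ k) (int N - 1 + 1 + 2 ^ k - int a - int b) / (2 * 2 ^ k))"
    by (intro sum.cong refl sum.swap)
  also have "\<dots> = (\<Sum>k<K. \<Sum>a=1..L. \<Sum>b=1..L. mdev a * mdev b * tent (2 ^ k) (int N - 1 + 1 + 2 ^ k - int a - int b) / (2 * 2 ^ k))"
    by (rule sum.swap)
  also have "\<dots> = (\<Sum>k<K. (\<Sum>a=1..L. \<Sum>b=1..L. mdev a * mdev b * tent (2 ^ k) (int N - 1 + 1 + 2 ^ k - int a - int b)) / (2 * 2 ^ k))"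
    by (simp only: sum_divide_distrib)
  also have "\<dots> = (\<Sum>k<K. corr (2 ^ k) (int N - 1) / (2 * 2 ^ k))"
    by (intro sum.cong refl) (subst corr, auto intro: power_increasing)
  also have "(\<Sum>a=1..L. \<Sum>b=1..L. mdev a * mdev b * tent (2 ^ K) (int N - 2 ^ K - 1 + 1 + 2 ^ K - int a - int b)) = corr (2 ^ K) (int N - 2 ^ K - 1)"
    by (rule corr[symmetric]) (simp, simp, use p2 in linarith)
  also have "(\<Sum>a=1..L. \<Sum>b=1..L. mdev a * mdev b * tent (2 ^ K) (int N - 2 * 2 ^ K - 1 + 1 + 2 ^ K - int a - int b)) = corr (2 ^ K) (int N - 2 * 2 ^ K - 1)"
    by (rule corr[symmetric]) (simp, simp, use p2 in linarith)
  finally have E2: "E = (corr (2 ^ K) (int N - 2 ^ K - 1) + corr (2 ^ K) (int N - 2 * 2 ^ K - 1)) / 2 ^ K - (\<Sum>k<K. corr (2 ^ k) (int N - 1) / (2 * 2 ^ k))" .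
  have mm: "int N - 2 ^ K - 1 < int N" "int N - 2 * 2 ^ K - 1 < int N" using p2 by linarith+
  define l where "l = lg (4 * 2 ^ K)"
  define B where "B = C * 2 ^ K * l\<^sup>2"
  have B0: "B \<ge> 0" using C_pos by (simp add: B_def)
  have cb: "\<bar>corr (2 ^ k) M\<bar> \<le> 100 * 2 ^ k * B" if "k \<le> K" "M < int N" for k M
    using corr_bound[of k K M] that K1i by (simp add: B_def l_def mult_ac)
  have "\<bar>E\<bar> \<le> (\<bar>corr (2 ^ K) (int N - 2 ^ K - 1)\<bar> + \<bar>corr (2 ^ K) (int N - 2 * 2 ^ K - 1)\<bar>) / 2 ^ K + (\<Sum>k<K. \<bar>corr (2 ^ k) (int N - 1)\<bar> / (2 * 2 ^ k))"
    unfolding E2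
    by (rule order_trans[OF abs_triangle_ineq4], intro add_mono order_trans[OF sum_abs])
      (auto simp: abs_divide intro!: divide_right_mono abs_triangle_ineq)
  also have "\<dots> \<le> (100 * 2 ^ K * B + 100 * 2 ^ K * B) / 2 ^ K + (\<Sum>k<K. 50 * B)"
  proof (intro add_mono divide_right_mono sum_mono cb)
    fix k assume "k \<in> {..<K}"
    hence "\<bar>corr (2 ^ k) (int N - 1)\<bar> / (2 * 2 ^ k) \<le> (100 * 2 ^ k * B) / (2 * 2 ^ k)"
      by (intro divide_right_mono cb) auto
    thus "\<bar>corr (2 ^ k) (int N - 1)\<bar> / (2 * 2 ^ k) \<le> 50 * B" by simp
  qed (use mm in simp_all)
  also have "\<dots> = (200 + 50 * real K) * B" by (simp add: algebra_simps add_divide_distrib)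
  \<comment> \<open>The bound \<open>l >= 1/2\<close> absorbs the two coarsest tents, and
    \<open>K / 2 <= K * ln 2 <= l\<close> turns the number of scales into the third
    logarithm.\<close>
  also have "\<dots> \<le> (400 * l + 100 * l) * B"
  proof (intro mult_right_mono add_mono B0)
    show "200 \<le> 400 * l" using lg_ge[of "4 * 2 ^ K"] by (simp add: l_def)
    have "real K * (1/2) \<le> real K * ln 2" using ln_2_ge_half by (intro mult_left_mono) auto
    also have "\<dots> = ln (2 ^ K)" by (simp add: ln_realpow)
    also have "\<dots> \<le> l" unfolding l_def lg_def by (intro ln_mono) (auto simp: add_pos_pos)
    finally show "50 * real K \<le> 100 * l" by simp
  qed
  also have "\<dots> = 500 * C * 2 ^ K * l ^ 3" by (simp add: B_def power2_eq_square power3_eq_cube)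
  also have "\<dots> \<le> 500 * C * (2 * real N) * (5 * ln (real N)) ^ 3"
  proof (intro mult_mono power_mono mult_left_mono)
    show two: "2 ^ K \<le> 2 * real N" using K2 by (metis of_nat_le_iff of_nat_mult of_nat_numeral of_nat_power)
    \<comment> \<open>This holds from \<open>N = 2\<close> on and yields
      \<open>l <= 5 * ln N\<close>; hence 125000 = 500 * 2 * 5^3.\<close>
    have "4 * 2 ^ K + 2 \<le> real N ^ 5"
    proof -
      have "4 * 2 ^ K + 2 \<le> 8 * real N + 2" using two by simp
      also have "\<dots> \<le> 16 * real N" using N by simp
      also have "\<dots> \<le> real N ^ 4 * real N" using N power_mono[of 2 "real N" 4] by (intro mult_right_mono) auto
      finally show ?thesis by (simp add: power_Suc2[symmetric] del: power_Suc2)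
    qed
    hence "l \<le> ln (real N ^ 5)" unfolding l_def lg_def using N by (intro ln_mono) (auto simp: add_pos_pos)
    also have "\<dots> = 5 * ln (real N)" using N by (simp add: ln_realpow)
    finally show "l \<le> 5 * ln (real N)" .
  qed (use C_pos lg_pos[of "4 * 2 ^ K"] in \<open>simp_all add: l_def\<close>)
  also have "\<dots> = 125000 * C * real N * ln (real N) ^ 3" by (simp add: power_mult_distrib)
  finally show ?thesis by (simp add: E_def)
qed

end

section \<open>The Goldbach sum under the Riemann Hypothesis\<close>

text \<open>The quotient of the two functions, \<open>1 / (s - 1)\<close>, is analytic and nonzero
  near \<open>\<rho>\<close>.\<close>

lemma zorder_zeta:
  assumes "\<rho> \<noteq> 1"
  shows "zorder zeta \<rho> = zorder zeta_entire \<rho>"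
proof -
  have ev: "\<forall>\<^sub>F s in at \<rho>. s \<noteq> 1"
    using assms by (metis eventually_neq_at_within)
  have "zorder zeta \<rho> = zorder (\<lambda>s. zeta_entire s * (1 / (s - 1))) \<rho>"
    by (rule zorder_cong) (use ev in \<open>auto elim!: eventually_mono simp: zeta_conv_zeta_entire\<close>)
  also have "\<dots> = zorder zeta_entire \<rho> + zorder (\<lambda>s. 1 / (s - 1)) \<rho>"
  proof (rule zorder_times_analytic'[OF isolated_singularity_at_analytic not_essential_analytic])
    show "(\<lambda>s. 1 / (s - 1)) analytic_on {\<rho>}" using assms by (auto intro!: analytic_intros)
    show "\<exists>\<^sub>F s in at \<rho>. zeta_entire s * (1 / (s - 1)) \<noteq> 0"
      using frequently_eventually_conj[OF frequently_zeta_entire_nonzero ev] by (rule frequently_elim1) auto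
  qed (rule zeta_entire_analytic)+
  also have "zorder (\<lambda>s. 1 / (s - 1)) \<rho> = 0"
    by (rule zorder_eq_0I) (use assms in \<open>auto intro!: analytic_intros\<close>)
  finally show ?thesis by simp
qed

lemma nontrivial_zeros_eq: "nontrivial_zeros = {\<rho> \<in> zeros. Re \<rho> > 0}"
proof -
  have "\<rho> \<noteq> 1" if "Re \<rho> < 1" for \<rho> :: complex using that by auto
  thus ?thesis using zeros_Re
    by (auto simp: nontrivial_zeros_def zeros_def zeta_conv_zeta_entire)
qed

lemma riemann_hypothesis_zeros:
  assumes riemann_hypothesis "\<rho> \<in> zeros"
  shows "Re \<rho> \<le> 1/2"
proof (cases "Re \<rho> > 0")
  case True
  thus ?thesis using assms by (auto simp: riemann_hypothesis_def nontrivial_zeros_eq)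
qed simp

lemma zero_term_eq:
  assumes "\<rho> \<in> zeros" "N > 0"
  shows "zero_term N \<rho> = of_real (zmult \<rho>) * cpow (\<rho> + 1) (real N) / (\<rho> * (\<rho> + 1))"
proof -
  have "\<rho> \<noteq> 1" using zeros_Re[OF assms(1)] by auto
  moreover have "of_nat N powr (\<rho> + 1) = cpow (\<rho> + 1) (real N)"
    using assms(2) by (simp add: powr_def cpow_def)
  ultimately show ?thesis by (simp add: zero_term_def zmult_def zorder_zeta)
qed

lemma sum_goldbach_R:
  "(\<Sum>n=1..N. goldbach_R n) = (\<Sum>a=1..N. \<Sum>b=1..N. mangoldt a * mangoldt b * of_bool (a + b \<le> N))"
proof -
  have "goldbach_R n = (\<Sum>a=1..N. \<Sum>b=1..N. mangoldt a * mangoldt b * of_bool (a + b = n))" if "n \<in> {1..N}" for n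
  proof -
    have "goldbach_R n = (\<Sum>(a, b)\<in>{1..N} \<times> {1..N}. mangoldt a * mangoldt b * of_bool (a + b = n))"
      unfolding goldbach_R_def by (rule sum.mono_neutral_cong_left) (use that in auto)
    thus ?thesis by (simp only: sum.cartesian_product)
  qed
  hence "(\<Sum>n=1..N. goldbach_R n) = (\<Sum>n=1..N. \<Sum>a=1..N. \<Sum>b=1..N. mangoldt a * mangoldt b * of_bool (a + b = n))"
    by (intro sum.cong) auto
  also have "\<dots> = (\<Sum>a=1..N. \<Sum>n=1..N. \<Sum>b=1..N. mangoldt a * mangoldt b * of_bool (a + b = n))"
    by (rule sum.swap)
  also have "\<dots> = (\<Sum>a=1..N. \<Sum>b=1..N. \<Sum>n=1..N. mangoldt a * mangoldt b * of_bool (a + b = n))"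
    by (intro sum.cong refl sum.swap)
  also have "\<dots> = (\<Sum>a=1..N. \<Sum>b=1..N. mangoldt a * mangoldt b * of_bool (a + b \<le> N))"
  proof (intro sum.cong refl)
    fix a b assume ab: "a \<in> {1..N}" "b \<in> {1..N}"
    have "(\<Sum>n=1..N. of_bool (a + b = n) :: real) = of_bool (a + b \<le> N)"
      using ab sum.delta'[of "{1..N}" "a + b" "\<lambda>_. 1::real"] by (simp add: of_bool_def)
    thus "(\<Sum>n=1..N. mangoldt a * mangoldt b * of_bool (a + b = n)) = (mangoldt a * mangoldt b * of_bool (a + b \<le> N) :: real)"
      by (simp only: sum_distrib_left[symmetric])
  qed
  finally show ?thesis .
qed

text \<open>For fixed \<open>a\<close> there are \<open>N - a\<close> admissible \<open>b\<close>,
  so each mixed sum is \<open>psi1 N\<close>, and the pairs number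
  \<open>N^2 / 2 - N / 2\<close>.\<close>

lemma sum_goldbach_R_eq:
  "(\<Sum>n=1..N. goldbach_R n) = (\<Sum>a=1..N. \<Sum>b=1..N. mdev a * mdev b * of_bool (a + b \<le> N))
     + 2 * psi1 (real N) - (real N)\<^sup>2 / 2 + real N / 2"
proof -
  have cnt: "(\<Sum>b=1..N. of_bool (a + b \<le> N)) = real N - real a" if "a \<in> {1..N}" for a
  proof -
    have "(\<Sum>b=1..N. of_bool (a + b \<le> N)) = real (card ({1..N} \<inter> {b. a + b \<le> N}))" by (simp add: sum_of_bool_eq)
    also have "{1..N} \<inter> {b. a + b \<le> N} = {1..N - a}" using that by auto
    finally show ?thesis using that by (simp add: of_nat_diff)
  qed
  have s1: "(\<Sum>a=1..N. \<Sum>b=1..N. mangoldt a * of_bool (a + b \<le> N)) = psi1 (real N)"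
    unfolding psi1_def sum_distrib_left[symmetric] by (intro sum.cong) (simp_all only: cnt floor_of_nat nat_int)
  have s2: "(\<Sum>a=1..N. \<Sum>b=1..N. mangoldt b * of_bool (a + b \<le> N)) = psi1 (real N)"
    by (subst sum.swap) (simp add: s1[symmetric] add.commute)
  have s3: "(\<Sum>a=1..N. \<Sum>b=1..N. of_bool (a + b \<le> N)) = (real N)\<^sup>2 / 2 - real N / 2"
  proof -
    have g: "2 * (\<Sum>a=1..N. real a) = real N * (real N + 1)" by (induction N) (auto simp: algebra_simps)
    have "(\<Sum>a=1..N. \<Sum>b=1..N. of_bool (a + b \<le> N)) = (\<Sum>a=1..N. real N - real a)" by (intro sum.cong cnt) auto
    also have "\<dots> = real N * real N - (\<Sum>a=1..N. real a)" by (simp add: sum_subtractf)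
    finally show ?thesis using g by (simp add: power2_eq_square algebra_simps)
  qed
  have "(\<Sum>a=1..N. \<Sum>b=1..N. mdev a * mdev b * of_bool (a + b \<le> N)) =
     (\<Sum>a=1..N. \<Sum>b=1..N. mangoldt a * mangoldt b * of_bool (a + b \<le> N) - mangoldt a * of_bool (a + b \<le> N)
        - mangoldt b * of_bool (a + b \<le> N) + of_bool (a + b \<le> N))"
    by (intro sum.cong refl) (simp add: mdev_def algebra_simps)
  also have "\<dots> = (\<Sum>n=1..N. goldbach_R n) - psi1 (real N) - psi1 (real N) + ((real N)\<^sup>2 / 2 - real N / 2)"
    by (simp only: sum.distrib sum_subtractf s1 s2 s3 sum_goldbach_R)
  finally show ?thesis by simp
qed

theorem theorem1:
  assumes riemann_hypothesis
  shows "\<exists>C::real. C > 0 \<and> (\<forall>N::nat. N \<ge> 2 \<longrightarrow>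
           (\<lambda>\<rho>. cmod (zero_term N \<rho>)) summable_on nontrivial_zeros \<and>
           cmod (of_real (\<Sum>n=1..N. goldbach_R n) - of_nat N ^ 2 / 2
                   + 2 * (\<Sum>\<^sub>\<infinity>\<rho>\<in>nontrivial_zeros. zero_term N \<rho>))
             \<le> C * real N * ln (real N) ^ 3)"
proof -
  obtain C where C: "C > 0"
    "\<And>X. X \<ge> 1 \<Longrightarrow> (\<Sum>n\<in>{X..<2*X}. (Delta n)\<^sup>2) \<le> C * (real X)\<^sup>2"
    "\<And>X h. 1 \<le> h \<Longrightarrow> h \<le> X \<Longrightarrow> (\<Sum>n\<in>{X..<2*X}. (Delta (n + h) - Delta n)\<^sup>2) \<le> C * real h * real X * (lg (real X))\<^sup>2"
    by (rule Delta_mean_square[OF riemann_hypothesis_zeros[OF assms]]) blast+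
  interpret mean_square C by (rule mean_square.intro) (fact C)+
  obtain \<alpha> \<beta> :: complex and e :: "real \<Rightarrow> complex" and K :: real where
    K: "K > 0" "\<And>x. x \<ge> 1 \<Longrightarrow> norm (e x) \<le> K * x"
    and EF: "\<And>x. x \<ge> 1 \<Longrightarrow> complex_of_real (psi1 x) = of_real (x\<^sup>2 / 2) + \<alpha> * of_real x + \<beta>
        - (\<Sum>\<^sub>\<infinity>\<rho>\<in>zeros. of_real (zmult \<rho>) * cpow (\<rho> + 1) x / (\<rho> * (\<rho> + 1))) + e x"
    by (rule explicit_formula_real) blast
  define w where "w = (\<lambda>\<rho>. norm (complex_of_real (zmult \<rho>) * 1 / (\<rho> * (\<rho> + 1))))"
  have w: "w summable_on zeros" unfolding w_def by (rule zeros_quad_summable(1)[where B = 1]) simp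
  \<comment> \<open>The zeros with nonpositive real part: there \<open>N powr (\<rho> + 1)\<close>
    has modulus at most \<open>N\<close>, so together they contribute at most
    \<open>W * N\<close>.\<close>
  define Z0 where "Z0 = zeros - nontrivial_zeros"
  have U: "nontrivial_zeros \<union> Z0 = zeros" "nontrivial_zeros \<inter> Z0 = {}" by (auto simp: Z0_def nontrivial_zeros_eq)
  define W where "W = infsum w Z0"
  have w0: "w summable_on Z0" by (rule summable_on_subset_banach[OF w]) (auto simp: Z0_def)
  have W0: "W \<ge> 0" unfolding W_def by (rule infsum_nonneg) (simp add: w_def)
  \<comment> \<open>Collects the O(N) terms: the linear and constant terms and the error of the
    explicit formula, the \<open>N / 2\<close> of the expansion, and the zeros in
    \<open>Z0\<close>.\<close>
  define B where "B = 2 * norm \<alpha> + 2 * norm \<beta> + 2 * K + 1/2 + 2 * W"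
  have B: "B > 0" using K W0 unfolding B_def by (intro add_pos_nonneg add_nonneg_pos) auto
  show ?thesis
  proof (intro exI[of _ "125000 * C + 8 * B"] conjI allI impI)
    show "125000 * C + 8 * B > 0" using C B by simp
    fix N :: nat assume N: "N \<ge> 2"
    hence N1: "real N \<ge> 1" by simp
    define z where "z = (\<lambda>\<rho>. of_real (zmult \<rho>) * cpow (\<rho> + 1) (real N) / (\<rho> * (\<rho> + 1)))"
    have zt: "zero_term N \<rho> = z \<rho>" if "\<rho> \<in> nontrivial_zeros" for \<rho>
      using that zero_term_eq[of \<rho> N] N by (simp add: z_def nontrivial_zeros_eq)
    have bN: "norm (cpow (\<rho> + 1) (real N)) \<le> (real N)\<^sup>2" if "\<rho> \<in> zeros" for \<rho>
    proof -
      have "real N powr (Re \<rho> + 1) \<le> real N powr 2" using zeros_Re[OF that] N1 by (intro powr_mono) auto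
      thus ?thesis using N by (simp add: norm_cpow)
    qed
    have z: "(\<lambda>\<rho>. norm (z \<rho>)) summable_on zeros" "z summable_on zeros"
      unfolding z_def by (rule zeros_quad_summable[OF bN], assumption)+
    have zn: "(\<lambda>\<rho>. norm (z \<rho>)) summable_on nontrivial_zeros" "z summable_on nontrivial_zeros"
      by (rule summable_on_subset_banach[OF z(1)], use U in blast, rule summable_on_subset_banach[OF z(2)], use U in blast)
    have z0: "(\<lambda>\<rho>. norm (z \<rho>)) summable_on Z0" "z summable_on Z0"
      by (rule summable_on_subset_banach[OF z(1)], use U in blast, rule summable_on_subset_banach[OF z(2)], use U in blast)
    show "(\<lambda>\<rho>. cmod (zero_term N \<rho>)) summable_on nontrivial_zeros"
      using zn(1) by (rule summable_on_cong[THEN iffD2, rotated]) (simp add: zt)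
    define S where "S = (\<Sum>\<^sub>\<infinity>\<rho>\<in>nontrivial_zeros. zero_term N \<rho>)"
    have S: "infsum z zeros = S + infsum z Z0"
      unfolding S_def using infsum_Un_disjoint[OF zn(2) z0(2) U(2)] unfolding U(1)
      by (simp add: zt cong: infsum_cong)
    have Zb: "norm (infsum z Z0) \<le> W * real N"
    proof -
      have "norm (infsum z Z0) \<le> infsum (\<lambda>\<rho>. norm (z \<rho>)) Z0" by (rule norm_infsum_bound[OF z0(1)])
      also have "\<dots> \<le> infsum (\<lambda>\<rho>. w \<rho> * real N) Z0"
      proof (rule infsum_mono[OF z0(1) summable_on_cmult_left[OF w0]])
        fix \<rho> assume "\<rho> \<in> Z0"
        hence "Re \<rho> \<le> 0" by (auto simp: Z0_def nontrivial_zeros_eq)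
        hence "real N powr (Re \<rho> + 1) \<le> real N powr 1" using N1 by (intro powr_mono) auto
        hence "norm (cpow (\<rho> + 1) (real N)) \<le> real N" using N by (simp add: norm_cpow)
        hence "w \<rho> * norm (cpow (\<rho> + 1) (real N)) \<le> w \<rho> * real N" by (intro mult_left_mono) (auto simp: w_def)
        thus "norm (z \<rho>) \<le> w \<rho> * real N" by (simp add: z_def w_def norm_mult norm_divide)
      qed
      also have "\<dots> = W * real N" unfolding W_def by (rule infsum_cmult_left')
      finally show ?thesis .
    qed
    define E where "E = (\<Sum>a=1..N. \<Sum>b=1..N. mdev a * mdev b * of_bool (a + b \<le> N))"
    have R: "(\<Sum>n=1..N. goldbach_R n) = E + 2 * psi1 (real N) - (real N)\<^sup>2 / 2 + real N / 2"
      unfolding E_def by (rule sum_goldbach_R_eq)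
    have P: "complex_of_real (psi1 (real N)) = of_nat N ^ 2 / 2 + \<alpha> * of_nat N + \<beta> - (S + infsum z Z0) + e (real N)"
      using EF[OF N1] unfolding z_def[symmetric] S by simp
    have "of_real (\<Sum>n=1..N. goldbach_R n) - of_nat N ^ 2 / 2 + 2 * S =
      complex_of_real E + (2 * (\<alpha> * of_nat N) + 2 * \<beta> + 2 * e (real N) + of_nat N / 2 - 2 * infsum z Z0)"
      unfolding R of_real_add of_real_diff of_real_mult P by (simp add: algebra_simps)
    also have "norm \<dots> \<le> \<bar>E\<bar> + (2 * (norm \<alpha> * real N) + 2 * norm \<beta> + 2 * norm (e (real N)) + real N / 2 + 2 * norm (infsum z Z0))"
    proof -
      have "norm (2 * (\<alpha> * of_nat N) + 2 * \<beta> + 2 * e (real N) + of_nat N / 2 - 2 * infsum z Z0) \<le>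
        norm (2 * (\<alpha> * of_nat N)) + norm (2 * \<beta>) + norm (2 * e (real N)) + norm (of_nat N / 2 :: complex) + norm (2 * infsum z Z0)"
        by (intro order_trans[OF norm_triangle_ineq] order_trans[OF norm_triangle_ineq4] add_mono order_refl)
      also have "\<dots> = 2 * (norm \<alpha> * real N) + 2 * norm \<beta> + 2 * norm (e (real N)) + real N / 2 + 2 * norm (infsum z Z0)"
        by (simp add: norm_mult norm_divide)
      finally have "norm (complex_of_real E) + norm (2 * (\<alpha> * of_nat N) + 2 * \<beta> + 2 * e (real N) + of_nat N / 2 - 2 * infsum z Z0) \<le>
        \<bar>E\<bar> + (2 * (norm \<alpha> * real N) + 2 * norm \<beta> + 2 * norm (e (real N)) + real N / 2 + 2 * norm (infsum z Z0))"
        by simp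
      thus ?thesis by (rule order_trans[OF norm_triangle_ineq])
    qed
    also have "\<dots> \<le> 125000 * C * real N * ln (real N) ^ 3 + B * real N"
    proof -
      have "\<bar>E\<bar> \<le> 125000 * C * real N * ln (real N) ^ 3" unfolding E_def by (rule mdev_pair_sum[OF N])
      moreover have "norm (e (real N)) \<le> K * real N" by (rule K(2)[OF N1])
      moreover have "norm \<beta> * 1 \<le> norm \<beta> * real N" using N1 by (intro mult_left_mono) auto
      moreover have "B * real N = 2 * (norm \<alpha> * real N) + 2 * (norm \<beta> * real N) + 2 * (K * real N) + real N / 2 + 2 * (W * real N)"
        unfolding B_def by (simp add: algebra_simps)
      ultimately show ?thesis using Zb by linarith
    qed
    \<comment> \<open>The O(N) terms fit under the main bound because
      \<open>ln N >= ln 2 >= 1/2\<close>, so \<open>8 * ln N ^ 3 >= 1\<close>.\<close>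
    also have "\<dots> \<le> 125000 * C * real N * ln (real N) ^ 3 + B * real N * (8 * ln (real N) ^ 3)"
    proof -
      have "ln 2 \<le> ln (real N)" using N by (intro ln_mono) auto
      hence "(1/2) ^ 3 \<le> ln (real N) ^ 3" using ln_2_ge_half by (intro power_mono) auto
      hence "1 \<le> 8 * ln (real N) ^ 3" by (simp add: power3_eq_cube)
      hence "B * real N * 1 \<le> B * real N * (8 * ln (real N) ^ 3)" using B by (intro mult_left_mono) auto
      thus ?thesis by simp
    qed
    also have "\<dots> = (125000 * C + 8 * B) * real N * ln (real N) ^ 3" by (simp add: algebra_simps)
    finally show "cmod (of_real (\<Sum>n=1..N. goldbach_R n) - of_nat N ^ 2 / 2 + 2 * (\<Sum>\<^sub>\<infinity>\<rho>\<in>nontrivial_zeros. zero_term N \<rho>))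
      \<le> (125000 * C + 8 * B) * real N * ln (real N) ^ 3" unfolding S_def .
  qed
qed

end
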